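(* In the setting of the context, let $I=[r_-,r_+]$ and $J$ be compact intervals with $I\Subset J\Subset(0,a_\star)$. Let $\xi_0,\xi_1\in\mathfrak X_\beta(J)$ and define the interpolations $$\rho_t=\rho_{\xi_0}+t(\rho_{\xi_1}-\rho_{\xi_0}),\qquad \xi_t(r)=(r\rho_t(r))^{-1},\qquad 0\le t\le1 .$$ Suppose that there is a compact interval $S_J\subset(v_\star,\infty)$, disjoint from the critical values of $V$, such that $s_{\xi_\star}(J)\subseteq S_J$ and, uniformly along the path, $s_{\xi_t}(J)\subseteq S_J$ for all $t\in[0,1]$; and that $$G(r):=\int_1^r(\rho_{\xi_1}(u)-\rho_{\xi_0}(u))\,\mathrm du=0\quad\text{for all } r\in[0,U]\setminus J,\qquad \|G\|_\infty\le\frac{\log2}{K(1+C_{V,J}|J|\kappa^{-1})},$$ where $C_{V,J}<\infty$ is an upper bound for $m_V$ on $S_J$. Under these assumptions there exists a constant $C_{\rm risk}>0$ depending on $I,J,\beta,H,\kappa,K,\xi_\star,d$ and $V$, but not on $n$, such that $$\inf_{\widehat\Xi_n}\sup_{\xi\in\mathfrak X_\beta(J)}\mathbb E_\xi\|\widehat\Xi_n-\xi\|_{L^2(I)}^2\ge C_{\rm risk}\,n^{-2\beta/(2\beta+3)}.$$ Moreover, for constants $C_{\rm sep}>0$ and $p\in(0,1)$ depending on the same variables as $C_{\rm risk}$, $$\inf_{\widehat\Xi_n}\sup_{\xi\in\mathfrak X_\beta(J)}\Pi_\xi^{\otimes n}\left(\|\widehat\Xi_n-\xi\|_{L^2(I)}\ge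 C_{\rm sep}\,n^{-\beta/(2\beta+3)}\right)\ge p.$$ The infimum is over all measurable estimators based on (i.i.d.) $X_1,\dots,X_n\sim\Pi_\xi$.
   Context: Potential: $V:\mathbb R^d\to[v_\star,\infty)$ is $C^2$ and coercive, $v_\star=\min V$, $e^{-aV}$ is integrable for every $a>0$; the level-set measure $m_V(s)=\int_{\{V=s\}}\|\nabla V\|_2^{-1}\,\mathrm d\mathcal H^{d-1}$ ($s>v_\star$) is locally finite and bounded above and below by positive constants on compact intervals away from critical values (so it is bounded on $S_J$). For a Lipschitz coefficient $\xi$ with $\kappa\le\xi\le K$ ($0<\kappa<K<\infty$): $g_\xi(r)=\int_1^r(u\xi(u))^{-1}\mathrm du$; $\mu_\xi$ is the unique constant with $\int_{v_\star}^\infty g_\xi^{-1}(\mu_\xi-s)m_V(s)\,\mathrm ds=1$; $q_\xi(s)=g_\xi^{-1}(\mu_\xi-s)$; $\pi_\xi(x)=q_\xi(V(x))$ is the zero-flux stationary density of the McKean–Vlasov dynamics $\mathrm dX_t=-\xi(p_t(X_t))\nabla V(X_t)\,\mathrm dt+\sqrt2\,\mathrm dW_t$ ($p_t$ the density of $X_t$), and $\Pi_\xi$ is its law; $a_\xi=q_\xi(v_\star)$ is the maximal stationary density; $s_\xi(r)=q_\xi^{-1}(r)=\mu_\xi-g_\xi(r)$; $\rho_\xi(r)=(r\xi(r))^{-1}$. $Z_K=\int_{\mathbb R^d} e^{-K(V(x)-v_\star)}\mathrm dx$ and $U\ge\max\{1,Z_K^{-1}\}$ is fixed; coefficients given on $[0,U]$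 are extended by their value at $U$ for $r>U$. $\mathcal H^\beta([0,U],H)$ is the Hölder ball of order $\beta>1$ and radius $H$ on $[0,U]$. $A\Subset B$ means that $A$ is a compact subset of the interior of $B$. Baseline: $\xi_\star\in\mathcal H^\beta([0,U],H/2)$ with $\kappa+\epsilon_0\le\xi_\star\le K-\epsilon_0$ on $[0,U]$ for some $\epsilon_0>0$; $a_\star=a_{\xi_\star}$. The coefficient class is $$\mathfrak X_\beta(J)=\{\xi\in\mathcal H^\beta([0,U],H):\kappa\le\xi(r)\le K\ \forall r\in[0,U],\ \xi(r)=\xi_\star(r)\text{ for }r\in[0,U]\setminus J\}.$$ *)

theory Defs
  imports "HOL-Analysis.Analysis"
begin

section \<open>Hausdorff measure\<close>

text \<open>
  The factor \<open>unit_ball_vol k / 2 ^ k\<close> is the geometric normalisation, for which the measure of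
  dimension \<open>k\<close> is surface measure and the coarea formula holds without a constant.
  For \<open>k = 0\<close> it is counting measure: as \<open>0 ^ 0 = 1\<close>, empty covering sets are excluded by hand.
  The outer measure is a metric one, hence countably additive on Borel sets, which is what
  \<^const>\<open>measure_of\<close> needs to keep its values.
\<close>

definition hausdorff_pre :: "nat \<Rightarrow> real \<Rightarrow> 'a::metric_space set \<Rightarrow> ennreal" where
  "hausdorff_pre k \<delta> A =
     (INF C \<in> {C :: nat \<Rightarrow> 'a set. A \<subseteq> (\<Union>i. C i) \<and> (\<forall>i. bounded (C i) \<and> diameter (C i) \<le> \<delta>)}.
        \<Sum>i. if C i = {} then 0
             else ennreal (unit_ball_vol (real k) * (diameter (C i) / 2) ^ k))"

definition hausdorff_outer :: "nat \<Rightarrow> 'a::metric_space set \<Rightarrow> ennreal" where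
  "hausdorff_outer k A = (SUP \<delta>\<in>{0<..}. hausdorff_pre k \<delta> A)"

definition hausdorff_measure :: "nat \<Rightarrow> 'a::metric_space measure" where
  "hausdorff_measure k = measure_of UNIV (sets borel) (hausdorff_outer k)"

section \<open>The potential\<close>

definition grad :: "('a::real_inner \<Rightarrow> real) \<Rightarrow> 'a \<Rightarrow> 'a" where
  "grad V x = (THE D. GDERIV V x :> D)"

definition C2 :: "('a::euclidean_space \<Rightarrow> real) \<Rightarrow> bool" where
  "C2 V \<longleftrightarrow> (\<exists>(D :: 'a \<Rightarrow> 'a) (D2 :: 'a \<Rightarrow> 'a \<Rightarrow>\<^sub>L 'a).
     (\<forall>x. GDERIV V x :> D x) \<and>
     (\<forall>x. (D has_derivative blinfun_apply (D2 x)) (at x)) \<and>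
     continuous_on UNIV D2)"

definition critical_values :: "('a::real_inner \<Rightarrow> real) \<Rightarrow> real set" where
  "critical_values V = V ` {x. grad V x = 0}"

definition vmin :: "('a \<Rightarrow> real) \<Rightarrow> real" where
  "vmin V = Inf (range V)"

text \<open>The weight is inverted in \<^typ>\<open>ennreal\<close>, so that it is infinite at critical points.\<close>

definition level_mass :: "(real^'d \<Rightarrow> real) \<Rightarrow> real \<Rightarrow> ennreal" where
  "level_mass V s =
     (\<integral>\<^sup>+ x \<in> {x. V x = s}. inverse (ennreal (norm (grad V x))) \<partial>hausdorff_measure (CARD('d) - 1))"

text \<open>
  Local finiteness of the level-set measure is that of the measure \<open>level_mass V s ds\<close>
  on \<open>[vmin V, \<infinity>)\<close>.
\<close>

definition admissible_potential :: "(real^'d \<Rightarrow> real) \<Rightarrow> bool" where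
  "admissible_potential V \<longleftrightarrow>
     C2 V \<and>
     filterlim V at_top at_infinity \<and>
     (\<forall>a>0. integrable lborel (\<lambda>x. exp (- a * V x))) \<and>
     (\<forall>a b. (\<integral>\<^sup>+ s \<in> {a..b} \<inter> {vmin V<..}. level_mass V s \<partial>lborel) < \<infinity>) \<and>
     (\<forall>a b. vmin V < a \<longrightarrow> a \<le> b \<longrightarrow> {a..b} \<inter> critical_values V = {} \<longrightarrow>
        (\<exists>c C. 0 < c \<and> (\<forall>s\<in>{a..b}. ennreal c \<le> level_mass V s \<and> level_mass V s \<le> ennreal C)))"

section \<open>Stationary laws\<close>

text \<open>In this section a coefficient \<open>\<xi>\<close> is a function on \<open>(0, \<infinity>)\<close>; other values are irrelevant.\<close>

definition const_ext :: "real \<Rightarrow> (real \<Rightarrow> real) \<Rightarrow> real \<Rightarrow> real" where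
  "const_ext U \<xi> r = \<xi> (min r U)"

definition rho :: "(real \<Rightarrow> real) \<Rightarrow> real \<Rightarrow> real" where
  "rho \<xi> r = 1 / (r * \<xi> r)"

definition g_fun :: "(real \<Rightarrow> real) \<Rightarrow> real \<Rightarrow> real" where
  "g_fun \<xi> r = (LBINT u=1..r. 1 / (u * \<xi> u))"

definition g_inv :: "(real \<Rightarrow> real) \<Rightarrow> real \<Rightarrow> real" where
  "g_inv \<xi> = the_inv_into {0<..} (g_fun \<xi>)"

definition mu :: "(real^'d \<Rightarrow> real) \<Rightarrow> (real \<Rightarrow> real) \<Rightarrow> real" where
  "mu V \<xi> = (THE m. (\<integral>\<^sup>+ s \<in> {vmin V<..}. ennreal (g_inv \<xi> (m - s)) * level_mass V s \<partial>lborel) = 1)"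

definition q_fun :: "(real^'d \<Rightarrow> real) \<Rightarrow> (real \<Rightarrow> real) \<Rightarrow> real \<Rightarrow> real" where
  "q_fun V \<xi> s = g_inv \<xi> (mu V \<xi> - s)"

definition s_fun :: "(real^'d \<Rightarrow> real) \<Rightarrow> (real \<Rightarrow> real) \<Rightarrow> real \<Rightarrow> real" where
  "s_fun V \<xi> r = mu V \<xi> - g_fun \<xi> r"

definition stat_density :: "(real^'d \<Rightarrow> real) \<Rightarrow> (real \<Rightarrow> real) \<Rightarrow> real^'d \<Rightarrow> real" where
  "stat_density V \<xi> x = q_fun V \<xi> (V x)"

definition stat_law :: "(real^'d \<Rightarrow> real) \<Rightarrow> (real \<Rightarrow> real) \<Rightarrow> (real^'d) measure" where
  "stat_law V \<xi> = density lborel (\<lambda>x. ennreal (stat_density V \<xi> x))"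

definition max_density :: "(real^'d \<Rightarrow> real) \<Rightarrow> (real \<Rightarrow> real) \<Rightarrow> real" where
  "max_density V \<xi> = q_fun V \<xi> (vmin V)"

definition interp_rho :: "(real \<Rightarrow> real) \<Rightarrow> (real \<Rightarrow> real) \<Rightarrow> real \<Rightarrow> real \<Rightarrow> real" where
  "interp_rho \<xi>0 \<xi>1 t r = rho \<xi>0 r + t * (rho \<xi>1 r - rho \<xi>0 r)"

definition interp_coeff :: "(real \<Rightarrow> real) \<Rightarrow> (real \<Rightarrow> real) \<Rightarrow> real \<Rightarrow> real \<Rightarrow> real" where
  "interp_coeff \<xi>0 \<xi>1 t r = 1 / (r * interp_rho \<xi>0 \<xi>1 t r)"

definition G_fun :: "(real \<Rightarrow> real) \<Rightarrow> (real \<Rightarrow> real) \<Rightarrow> real \<Rightarrow> real" where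
  "G_fun \<xi>0 \<xi>1 r = (LBINT u=1..r. rho \<xi>1 u - rho \<xi>0 u)"

section \<open>Hoelder balls and the coefficient class\<close>

text \<open>Derivatives on \<open>S\<close> are one-sided at the endpoints when \<open>S\<close> is a closed interval.\<close>

primrec iter_deriv :: "real set \<Rightarrow> nat \<Rightarrow> (real \<Rightarrow> real) \<Rightarrow> real \<Rightarrow> real" where
  "iter_deriv S 0 f = f"
| "iter_deriv S (Suc k) f = (\<lambda>x. vector_derivative (iter_deriv S k f) (at x within S))"

text \<open>
  The number of derivatives is the largest integer strictly below \<open>\<beta>\<close>, so the Hoelder exponent
  of the last one lies in \<open>(0, 1]\<close>. Norms are extended-valued to need no boundedness condition.
\<close>

definition hoelder_deg :: "real \<Rightarrow> nat" where
  "hoelder_deg \<beta> = nat (\<lceil>\<beta>\<rceil> - 1)"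

definition hoelder_norm :: "real \<Rightarrow> real set \<Rightarrow> (real \<Rightarrow> real) \<Rightarrow> ennreal" where
  "hoelder_norm \<beta> S f =
     (\<Sum>k\<le>hoelder_deg \<beta>. SUP x\<in>S. ennreal \<bar>iter_deriv S k f x\<bar>) +
     (SUP (x, y)\<in>{(x, y). x \<in> S \<and> y \<in> S \<and> x \<noteq> y}.
        ennreal (\<bar>iter_deriv S (hoelder_deg \<beta>) f x - iter_deriv S (hoelder_deg \<beta>) f y\<bar>
                 / \<bar>x - y\<bar> powr (\<beta> - real (hoelder_deg \<beta>))))"

definition hoelder_ball :: "real \<Rightarrow> real set \<Rightarrow> real \<Rightarrow> (real \<Rightarrow> real) set" where
  "hoelder_ball \<beta> S H =
     {f. (\<forall>k<hoelder_deg \<beta>. iter_deriv S k f differentiable_on S) \<and> hoelder_norm \<beta> S f \<le> ennreal H}"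

definition coeff_class ::
  "real \<Rightarrow> real \<Rightarrow> real \<Rightarrow> real \<Rightarrow> real \<Rightarrow> (real \<Rightarrow> real) \<Rightarrow> real set \<Rightarrow> (real \<Rightarrow> real) set" where
  "coeff_class \<beta> H \<kappa> K U \<xi>s J =
     {\<xi> \<in> hoelder_ball \<beta> {0..U} H.
        (\<forall>r\<in>{0..U}. \<kappa> \<le> \<xi> r \<and> \<xi> r \<le> K) \<and> (\<forall>r\<in>{0..U} - J. \<xi> r = \<xi>s r)}"

definition compactly_inside :: "real set \<Rightarrow> real set \<Rightarrow> bool" where
  "compactly_inside A B \<longleftrightarrow> compact A \<and> A \<subseteq> interior B"

section \<open>Estimators and sampling\<close>

definition L2_norm_on :: "real set \<Rightarrow> (real \<Rightarrow> real) \<Rightarrow> real" where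
  "L2_norm_on I f = sqrt (LBINT r:I. (f r)\<^sup>2)"

text \<open>
  An estimator is a measurable map from the sample space to \<open>L\<^sup>2(I)\<close>. As \<open>L\<^sup>2(I)\<close> is separable,
  this is the same as having a jointly measurable representative.
\<close>

definition estimators :: "nat \<Rightarrow> real set \<Rightarrow> ((nat \<Rightarrow> real^'d) \<Rightarrow> real \<Rightarrow> real) set" where
  "estimators n I =
     {T. (\<lambda>(x, r). T x r) \<in> borel_measurable (PiM {..<n} (\<lambda>_. borel) \<Otimes>\<^sub>M borel) \<and>
         (\<forall>x \<in> space (PiM {..<n} (\<lambda>_. borel)). set_integrable lborel I (\<lambda>r. (T x r)\<^sup>2))}"

text \<open>The law of the i.i.d. sample for a coefficient given on \<open>[0, U]\<close>.\<close>

definition sample_law ::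
  "(real^'d \<Rightarrow> real) \<Rightarrow> real \<Rightarrow> nat \<Rightarrow> (real \<Rightarrow> real) \<Rightarrow> (nat \<Rightarrow> real^'d) measure" where
  "sample_law V U n \<xi> = PiM {..<n} (\<lambda>_. stat_law V (const_ext U \<xi>))"

end

theory Submission
  imports Defs "HOL-Probability.Infinite_Product_Measure"
begin

text \<open>
  Assouad's scheme is run on the coefficients \<open>\<xi>s + \<Sum>\<^sub>j\<in>\<omega> B\<^sub>j\<close>, where the \<open>M \<approx> n\<^bsup>1/(2\<beta>+3)\<^esup>\<close> bumps
  \<open>B\<^sub>j\<close> have width \<open>w \<approx> 1/M\<close> and height \<open>w\<^bsup>\<beta>\<^esup>\<close>. Each bump consists of a positive and a negative
  half, balanced such that \<open>g\<close> only changes on the support of the bump, by at most \<open>w\<^bsup>\<beta>+1\<^esup>\<close>. As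
  the level mass is bounded on the relevant heights, \<open>\<mu>\<close> moves by at most \<open>w\<^bsup>\<beta>+2\<^esup>\<close>, so flipping a
  bump changes the density by a squared Hellinger distance of order \<open>w\<^bsup>2\<beta>+3\<^esup> \<approx> 1/n\<close>, and the flips
  cannot be detected, whereas each wrong decision costs \<open>w\<^bsup>2\<beta>+1\<^esup>\<close> in the squared loss.

  The constant \<open>\<mu>\<close> is normalised through the level masses, while the law is a density with respect
  to Lebesgue measure. Only one half of the coarea formula is needed to compare the two: the
  stationary density has finite mass at least 1, and excess mass only increases the risk.
\<close>

section \<open>Rotation invariance and the volume of a cylinder\<close>

text \<open>The half coarea inequality is needed with its sharp constant: a density of mass
  \<open>c\<close> gives a sample law of mass \<open>c ^ n\<close>, so a lower bound for the mass
  that is below 1 would be useless for large \<open>n\<close>. This is why coverings by cubes do not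
  suffice and flat cylinders orthogonal to the gradient are used, whose volume calls for rotation
  invariance.

  The tests therefore get individual error budgets; only their sum is controlled, because the slabs
  are disjoint and lie in one set of finite volume.

  Integrals containing \<open>level_mass\<close> are lower integrals, for which only monotonicity,
  scaling and subadditivity with a measurable second term are used.

  Densities are compared through their logarithms: \<open>ln\<close> of \<open>g_inv\<close> has
  slopes between \<open>\<kappa>\<close> and \<open>K\<close>, so a shift of \<open>g\<close> or of
  \<open>mu\<close> becomes an additive error.\<close>

lemma nn_integral_lborel_translate:
  fixes h :: "'a::euclidean_space \<Rightarrow> ennreal"
  assumes [measurable]: "h \<in> borel_measurable borel"
  shows "(\<integral>\<^sup>+ y. h (y + z) \<partial>lborel) = (\<integral>\<^sup>+ y. h y \<partial>lborel)"
proof -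
  have "(\<integral>\<^sup>+ y. h y \<partial>lborel) = (\<integral>\<^sup>+ y. h y \<partial>distr lborel borel ((+) z))"
    by (simp add: lborel_distr_plus)
  also have "\<dots> = (\<integral>\<^sup>+ y. h (z + y) \<partial>lborel)"
    by (subst nn_integral_distr) auto
  finally show ?thesis by (simp add: add.commute)
qed

lemma nn_integral_lborel_reflect:
  fixes h :: "'a::euclidean_space \<Rightarrow> ennreal"
  assumes [measurable]: "h \<in> borel_measurable borel"
  shows "(\<integral>\<^sup>+ y. h (z - y) \<partial>lborel) = (\<integral>\<^sup>+ y. h y \<partial>lborel)"
proof -
  have "(\<integral>\<^sup>+ y. h y \<partial>lborel) = (\<integral>\<^sup>+ y. h y \<partial>distr lborel borel (\<lambda>x. z + (-1) *\<^sub>R x))"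
    by (subst lborel_affine[of "-1" z]) (auto simp: density_1)
  also have "\<dots> = (\<integral>\<^sup>+ y. h (z - y) \<partial>lborel)"
    by (subst nn_integral_distr) auto
  finally show ?thesis by simp
qed

text \<open>
  Fubini applied to \<open>\<integral>\<integral> 1_A(x) 1_B(f y - x) dx dy\<close>, with \<open>B\<close> the unit ball, gives
  \<open>\<lambda>(A) \<lambda>(B) = \<lambda>(f\<inverse> A) \<lambda>(B)\<close>.
\<close>

lemma emeasure_lborel_orthogonal_vimage:
  fixes f :: "'a::euclidean_space \<Rightarrow> 'a"
  assumes f: "orthogonal_transformation f" and A[measurable]: "A \<in> sets borel"
  shows "emeasure lborel (f -` A) = emeasure lborel A"
proof -
  have lin: "linear f" using f by (rule orthogonal_transformation_linear)
  have [measurable]: "f \<in> borel_measurable borel"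
    using lin by (intro borel_measurable_continuous_onI linear_continuous_on linear_conv_bounded_linear[THEN iffD1])
  define B where "B = cball (0::'a) 1"
  have [measurable]: "B \<in> sets borel" by (simp add: B_def)
  have bij: "bij f" using f by (rule orthogonal_transformation_bij)
  \<comment> \<open>Norm preservation enters only here; the rest of the argument works for any
    linear bijection.\<close>
  have fB: "f y \<in> B \<longleftrightarrow> y \<in> B" for y
    using f by (simp add: B_def orthogonal_transformation_norm)
  let ?I = "\<lambda>S. indicator S :: 'a \<Rightarrow> ennreal"
  have "(\<integral>\<^sup>+ x. \<integral>\<^sup>+ y. ?I A x * ?I B (f y - x) \<partial>lborel \<partial>lborel) =
        (\<integral>\<^sup>+ x. ?I A x * emeasure lborel B \<partial>lborel)"
  proof (intro nn_integral_cong)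
    fix x
    obtain z where z: "f z = - x" using bij by (metis bij_pointE)
    have "(\<integral>\<^sup>+ y. ?I A x * ?I B (f y - x) \<partial>lborel) = ?I A x * (\<integral>\<^sup>+ y. ?I B (f y - x) \<partial>lborel)"
      by (rule nn_integral_cmult) auto
    also have "(\<integral>\<^sup>+ y. ?I B (f y - x) \<partial>lborel) = (\<integral>\<^sup>+ y. ?I B (f (y + z)) \<partial>lborel)"
      using z lin by (simp add: linear_add)
    also have "\<dots> = (\<integral>\<^sup>+ y. ?I B (f y) \<partial>lborel)"
      by (rule nn_integral_lborel_translate[where h="\<lambda>y. ?I B (f y)"]) auto
    also have "\<dots> = (\<integral>\<^sup>+ y. ?I B y \<partial>lborel)"
      by (intro nn_integral_cong) (simp add: indicator_def fB)
    also have "\<dots> = emeasure lborel B" by simp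
    finally show "(\<integral>\<^sup>+ y. ?I A x * ?I B (f y - x) \<partial>lborel) = ?I A x * emeasure lborel B" .
  qed
  also have "\<dots> = emeasure lborel A * emeasure lborel B"
    by (subst nn_integral_multc) auto
  finally have 1: "(\<integral>\<^sup>+ x. \<integral>\<^sup>+ y. ?I A x * ?I B (f y - x) \<partial>lborel \<partial>lborel) = emeasure lborel A * emeasure lborel B" .
  have "(\<integral>\<^sup>+ x. \<integral>\<^sup>+ y. ?I A x * ?I B (f y - x) \<partial>lborel \<partial>lborel) =
        (\<integral>\<^sup>+ y. \<integral>\<^sup>+ x. ?I A x * ?I B (f y - x) \<partial>lborel \<partial>lborel)"
    by (rule lborel_pair.Fubini') simp
  also have "\<dots> = (\<integral>\<^sup>+ y. \<integral>\<^sup>+ x. ?I A (f y - x) * ?I B x \<partial>lborel \<partial>lborel)"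
  proof (rule nn_integral_cong)
    fix y
    have "(\<integral>\<^sup>+ x. ?I A x * ?I B (f y - x) \<partial>lborel)
       = (\<integral>\<^sup>+ x. (\<lambda>x. ?I A (f y - x) * ?I B x) (f y - x) \<partial>lborel)" by simp
    also have "\<dots> = (\<integral>\<^sup>+ x. ?I A (f y - x) * ?I B x \<partial>lborel)"
      by (rule nn_integral_lborel_reflect) measurable
    finally show "(\<integral>\<^sup>+ x. ?I A x * ?I B (f y - x) \<partial>lborel)
       = (\<integral>\<^sup>+ x. ?I A (f y - x) * ?I B x \<partial>lborel)" by simp
  qed
  also have "\<dots> = (\<integral>\<^sup>+ x. \<integral>\<^sup>+ y. ?I A (f y - x) * ?I B x \<partial>lborel \<partial>lborel)"
    by (rule lborel_pair.Fubini'[symmetric]) simp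
  also have "\<dots> = (\<integral>\<^sup>+ x. ?I B x * emeasure lborel (f -` A) \<partial>lborel)"
  proof (intro nn_integral_cong)
    fix x
    obtain z where z: "f z = - x" using bij by (metis bij_pointE)
    have "(\<integral>\<^sup>+ y. ?I A (f y - x) * ?I B x \<partial>lborel) = (\<integral>\<^sup>+ y. ?I A (f y - x) \<partial>lborel) * ?I B x"
      by (rule nn_integral_multc) auto
    also have "(\<integral>\<^sup>+ y. ?I A (f y - x) \<partial>lborel) = (\<integral>\<^sup>+ y. ?I A (f (y + z)) \<partial>lborel)"
      using z lin by (simp add: linear_add)
    also have "\<dots> = (\<integral>\<^sup>+ y. ?I A (f y) \<partial>lborel)"
      by (rule nn_integral_lborel_translate[where h="\<lambda>y. ?I A (f y)"]) auto
    also have "\<dots> = (\<integral>\<^sup>+ y. ?I (f -` A) y \<partial>lborel)"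
      by (intro nn_integral_cong) (simp add: indicator_def)
    also have "\<dots> = emeasure lborel (f -` A)"
      by (rule nn_integral_indicator) (metis A \<open>f \<in> borel_measurable borel\<close> in_borel_measurable_borel sets_lborel space_borel Int_UNIV_right)
    finally show "(\<integral>\<^sup>+ y. ?I A (f y - x) * ?I B x \<partial>lborel) = ?I B x * emeasure lborel (f -` A)"
      by (simp add: mult.commute)
  qed
  also have "\<dots> = emeasure lborel (f -` A) * emeasure lborel B"
    by (subst nn_integral_multc) (auto simp: mult.commute)
  finally have "emeasure lborel A * emeasure lborel B = emeasure lborel (f -` A) * emeasure lborel B"
    using 1 by simp
  moreover have "emeasure lborel B \<noteq> 0" "emeasure lborel B \<noteq> \<infinity>"
    using less_imp_neq[OF unit_ball_vol_pos[of "real DIM('a)"]] by (auto simp: B_def emeasure_cball)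
  ultimately show ?thesis
    by (metis mult_divide_eq_ennreal infinity_ennreal_def)
qed

lemma norm_diff_Basis_component:
  fixes x :: "'a::euclidean_space"
  assumes b: "b \<in> Basis"
  shows "norm (x - (x \<bullet> b) *\<^sub>R b) = sqrt (\<Sum>i\<in>Basis - {b}. (x \<bullet> i)\<^sup>2)"
proof -
  have "norm (x - (x \<bullet> b) *\<^sub>R b) = sqrt (\<Sum>i\<in>Basis. ((x - (x \<bullet> b) *\<^sub>R b) \<bullet> i)\<^sup>2)"
    by (simp add: norm_eq_sqrt_inner euclidean_inner[of "x - (x \<bullet> b) *\<^sub>R b" "x - (x \<bullet> b) *\<^sub>R b"] power2_eq_square)
  also have "(\<Sum>i\<in>Basis. ((x - (x \<bullet> b) *\<^sub>R b) \<bullet> i)\<^sup>2) = (\<Sum>i\<in>Basis - {b}. ((x - (x \<bullet> b) *\<^sub>R b) \<bullet> i)\<^sup>2)"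
    using b by (intro sum.mono_neutral_right) (auto simp: inner_diff_left)
  also have "\<dots> = (\<Sum>i\<in>Basis - {b}. (x \<bullet> i)\<^sup>2)"
    using b by (intro sum.cong) (auto simp: inner_diff_left inner_not_same_Basis)
  finally show ?thesis .
qed

text \<open>Fubini splits off the coordinate along \<open>b\<close>; the slices in the remaining
  coordinates are balls, with volume given by \<open>emeasure_cball_aux\<close>.\<close>

lemma emeasure_cylinder_Basis:
  fixes b :: "'a::euclidean_space"
  assumes b: "b \<in> Basis" and r: "0 < r" and h: "0 \<le> h"
  shows "emeasure lborel {x. norm (x - (x \<bullet> b) *\<^sub>R b) \<le> r \<and> \<bar>x \<bullet> b\<bar> \<le> h}
     = ennreal (unit_ball_vol (real (DIM('a) - 1)) * r ^ (DIM('a) - 1) * (2 * h))"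
proof -
  interpret product_sigma_finite "\<lambda>_::'a. lborel :: real measure" by standard
  let ?C = "{x. norm (x - (x \<bullet> b) *\<^sub>R b) \<le> r \<and> \<bar>x \<bullet> b\<bar> \<le> h}"
  let ?P = "\<lambda>A. Pi\<^sub>M A (\<lambda>_::'a. lborel :: real measure)"
  define A where "A = Basis - {b}"
  have A: "finite A" "b \<notin> A" "insert b A = Basis" "card A = DIM('a) - 1"
    using b by (auto simp: A_def)
  have [measurable]: "?C \<in> sets borel" by measurable
  let ?f = "\<lambda>f. \<Sum>i\<in>Basis. f i *\<^sub>R (i::'a)"
  let ?D = "{f. sqrt (\<Sum>i\<in>A. (f i)\<^sup>2) \<le> r}"
  have fin: "?f f \<in> ?C \<longleftrightarrow> f \<in> ?D \<and> f b \<in> {-h..h}" for f :: "'a \<Rightarrow> real"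
    using b by (simp add: norm_diff_Basis_component[OF b] A_def inner_sum_left_Basis abs_le_iff) (auto)
  have [measurable]: "?f \<in> borel_measurable (?P Basis)"
    by measurable
  have "emeasure lborel ?C = emeasure (distr (?P Basis) borel ?f) ?C"
    by (simp add: lborel_eq[symmetric])
  also have "\<dots> = (\<integral>\<^sup>+ x. indicator ?C x \<partial>distr (?P Basis) borel ?f)"
    by (rule nn_integral_indicator[symmetric]) simp
  also have "\<dots> = (\<integral>\<^sup>+ f. indicator ?C (?f f) \<partial>?P Basis)"
    by (rule nn_integral_distr) auto
  also have "\<dots> = (\<integral>\<^sup>+ f. indicator ?C (?f f) \<partial>?P (insert b A))"
    by (simp add: A)
  also have "\<dots> = (\<integral>\<^sup>+ y. (\<integral>\<^sup>+ f. indicator ?C (?f (f(b := y))) \<partial>?P A) \<partial>lborel)"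
    by (rule product_nn_integral_insert_rev[OF A(1,2)]) (simp add: A)
  also have "\<dots> = (\<integral>\<^sup>+ y. indicator {-h..h} y * ennreal (unit_ball_vol (real (DIM('a) - 1)) * r ^ (DIM('a) - 1)) \<partial>lborel)"
  proof (intro nn_integral_cong)
    fix y :: real
    have "(f(b := y)) \<in> ?D \<longleftrightarrow> f \<in> ?D" for f :: "'a \<Rightarrow> real"
    proof -
      have "(\<Sum>i\<in>A. ((f(b := y)) i)\<^sup>2) = (\<Sum>i\<in>A. (f i)\<^sup>2)"
        using A(2) by (intro sum.cong) auto
      then show ?thesis by simp
    qed
    then have "(\<integral>\<^sup>+ f. indicator ?C (?f (f(b := y))) \<partial>?P A)
       = (\<integral>\<^sup>+ f. indicator {-h..h} y * indicator (?D \<inter> space (?P A)) f \<partial>?P A)"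
      by (intro nn_integral_cong) (simp only: indicator_def fin Int_iff, auto)
    also have "\<dots> = indicator {-h..h} y * emeasure (?P A) (?D \<inter> space (?P A))"
      by (subst nn_integral_cmult) (auto simp: A(1))
    finally show "(\<integral>\<^sup>+ f. indicator ?C (?f (f(b := y))) \<partial>?P A)
       = indicator {-h..h} y * ennreal (unit_ball_vol (real (DIM('a) - 1)) * r ^ (DIM('a) - 1))"
      using emeasure_cball_aux[OF A(1) r] by (simp add: A(4))
  qed
  also have "\<dots> = ennreal (2 * h) * ennreal (unit_ball_vol (real (DIM('a) - 1)) * r ^ (DIM('a) - 1))"
    using h by (subst nn_integral_multc) auto
  also have "\<dots> = ennreal (unit_ball_vol (real (DIM('a) - 1)) * r ^ (DIM('a) - 1) * (2 * h))"
    using h r by (simp add: ennreal_mult'[symmetric] mult_ac)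
  finally show ?thesis .
qed

text \<open>A rotation taking a basis vector to \<open>u\<close>, followed by a translation, reduces
  this to the axis-parallel case.\<close>

lemma emeasure_cylinder:
  fixes u c :: "real^'d"
  assumes u: "norm u = 1" and r: "0 < r" and h: "0 \<le> h"
  shows "emeasure lborel {x. norm ((x - c) - ((x - c) \<bullet> u) *\<^sub>R u) \<le> r \<and> \<bar>(x - c) \<bullet> u\<bar> \<le> h}
     = ennreal (unit_ball_vol (real (CARD('d) - 1)) * r ^ (CARD('d) - 1) * (2 * h))"
proof -
  obtain b :: "real^'d" where b: "b \<in> Basis" using nonempty_Basis by blast
  obtain f where f: "orthogonal_transformation f" "f b = u"
    using orthogonal_transformation_exists_1[of b u] b u by auto
  have lin: "linear f" using f by (rule_tac orthogonal_transformation_linear)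
  let ?C = "\<lambda>u. {x. norm (x - (x \<bullet> u) *\<^sub>R u) \<le> r \<and> \<bar>x \<bullet> u\<bar> \<le> h}"
  have inn: "f x \<bullet> u = x \<bullet> b" for x
    using f by (metis orthogonal_transformation_def)
  have nrm: "norm (f x - (f x \<bullet> u) *\<^sub>R u) = norm (x - (x \<bullet> b) *\<^sub>R b)" for x
  proof -
    have "f x - (f x \<bullet> u) *\<^sub>R u = f (x - (x \<bullet> b) *\<^sub>R b)"
      using lin f(2) by (simp add: inn linear_diff linear_scale)
    then show ?thesis using f(1) by (simp add: orthogonal_transformation_norm)
  qed
  have [measurable]: "?C u \<in> sets borel" by measurable
  have eq: "f -` ?C u = ?C b"
    by (simp add: vimage_def nrm del: inn) (simp add: inn)
  have "emeasure lborel {x. norm ((x - c) - ((x - c) \<bullet> u) *\<^sub>R u) \<le> r \<and> \<bar>(x - c) \<bullet> u\<bar> \<le> h}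
    = (\<integral>\<^sup>+ x. indicator (?C u) (x + (- c)) \<partial>lborel)"
  proof -
    let ?S = "{x. norm ((x - c) - ((x - c) \<bullet> u) *\<^sub>R u) \<le> r \<and> \<bar>(x - c) \<bullet> u\<bar> \<le> h}"
    have "?S \<in> sets lborel" by measurable
    then have "emeasure lborel ?S = (\<integral>\<^sup>+ x. indicator ?S x \<partial>lborel)" by simp
    also have "\<dots> = (\<integral>\<^sup>+ x. indicator (?C u) (x + (- c)) \<partial>lborel)"
      by (intro nn_integral_cong) (simp add: indicator_def)
    finally show ?thesis .
  qed
  also have "\<dots> = (\<integral>\<^sup>+ x. indicator (?C u) x \<partial>lborel)"
    by (rule nn_integral_lborel_translate) auto
  also have "\<dots> = emeasure lborel (?C u)" by simp
  also have "\<dots> = emeasure lborel (?C b)"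
    using emeasure_lborel_orthogonal_vimage[OF f(1), of "?C u", unfolded eq] by simp
  also have "\<dots> = ennreal (unit_ball_vol (real (CARD('d) - 1)) * r ^ (CARD('d) - 1) * (2 * h))"
    using emeasure_cylinder_Basis[OF b r h] by simp
  finally show ?thesis .
qed

section \<open>Half of the coarea formula\<close>

text \<open>
  An outer measure dominating the integral over \<open>s\<close> of the Hausdorff premeasures of \<open>A \<inter> {V = s}\<close>:
  a covering set meets only the levels in \<open>{a i..b i}\<close>.
\<close>

definition cover_cost :: "('a::euclidean_space \<Rightarrow> real) \<Rightarrow> real \<Rightarrow> 'a set \<Rightarrow> ennreal" where
  "cover_cost V \<delta> A =
     (INF (C, a, b) \<in> {(C :: nat \<Rightarrow> 'a set, a :: nat \<Rightarrow> real, b). A \<subseteq> (\<Union>i. C i) \<and>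
         (\<forall>i. bounded (C i) \<and> diameter (C i) \<le> \<delta> \<and> a i \<le> b i \<and> V ` C i \<subseteq> {a i..b i})}.
        \<Sum>i. ennreal (unit_ball_vol (real (DIM('a) - 1)) * (diameter (C i) / 2) ^ (DIM('a) - 1) * (b i - a i)))"

lemma cover_cost_le:
  fixes V :: "'a::euclidean_space \<Rightarrow> real"
  assumes "A \<subseteq> (\<Union>i. C i)" "\<And>i. bounded (C i)" "\<And>i. diameter (C i) \<le> \<delta>"
    "\<And>i. a i \<le> b i" "\<And>i. V ` C i \<subseteq> {a i..b i}"
  shows "cover_cost V \<delta> A \<le>
    (\<Sum>i. ennreal (unit_ball_vol (real (DIM('a) - 1)) * (diameter (C i) / 2) ^ (DIM('a) - 1) * (b i - a i)))"
  unfolding cover_cost_def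
  by (rule INF_lower2[of "(C, a, b)"]) (use assms in auto)

lemma cover_cost_lessE:
  fixes V :: "'a::euclidean_space \<Rightarrow> real"
  assumes "cover_cost V \<delta> A < c"
  obtains C a b where "A \<subseteq> (\<Union>i::nat. C i)" "\<And>i. bounded (C i)" "\<And>i. diameter (C i) \<le> \<delta>"
    "\<And>i. a i \<le> b i" "\<And>i. V ` C i \<subseteq> {a i..b i}"
    "(\<Sum>i. ennreal (unit_ball_vol (real (DIM('a) - 1)) * (diameter (C i) / 2) ^ (DIM('a) - 1) * (b i - a i))) < c"
proof -
  obtain p where p: "p \<in> {(C :: nat \<Rightarrow> 'a set, a :: nat \<Rightarrow> real, b). A \<subseteq> (\<Union>i. C i) \<and>
         (\<forall>i. bounded (C i) \<and> diameter (C i) \<le> \<delta> \<and> a i \<le> b i \<and> V ` C i \<subseteq> {a i..b i})}"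
    "(case p of (C, a, b) \<Rightarrow> \<Sum>i. ennreal (unit_ball_vol (real (DIM('a) - 1)) * (diameter (C i) / 2) ^ (DIM('a) - 1) * (b i - a i))) < c"
    using assms unfolding cover_cost_def INF_less_iff by blast
  obtain C a b where eq: "p = (C, a, b)" by (cases p)
  show thesis
    by (rule that[of C a b]) (use p in \<open>simp_all only: eq mem_Collect_eq case_prod_conv\<close>)
qed

lemma cover_cost_mono: "A \<subseteq> B \<Longrightarrow> cover_cost V \<delta> A \<le> cover_cost V \<delta> B"
  unfolding cover_cost_def by (rule INF_superset_mono) auto

lemma cover_cost_single:
  fixes V :: "'a::euclidean_space \<Rightarrow> real"
  assumes "bounded A" "diameter A \<le> \<delta>" "a \<le> b" "V ` A \<subseteq> {a..b}" "0 \<le> \<delta>"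
  shows "cover_cost V \<delta> A \<le>
    ennreal (unit_ball_vol (real (DIM('a) - 1)) * (diameter A / 2) ^ (DIM('a) - 1) * (b - a))"
proof -
  let ?C = "\<lambda>i::nat. if i = 0 then A else {}"
  let ?a = "\<lambda>i::nat. if i = 0 then a else 0"
  let ?b = "\<lambda>i::nat. if i = 0 then b else 0"
  have "cover_cost V \<delta> A \<le> (\<Sum>i. ennreal (unit_ball_vol (real (DIM('a) - 1)) *
      (diameter (?C i) / 2) ^ (DIM('a) - 1) * (?b i - ?a i)))"
  proof (rule cover_cost_le)
    show "A \<subseteq> (\<Union>i. ?C i)" using UN_upper[of 0 UNIV ?C] by simp
  qed (use assms in auto)
  also have "\<dots> = ennreal (unit_ball_vol (real (DIM('a) - 1)) * (diameter A / 2) ^ (DIM('a) - 1) * (b - a))"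
    by (subst suminf_finite[of "{0}"]) auto
  finally show ?thesis .
qed

lemma cover_cost_empty: "0 \<le> \<delta> \<Longrightarrow> cover_cost V \<delta> {} = 0"
  using cover_cost_single[of "{}" \<delta> 0 0 V] by simp

lemma cover_cost_UN: "cover_cost V \<delta> (\<Union>i::nat. A i) \<le> (\<Sum>i. cover_cost V \<delta> (A i))"
proof (rule ennreal_le_epsilon)
  fix e :: real
  assume fin: "(\<Sum>i. cover_cost V \<delta> (A i)) < top" and e: "0 < e"
  let ?k = "DIM('a) - 1"
  let ?cost = "\<lambda>C a b. ennreal (unit_ball_vol (real ?k) * (diameter C / 2) ^ ?k * (b - a))"
  define Q where "Q i C a b \<longleftrightarrow> A i \<subseteq> (\<Union>j::nat. C j) \<and> (\<forall>j. bounded (C j) \<and> diameter (C j) \<le> \<delta> \<and> a j \<le> b j \<and> V ` C j \<subseteq> {a j..b j}) \<and>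
      (\<Sum>j. ?cost (C j) (a j) (b j)) \<le> cover_cost V \<delta> (A i) + ennreal (e * (1/2) ^ Suc i)" for i C a b
  have "\<exists>C a b. Q i C a b" for i
  proof -
    have "cover_cost V \<delta> (A i) < top"
      using fin by (metis ennreal_suminf_lessD)
    then have lt: "cover_cost V \<delta> (A i) < cover_cost V \<delta> (A i) + ennreal (e * (1/2) ^ Suc i)"
      using e by (simp add: less_top ennreal_add_left_cancel_less[of _ 0, simplified])
    obtain C a b where "A i \<subseteq> (\<Union>i::nat. C i)" "\<And>i. bounded (C i)" "\<And>i. diameter (C i) \<le> \<delta>"
    "\<And>i. a i \<le> b i" "\<And>i. V ` C i \<subseteq> {a i..b i}" "(\<Sum>j. ?cost (C j) (a j) (b j)) < cover_cost V \<delta> (A i) + ennreal (e * (1/2) ^ Suc i)"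
      apply (rule cover_cost_lessE[OF lt])
      subgoal premises p by (rule p(1)[OF p(2-)])
      done
    then show ?thesis by (intro exI[of _ C] exI[of _ a] exI[of _ b]) (simp add: Q_def less_imp_le)
  qed
  then obtain C a b where Q: "\<And>i. Q i (C i) (a i) (b i)" by metis
  have C: "\<And>i. A i \<subseteq> (\<Union>j::nat. C i j)"
    "\<And>i j. bounded (C i j) \<and> diameter (C i j) \<le> \<delta> \<and> a i j \<le> b i j \<and> V ` C i j \<subseteq> {a i j..b i j}"
    "\<And>i. (\<Sum>j. ?cost (C i j) (a i j) (b i j)) \<le> cover_cost V \<delta> (A i) + ennreal (e * (1/2) ^ Suc i)"
    using Q unfolding Q_def by blast+
  let ?f = "\<lambda>F n. F (fst (prod_decode n)) (snd (prod_decode n))"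
  have "cover_cost V \<delta> (\<Union>i. A i) \<le> (\<Sum>n. ?cost (?f C n) (?f a n) (?f b n))"
  proof (rule cover_cost_le)
    show "(\<Union>i. A i) \<subseteq> (\<Union>n. ?f C n)"
    proof
      fix x assume "x \<in> (\<Union>i. A i)"
      then obtain i j where "x \<in> C i j" using C(1) by blast
      then have "x \<in> ?f C (prod_encode (i, j))" by simp
      then show "x \<in> (\<Union>n. ?f C n)" by (rule UN_I[OF UNIV_I])
    qed
  qed (simp_all only: C(2))
  also have "\<dots> = (\<Sum>n. (\<lambda>(i, j). ?cost (C i j) (a i j) (b i j)) (prod_decode n))"
    by (simp add: case_prod_beta)
  also have "\<dots> = (\<Sum>i. \<Sum>j. ?cost (C i j) (a i j) (b i j))"
    by (rule suminf_ennreal_2dimen) simp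
  also have "\<dots> \<le> (\<Sum>i. cover_cost V \<delta> (A i) + ennreal (e * (1/2) ^ Suc i))"
    by (intro suminf_le C(3)) auto
  also have "\<dots> = (\<Sum>i. cover_cost V \<delta> (A i)) + (\<Sum>i. ennreal (e * (1/2) ^ Suc i))"
    by (rule suminf_add[symmetric]) auto
  also have "(\<Sum>i. ennreal (e * (1/2) ^ Suc i)) = ennreal (e * 1)"
    using e by (intro suminf_ennreal_eq sums_mult power_half_series) auto
  finally show "cover_cost V \<delta> (\<Union>i. A i) \<le> (\<Sum>i. cover_cost V \<delta> (A i)) + ennreal e" by simp
qed

lemma cover_cost_Un: 
  assumes "0 \<le> \<delta>"
  shows "cover_cost V \<delta> (A \<union> B) \<le> cover_cost V \<delta> A + cover_cost V \<delta> B"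
proof -
  let ?A = "\<lambda>i::nat. if i = 0 then A else if i = 1 then B else {}"
  have "A \<union> B = (\<Union>i. ?A i)"
    by (auto split: if_splits intro: exI[of _ 0] exI[of _ 1])
  then have "cover_cost V \<delta> (A \<union> B) \<le> (\<Sum>i. cover_cost V \<delta> (?A i))"
    using cover_cost_UN[of V \<delta> ?A] by simp
  also have "\<dots> = (\<Sum>i\<in>{0,1}. cover_cost V \<delta> (?A i))"
    by (rule suminf_finite) (auto simp: cover_cost_empty assms)
  finally show ?thesis by simp
qed

section \<open>Covering Borel sets by small cubes\<close>

lemma emeasure_cube:
  fixes c :: "'a::euclidean_space"
  assumes "0 < s"
  shows "emeasure lborel (cbox (c - s *\<^sub>R One) (c + s *\<^sub>R One)) = ennreal ((2 * s) ^ DIM('a))"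
proof -
  have "(\<Prod>b\<in>Basis. ((c + s *\<^sub>R One) - (c - s *\<^sub>R One)) \<bullet> b) = (\<Prod>b\<in>(Basis::'a set). 2 * s)"
    by (intro prod.cong) (auto simp: inner_simps)
  then show ?thesis using assms by (subst emeasure_lborel_cbox) (auto simp: inner_simps)
qed

text \<open>Outer regularity puts \<open>W\<close> into an open set of barely larger measure, and
  the dyadic \<open>covering_lemma\<close> fills it with non-overlapping boxes, kept small and
  inside by the gauge. The boxes are genuine cubes because the starting box is one; the inscribed
  cylinders used later rely on this.\<close>

lemma cube_cover:
  fixes W :: "'a::euclidean_space set"
  assumes W: "W \<in> sets borel" "W \<subseteq> G" and G: "open G" "bounded G" and e: "0 < e" and \<delta>: "0 < \<delta>"
  obtains K :: "nat \<Rightarrow> 'a set" where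
    "\<And>i. K i = {} \<or> (\<exists>c s. 0 < s \<and> K i = cbox (c - s *\<^sub>R One) (c + s *\<^sub>R One))"
    "\<And>i. K i \<subseteq> G" "\<And>i. diameter (K i) \<le> \<delta>" "W \<subseteq> (\<Union>i. K i)"
    "(\<Sum>i. emeasure lborel (K i)) \<le> emeasure lborel W + ennreal e"
proof -
  obtain U where U: "open U" "W \<subseteq> U" "emeasure lborel (U - W) < ennreal e"
    using outer_regular_lborel[OF W(1) e] by blast
  define U' where "U' = U \<inter> G"
  have U': "open U'" "W \<subseteq> U'" using U W G by (auto simp: U'_def)
  obtain B where B: "0 < B" "\<And>x. x \<in> G \<Longrightarrow> norm x \<le> B"
    using G(2) by (metis bounded_pos)
  let ?a = "- B *\<^sub>R One :: 'a" and ?b = "B *\<^sub>R One :: 'a"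
  \<comment> \<open>Each box of \<open>covering_lemma\<close> contains a point of \<open>W\<close>
    whose gauge neighbourhood contains the box. As \<open>W \<subseteq> U'\<close>, the second
    branch never concerns such a point.\<close>
  define g where "g x = (if x \<in> U' then U' \<inter> ball x (\<delta>/2) else ball x 1)" for x
  have g: "gauge g" using U' \<delta> by (auto simp: gauge_def g_def)
  have sub: "W \<subseteq> cbox ?a ?b"
  proof
    fix x assume "x \<in> W"
    then have "norm x \<le> B" using W B by auto
    then have *: "\<bar>x \<bullet> i\<bar> \<le> B" if "i \<in> Basis" for i
      using Basis_le_norm[OF that] by (meson order_trans)
    show "x \<in> cbox ?a ?b"
      unfolding mem_box
    proof (intro ballI)
      fix i :: 'a assume i: "i \<in> Basis"
      show "?a \<bullet> i \<le> x \<bullet> i \<and> x \<bullet> i \<le> ?b \<bullet> i" using *[OF i] i by (simp add: abs_le_iff)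
    qed
  qed
  have ne: "box ?a ?b \<noteq> {}" using B by (auto simp: box_ne_empty)
  obtain \<D> where D: "countable \<D>"  "\<Union>\<D> \<subseteq> cbox ?a ?b"
    "\<And>K. K \<in> \<D> \<Longrightarrow> interior K \<noteq> {} \<and> (\<exists>c d. K = cbox c d)"
    "pairwise (\<lambda>A B. interior A \<inter> interior B = {}) \<D>"
    "\<And>K. K \<in> \<D> \<Longrightarrow> \<exists>x \<in> W \<inter> K. K \<subseteq> g x"
    "\<And>u v. cbox u v \<in> \<D> \<Longrightarrow> \<exists>n. \<forall>i \<in> Basis. v \<bullet> i - u \<bullet> i = (?b \<bullet> i - ?a \<bullet> i) / 2^n"
    "W \<subseteq> \<Union>\<D>"
    apply (rule covering_lemma[OF sub ne g])
    subgoal premises p by (rule p(1)[OF p(2-)])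
    done
  define K where "K i = (if i \<in> to_nat_on \<D> ` \<D> then from_nat_into \<D> i else {})" for i
  have K: "K i = {} \<or> K i \<in> \<D>" for i
    using D(1) by (auto simp: K_def)
  have small: "K i \<subseteq> U' \<and> diameter (K i) \<le> \<delta>" for i
  proof (cases "K i = {}")
    case False
    then obtain x where "x \<in> W" "K i \<subseteq> g x" using K D(5) by blast
    then have *: "K i \<subseteq> U'" "K i \<subseteq> ball x (\<delta>/2)" using U' by (auto simp: g_def split: if_splits)
    have "diameter (K i) \<le> diameter (ball x (\<delta>/2))"
      by (rule diameter_subset[OF *(2)]) simp
    then show ?thesis using * \<delta> by simp
  qed (use \<delta> in auto)
  have cube: "K i = {} \<or> (\<exists>c s. 0 < s \<and> K i = cbox (c - s *\<^sub>R One) (c + s *\<^sub>R One))" for i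
  proof (cases "K i = {}")
    case False
    then have KD: "K i \<in> \<D>" using K by auto
    then obtain u v where uv: "K i = cbox u v" using D(3) by blast
    obtain n where n: "\<forall>i \<in> Basis. v \<bullet> i - u \<bullet> i = (?b \<bullet> i - ?a \<bullet> i) / 2^n"
      using D(6) KD uv by metis
    define s where "s = B / 2^n"
    have s: "0 < s" using B by (simp add: s_def)
    have v: "v = u + (2 * s) *\<^sub>R One"
      using n by (intro euclidean_eqI[of v]) (auto simp: inner_simps s_def)
    let ?c = "u + s *\<^sub>R One"
    have "K i = cbox (?c - s *\<^sub>R One) (?c + s *\<^sub>R One)"
      using uv v by (simp add: algebra_simps scaleR_2[symmetric])
    then show ?thesis using s by blast
  qed auto
  \<comment> \<open>Neighbouring cubes may share faces, so only the interiors are disjoint; the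
    faces have measure zero.\<close>
  have intK: "emeasure lborel (K i) = emeasure lborel (interior (K i))" for i
    using cube[of i]
  proof
    assume "\<exists>c s. 0 < s \<and> K i = cbox (c - s *\<^sub>R One) (c + s *\<^sub>R One)"
    then obtain c s where "K i = cbox (c - s *\<^sub>R One) (c + s *\<^sub>R One)" by blast
    then show ?thesis by (simp add: emeasure_lborel_box_eq emeasure_lborel_cbox_eq)
  qed simp
  have disj: "disjoint_family (\<lambda>i. interior (K i))"
    unfolding disjoint_family_on_def
  proof (intro ballI impI)
    fix i j :: nat assume "i \<noteq> j"
    show "interior (K i) \<inter> interior (K j) = {}"
    proof (cases "i \<in> to_nat_on \<D> ` \<D> \<and> j \<in> to_nat_on \<D> ` \<D>")
      case True
      then obtain X Y where XY: "X \<in> \<D>" "i = to_nat_on \<D> X" "Y \<in> \<D>" "j = to_nat_on \<D> Y" by blast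
      then have "K i = X" "K j = Y" using D(1) by (auto simp: K_def)
      moreover have "X \<noteq> Y" using XY \<open>i \<noteq> j\<close> by blast
      ultimately show ?thesis using XY D(4) unfolding pairwise_def by blast
    qed (auto simp: K_def)
  qed
  have "(\<Sum>i. emeasure lborel (K i)) = emeasure lborel (\<Union>i. interior (K i))"
    unfolding intK by (rule suminf_emeasure) (use disj in auto)
  also have "\<dots> \<le> emeasure lborel U'"
    using small U' interior_subset by (intro emeasure_mono) (auto, blast)
  also have "\<dots> \<le> emeasure lborel (W \<union> (U - W))"
    using U W by (intro emeasure_mono) (auto simp: U'_def)
  also have "\<dots> \<le> emeasure lborel W + emeasure lborel (U - W)"
    using U W by (intro emeasure_subadditive) auto
  also have "\<dots> \<le> emeasure lborel W + ennreal e"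
    using U by (intro add_left_mono) auto
  finally have sum: "(\<Sum>i. emeasure lborel (K i)) \<le> emeasure lborel W + ennreal e" .
  have "W \<subseteq> (\<Union>i. K i)"
  proof
    fix x assume "x \<in> W"
    then obtain X where X: "X \<in> \<D>" "x \<in> X" using D(7) by blast
    then have "K (to_nat_on \<D> X) = X" using D(1) by (auto simp: K_def)
    then show "x \<in> (\<Union>i. K i)" using X by blast
  qed
  then show ?thesis
    using that[of K] cube small sum U'_def by auto
qed

text \<open>By countable subadditivity of the cost, a bound by volume need only be checked on small
  cubes. Both the crude bound and its improvement are proved through this reduction.\<close>

lemma cover_cost_from_cubes:
  fixes V :: "'a::euclidean_space \<Rightarrow> real"
  assumes G: "open G" "bounded G" and \<delta>: "0 < \<delta>" and B: "0 \<le> B"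
    and cube: "\<And>c s. 0 < s \<Longrightarrow> cbox (c - s *\<^sub>R One) (c + s *\<^sub>R One) \<subseteq> G \<Longrightarrow>
      diameter (cbox (c - s *\<^sub>R One) (c + s *\<^sub>R One)) \<le> \<delta> \<Longrightarrow>
      cover_cost V \<delta> (cbox (c - s *\<^sub>R One) (c + s *\<^sub>R One)) \<le> ennreal (B * (2 * s) ^ DIM('a))"
    and W: "W \<in> sets borel" "W \<subseteq> G"
  shows "cover_cost V \<delta> W \<le> ennreal B * emeasure lborel W"
proof (rule ennreal_le_epsilon)
  fix e :: real assume e: "0 < e"
  \<comment> \<open>The denominator is \<open>B + 1\<close> because \<open>B\<close> may be
    0.\<close>
  have e': "0 < e / (B + 1)" using e B by simp
  obtain K where K: "\<And>i. K i = {} \<or> (\<exists>c s. 0 < s \<and> K i = cbox (c - s *\<^sub>R One) (c + s *\<^sub>R One))"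
    "\<And>i. K i \<subseteq> G" "\<And>i. diameter (K i) \<le> \<delta>" "W \<subseteq> (\<Union>i::nat. K i)"
    "(\<Sum>i. emeasure lborel (K i)) \<le> emeasure lborel W + ennreal (e / (B + 1))"
    using cube_cover[OF W G e' \<delta>] by metis
  have cubeK: "cover_cost V \<delta> (K i) \<le> ennreal B * emeasure lborel (K i)" for i
    using K(1)[of i]
  proof
    assume "K i = {}" then show ?thesis using \<delta> by (simp add: cover_cost_empty)
  next
    assume "\<exists>c s. 0 < s \<and> K i = cbox (c - s *\<^sub>R One) (c + s *\<^sub>R One)"
    then obtain c s where s: "0 < s" and Kc: "K i = cbox (c - s *\<^sub>R One) (c + s *\<^sub>R One)" by blast
    show ?thesis
      using cube[OF s, of c] K(2,3)[of i] B unfolding Kc emeasure_cube[OF s] by (simp only: ennreal_mult')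
  qed
  have "cover_cost V \<delta> W \<le> cover_cost V \<delta> (\<Union>i. K i)" by (rule cover_cost_mono[OF K(4)])
  also have "\<dots> \<le> (\<Sum>i. cover_cost V \<delta> (K i))" by (rule cover_cost_UN)
  also have "\<dots> \<le> (\<Sum>i. ennreal B * emeasure lborel (K i))"
    by (intro suminf_le cubeK) auto
  also have "\<dots> \<le> ennreal B * (emeasure lborel W + ennreal (e / (B + 1)))"
    unfolding ennreal_suminf_cmult by (intro mult_left_mono K) auto
  also have "\<dots> = ennreal B * emeasure lborel W + ennreal (B * (e / (B + 1)))"
    using B e' by (simp add: distrib_left ennreal_mult'[symmetric] del: times_divide_eq_right)
  also have "\<dots> \<le> ennreal B * emeasure lborel W + ennreal e"
    using B e by (intro add_left_mono ennreal_leI) (simp add: field_simps)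
  finally show "cover_cost V \<delta> W \<le> ennreal B * emeasure lborel W + ennreal e" .
qed

text \<open>Each cube serves as its own cover, which gives some finite constant for a Lipschitz
  \<open>V\<close>. The value is far from optimal, but the improvement argument needs a finite
  constant to start from.\<close>

lemma cover_cost_crude:
  fixes V :: "'a::euclidean_space \<Rightarrow> real"
  assumes G: "open G" "bounded G" and \<delta>: "0 < \<delta>" and L: "0 \<le> L"
    and lip: "\<And>x y. x \<in> G \<Longrightarrow> y \<in> G \<Longrightarrow> \<bar>V x - V y\<bar> \<le> L * norm (x - y)"
  obtains B where "0 \<le> B" "\<And>W. W \<in> sets borel \<Longrightarrow> W \<subseteq> G \<Longrightarrow> cover_cost V \<delta> W \<le> ennreal B * emeasure lborel W"
proof -
  let ?D = "DIM('a)"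
  let ?k = "?D - 1"
  let ?u = "unit_ball_vol (real ?k)"
  have u: "0 \<le> ?u" by simp
  have D: "?D = Suc ?k" using DIM_positive[where 'a='a] by simp
  define B where "B = ?u * real ?D ^ ?k * (4 * L * ?D)"
  have B: "0 \<le> B" using u L by (simp add: B_def)
  have cube: "cover_cost V \<delta> (cbox (c - s *\<^sub>R One) (c + s *\<^sub>R One)) \<le> ennreal (B * (2 * s) ^ ?D)"
    if s: "0 < s" and KG: "cbox (c - s *\<^sub>R One) (c + s *\<^sub>R One) \<subseteq> G"
      and K\<delta>: "diameter (cbox (c - s *\<^sub>R One) (c + s *\<^sub>R One)) \<le> \<delta>" for c :: 'a and s
  proof -
    define K where Kc: "K = cbox (c - s *\<^sub>R One) (c + s *\<^sub>R One)"
    note KG = KG[folded Kc] and K\<delta> = K\<delta>[folded Kc]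
    have nrm: "norm (x - y) \<le> 2 * s * ?D" if "x \<in> K" "y \<in> K" for x y
    proof -
      have "norm (x - y) \<le> (\<Sum>b\<in>Basis. \<bar>(x - y) \<bullet> b\<bar>)" by (rule norm_le_l1)
      also have "\<dots> \<le> (\<Sum>b\<in>(Basis::'a set). 2 * s)"
      proof (rule sum_mono)
        fix b :: 'a assume b: "b \<in> Basis"
        have "c \<bullet> b - s \<le> x \<bullet> b" "x \<bullet> b \<le> c \<bullet> b + s" "c \<bullet> b - s \<le> y \<bullet> b" "y \<bullet> b \<le> c \<bullet> b + s"
          using that b unfolding Kc mem_box by (auto simp: inner_simps)
        then show "\<bar>(x - y) \<bullet> b\<bar> \<le> 2 * s" by (simp add: inner_simps)
      qed
      finally show ?thesis by (simp add: mult_ac)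
    qed
    have diam: "diameter K \<le> 2 * s * ?D"
      by (rule diameter_le) (use nrm s in auto)
    have c: "c \<in> K" using s by (auto simp: Kc mem_box inner_simps)
    have "cover_cost V \<delta> K \<le> ennreal (?u * (diameter K / 2) ^ ?k *
        ((V c + L * (2 * s * ?D)) - (V c - L * (2 * s * ?D))))"
    proof (rule cover_cost_single)
      show "bounded K" using Kc by simp
      show "V ` K \<subseteq> {V c - L * (2 * s * ?D)..V c + L * (2 * s * ?D)}"
      proof
        fix t assume "t \<in> V ` K"
        then obtain x where x: "x \<in> K" "t = V x" by blast
        have "\<bar>V x - V c\<bar> \<le> L * norm (x - c)" using lip x c KG by blast
        also have "\<dots> \<le> L * (2 * s * ?D)" using nrm[OF x(1) c] L by (rule mult_left_mono)
        finally show "t \<in> {V c - L * (2 * s * ?D)..V c + L * (2 * s * ?D)}" using x by auto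
      qed
    qed (use K\<delta> \<delta> s L in auto)
    also have "\<dots> \<le> ennreal (?u * (s * ?D) ^ ?k * (4 * L * s * ?D))"
      using u diam s L diameter_ge_0[of K] Kc by (intro ennreal_leI mult_mono power_mono) (auto simp: algebra_simps)
    also have "?u * (s * ?D) ^ ?k * (4 * L * s * ?D) = B * s ^ ?D"
    proof -
      have "s ^ ?D = s ^ ?k * s" using D by (metis power_Suc2)
      then show ?thesis by (simp add: B_def power_mult_distrib mult_ac del: of_nat_diff)
    qed
    also have "\<dots> \<le> B * (2 * s) ^ ?D"
      using B s by (intro mult_left_mono power_mono) auto
    finally show ?thesis by (simp add: Kc[symmetric] ennreal_leI)
  qed
  show thesis
    by (rule that[OF B]) (rule cover_cost_from_cubes[OF G \<delta> B cube])
qed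

text \<open>The volume of a cylinder of radius \<open>s / 2\<close> and height
  \<open>\<eta> * s / 2\<close> relative to the cube of side \<open>2 * s\<close>; it does not
  depend on \<open>s\<close>.\<close>

definition cylinder_fraction :: "'a::euclidean_space itself \<Rightarrow> real \<Rightarrow> real" where
  "cylinder_fraction _ \<eta> = unit_ball_vol (real (DIM('a) - 1)) * \<eta> / 4 ^ DIM('a)"

text \<open>The point is the diameter: a flat cylinder exceeds the diameter \<open>s\<close> of its
  base by a factor of at most \<open>1 + \<eta>\<close>, so the ball volume of half the diameter is
  almost the area of the base. For a cube these two quantities are far apart.\<close>

lemma cylinder_in_cube:
  fixes u c :: "real^'d"
  assumes u: "norm u = 1" and s: "0 < s" and \<eta>: "0 < \<eta>" "\<eta> \<le> 1"
  defines "Z \<equiv> {x. norm ((x - c) - ((x - c) \<bullet> u) *\<^sub>R u) \<le> s/2 \<and> \<bar>(x - c) \<bullet> u\<bar> \<le> \<eta> * s / 4}"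
  shows "Z \<subseteq> cbox (c - s *\<^sub>R One) (c + s *\<^sub>R One)" "Z \<in> sets borel"
    "\<And>x. x \<in> Z \<Longrightarrow> norm (x - c) \<le> s"
    "diameter Z \<le> s * (1 + \<eta>)"
    "emeasure lborel Z = ennreal (cylinder_fraction TYPE(real^'d) \<eta> * (2 * s) ^ CARD('d))"
    "emeasure lborel Z = ennreal (unit_ball_vol (real (CARD('d) - 1)) * (s/2) ^ (CARD('d) - 1) * (\<eta> * s / 2))"
proof -
  show meas: "Z \<in> sets borel" unfolding Z_def by measurable
  have es: "\<eta> * s \<le> s" using \<eta> s by simp
  show nrm: "norm (x - c) \<le> s" if "x \<in> Z" for x
  proof -
    have "norm (x - c) \<le> norm ((x - c) - ((x - c) \<bullet> u) *\<^sub>R u) + norm (((x - c) \<bullet> u) *\<^sub>R u)"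
      using norm_triangle_ineq[of "(x - c) - ((x - c) \<bullet> u) *\<^sub>R u" "((x - c) \<bullet> u) *\<^sub>R u"] by simp
    also have "\<dots> \<le> s/2 + \<eta> * s / 4" using that u by (auto simp: Z_def)
    also have "\<dots> \<le> s" using es s by linarith
    finally show ?thesis .
  qed
  show "Z \<subseteq> cbox (c - s *\<^sub>R One) (c + s *\<^sub>R One)"
  proof
    fix x assume "x \<in> Z"
    show "x \<in> cbox (c - s *\<^sub>R One) (c + s *\<^sub>R One)"
      unfolding mem_box
    proof (intro ballI)
      fix b :: "real^'d" assume b: "b \<in> Basis"
      have "\<bar>(x - c) \<bullet> b\<bar> \<le> s" using nrm[OF \<open>x \<in> Z\<close>] Basis_le_norm[OF b, of "x - c"] by linarith
      then show "(c - s *\<^sub>R One) \<bullet> b \<le> x \<bullet> b \<and> x \<bullet> b \<le> (c + s *\<^sub>R One) \<bullet> b"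
        using b by (simp add: inner_diff_left inner_add_left abs_le_iff)
    qed
  qed
  show "diameter Z \<le> s * (1 + \<eta>)"
  proof (rule diameter_le)
    fix x y assume xy: "x \<in> Z" "y \<in> Z"
    let ?p = "\<lambda>x. (x - c) - ((x - c) \<bullet> u) *\<^sub>R u"
    have eq: "x - y = (?p x - ?p y) + (((x - c) \<bullet> u) - ((y - c) \<bullet> u)) *\<^sub>R u"
      by (simp add: algebra_simps)
    have "norm (x - y) \<le> norm (?p x - ?p y) + norm ((((x - c) \<bullet> u) - ((y - c) \<bullet> u)) *\<^sub>R u)"
      by (subst eq) (rule norm_triangle_ineq)
    also have "norm ((((x - c) \<bullet> u) - ((y - c) \<bullet> u)) *\<^sub>R u) = \<bar>((x - c) \<bullet> u) - ((y - c) \<bullet> u)\<bar>"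
      using u by simp
    finally have "norm (x - y) \<le> norm (?p x - ?p y) + \<bar>((x - c) \<bullet> u) - ((y - c) \<bullet> u)\<bar>" .
    also have "\<dots> \<le> (norm (?p x) + norm (?p y)) + (\<bar>(x - c) \<bullet> u\<bar> + \<bar>(y - c) \<bullet> u\<bar>)"
      by (intro add_mono norm_triangle_ineq4 abs_triangle_ineq4)
    also have "\<dots> \<le> s * (1 + \<eta>)"
    proof -
      have "0 \<le> \<eta> * s" using s \<eta> by simp
      moreover have "norm (?p x) \<le> s/2" "norm (?p y) \<le> s/2" "\<bar>(x - c) \<bullet> u\<bar> \<le> \<eta> * s / 4" "\<bar>(y - c) \<bullet> u\<bar> \<le> \<eta> * s / 4"
        using xy by (auto simp: Z_def)
      ultimately show ?thesis unfolding distrib_left mult_1_right mult.commute[of s \<eta>] by linarith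
    qed
    finally show "norm (x - y) \<le> s * (1 + \<eta>)" .
  qed (use s \<eta> in auto)
  show Z: "emeasure lborel Z = ennreal (unit_ball_vol (real (CARD('d) - 1)) * (s/2) ^ (CARD('d) - 1) * (\<eta> * s / 2))"
    unfolding Z_def using emeasure_cylinder[OF u, of "s/2" "\<eta> * s / 4" c] s \<eta> by simp
  have D: "CARD('d) = Suc (CARD('d) - 1)" by simp
  have eq: "(2 * s) ^ CARD('d) = 4 ^ CARD('d) * (s / 2) ^ CARD('d)"
    by (subst power_mult_distrib[symmetric]) simp
  have "cylinder_fraction TYPE(real^'d) \<eta> * (2 * s) ^ CARD('d) = unit_ball_vol (real (CARD('d) - 1)) * \<eta> * (s / 2) ^ CARD('d)"
    unfolding cylinder_fraction_def eq by simp
  also have "\<dots> = unit_ball_vol (real (CARD('d) - 1)) * (s/2) ^ (CARD('d) - 1) * (\<eta> * s / 2)"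
  proof -
    have "(s / 2) ^ CARD('d) = (s / 2) ^ (CARD('d) - 1) * (s / 2)" using D by (metis power_Suc2)
    then show ?thesis by simp
  qed
  finally show "emeasure lborel Z = ennreal (cylinder_fraction TYPE(real^'d) \<eta> * (2 * s) ^ CARD('d))"
    by (simp only: Z)
qed

text \<open>The upper bound is read off from the inclusion of the cylinder in its cube for
  \<open>s = 1\<close>.\<close>

lemma cylinder_fraction_bounds:
  assumes "0 < \<eta>" "\<eta> \<le> 1"
  shows "0 < cylinder_fraction TYPE(real^'d) \<eta>" "cylinder_fraction TYPE(real^'d) \<eta> \<le> 1"
proof -
  show pos: "0 < cylinder_fraction TYPE(real^'d) \<eta>"
    using assms unit_ball_vol_pos[of "real (CARD('d) - 1)"] by (simp add: cylinder_fraction_def del: of_nat_diff)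
  obtain b :: "real^'d" where b: "b \<in> Basis" using nonempty_Basis by blast
  have "ennreal (cylinder_fraction TYPE(real^'d) \<eta> * (2 * 1) ^ CARD('d)) \<le> ennreal ((2 * 1) ^ DIM(real^'d))"
    unfolding cylinder_in_cube(5)[OF norm_Basis[OF b] zero_less_one assms, where c=0, symmetric]
      emeasure_cube[OF zero_less_one, of "0::real^'d", symmetric]
    using cylinder_in_cube(1)[OF norm_Basis[OF b] zero_less_one assms, where c=0] by (intro emeasure_mono) auto
  then show "cylinder_fraction TYPE(real^'d) \<eta> \<le> 1"
    using pos by (subst (asm) ennreal_le_iff) auto
qed

text \<open>
  Flat cylinders orthogonal to \<open>v\<close> have an almost optimal cost, and they fill a fixed fraction of
  every cube, so any a priori constant \<open>c\<close> can be improved towards the optimal one.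
\<close>

lemma cover_cost_improve:
  fixes V :: "real^'d \<Rightarrow> real" and v :: "real^'d"
  assumes G: "open G" "bounded G" and \<delta>: "0 < \<delta>" and \<eta>: "0 < \<eta>" "\<eta> \<le> 1" and \<epsilon>: "0 \<le> \<epsilon>"
    and lin: "\<And>x y. x \<in> G \<Longrightarrow> y \<in> G \<Longrightarrow> \<bar>V x - V y - v \<bullet> (x - y)\<bar> \<le> \<epsilon> * norm (x - y)"
    and c: "0 \<le> c" "\<And>W. W \<in> sets borel \<Longrightarrow> W \<subseteq> G \<Longrightarrow> cover_cost V \<delta> W \<le> ennreal c * emeasure lborel W"
    and W: "W \<in> sets borel" "W \<subseteq> G"
  defines "A \<equiv> (1 + \<eta>) ^ (CARD('d) - 1) * (norm v + 4 * \<epsilon> / \<eta>)"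
    and "\<theta> \<equiv> cylinder_fraction TYPE(real^'d) \<eta>"
  shows "cover_cost V \<delta> W \<le> ennreal (A * \<theta> + c * (1 - \<theta>)) * emeasure lborel W"
proof -
  let ?k = "CARD('d) - 1"
  let ?u = "unit_ball_vol (real ?k)"
  note \<theta> = cylinder_fraction_bounds[OF \<eta>, where 'd='d, folded \<theta>_def]
  have u: "0 \<le> ?u" by simp
  have A: "0 \<le> A" using \<eta> \<epsilon> by (simp add: A_def)
  define B where "B = A * \<theta> + c * (1 - \<theta>)"
  have B: "0 \<le> B" using A \<theta> c by (simp add: B_def)
  obtain w where w: "norm w = 1" "v = norm v *\<^sub>R w"
  proof (cases "v = 0")
    case True
    obtain b :: "real^'d" where b: "b \<in> Basis" using nonempty_Basis by blast
    show ?thesis by (rule that[of b]) (use True b in auto)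
  next
    case False
    show ?thesis by (rule that[of "v /\<^sub>R norm v"]) (use False in auto)
  qed
  have cube: "cover_cost V \<delta> (cbox (p - s *\<^sub>R One) (p + s *\<^sub>R One)) \<le> ennreal (B * (2 * s) ^ DIM(real^'d))"
    if s: "0 < s" and KG: "cbox (p - s *\<^sub>R One) (p + s *\<^sub>R One) \<subseteq> G"
      and K\<delta>: "diameter (cbox (p - s *\<^sub>R One) (p + s *\<^sub>R One)) \<le> \<delta>" for p :: "real^'d" and s
  proof -
    define K where Kc: "K = cbox (p - s *\<^sub>R One) (p + s *\<^sub>R One)"
    note KG = KG[folded Kc] and K\<delta> = K\<delta>[folded Kc]
    define Z where "Z = {x. norm ((x - p) - ((x - p) \<bullet> w) *\<^sub>R w) \<le> s/2 \<and> \<bar>(x - p) \<bullet> w\<bar> \<le> \<eta> * s / 4}"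
    note Z = cylinder_in_cube[OF w(1) s \<eta>, where c=p, folded Z_def, folded Kc \<theta>_def]
    have p: "p \<in> K" using s by (auto simp: Kc mem_box inner_simps)
    have Kborel: "K \<in> sets borel" by (simp add: Kc)
    have K\<mu>: "emeasure lborel K = ennreal ((2 * s) ^ CARD('d))" using emeasure_cube[OF s, of p] by (simp add: Kc)
    define m where "m = (2 * s) ^ CARD('d)"
    have m: "0 \<le> m" using s by (simp add: m_def)
    \<comment> \<open>Largest deviation of \<open>V\<close> from its value at the centre: slope
      times half the height, plus the linearisation error over a distance of at most
      \<open>s\<close>.\<close>
    let ?r = "norm v * (\<eta> * s / 4) + \<epsilon> * s"
    have "cover_cost V \<delta> Z \<le> ennreal (unit_ball_vol (real (DIM(real^'d) - 1)) * (diameter Z / 2) ^ (DIM(real^'d) - 1) * ((V p + ?r) - (V p - ?r)))"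
    proof (rule cover_cost_single)
      show "bounded Z" using Z(1) Kc bounded_cbox bounded_subset by blast
      show "diameter Z \<le> \<delta>" using diameter_subset[OF Z(1)] Kc K\<delta> by simp
      show "V p - ?r \<le> V p + ?r" using \<eta> \<epsilon> s by simp
      show "V ` Z \<subseteq> {V p - ?r..V p + ?r}"
      proof
        fix t assume "t \<in> V ` Z"
        then obtain x where x: "x \<in> Z" "t = V x" by blast
        have "\<bar>V x - V p - v \<bullet> (x - p)\<bar> \<le> \<epsilon> * norm (x - p)"
          by (rule lin) (use x p Z(1) KG in auto)
        also have "\<dots> \<le> \<epsilon> * s" using Z(3)[OF x(1)] \<epsilon> by (rule mult_left_mono)
        finally have 1: "\<bar>V x - V p - v \<bullet> (x - p)\<bar> \<le> \<epsilon> * s" .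
        have "\<bar>v \<bullet> (x - p)\<bar> = norm v * \<bar>(x - p) \<bullet> w\<bar>"
          by (subst w(2)) (simp add: abs_mult inner_commute)
        also have "\<dots> \<le> norm v * (\<eta> * s / 4)"
          using x by (intro mult_left_mono) (auto simp: Z_def)
        finally show "t \<in> {V p - ?r..V p + ?r}" using 1 x by auto
      qed
    qed (use \<delta> in auto)
    also have "\<dots> \<le> ennreal (?u * (s * (1 + \<eta>) / 2) ^ ?k * (2 * ?r))"
    proof -
      have "0 \<le> diameter Z" using Z(1) Kc by (meson bounded_cbox bounded_subset diameter_ge_0)
      then have pw: "(diameter Z / 2) ^ ?k \<le> (s * (1 + \<eta>) / 2) ^ ?k" using Z(4) by (intro power_mono) auto
      have r: "0 \<le> 2 * ?r" using \<eta> \<epsilon> s by simp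
      have eq: "(V p + ?r) - (V p - ?r) = 2 * ?r" by simp
      show ?thesis
        unfolding eq DIM_cart DIM_real mult_1_right
        by (intro ennreal_leI mult_right_mono mult_left_mono pw u r)
    qed
    also have "?u * (s * (1 + \<eta>) / 2) ^ ?k * (2 * ?r) = A * (?u * (s/2) ^ ?k * (\<eta> * s / 2))"
    proof -
      \<comment> \<open>Relative to the height \<open>\<eta> * s / 2\<close> of the cylinder, the
        linearisation error costs \<open>4 * \<epsilon> / \<eta>\<close>. Flatness thus has to be
        paid for with a smaller \<open>\<epsilon>\<close>; \<open>\<eta>^2\<close> will be small
        enough.\<close>
      have "2 * ?r = (norm v + 4 * \<epsilon> / \<eta>) * (\<eta> * s / 2)" using \<eta> by (simp add: field_simps)
      moreover have "(s * (1 + \<eta>) / 2) ^ ?k = (1 + \<eta>) ^ ?k * (s/2) ^ ?k"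
        by (subst power_mult_distrib[symmetric]) (simp add: mult_ac)
      ultimately show ?thesis by (simp add: A_def mult_ac)
    qed
    also have "ennreal (A * (?u * (s/2) ^ ?k * (\<eta> * s / 2))) = ennreal A * emeasure lborel Z"
      using A by (simp only: Z(6) ennreal_mult')
    also have "\<dots> = ennreal (A * (\<theta> * m))"
      using A by (simp only: Z(5) ennreal_mult' m_def)
    finally have 1: "cover_cost V \<delta> Z \<le> ennreal (A * (\<theta> * m))" .
    have "emeasure lborel (K - Z) = emeasure lborel K - emeasure lborel Z"
      by (rule emeasure_Diff) (use Z Kborel in auto)
    also have "\<dots> = ennreal (m - \<theta> * m)"
      unfolding K\<mu> Z(5) m_def using \<theta> s by (subst ennreal_minus[symmetric]) auto
    also have "m - \<theta> * m = (1 - \<theta>) * m" by (simp add: algebra_simps)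
    finally have 2: "emeasure lborel (K - Z) = ennreal ((1 - \<theta>) * m)" .
    have "cover_cost V \<delta> (K - Z) \<le> ennreal c * emeasure lborel (K - Z)"
      by (rule c(2)) (use Kborel Z KG in auto)
    also have "\<dots> = ennreal (c * ((1 - \<theta>) * m))"
      unfolding 2 using c by (simp only: ennreal_mult')
    finally have 3: "cover_cost V \<delta> (K - Z) \<le> ennreal (c * ((1 - \<theta>) * m))" .
    have "cover_cost V \<delta> K \<le> cover_cost V \<delta> (Z \<union> (K - Z))" by (rule cover_cost_mono) auto
    also have "\<dots> \<le> cover_cost V \<delta> Z + cover_cost V \<delta> (K - Z)" using \<delta> by (intro cover_cost_Un) simp
    also have "\<dots> \<le> ennreal (A * (\<theta> * m)) + ennreal (c * ((1 - \<theta>) * m))" by (intro add_mono 1 3)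
    also have "\<dots> = ennreal (B * m)"
    proof -
      have "0 \<le> A * (\<theta> * m)" "0 \<le> c * ((1 - \<theta>) * m)" using A \<theta> m c(1) by auto
      then have "ennreal (A * (\<theta> * m)) + ennreal (c * ((1 - \<theta>) * m)) = ennreal (A * (\<theta> * m) + c * ((1 - \<theta>) * m))"
        by (rule ennreal_plus[symmetric])
      then show ?thesis by (simp add: B_def algebra_simps)
    qed
    finally show ?thesis by (simp add: Kc[symmetric] m_def)
  qed
  show ?thesis
    unfolding B_def[symmetric] by (rule cover_cost_from_cubes[OF G \<delta> B cube W])
qed

text \<open>An infimum argument replaces the exhaustion of cubes by cylinders: improvement turns an
  admissible constant \<open>c\<close> into a convex combination of \<open>A\<close> and
  \<open>c\<close> with a fixed weight, so the infimum of all admissible constants cannot exceed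
  \<open>A\<close>. The infimum need not be attained, hence the slack \<open>e\<close>.\<close>

lemma cover_cost_affine:
  fixes V :: "real^'d \<Rightarrow> real" and v :: "real^'d"
  assumes G: "open G" "bounded G" and \<delta>: "0 < \<delta>" and \<eta>: "0 < \<eta>" "\<eta> \<le> 1" and \<epsilon>: "0 \<le> \<epsilon>"
    and lin: "\<And>x y. x \<in> G \<Longrightarrow> y \<in> G \<Longrightarrow> \<bar>V x - V y - v \<bullet> (x - y)\<bar> \<le> \<epsilon> * norm (x - y)"
    and W: "W \<in> sets borel" "W \<subseteq> G" and e: "0 < e"
  shows "cover_cost V \<delta> W \<le>
    ennreal ((1 + \<eta>) ^ (CARD('d) - 1) * (norm v + 4 * \<epsilon> / \<eta>) + e) * emeasure lborel W"
proof -
  define A where "A = (1 + \<eta>) ^ (CARD('d) - 1) * (norm v + 4 * \<epsilon> / \<eta>)"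
  define \<theta> where "\<theta> = cylinder_fraction TYPE(real^'d) \<eta>"
  have \<theta>: "0 < \<theta>" "\<theta> \<le> 1" using cylinder_fraction_bounds[OF \<eta>, where 'd='d] by (auto simp: \<theta>_def)
  have A: "0 \<le> A" using \<eta> \<epsilon> by (simp add: A_def)
  define S where "S = {c. 0 \<le> c \<and> (\<forall>W. W \<in> sets borel \<longrightarrow> W \<subseteq> G \<longrightarrow> cover_cost V \<delta> W \<le> ennreal c * emeasure lborel W)}"
  have lip: "\<bar>V x - V y\<bar> \<le> (norm v + \<epsilon>) * norm (x - y)" if "x \<in> G" "y \<in> G" for x y
  proof -
    have "\<bar>V x - V y\<bar> \<le> \<bar>V x - V y - v \<bullet> (x - y)\<bar> + \<bar>v \<bullet> (x - y)\<bar>" by linarith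
    also have "\<dots> \<le> \<epsilon> * norm (x - y) + norm v * norm (x - y)"
      by (intro add_mono lin that Cauchy_Schwarz_ineq2)
    finally show ?thesis by (simp add: algebra_simps)
  qed
  obtain B where "0 \<le> B" "\<And>W. W \<in> sets borel \<Longrightarrow> W \<subseteq> G \<Longrightarrow> cover_cost V \<delta> W \<le> ennreal B * emeasure lborel W"
    using cover_cost_crude[OF G \<delta> _ lip] \<epsilon> by (metis add_nonneg_nonneg norm_ge_zero)
  then have "B \<in> S" by (auto simp: S_def)
  then have ne: "S \<noteq> {}" by blast
  have bdd: "bdd_below S" by (intro bdd_belowI[of _ 0]) (auto simp: S_def)
  have le: "Inf S \<le> A"
  proof (rule ccontr)
    assume "\<not> Inf S \<le> A"
    then have gt: "0 < Inf S - A" by simp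
    \<comment> \<open>A constant this close to the infimum is improved to one that lies below it by
      at least \<open>\<theta> * \<theta> * (Inf S - A)\<close>.\<close>
    then have "Inf S < Inf S + \<theta> * (Inf S - A)" using \<theta> by simp
    then obtain c where c: "c \<in> S" "c < Inf S + \<theta> * (Inf S - A)"
      using cInf_lessD[OF ne] by blast
    have "A * \<theta> + c * (1 - \<theta>) \<in> S"
      unfolding S_def
    proof (intro CollectI conjI allI impI)
      show "0 \<le> A * \<theta> + c * (1 - \<theta>)" using A \<theta> c by (simp add: S_def)
      fix W assume "W \<in> sets borel" "W \<subseteq> G"
      then show "cover_cost V \<delta> W \<le> ennreal (A * \<theta> + c * (1 - \<theta>)) * emeasure lborel W"
        unfolding A_def \<theta>_def using c(1)
        by (intro cover_cost_improve[OF G \<delta> \<eta> \<epsilon> lin]) (auto simp: S_def)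
    qed
    then have "Inf S \<le> A * \<theta> + c * (1 - \<theta>)" by (rule cInf_lower[OF _ bdd])
    also have "\<dots> \<le> A * \<theta> + (Inf S + \<theta> * (Inf S - A)) * (1 - \<theta>)"
      using c \<theta> by (intro add_left_mono mult_right_mono) auto
    also have "\<dots> = Inf S - \<theta> * \<theta> * (Inf S - A)" by (simp add: algebra_simps)
    finally have "\<theta> * \<theta> * (Inf S - A) \<le> 0" by simp
    moreover have "0 < \<theta> * \<theta> * (Inf S - A)" using gt \<theta> by simp
    ultimately show False by linarith
  qed
  then have "Inf S < A + e" using e by simp
  then obtain c where c: "c \<in> S" "c < A + e" using cInf_lessD[OF ne] by blast
  then have "cover_cost V \<delta> W \<le> ennreal c * emeasure lborel W" using W by (simp add: S_def)
  also have "\<dots> \<le> ennreal (A + e) * emeasure lborel W"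
    using c by (intro mult_right_mono ennreal_leI) auto
  finally show ?thesis by (simp add: A_def)
qed

text \<open>Near \<open>p\<close> the gradient varies by at most \<open>\<eta>^2\<close>, so
  \<open>V\<close> is affine up to slope \<open>\<eta>^2\<close>. The \<open>6 * \<eta>\<close>
  collects \<open>4 * \<eta>\<close> from \<open>4 * \<eta>^2 / \<eta>\<close>, one
  \<open>\<eta>\<close> from replacing \<open>D p\<close> by \<open>D x\<close>, and one from the
  slack.\<close>

lemma cover_cost_local:
  fixes V :: "real^'d \<Rightarrow> real" and D :: "real^'d \<Rightarrow> real^'d"
  assumes D: "\<And>x. GDERIV V x :> D x" "continuous_on UNIV D" and \<delta>: "0 < \<delta>" and \<eta>: "0 < \<eta>" "\<eta> \<le> 1"
  obtains G where "open G" "p \<in> G" "\<And>W. W \<in> sets borel \<Longrightarrow> W \<subseteq> G \<Longrightarrow>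
     cover_cost V \<delta> W \<le> (\<integral>\<^sup>+ x\<in>W. ennreal ((1 + \<eta>) ^ (CARD('d) - 1) * (norm (D x) + 6 * \<eta>)) \<partial>lborel)"
proof -
  have "isCont D p" using D(2) continuous_on_eq_continuous_at by blast
  moreover have "0 < \<eta>^2" using \<eta> by simp
  ultimately obtain r where r: "0 < r" "\<And>x. dist x p < r \<Longrightarrow> dist (D x) (D p) < \<eta>^2"
    unfolding continuous_at_eps_delta by metis
  let ?G = "ball p r"
  let ?v = "D p"
  have near: "norm (D x - ?v) \<le> \<eta>^2" if "x \<in> ?G" for x
    using r(2)[of x] that by (simp add: dist_norm norm_minus_commute less_imp_le)
  have lin: "\<bar>V x - V y - ?v \<bullet> (x - y)\<bar> \<le> \<eta>^2 * norm (x - y)" if "x \<in> ?G" "y \<in> ?G" for x y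
  proof -
    let ?f = "\<lambda>x. V x - ?v \<bullet> x"
    have "norm (?f x - ?f y) \<le> \<eta>^2 * norm (x - y)"
    proof (rule differentiable_bound[of ?G ?f "\<lambda>x h. inner h (D x) - ?v \<bullet> h"])
      fix z assume z: "z \<in> ?G"
      show "(?f has_derivative (\<lambda>h. inner h (D z) - ?v \<bullet> h)) (at z within ?G)"
        by (intro has_derivative_diff has_derivative_at_withinI[OF D(1)[unfolded gderiv_def]])
           (auto intro!: derivative_eq_intros)
      show "onorm (\<lambda>h. inner h (D z) - ?v \<bullet> h) \<le> \<eta>^2"
      proof (rule onorm_le)
        fix h
        have "norm (inner h (D z) - ?v \<bullet> h) = \<bar>(D z - ?v) \<bullet> h\<bar>"
          by (simp add: inner_diff_left inner_diff_right inner_commute)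
        also have "\<dots> \<le> norm (D z - ?v) * norm h" by (rule Cauchy_Schwarz_ineq2)
        also have "\<dots> \<le> \<eta>^2 * norm h" by (intro mult_right_mono near z) auto
        finally show "norm (inner h (D z) - ?v \<bullet> h) \<le> \<eta>^2 * norm h" .
      qed
    qed (use that in auto)
    then show ?thesis by (simp add: inner_diff_right algebra_simps)
  qed
  show thesis
  proof (rule that[of ?G])
    fix W assume W: "W \<in> sets borel" "W \<subseteq> ?G"
    let ?c = "(1 + \<eta>) ^ (CARD('d) - 1)"
    have c1: "1 \<le> ?c" using \<eta> by (intro one_le_power) simp
    have "cover_cost V \<delta> W \<le> ennreal (?c * (norm ?v + 4 * \<eta>^2 / \<eta>) + \<eta>) * emeasure lborel W"
      by (rule cover_cost_affine[OF _ _ \<delta> \<eta> _ lin W \<eta>(1)]) auto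
    also have "\<dots> = (\<integral>\<^sup>+ x\<in>W. ennreal (?c * (norm ?v + 4 * \<eta>^2 / \<eta>) + \<eta>) \<partial>lborel)"
      using W by (simp add: nn_integral_cmult_indicator)
    also have "\<dots> \<le> (\<integral>\<^sup>+ x\<in>W. ennreal (?c * (norm (D x) + 6 * \<eta>)) \<partial>lborel)"
    proof (intro nn_integral_mono)
      fix x
      show "ennreal (?c * (norm ?v + 4 * \<eta>^2 / \<eta>) + \<eta>) * indicator W x
        \<le> ennreal (?c * (norm (D x) + 6 * \<eta>)) * indicator W x"
      proof (cases "x \<in> W")
        case True
        have "norm ?v \<le> norm (D x) + norm (D x - ?v)"
          by (metis norm_minus_commute norm_triangle_sub)
        also have "\<dots> \<le> norm (D x) + \<eta>^2" using near[of x] True W by auto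
        also have "\<dots> \<le> norm (D x) + \<eta>" using \<eta> by (simp add: power2_eq_square mult_left_le)
        finally have "?c * (norm ?v + 4 * \<eta>^2 / \<eta>) \<le> ?c * (norm (D x) + 5 * \<eta>)"
          using c1 \<eta> by (intro mult_left_mono) (auto simp: power2_eq_square)
        moreover have "\<eta> \<le> ?c * \<eta>" using c1 \<eta> by simp
        ultimately have "?c * (norm ?v + 4 * \<eta>^2 / \<eta>) + \<eta> \<le> ?c * (norm (D x) + 6 * \<eta>)"
          by (simp add: algebra_simps)
        then show ?thesis using True by (simp add: ennreal_leI)
      qed simp
    qed
    finally show "cover_cost V \<delta> W \<le> (\<integral>\<^sup>+ x\<in>W. ennreal (?c * (norm (D x) + 6 * \<eta>)) \<partial>lborel)" .
  qed (use r in auto)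
qed

lemma nn_integral_disjoint_UN:
  assumes f: "f \<in> borel_measurable M" and A: "\<And>i::nat. A i \<in> sets M" "disjoint_family A"
  shows "(\<Sum>i. \<integral>\<^sup>+ x\<in>A i. f x \<partial>M) = (\<integral>\<^sup>+ x\<in>(\<Union>i. A i). f x \<partial>M)"
proof -
  have "(\<integral>\<^sup>+ x\<in>(\<Union>i. A i). f x \<partial>M) = emeasure (density M f) (\<Union>i. A i)"
    using f A by (intro emeasure_density[symmetric]) auto
  also have "\<dots> = (\<Sum>i. emeasure (density M f) (A i))"
    using A by (intro suminf_emeasure[symmetric]) auto
  finally show ?thesis using f A by (simp add: emeasure_density)
qed

text \<open>The Lindelof property selects countably many neighbourhoods from
  \<open>cover_cost_local\<close>; made disjoint, they add up to a bound on all of \<open>W\<close>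
  with error \<open>6 * \<eta>\<close> in the integrand, and \<open>\<eta>\<close> then tends to
  0.\<close>

lemma cover_cost_le_integral:
  fixes V :: "real^'d \<Rightarrow> real" and D :: "real^'d \<Rightarrow> real^'d"
  assumes D: "\<And>x. GDERIV V x :> D x" "continuous_on UNIV D" and \<delta>: "0 < \<delta>" and W: "W \<in> sets borel"
  shows "cover_cost V \<delta> W \<le> (\<integral>\<^sup>+ x\<in>W. ennreal (norm (D x)) \<partial>lborel)"
proof -
  have [measurable]: "D \<in> borel_measurable borel" using D(2) by (rule borel_measurable_continuous_onI)
  let ?c = "\<lambda>\<eta>. (1 + \<eta>) ^ (CARD('d) - 1) :: real"
  have step: "cover_cost V \<delta> W \<le> (\<integral>\<^sup>+ x\<in>W. ennreal (?c \<eta> * (norm (D x) + 6 * \<eta>)) \<partial>lborel)"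
    if W: "W \<in> sets borel" and \<eta>: "0 < \<eta>" "\<eta> \<le> 1" for W \<eta>
  proof -
    let ?f = "\<lambda>x. ennreal (?c \<eta> * (norm (D x) + 6 * \<eta>))"
    let ?good = "\<lambda>G. open G \<and> (\<forall>W. W \<in> sets borel \<longrightarrow> W \<subseteq> G \<longrightarrow> cover_cost V \<delta> W \<le> (\<integral>\<^sup>+ x\<in>W. ?f x \<partial>lborel))"
    have ex: "\<exists>G. ?good G \<and> p \<in> G" for p
    proof -
      obtain G where "open G" "p \<in> G" "\<And>W. W \<in> sets borel \<Longrightarrow> W \<subseteq> G \<Longrightarrow> cover_cost V \<delta> W \<le> (\<integral>\<^sup>+ x\<in>W. ?f x \<partial>lborel)"
        using cover_cost_local[OF D \<delta> \<eta>, of p] by blast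
      then show ?thesis by (intro exI[of _ G]) auto
    qed
    obtain F where F: "F \<subseteq> {G. ?good G}" "countable F" "\<Union>F = \<Union>{G. ?good G}"
      by (rule Lindelof[of "{G. ?good G}"]) auto
    have U: "\<Union>F = UNIV" using ex F(3) by blast
    then have Fne: "F \<noteq> {}" by auto
    define G where "G = from_nat_into F"
    have G: "?good (G i)" for i using F Fne from_nat_into[OF Fne, of i] by (auto simp: G_def)
    have GU: "(\<Union>i. G i) = UNIV" using U range_from_nat_into[OF Fne F(2)] by (simp add: G_def)
    have [measurable]: "G i \<in> sets borel" for i using G by auto
    let ?A = "\<lambda>i. W \<inter> disjointed G i"
    have dG: "range (disjointed G) \<subseteq> sets borel" by (rule sets.range_disjointed_sets) auto
    have A: "?A i \<in> sets borel" for i using dG W by auto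
    have "cover_cost V \<delta> W = cover_cost V \<delta> (\<Union>i. ?A i)"
      using UN_disjointed_eq[of G] GU by (simp add: Int_UN_distrib[symmetric] del: UN_simps)
    also have "\<dots> \<le> (\<Sum>i. cover_cost V \<delta> (?A i))" by (rule cover_cost_UN)
    also have "\<dots> \<le> (\<Sum>i. \<integral>\<^sup>+ x\<in>?A i. ?f x \<partial>lborel)"
    proof (intro suminf_le)
      fix i show "cover_cost V \<delta> (?A i) \<le> (\<integral>\<^sup>+ x\<in>?A i. ?f x \<partial>lborel)"
        using G[of i] A[of i] disjointed_subset[of G i] by (meson Int_lower2 order_trans)
    qed auto
    also have "\<dots> = (\<integral>\<^sup>+ x\<in>(\<Union>i. ?A i). ?f x \<partial>lborel)"
    proof (rule nn_integral_disjoint_UN)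
      show "disjoint_family ?A" using disjoint_family_disjointed[of G] by (auto simp: disjoint_family_on_def)
    qed (use A in auto)
    also have "(\<Union>i. ?A i) = W" using UN_disjointed_eq[of G] GU by (simp add: Int_UN_distrib[symmetric] del: UN_simps)
    finally show ?thesis .
  qed
  \<comment> \<open>The error is integrated over \<open>W\<close>, so the limit requires finite
    measure; shells of balls take care of the general case below.\<close>
  have fin: "cover_cost V \<delta> W \<le> (\<integral>\<^sup>+ x\<in>W. ennreal (norm (D x)) \<partial>lborel)"
    if W: "W \<in> sets borel" and m: "emeasure lborel W < \<infinity>" for W
  proof (cases "(\<integral>\<^sup>+ x\<in>W. ennreal (norm (D x)) \<partial>lborel) = \<infinity>")
    case False
    note [measurable] = W
    obtain I where I: "0 \<le> I" "(\<integral>\<^sup>+ x\<in>W. ennreal (norm (D x)) \<partial>lborel) = ennreal I"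
      using False by (metis ennreal_cases infinity_ennreal_def)
    obtain m where m: "0 \<le> m" "emeasure lborel W = ennreal m" using m by (metis ennreal_cases less_irrefl infinity_ennreal_def)
    have le: "cover_cost V \<delta> W \<le> ennreal (?c \<eta> * (I + 6 * \<eta> * m))" if \<eta>: "0 < \<eta>" "\<eta> \<le> 1" for \<eta>
    proof -
      have "(\<integral>\<^sup>+ x\<in>W. ennreal (?c \<eta> * (norm (D x) + 6 * \<eta>)) \<partial>lborel)
        = (\<integral>\<^sup>+ x. ennreal (?c \<eta>) * (ennreal (norm (D x)) * indicator W x + ennreal (6 * \<eta>) * indicator W x) \<partial>lborel)"
        using \<eta> by (intro nn_integral_cong) (simp add: ennreal_mult' indicator_def)
      also have "\<dots> = ennreal (?c \<eta>) * ((\<integral>\<^sup>+ x\<in>W. ennreal (norm (D x)) \<partial>lborel) + ennreal (6 * \<eta>) * emeasure lborel W)"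
        by (simp add: nn_integral_cmult nn_integral_add)
      also have "\<dots> = ennreal (?c \<eta> * (I + 6 * \<eta> * m))"
        using \<eta> I m by (simp add: ennreal_mult'[symmetric] ennreal_plus[symmetric] del: ennreal_plus)
      finally show ?thesis using step[OF W \<eta>] by simp
    qed
    have "((\<lambda>\<eta>. ennreal (?c \<eta> * (I + 6 * \<eta> * m))) \<longlongrightarrow> ennreal (?c 0 * (I + 6 * 0 * m))) (at_right 0)"
      by (intro tendsto_ennrealI tendsto_intros)
    moreover have "\<forall>\<^sub>F \<eta> in at_right 0. cover_cost V \<delta> W \<le> ennreal (?c \<eta> * (I + 6 * \<eta> * m))"
      using eventually_at_right_real[OF zero_less_one] by (rule eventually_mono) (rule le, auto)
    ultimately have "cover_cost V \<delta> W \<le> ennreal (?c 0 * (I + 6 * 0 * m))"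
      by (rule tendsto_lowerbound) simp
    then show ?thesis by (simp add: I)
  qed simp
  define B where "B = (\<lambda>n. ball (0::real^'d) (real n))"
  have BU: "(\<Union>i. B i) = UNIV"
    using reals_Archimedean2 by (auto simp: B_def)
  have dB: "range (disjointed B) \<subseteq> sets borel" by (rule sets.range_disjointed_sets) (auto simp: B_def)
  let ?A = "\<lambda>i. W \<inter> disjointed B i"
  have A: "?A i \<in> sets borel" for i using dB W by auto
  have Un: "(\<Union>i. ?A i) = W" using UN_disjointed_eq[of B] BU by (simp add: Int_UN_distrib[symmetric] del: UN_simps)
  have "cover_cost V \<delta> (\<Union>i. ?A i) \<le> (\<Sum>i. cover_cost V \<delta> (?A i))" by (rule cover_cost_UN)
  also have "\<dots> \<le> (\<Sum>i. \<integral>\<^sup>+ x\<in>?A i. ennreal (norm (D x)) \<partial>lborel)"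
  proof (intro suminf_le fin)
    fix i
    have "emeasure lborel (?A i) \<le> emeasure lborel (B i)"
      using disjointed_subset[of B i] by (intro emeasure_mono) (auto simp: B_def)
    also have "\<dots> < \<infinity>" unfolding B_def by (rule emeasure_bounded_finite) simp
    finally show "emeasure lborel (?A i) < \<infinity>" .
  qed (use A in auto)
  also have "\<dots> = (\<integral>\<^sup>+ x\<in>(\<Union>i. ?A i). ennreal (norm (D x)) \<partial>lborel)"
  proof (rule nn_integral_disjoint_UN)
    show "disjoint_family ?A" using disjoint_family_disjointed[of B] by (auto simp: disjoint_family_on_def)
  qed (use A in auto)
  finally show ?thesis unfolding Un .
qed

section \<open>From cover costs to the Hausdorff measure of level sets\<close>

lemma hausdorff_pre_antimono:
  assumes "\<delta> \<le> \<delta>'"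
  shows "hausdorff_pre k \<delta>' A \<le> hausdorff_pre k \<delta> A"
  unfolding hausdorff_pre_def
  by (rule INF_superset_mono) (use assms in \<open>auto intro: order_trans\<close>)

text \<open>The form with \<open>liminf\<close> is chosen for Fatou's lemma: the majorants
  \<open>g n\<close> come from unrelated covers and need not be monotone in
  \<open>n\<close>.\<close>

lemma hausdorff_outer_le_liminf:
  assumes "\<And>n. hausdorff_pre k (inverse (real (Suc n))) A \<le> g n"
  shows "hausdorff_outer k A \<le> liminf g"
  unfolding hausdorff_outer_def
proof (rule SUP_least)
  fix \<delta> :: real assume "\<delta> \<in> {0<..}"
  then obtain m where m: "inverse (real (Suc m)) < \<delta>" using reals_Archimedean by auto
  have "hausdorff_pre k \<delta> A \<le> g n" if "m \<le> n" for n
  proof -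
    have "inverse (real (Suc n)) \<le> inverse (real (Suc m))" using that by (intro le_imp_inverse_le) auto
    then have "hausdorff_pre k \<delta> A \<le> hausdorff_pre k (inverse (real (Suc n))) A"
      using m by (intro hausdorff_pre_antimono) linarith
    then show ?thesis using assms[of n] by (rule order_trans)
  qed
  then show "hausdorff_pre k \<delta> A \<le> liminf g"
    by (intro Liminf_bounded) (auto simp: eventually_sequentially)
qed

text \<open>Slicing does not increase diameters. The gain is a right-hand side that is measurable in
  \<open>s\<close> and whose integral is exactly the cost of the cover.\<close>

lemma hausdorff_pre_le_slices:
  fixes V :: "real^'d \<Rightarrow> real"
  assumes "A \<subseteq> (\<Union>i::nat. C i)" "\<And>i. bounded (C i)" "\<And>i. diameter (C i) \<le> \<delta>"
    "\<And>i. V ` C i \<subseteq> {a i..b i}"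
  shows "hausdorff_pre (CARD('d) - 1) \<delta> (A \<inter> {x. V x = s}) \<le>
    (\<Sum>i. ennreal (unit_ball_vol (real (CARD('d) - 1)) * (diameter (C i) / 2) ^ (CARD('d) - 1)) * indicator {a i..b i} s)"
proof -
  let ?C = "\<lambda>i. C i \<inter> {x. V x = s}"
  let ?t = "\<lambda>C. ennreal (unit_ball_vol (real (CARD('d) - 1)) * (diameter C / 2) ^ (CARD('d) - 1))"
  have d: "diameter (?C i) \<le> diameter (C i)" for i
    by (rule diameter_subset) (use assms in auto)
  have b: "bounded (?C i)" for i using assms(2) by (meson Int_lower1 bounded_subset)
  have "hausdorff_pre (CARD('d) - 1) \<delta> (A \<inter> {x. V x = s}) \<le> (\<Sum>i. if ?C i = {} then 0 else ?t (?C i))"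
    unfolding hausdorff_pre_def
  proof (rule INF_lower, intro CollectI conjI allI)
    show "A \<inter> {x. V x = s} \<subseteq> (\<Union>i. ?C i)" using assms(1) by blast
    show "bounded (?C i)" for i by (rule b)
    show "diameter (?C i) \<le> \<delta>" for i by (rule order_trans[OF d assms(3)])
  qed
  also have "\<dots> \<le> (\<Sum>i. ?t (C i) * indicator {a i..b i} s)"
  proof (intro suminf_le)
    fix i
    show "(if ?C i = {} then 0 else ?t (?C i)) \<le> ?t (C i) * indicator {a i..b i} s"
    proof (cases "?C i = {}")
      case False
      then have "s \<in> {a i..b i}" using assms(4) by blast
      moreover have "?t (?C i) \<le> ?t (C i)"
        using d[of i] diameter_ge_0[OF b, of i] by (intro ennreal_leI mult_left_mono power_mono) auto
      ultimately show ?thesis using False by simp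
    qed simp
  qed auto
  finally show ?thesis .
qed

text \<open>\<open>measure_of\<close> yields either the given set function or 0, so this bound
  requires no proof of countable additivity.\<close>

lemma emeasure_hausdorff_measure_le:
  "A \<in> sets borel \<Longrightarrow> emeasure (hausdorff_measure k) A \<le> hausdorff_outer k A"
  unfolding hausdorff_measure_def emeasure_measure_of_conv by auto

lemma sets_hausdorff_measure [simp, measurable_cong]: "sets (hausdorff_measure k) = sets borel"
  unfolding hausdorff_measure_def using sets.sigma_sets_eq[of borel] by (simp add: sets_measure_of_conv)

lemma space_hausdorff_measure [simp]: "space (hausdorff_measure k) = UNIV"
  unfolding hausdorff_measure_def by (simp add: space_measure_of_conv)

text \<open>Measurability in \<open>s\<close> of the measure of the slices is not established;
  instead a measurable majorant \<open>G\<close> is carried along. It is the \<open>liminf\<close>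
  of the slice bounds of nearly optimal covers with diameters at most \<open>1 / (n + 1)\<close>,
  and Fatou's lemma bounds its integral.\<close>

lemma coarea_set:
  fixes V :: "real^'d \<Rightarrow> real" and D :: "real^'d \<Rightarrow> real^'d"
  assumes D: "\<And>x. GDERIV V x :> D x" "continuous_on UNIV D" and W: "W \<in> sets borel"
  obtains G where "G \<in> borel_measurable borel"
    "\<And>s. hausdorff_outer (CARD('d) - 1) (W \<inter> {x. V x = s}) \<le> G s"
    "(\<integral>\<^sup>+ s. G s \<partial>lborel) \<le> (\<integral>\<^sup>+ x\<in>W. ennreal (norm (D x)) \<partial>lborel)"
proof (cases "(\<integral>\<^sup>+ x\<in>W. ennreal (norm (D x)) \<partial>lborel) = \<infinity>")
  case True
  then show ?thesis by (intro that[of "\<lambda>_. \<infinity>"]) auto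
next
  case False
  let ?k = "CARD('d) - 1"
  let ?I = "\<integral>\<^sup>+ x\<in>W. ennreal (norm (D x)) \<partial>lborel"
  let ?e = "\<lambda>n. inverse (real (Suc n))"
  define Q where "Q n g \<longleftrightarrow> g \<in> borel_measurable borel \<and>
     (\<forall>s. hausdorff_pre ?k (?e n) (W \<inter> {x. V x = s}) \<le> g s) \<and> (\<integral>\<^sup>+ s. g s \<partial>lborel) \<le> ?I + ennreal (?e n)"
    for n and g :: "real \<Rightarrow> ennreal"
  have "\<exists>g. Q n g" for n
  proof -
    have "cover_cost V (?e n) W \<le> ?I" by (rule cover_cost_le_integral[OF D _ W]) simp
    also have "?I < ?I + ennreal (?e n)"
      using False by (simp add: less_top ennreal_add_left_cancel_less[of _ 0, simplified])
    finally obtain C a b where C: "W \<subseteq> (\<Union>i::nat. C i)" "\<And>i. bounded (C i)" "\<And>i. diameter (C i) \<le> ?e n"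
      "\<And>i. a i \<le> b i" "\<And>i. V ` C i \<subseteq> {a i..b i}"
      "(\<Sum>i. ennreal (unit_ball_vol (real (DIM(real^'d) - 1)) * (diameter (C i) / 2) ^ (DIM(real^'d) - 1) * (b i - a i))) < ?I + ennreal (?e n)"
      apply (rule cover_cost_lessE)
      subgoal premises p by (rule p(1)[OF p(2-)])
      done
    let ?t = "\<lambda>i. unit_ball_vol (real ?k) * (diameter (C i) / 2) ^ ?k"
    let ?g = "\<lambda>s. \<Sum>i. ennreal (?t i) * indicator {a i..b i} s"
    have t: "0 \<le> ?t i" for i using diameter_ge_0[OF C(2)] by (intro mult_nonneg_nonneg zero_le_power) auto
    have "(\<integral>\<^sup>+ s. ?g s \<partial>lborel) = (\<Sum>i. \<integral>\<^sup>+ s. ennreal (?t i) * indicator {a i..b i} s \<partial>lborel)"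
      by (rule nn_integral_suminf) measurable
    also have "\<dots> = (\<Sum>i. ennreal (?t i * (b i - a i)))"
    proof (rule suminf_cong)
      fix i
      show "(\<integral>\<^sup>+ s. ennreal (?t i) * indicator {a i..b i} s \<partial>lborel) = ennreal (?t i * (b i - a i))"
        using C(4)[of i] t[of i] by (simp add: nn_integral_cmult_indicator ennreal_mult' del: of_nat_diff)
    qed
    also have "\<dots> \<le> ?I + ennreal (?e n)"
      using C(6) by (simp del: of_nat_diff of_nat_Suc add: less_imp_le)
    finally have "(\<integral>\<^sup>+ s. ?g s \<partial>lborel) \<le> ?I + ennreal (?e n)" .
    moreover have "?g \<in> borel_measurable borel" by measurable
    ultimately show ?thesis
      using hausdorff_pre_le_slices[of W C "?e n" V a b] C(1-3,5) unfolding Q_def by blast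
  qed
  then obtain g where g: "\<And>n. Q n (g n)" by metis
  then have [measurable]: "g n \<in> borel_measurable borel" for n by (simp add: Q_def)
  show ?thesis
  proof (rule that)
    show "(\<lambda>s. liminf (\<lambda>n. g n s)) \<in> borel_measurable borel" by measurable
    show "hausdorff_outer ?k (W \<inter> {x. V x = s}) \<le> liminf (\<lambda>n. g n s)" for s
      by (rule hausdorff_outer_le_liminf) (use g in \<open>simp add: Q_def\<close>)
    have "(\<integral>\<^sup>+ s. liminf (\<lambda>n. g n s) \<partial>lborel) \<le> liminf (\<lambda>n. \<integral>\<^sup>+ s. g n s \<partial>lborel)"
      by (rule nn_integral_liminf) measurable
    also have "\<dots> \<le> liminf (\<lambda>n. ?I + ennreal (?e n))"
      using g by (intro Liminf_mono) (auto simp: Q_def)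
    also have "\<dots> = ?I"
    proof (rule lim_imp_Liminf)
      have "(\<lambda>n. ?I + ennreal (?e n)) \<longlonglongrightarrow> ?I + ennreal 0"
        by (intro tendsto_add tendsto_const tendsto_ennrealI LIMSEQ_inverse_real_of_nat)
      then show "(\<lambda>n. ?I + ennreal (?e n)) \<longlonglongrightarrow> ?I" by simp
    qed simp
    finally show "(\<integral>\<^sup>+ s. liminf (\<lambda>n. g n s) \<partial>lborel) \<le> ?I" .
  qed
qed

text \<open>Induction on the weight \<open>w\<close>, with the existence of a measurable majorant as
  the induction statement.\<close>

lemma coarea_function:
  fixes V :: "real^'d \<Rightarrow> real" and D :: "real^'d \<Rightarrow> real^'d"
  assumes D: "\<And>x. GDERIV V x :> D x" "continuous_on UNIV D" and w: "w \<in> borel_measurable borel"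
  shows "\<exists>G \<in> borel_measurable borel.
    (\<forall>s. (\<integral>\<^sup>+ x\<in>{x. V x = s}. w x \<partial>hausdorff_measure (CARD('d) - 1)) \<le> G s) \<and>
    (\<integral>\<^sup>+ s. G s \<partial>lborel) \<le> (\<integral>\<^sup>+ x. w x * ennreal (norm (D x)) \<partial>lborel)"
  (is "\<exists>G \<in> _. ?P w G")
proof -
  have [measurable]: "D \<in> borel_measurable borel" using D(2) by (rule borel_measurable_continuous_onI)
  have "continuous_on UNIV V"
    using D(1) unfolding gderiv_def by (meson continuous_at_imp_continuous_on has_derivative_continuous)
  then have [measurable]: "V \<in> borel_measurable borel" by (rule borel_measurable_continuous_onI)
  have lev[measurable]: "{x. V x = s} \<in> sets borel" for s by measurable
  let ?H = "hausdorff_measure (CARD('d) - 1) :: (real^'d) measure"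
  from w show ?thesis
  proof (induction rule: borel_measurable_induct)
    case (cong f g)
    then have "f = g" by auto
    then show ?case using cong by simp
  next
    case (set A)
    then have A: "A \<in> sets borel" by simp
    obtain G where G: "G \<in> borel_measurable borel"
      "\<And>s. hausdorff_outer (CARD('d) - 1) (A \<inter> {x. V x = s}) \<le> G s"
      "(\<integral>\<^sup>+ s. G s \<partial>lborel) \<le> (\<integral>\<^sup>+ x\<in>A. ennreal (norm (D x)) \<partial>lborel)"
      using coarea_set[OF D A] by blast
    have "(\<integral>\<^sup>+ x\<in>{x. V x = s}. indicator A x \<partial>?H) \<le> G s" for s
    proof -
      have "(\<integral>\<^sup>+ x\<in>{x. V x = s}. indicator A x \<partial>?H) = (\<integral>\<^sup>+ x. indicator (A \<inter> {x. V x = s}) x \<partial>?H)"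
        by (simp add: indicator_inter_arith)
      also have "\<dots> = emeasure ?H (A \<inter> {x. V x = s})"
        using A by (intro nn_integral_indicator) auto
      also have "\<dots> \<le> G s"
        using A by (intro order_trans[OF emeasure_hausdorff_measure_le G(2)]) auto
      finally show ?thesis .
    qed
    then show ?case using G(1,3) by (auto simp: mult.commute intro!: bexI[of _ G])
  next
    case (mult u c)
    then obtain G where [measurable]: "G \<in> borel_measurable borel" and G: "?P u G" by auto
    note [measurable] = mult(2)
    have "?P (\<lambda>x. c * u x) (\<lambda>s. c * G s)"
      using G by (auto simp: mult.assoc nn_integral_cmult intro!: mult_left_mono)
    moreover have "(\<lambda>s. c * G s) \<in> borel_measurable borel" by measurable
    ultimately show ?case by (rule bexI)
  next
    case (add u v)
    then obtain Gu Gv where [measurable]: "Gu \<in> borel_measurable borel" "Gv \<in> borel_measurable borel"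
      and G: "?P u Gu" "?P v Gv" by auto
    note [measurable] = add(1,3)
    have "?P (\<lambda>x. v x + u x) (\<lambda>s. Gv s + Gu s)"
      using G by (auto simp: distrib_right nn_integral_add intro!: add_mono)
    moreover have "(\<lambda>s. Gv s + Gu s) \<in> borel_measurable borel" by measurable
    ultimately show ?case by (rule bexI)
  next
    case (seq U)
    then have "\<forall>i. \<exists>G. G \<in> borel_measurable borel \<and> ?P (U i) G" by blast
    from choice[OF this] obtain G where "\<forall>i. G i \<in> borel_measurable borel \<and> ?P (U i) (G i)" ..
    then have Gm: "\<And>i. G i \<in> borel_measurable borel" and G: "\<And>i. ?P (U i) (G i)" by simp_all
    note [measurable] = seq(1) Gm
    have mono: "incseq U" by (rule seq)
    \<comment> \<open>The majorants of the approximating weights need not increase, so the limit is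
      again taken as a \<open>liminf\<close> with Fatou's lemma.\<close>
    have "?P (SUP i. U i) (\<lambda>s. liminf (\<lambda>i. G i s))"
    proof (intro conjI allI)
      fix s
      have "(\<integral>\<^sup>+ x\<in>{x. V x = s}. (SUP i. U i) x \<partial>?H) = (\<integral>\<^sup>+ x. (SUP i. U i x * indicator {x. V x = s} x) \<partial>?H)"
        by (intro nn_integral_cong) (simp add: SUP_mult_right_ennreal SUP_apply image_comp)
      also have "\<dots> = (SUP i. \<integral>\<^sup>+ x\<in>{x. V x = s}. U i x \<partial>?H)"
        using mono by (intro nn_integral_monotone_convergence_SUP)
          (auto simp: incseq_def le_fun_def intro!: mult_right_mono)
      also have "\<dots> \<le> liminf (\<lambda>i. G i s)"
      proof (rule SUP_least)
        fix i
        have "(\<integral>\<^sup>+ x\<in>{x. V x = s}. U i x \<partial>?H) \<le> G j s" if "i \<le> j" for j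
        proof -
          have "(\<integral>\<^sup>+ x\<in>{x. V x = s}. U i x \<partial>?H) \<le> (\<integral>\<^sup>+ x\<in>{x. V x = s}. U j x \<partial>?H)"
            using mono that by (intro nn_integral_mono mult_right_mono) (auto simp: incseq_def le_fun_def)
          then show ?thesis using G[of j] by (meson order_trans)
        qed
        then show "(\<integral>\<^sup>+ x\<in>{x. V x = s}. U i x \<partial>?H) \<le> liminf (\<lambda>i. G i s)"
          by (intro Liminf_bounded) (auto simp: eventually_sequentially)
      qed
      finally show "(\<integral>\<^sup>+ x\<in>{x. V x = s}. (SUP i. U i) x \<partial>?H) \<le> liminf (\<lambda>i. G i s)" .
    next
      have "(\<integral>\<^sup>+ s. liminf (\<lambda>i. G i s) \<partial>lborel) \<le> liminf (\<lambda>i. \<integral>\<^sup>+ s. G i s \<partial>lborel)"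
        by (rule nn_integral_liminf) measurable
      also have "\<dots> \<le> liminf (\<lambda>i. \<integral>\<^sup>+ x. (SUP i. U i) x * ennreal (norm (D x)) \<partial>lborel)"
      proof (intro Liminf_mono always_eventually allI)
        fix i
        have "(\<integral>\<^sup>+ x. U i x * ennreal (norm (D x)) \<partial>lborel) \<le> (\<integral>\<^sup>+ x. (SUP i. U i) x * ennreal (norm (D x)) \<partial>lborel)"
          by (intro nn_integral_mono mult_right_mono) (auto simp: SUP_apply intro: SUP_upper)
        then show "(\<integral>\<^sup>+ s. G i s \<partial>lborel) \<le> (\<integral>\<^sup>+ x. (SUP i. U i) x * ennreal (norm (D x)) \<partial>lborel)"
          using G[of i] by (meson order_trans)
      qed
      also have "\<dots> = (\<integral>\<^sup>+ x. (SUP i. U i) x * ennreal (norm (D x)) \<partial>lborel)"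
        by (rule Liminf_const) simp
      finally show "(\<integral>\<^sup>+ s. liminf (\<lambda>i. G i s) \<partial>lborel) \<le> (\<integral>\<^sup>+ x. (SUP i. U i) x * ennreal (norm (D x)) \<partial>lborel)" .
    qed
    moreover have "(\<lambda>s. liminf (\<lambda>i. G i s)) \<in> borel_measurable borel" by measurable
    ultimately show ?case by (rule bexI)
  qed
qed

lemma C2_gradient:
  assumes "C2 V"
  obtains "\<And>x. GDERIV V x :> grad V x" "continuous_on UNIV (grad V)" "continuous_on UNIV V"
proof -
  obtain D D2 where D: "\<And>x. GDERIV V x :> D x" and D2: "\<And>x. (D has_derivative blinfun_apply (D2 x)) (at x)"
    using assms unfolding C2_def by blast
  have uniq: "E = D x" if "GDERIV V x :> E" for x E
  proof -
    have "(\<lambda>h. inner h E) = (\<lambda>h. inner h (D x))"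
      using that D[of x] unfolding gderiv_def by (rule has_derivative_unique)
    then have "inner (E - D x) E = inner (E - D x) (D x)" by meson
    then show ?thesis by (metis inner_eq_zero_iff inner_diff_right right_minus_eq)
  qed
  have eq: "grad V = D" unfolding grad_def using D uniq by (intro ext the_equality) blast+
  show thesis
  proof (rule that)
    show "GDERIV V x :> grad V x" for x using D eq by simp
    show "continuous_on UNIV (grad V)"
      unfolding eq using D2 by (meson continuous_at_imp_continuous_on has_derivative_continuous)
    show "continuous_on UNIV V"
      using D unfolding gderiv_def by (meson continuous_at_imp_continuous_on has_derivative_continuous)
  qed
qed

text \<open>
  Half of the coarea formula. The left-hand side is a lower integral, as \<^const>\<open>level_mass\<close>
  is not known to be measurable.
\<close>

theorem nn_integral_level_mass_le:
  fixes V :: "real^'d \<Rightarrow> real"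
  assumes V: "C2 V" and f[measurable]: "f \<in> borel_measurable borel"
  shows "(\<integral>\<^sup>+ s. f s * level_mass V s \<partial>lborel) \<le> (\<integral>\<^sup>+ x. f (V x) \<partial>lborel)"
proof -
  obtain D: "\<And>x. GDERIV V x :> grad V x" "continuous_on UNIV (grad V)" and Vc: "continuous_on UNIV V"
    using C2_gradient[OF V] by blast
  have [measurable]: "grad V \<in> borel_measurable borel" "V \<in> borel_measurable borel"
    using D(2) Vc by (auto intro: borel_measurable_continuous_onI)
  let ?H = "hausdorff_measure (CARD('d) - 1) :: (real^'d) measure"
  let ?n = "\<lambda>x. ennreal (norm (grad V x))"
  have lev[measurable]: "{x. V x = s} \<in> sets borel" for s by measurable
  obtain G where G: "G \<in> borel_measurable borel"
    "\<And>s. (\<integral>\<^sup>+ x\<in>{x. V x = s}. f (V x) * inverse (?n x) \<partial>?H) \<le> G s"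
    "(\<integral>\<^sup>+ s. G s \<partial>lborel) \<le> (\<integral>\<^sup>+ x. f (V x) * inverse (?n x) * ?n x \<partial>lborel)"
    using coarea_function[OF D, of "\<lambda>x. f (V x) * inverse (?n x)"] by auto
  have "f s * level_mass V s \<le> G s" for s
  proof -
    have "f s * level_mass V s = (\<integral>\<^sup>+ x. f s * (inverse (?n x) * indicator {x. V x = s} x) \<partial>?H)"
      unfolding level_mass_def by (rule nn_integral_cmult[symmetric]) measurable
    also have "\<dots> = (\<integral>\<^sup>+ x\<in>{x. V x = s}. f (V x) * inverse (?n x) \<partial>?H)"
      by (intro nn_integral_cong) (auto simp: indicator_def)
    finally show ?thesis using G(2)[of s] by simp
  qed
  then have "(\<integral>\<^sup>+ s. f s * level_mass V s \<partial>lborel) \<le> (\<integral>\<^sup>+ s. G s \<partial>lborel)"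
    by (intro nn_integral_mono)
  also have "\<dots> \<le> (\<integral>\<^sup>+ x. f (V x) * inverse (?n x) * ?n x \<partial>lborel)" by (rule G)
  also have "\<dots> \<le> (\<integral>\<^sup>+ x. f (V x) \<partial>lborel)"
  proof (intro nn_integral_mono)
    fix x
    \<comment> \<open>At critical points the product is infinity times 0, which is 0 in
      \<open>ennreal\<close>; elsewhere it is 1.\<close>
    have "inverse (?n x) * ?n x \<le> 1"
    proof (cases "grad V x = 0")
      case False
      then show ?thesis by (simp add: inverse_ennreal ennreal_mult'[symmetric])
    qed simp
    then have "f (V x) * (inverse (?n x) * ?n x) \<le> f (V x) * 1" by (intro mult_left_mono) auto
    then show "f (V x) * inverse (?n x) * ?n x \<le> f (V x)" by (simp add: mult.assoc)
  qed
  finally show ?thesis .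
qed

section \<open>Stationary densities\<close>

text \<open>\<open>f\<close> is arbitrary here, since the lemma is applied to integrands containing
  \<open>level_mass\<close>. By definition the integral is a supremum over simple functions below
  \<open>f\<close>, and these scale with \<open>c\<close>.\<close>

lemma nn_integral_cmult_ge:
  assumes "0 < c" "c < \<infinity>"
  shows "c * integral\<^sup>N M f \<le> (\<integral>\<^sup>+ x. c * f x \<partial>M)"
proof -
  have "c * integral\<^sup>N M f = (SUP g\<in>{g. simple_function M g \<and> g \<le> f}. c * integral\<^sup>S M g)"
    unfolding nn_integral_def by (subst SUP_mult_left_ennreal) simp
  also have "\<dots> \<le> (\<integral>\<^sup>+ x. c * f x \<partial>M)"
  proof (rule SUP_least)
    fix g assume g: "g \<in> {g. simple_function M g \<and> g \<le> f}"
    then have [measurable]: "g \<in> borel_measurable M" by (auto intro: borel_measurable_simple_function)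
    have "c * integral\<^sup>S M g = c * integral\<^sup>N M g" using g by (simp add: nn_integral_eq_simple_integral)
    also have "\<dots> = (\<integral>\<^sup>+ x. c * g x \<partial>M)" by (rule nn_integral_cmult[symmetric]) simp
    also have "\<dots> \<le> (\<integral>\<^sup>+ x. c * f x \<partial>M)" using g by (intro nn_integral_mono mult_left_mono) (auto simp: le_fun_def)
    finally show "c * integral\<^sup>S M g \<le> (\<integral>\<^sup>+ x. c * f x \<partial>M)" .
  qed
  finally show ?thesis .
qed

lemma nn_integral_cmult':
  assumes "0 < (c::real)"
  shows "(\<integral>\<^sup>+ x. ennreal c * f x \<partial>M) = ennreal c * integral\<^sup>N M f"
proof (rule antisym)
  have inv: "ennreal c * (ennreal (1 / c) * y) = y" "ennreal (1 / c) * (ennreal c * y) = y" for y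
    using assms by (simp_all add: mult.assoc[symmetric] ennreal_mult'[symmetric])
  have "ennreal (1 / c) * (\<integral>\<^sup>+ x. ennreal c * f x \<partial>M) \<le> (\<integral>\<^sup>+ x. ennreal (1 / c) * (ennreal c * f x) \<partial>M)"
    using assms by (intro nn_integral_cmult_ge) auto
  then have "ennreal c * (ennreal (1 / c) * (\<integral>\<^sup>+ x. ennreal c * f x \<partial>M)) \<le> ennreal c * integral\<^sup>N M f"
    by (intro mult_left_mono) (simp_all add: inv)
  then show "(\<integral>\<^sup>+ x. ennreal c * f x \<partial>M) \<le> ennreal c * integral\<^sup>N M f" by (simp add: inv)
  show "ennreal c * integral\<^sup>N M f \<le> (\<integral>\<^sup>+ x. ennreal c * f x \<partial>M)"
    using assms by (intro nn_integral_cmult_ge) auto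
qed

text \<open>For lower integrals subadditivity can fail; it holds if one summand \<open>h\<close> is
  measurable and finite, because subtracting \<open>h\<close> from a simple function below
  \<open>f + h\<close> leaves a measurable function below \<open>f\<close>.\<close>

lemma nn_integral_add_le:
  assumes h[measurable]: "h \<in> borel_measurable M" and fin: "\<And>x. h x \<noteq> top"
  shows "(\<integral>\<^sup>+ x. f x + h x \<partial>M) \<le> integral\<^sup>N M f + integral\<^sup>N M h"
  unfolding nn_integral_def[of M "\<lambda>x. f x + h x"]
proof (rule SUP_least)
  fix g assume g: "g \<in> {g. simple_function M g \<and> g \<le> (\<lambda>x. f x + h x)}"
  then have [measurable]: "g \<in> borel_measurable M" by (auto intro: borel_measurable_simple_function)
  have "integral\<^sup>S M g = integral\<^sup>N M g" using g by (simp add: nn_integral_eq_simple_integral)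
  also have "\<dots> \<le> (\<integral>\<^sup>+ x. (g x - h x) + h x \<partial>M)"
  proof (intro nn_integral_mono)
    fix x
    show "g x \<le> (g x - h x) + h x"
    proof (cases "h x \<le> g x")
      case True
      then show ?thesis by (simp add: diff_add_cancel_ennreal)
    qed (auto simp: not_le intro: add_increasing)
  qed
  also have "\<dots> = (\<integral>\<^sup>+ x. g x - h x \<partial>M) + integral\<^sup>N M h" by (rule nn_integral_add) auto
  also have "(\<integral>\<^sup>+ x. g x - h x \<partial>M) \<le> integral\<^sup>N M f"
  proof (intro nn_integral_mono)
    fix x have "g x \<le> f x + h x" using g by (simp add: le_fun_def)
    then show "g x - h x \<le> f x" using fin[of x] by (simp add: ennreal_minus_le_iff add.commute)
  qed
  finally show "integral\<^sup>S M g \<le> integral\<^sup>N M f + integral\<^sup>N M h" by simp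
qed

text \<open>The lower slope gives injectivity and unboundedness, the upper slope continuity. It is
  applied to \<open>g_fun\<close> on a logarithmic scale and to the logarithm of the mass as a
  function of \<open>m\<close>.\<close>

lemma bi_slope_unique_solution:
  fixes h :: "real \<Rightarrow> real"
  assumes a: "0 < a" and h: "\<And>s t. s \<le> t \<Longrightarrow> a * (t - s) \<le> h t - h s \<and> h t - h s \<le> b * (t - s)"
  shows "\<exists>!t. h t = y"
proof -
  have b: "0 \<le> b" using h[of 0 1] a by simp
  have lip: "\<bar>h t - h s\<bar> \<le> b * \<bar>t - s\<bar>" for s t
  proof (cases "s \<le> t")
    case True
    moreover have "0 \<le> a * (t - s)" using True a by simp
    ultimately show ?thesis using h[of s t] by simp
  next
    case False
    then have "t \<le> s" by simp
    moreover have "0 \<le> a * (s - t)" using False a by simp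
    ultimately show ?thesis using h[of t s] by simp
  qed
  have cont: "isCont h t" for t
  proof -
    have "(\<lambda>s. h s - h t) \<midarrow>t\<rightarrow> 0"
    proof (rule Lim_null_comparison)
      show "\<forall>\<^sub>F s in at t. norm (h s - h t) \<le> b * \<bar>s - t\<bar>" using lip by simp
      have "(\<lambda>s. b * \<bar>s - t\<bar>) \<midarrow>t\<rightarrow> b * \<bar>t - t\<bar>" by (intro tendsto_intros)
      then show "(\<lambda>s. b * \<bar>s - t\<bar>) \<midarrow>t\<rightarrow> 0" by simp
    qed
    then show ?thesis unfolding isCont_def using LIM_zero_cancel by blast
  qed
  \<comment> \<open>Within distance \<open>T\<close> of 0 the lower slope forces \<open>h\<close> to
    pass the value \<open>y\<close>.\<close>
  define T where "T = \<bar>y - h 0\<bar> / a"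
  have T: "0 \<le> T" "a * T = \<bar>y - h 0\<bar>" using a by (auto simp: T_def)
  have "h (- T) \<le> y" "y \<le> h T" using h[of "-T" 0] h[of 0 T] T by auto
  then have "\<exists>t. - T \<le> t \<and> t \<le> T \<and> h t = y"
    using cont T by (intro IVT) auto
  moreover have "s = t" if "h s = h t" for s t
  proof (rule ccontr)
    assume "s \<noteq> t"
    then have "0 < a * \<bar>t - s\<bar>" using a by simp
    moreover have "a * \<bar>t - s\<bar> \<le> 0"
    proof (cases "s \<le> t")
      case True
      then show ?thesis using h[OF True] that by simp
    next
      case False
      then have "t \<le> s" by simp
      then show ?thesis using h[of t s] that by simp
    qed
    ultimately show False by linarith
  qed
  ultimately show ?thesis by blast
qed

section \<open>The function g and its inverse\<close>

locale coefficient =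
  fixes \<kappa> K :: real and \<xi> :: "real \<Rightarrow> real"
  assumes \<kappa>: "0 < \<kappa>" and cont: "continuous_on {0<..} \<xi>"
    and bounds: "\<And>r. 0 < r \<Longrightarrow> \<kappa> \<le> \<xi> r" "\<And>r. 0 < r \<Longrightarrow> \<xi> r \<le> K"
begin

lemma K: "0 < K" "\<kappa> \<le> K" using \<kappa> bounds[of 1] by linarith+

lemma cont_integrand: "continuous_on {a..b} (\<lambda>u. 1 / (u * \<xi> u))" if "0 < a"
proof (intro continuous_intros continuous_on_subset[OF cont] ballI)
  fix u assume "u \<in> {a..b}"
  then have "0 < u" using that by simp
  then show "u * \<xi> u \<noteq> 0" using bounds(1)[of u] \<kappa> by simp
qed (use that in auto)

lemma g_fun_diff:
  assumes "0 < r" "r \<le> r'"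
  shows "g_fun \<xi> r' - g_fun \<xi> r = integral {r..r'} (\<lambda>u. 1 / (u * \<xi> u))"
proof -
  let ?f = "\<lambda>u. 1 / (u * \<xi> u)"
  have int: "interval_lebesgue_integrable lborel (ereal a) (ereal b) ?f" if "0 < a" "a \<le> b" for a b
    using that cont_integrand by (intro interval_integrable_continuous_on) auto
  have "min (1::real) (min r r') > 0" using assms by auto
  moreover have "min 1 (min r r') \<le> max 1 (max r r')" by simp
  ultimately have "interval_lebesgue_integrable lborel (ereal (min 1 (min r r'))) (ereal (max 1 (max r r'))) ?f"
    by (rule int)
  then have "(LBINT u=ereal 1..ereal r. ?f u) + (LBINT u=ereal r..ereal r'. ?f u) = (LBINT u=ereal 1..ereal r'. ?f u)"
    by (intro interval_integral_sum) (simp only: ereal_min ereal_max)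
  then have "g_fun \<xi> r' - g_fun \<xi> r = (LBINT u=ereal r..ereal r'. ?f u)"
    by (simp add: g_fun_def one_ereal_def)
  also have "\<dots> = integral {r..r'} ?f"
    using assms cont_integrand by (intro interval_integral_eq_integral borel_integrable_atLeastAtMost') auto
  finally show ?thesis .
qed

text \<open>Comparison with the constant coefficients \<open>K\<close> and \<open>\<kappa>\<close>,
  for which \<open>g_fun\<close> is a multiple of the logarithm.\<close>

lemma g_fun_bounds:
  assumes "0 < r" "r \<le> r'"
  shows "ln (r' / r) / K \<le> g_fun \<xi> r' - g_fun \<xi> r" "g_fun \<xi> r' - g_fun \<xi> r \<le> ln (r' / r) / \<kappa>"
proof -
  have hi: "((\<lambda>u. 1 / (u * c)) has_integral ln (r' / r) / c) {r..r'}" if "c > 0" for c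
  proof -
    have "((\<lambda>u. 1 / (u * c)) has_integral (ln r' / c - ln r / c)) {r..r'}"
      using assms that by (intro fundamental_theorem_of_calculus)
        (auto intro!: derivative_eq_intros simp: has_real_derivative_iff_has_vector_derivative[symmetric] field_simps)
    then show ?thesis using assms by (simp add: ln_div diff_divide_distrib)
  qed
  have "((\<lambda>u. 1 / (u * \<xi> u)) has_integral (g_fun \<xi> r' - g_fun \<xi> r)) {r..r'}"
    unfolding g_fun_diff[OF assms] using assms
    by (intro integrable_integral integrable_continuous_real cont_integrand)
  note g = this
  show "ln (r' / r) / K \<le> g_fun \<xi> r' - g_fun \<xi> r"
  proof (rule has_integral_le[OF hi[OF K(1)] g])
    fix u assume "u \<in> {r..r'}"
    then have "0 < u" using assms by auto
    then show "1 / (u * K) \<le> 1 / (u * \<xi> u)"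
      using bounds[of u] \<kappa> by (intro divide_left_mono mult_left_mono mult_pos_pos) auto
  qed
  show "g_fun \<xi> r' - g_fun \<xi> r \<le> ln (r' / r) / \<kappa>"
  proof (rule has_integral_le[OF g hi[OF \<kappa>]])
    fix u assume "u \<in> {r..r'}"
    then have "0 < u" using assms by auto
    then show "1 / (u * \<xi> u) \<le> 1 / (u * \<kappa>)"
      using bounds[of u] \<kappa> by (intro divide_left_mono mult_left_mono mult_pos_pos) auto
  qed
qed

lemma g_fun_exp_unique: "\<exists>!t. g_fun \<xi> (exp t) = y"
proof (rule bi_slope_unique_solution[of "1 / K" _ "1 / \<kappa>"])
  fix s t :: real assume "s \<le> t"
  then show "1 / K * (t - s) \<le> g_fun \<xi> (exp t) - g_fun \<xi> (exp s) \<and> g_fun \<xi> (exp t) - g_fun \<xi> (exp s) \<le> 1 / \<kappa> * (t - s)"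
    using g_fun_bounds[of "exp s" "exp t"] by (simp add: exp_diff[symmetric])
qed (use K in auto)

lemma inj_on_g_fun: "inj_on (g_fun \<xi>) {0<..}"
proof (rule inj_onI)
  fix r r' assume "r \<in> {0<..}" "r' \<in> {0<..}" "g_fun \<xi> r = g_fun \<xi> r'"
  then have "ln r = ln r'" using g_fun_exp_unique[of "g_fun \<xi> r"] by (metis exp_ln greaterThan_iff)
  then show "r = r'" using \<open>r \<in> {0<..}\<close> \<open>r' \<in> {0<..}\<close> by simp
qed

lemma g_inv_g_fun [simp]: "0 < r \<Longrightarrow> g_inv \<xi> (g_fun \<xi> r) = r"
  unfolding g_inv_def by (rule the_inv_into_f_f[OF inj_on_g_fun]) simp

lemma g_fun_g_inv [simp]: "g_fun \<xi> (g_inv \<xi> y) = y" and g_inv_pos [simp]: "0 < g_inv \<xi> y"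
proof -
  obtain t where t: "g_fun \<xi> (exp t) = y" using g_fun_exp_unique by metis
  then show "g_fun \<xi> (g_inv \<xi> y) = y" "0 < g_inv \<xi> y" by auto
qed

lemma g_fun_mono_iff: 
  assumes "0 < r" "0 < r'"
  shows "g_fun \<xi> r \<le> g_fun \<xi> r' \<longleftrightarrow> r \<le> r'"
proof (cases "r \<le> r'")
  case True
  then have "0 \<le> ln (r' / r) / K" using assms K by simp
  then show ?thesis using g_fun_bounds(1)[OF assms(1) True] True by simp
next
  case False
  then have "0 < ln (r / r') / K" using assms K by simp
  then show ?thesis using g_fun_bounds(1)[OF assms(2), of r] False by simp
qed

lemma g_fun_less_iff: "0 < r \<Longrightarrow> 0 < r' \<Longrightarrow> g_fun \<xi> r < g_fun \<xi> r' \<longleftrightarrow> r < r'"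
  using g_fun_mono_iff[of r' r] by linarith

lemma g_inv_le_iff: "g_inv \<xi> y \<le> r \<longleftrightarrow> y \<le> g_fun \<xi> r" if "0 < r"
  using g_fun_mono_iff[of "g_inv \<xi> y" r] that by simp

text \<open>\<open>g_fun_bounds\<close> inverted. These two slopes are the source of every later
  comparison of densities, which is why logarithms are used throughout.\<close>

lemma g_inv_ratio:
  assumes "y \<le> y'"
  shows "\<kappa> * (y' - y) \<le> ln (g_inv \<xi> y') - ln (g_inv \<xi> y)" "ln (g_inv \<xi> y') - ln (g_inv \<xi> y) \<le> K * (y' - y)"
proof -
  have le: "g_inv \<xi> y \<le> g_inv \<xi> y'" using assms by (simp add: g_inv_le_iff)
  have ln_div_g_inv: "ln (g_inv \<xi> y' / g_inv \<xi> y) = ln (g_inv \<xi> y') - ln (g_inv \<xi> y)"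
    using less_imp_neq[OF g_inv_pos[of y]] less_imp_neq[OF g_inv_pos[of y']] by (subst ln_div) auto
  from g_fun_bounds[OF _ le]
  show "\<kappa> * (y' - y) \<le> ln (g_inv \<xi> y') - ln (g_inv \<xi> y)" "ln (g_inv \<xi> y') - ln (g_inv \<xi> y) \<le> K * (y' - y)"
    using \<kappa> K unfolding ln_div_g_inv by (auto simp: field_simps)
qed

lemma g_inv_scale:
  assumes "y \<le> y'"
  shows "exp (\<kappa> * (y' - y)) * g_inv \<xi> y \<le> g_inv \<xi> y'" "g_inv \<xi> y' \<le> exp (K * (y' - y)) * g_inv \<xi> y"
proof -
  have "exp (\<kappa> * (y' - y)) * g_inv \<xi> y = exp (\<kappa> * (y' - y) + ln (g_inv \<xi> y))"
    by (simp add: exp_add)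
  also have "\<dots> \<le> exp (ln (g_inv \<xi> y'))" unfolding exp_le_cancel_iff using g_inv_ratio(1)[OF assms] by linarith
  finally show "exp (\<kappa> * (y' - y)) * g_inv \<xi> y \<le> g_inv \<xi> y'" by simp
  have "g_inv \<xi> y' = exp (ln (g_inv \<xi> y'))" by simp
  also have "\<dots> \<le> exp (K * (y' - y) + ln (g_inv \<xi> y))" unfolding exp_le_cancel_iff using g_inv_ratio(2)[OF assms] by linarith
  finally show "g_inv \<xi> y' \<le> exp (K * (y' - y)) * g_inv \<xi> y" by (simp add: exp_add)
qed

lemma g_inv_mono: "mono (g_inv \<xi>)"
  by (rule monoI) (simp add: g_inv_le_iff)

lemma g_inv_measurable [measurable]: "g_inv \<xi> \<in> borel_measurable borel"
  by (rule borel_measurable_mono[OF g_inv_mono])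

end

section \<open>The normalising constant\<close>

lemma vmin_le:
  fixes V :: "real^'d \<Rightarrow> real"
  assumes "continuous_on UNIV V" "filterlim V at_top at_infinity"
  shows "vmin V \<le> V x"
proof -
  have "\<forall>\<^sub>F x in at_infinity. V 0 \<le> V x"
    using assms(2) by (simp add: filterlim_at_top)
  then obtain b where b: "\<And>x. b \<le> norm x \<Longrightarrow> V 0 \<le> V x" unfolding eventually_at_infinity by blast
  obtain x0 where x0: "\<And>x. x \<in> cball 0 \<bar>b\<bar> \<Longrightarrow> V x0 \<le> V x"
    using continuous_attains_inf[of "cball 0 \<bar>b\<bar>" V] assms(1) continuous_on_subset
    by (metis abs_ge_zero cball_eq_empty compact_cball not_less subset_UNIV)
  have "V x0 \<le> V x" for x
  proof (cases "norm x \<le> \<bar>b\<bar>")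
    case False
    then have "V 0 \<le> V x" by (intro b) simp
    then show ?thesis using x0[of 0] by simp
  qed (simp add: x0)
  then have "bdd_below (range V)" by (auto intro!: bdd_belowI)
  then show ?thesis unfolding vmin_def by (intro cINF_lower) auto
qed

text \<open>\<open>level_pos\<close> keeps the normalising integral from vanishing, so that
  \<open>mu\<close> is well defined.\<close>

locale stationary = coefficient \<kappa> K \<xi> for \<kappa> K \<xi> +
  fixes V :: "real^'d \<Rightarrow> real"
  assumes V: "admissible_potential V"
    and level_pos: "\<exists>a b c. a < b \<and> vmin V < a \<and> 0 < c \<and> (\<forall>s\<in>{a..b}. ennreal c \<le> level_mass V s)"
begin

lemma V_cont: "continuous_on UNIV V"
  using V unfolding admissible_potential_def by (meson C2_gradient)

lemma V_measurable [measurable]: "V \<in> borel_measurable borel"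
  using V_cont by (rule borel_measurable_continuous_onI)

lemma vmin_le_V: "vmin V \<le> V x"
  using V V_cont by (intro vmin_le) (auto simp: admissible_potential_def)

definition mass :: "real \<Rightarrow> ennreal" where
  "mass m = (\<integral>\<^sup>+ s \<in> {vmin V<..}. ennreal (g_inv \<xi> (m - s)) * level_mass V s \<partial>lborel)"

text \<open>This is where the coarea inequality enters. It makes \<open>mass\<close> finite, and at
  \<open>m = mu V \<xi>\<close> it says that the stationary density has Lebesgue mass at least
  1.\<close>

lemma mass_le: "mass m \<le> (\<integral>\<^sup>+ x. ennreal (g_inv \<xi> (m - V x)) \<partial>lborel)"
proof -
  have "mass m \<le> (\<integral>\<^sup>+ s. ennreal (g_inv \<xi> (m - s)) * level_mass V s \<partial>lborel)"
    unfolding mass_def by (intro nn_integral_mono) (auto simp: indicator_def)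
  also have "\<dots> \<le> (\<integral>\<^sup>+ x. ennreal (g_inv \<xi> (m - V x)) \<partial>lborel)"
    using V by (intro nn_integral_level_mass_le[where f="\<lambda>s. ennreal (g_inv \<xi> (m - s))"]) (auto simp: admissible_potential_def)
  finally show ?thesis .
qed

text \<open>By the lower slope of \<open>g_inv\<close> the density is at most a multiple of
  \<open>exp (- \<kappa> * V x)\<close>.\<close>

lemma nn_integral_density_finite: "(\<integral>\<^sup>+ x. ennreal (g_inv \<xi> (m - V x)) \<partial>lborel) < \<infinity>"
proof -
  define c where "c = exp (\<kappa> * vmin V) * g_inv \<xi> (m - vmin V)"
  have c: "0 \<le> c" by (simp add: c_def less_imp_le)
  have "g_inv \<xi> (m - V x) \<le> c * exp (- \<kappa> * V x)" for x
  proof -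
    have "exp (\<kappa> * (V x - vmin V)) * g_inv \<xi> (m - V x) \<le> g_inv \<xi> (m - vmin V)"
      using g_inv_scale(1)[of "m - V x" "m - vmin V"] vmin_le_V[of x] by simp
    then have le: "exp (- \<kappa> * V x + \<kappa> * vmin V) * (exp (\<kappa> * (V x - vmin V)) * g_inv \<xi> (m - V x))
        \<le> exp (- \<kappa> * V x + \<kappa> * vmin V) * g_inv \<xi> (m - vmin V)"
      by (rule mult_left_mono) simp
    have "exp (- \<kappa> * V x + \<kappa> * vmin V) * exp (\<kappa> * (V x - vmin V)) = 1"
      unfolding exp_add[symmetric] by (simp add: algebra_simps)
    then have "g_inv \<xi> (m - V x) = exp (- \<kappa> * V x + \<kappa> * vmin V) * (exp (\<kappa> * (V x - vmin V)) * g_inv \<xi> (m - V x))"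
      by (simp only: mult.assoc[symmetric] mult_1_left)
    also note le
    also have "exp (- \<kappa> * V x + \<kappa> * vmin V) * g_inv \<xi> (m - vmin V) = c * exp (- \<kappa> * V x)"
      by (simp only: c_def exp_add mult_ac)
    finally show ?thesis .
  qed
  then have "(\<integral>\<^sup>+ x. ennreal (g_inv \<xi> (m - V x)) \<partial>lborel) \<le> (\<integral>\<^sup>+ x. ennreal (c * exp (- \<kappa> * V x)) \<partial>lborel)"
    by (intro nn_integral_mono ennreal_leI)
  also have "\<dots> < \<infinity>"
  proof -
    have "integrable lborel (\<lambda>x. exp (- \<kappa> * V x))"
      using V \<kappa> unfolding admissible_potential_def by blast
    then have "integrable lborel (\<lambda>x. c * exp (- \<kappa> * V x))" by (rule integrable_mult_right)
    then show ?thesis using c by (subst nn_integral_eq_integral) auto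
  qed
  finally show ?thesis .
qed

lemma mass_finite: "mass m < \<infinity>"
  using mass_le nn_integral_density_finite by (rule le_less_trans)

lemma mass_pos: "0 < mass m"
proof -
  obtain a b c where abc: "a < b" "vmin V < a" "0 < c" "\<And>s. s \<in> {a..b} \<Longrightarrow> ennreal c \<le> level_mass V s"
    using level_pos by blast
  have "0 < ennreal (g_inv \<xi> (m - b) * c * (b - a))"
    using abc by (simp add: ennreal_zero_less_mult_iff)
  also have "\<dots> = (\<integral>\<^sup>+ s. ennreal (g_inv \<xi> (m - b) * c) * indicator {a..b} s \<partial>lborel)"
    using abc by (simp add: nn_integral_cmult_indicator ennreal_mult' less_imp_le)
  also have "\<dots> \<le> mass m"
    unfolding mass_def
  proof (intro nn_integral_mono)
    fix s
    show "ennreal (g_inv \<xi> (m - b) * c) * indicator {a..b} s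
       \<le> ennreal (g_inv \<xi> (m - s)) * level_mass V s * indicator {vmin V<..} s"
    proof (cases "s \<in> {a..b}")
      case True
      have "ennreal (g_inv \<xi> (m - b) * c) = ennreal (g_inv \<xi> (m - b)) * ennreal c"
        using abc by (simp add: ennreal_mult' less_imp_le)
      also have "\<dots> \<le> ennreal (g_inv \<xi> (m - s)) * level_mass V s"
        using True by (intro mult_mono ennreal_leI abc monoD[OF g_inv_mono]) auto
      finally show ?thesis using True abc by simp
    qed simp
  qed
  finally show ?thesis .
qed

lemma mass_scale:
  assumes "m \<le> m'"
  shows "ennreal (exp (\<kappa> * (m' - m))) * mass m \<le> mass m'" "mass m' \<le> ennreal (exp (K * (m' - m))) * mass m"
proof -
  have "ennreal (exp (\<kappa> * (m' - m))) * mass m = (\<integral>\<^sup>+ s. ennreal (exp (\<kappa> * (m' - m))) * (ennreal (g_inv \<xi> (m - s)) * level_mass V s * indicator {vmin V<..} s) \<partial>lborel)"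
    unfolding mass_def by (rule nn_integral_cmult'[symmetric]) simp
  also have "\<dots> \<le> mass m'"
    unfolding mass_def
  proof (intro nn_integral_mono)
    fix s
    have "ennreal (exp (\<kappa> * (m' - m))) * ennreal (g_inv \<xi> (m - s)) \<le> ennreal (g_inv \<xi> (m' - s))"
      using g_inv_scale(1)[of "m - s" "m' - s"] assms by (simp add: ennreal_mult'[symmetric] ennreal_leI)
    then show "ennreal (exp (\<kappa> * (m' - m))) * (ennreal (g_inv \<xi> (m - s)) * level_mass V s * indicator {vmin V<..} s)
       \<le> ennreal (g_inv \<xi> (m' - s)) * level_mass V s * indicator {vmin V<..} s"
      unfolding mult.assoc[symmetric] by (intro mult_right_mono) auto
  qed
  finally show "ennreal (exp (\<kappa> * (m' - m))) * mass m \<le> mass m'" .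
  have "mass m' \<le> (\<integral>\<^sup>+ s. ennreal (exp (K * (m' - m))) * (ennreal (g_inv \<xi> (m - s)) * level_mass V s * indicator {vmin V<..} s) \<partial>lborel)"
    unfolding mass_def
  proof (intro nn_integral_mono)
    fix s
    have "ennreal (g_inv \<xi> (m' - s)) \<le> ennreal (exp (K * (m' - m))) * ennreal (g_inv \<xi> (m - s))"
      using g_inv_scale(2)[of "m - s" "m' - s"] assms by (simp add: ennreal_mult'[symmetric] ennreal_leI)
    then show "ennreal (g_inv \<xi> (m' - s)) * level_mass V s * indicator {vmin V<..} s
      \<le> ennreal (exp (K * (m' - m))) * (ennreal (g_inv \<xi> (m - s)) * level_mass V s * indicator {vmin V<..} s)"
      unfolding mult.assoc[symmetric] by (intro mult_right_mono) auto
  qed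
  also have "\<dots> = ennreal (exp (K * (m' - m))) * mass m"
    unfolding mass_def by (rule nn_integral_cmult') simp
  finally show "mass m' \<le> ennreal (exp (K * (m' - m))) * mass m" .
qed

text \<open>By \<open>mass_scale\<close> the logarithm of the mass has slopes between
  \<open>\<kappa>\<close> and \<open>K\<close> in \<open>m\<close>. Without this the
  \<open>THE\<close> in \<open>mu\<close> would carry no information.\<close>

lemma mass_eq_1_unique: "\<exists>!m. mass m = 1"
proof -
  define f where "f m = ln (enn2real (mass m))" for m
  have m: "0 < enn2real (mass m)" "mass m = ennreal (enn2real (mass m))" for m
    using mass_pos[of m] mass_finite[of m] by (auto simp: enn2real_positive_iff)
  have "\<exists>!m. f m = 0"
  proof (rule bi_slope_unique_solution[OF \<kappa>])
    fix s t :: real assume st: "s \<le> t"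
    have "ennreal (exp (\<kappa> * (t - s)) * enn2real (mass s)) \<le> ennreal (enn2real (mass t))"
      "ennreal (enn2real (mass t)) \<le> ennreal (exp (K * (t - s)) * enn2real (mass s))"
      using mass_scale[OF st] m[of s] m[of t] by (simp_all add: ennreal_mult')
    then have le: "exp (\<kappa> * (t - s)) * enn2real (mass s) \<le> enn2real (mass t)"
      "enn2real (mass t) \<le> exp (K * (t - s)) * enn2real (mass s)"
      using m(1)[of s] m(1)[of t] by simp_all
    have "ln (exp (\<kappa> * (t - s)) * enn2real (mass s)) \<le> f t" "f t \<le> ln (exp (K * (t - s)) * enn2real (mass s))"
      unfolding f_def using le m(1)[of s] m(1)[of t] by simp_all
    then show "\<kappa> * (t - s) \<le> f t - f s \<and> f t - f s \<le> K * (t - s)"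
      using m(1)[of s] by (simp add: f_def ln_mult)
  qed
  moreover have "f t = 0 \<longleftrightarrow> mass t = 1" for t
  proof -
    have "f t = 0 \<longleftrightarrow> enn2real (mass t) = 1" using m(1)[of t] by (simp add: f_def)
    also have "\<dots> \<longleftrightarrow> mass t = 1" using m(2)[of t] by (metis enn2real_1 ennreal_1)
    finally show ?thesis .
  qed
  ultimately show ?thesis by simp
qed

lemma mass_mu: "mass (mu V \<xi>) = 1"
  using theI'[OF mass_eq_1_unique] by (simp add: mu_def mass_def)

lemma mass_less_iff: "mass m < mass m' \<longleftrightarrow> m < m'"
proof -
  have *: "mass s < mass t" if "s < t" for s t
  proof -
    have "1 < exp (\<kappa> * (t - s))" using that \<kappa> by simp
    then have "mass s < ennreal (exp (\<kappa> * (t - s))) * mass s"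
      using mass_pos[of s] mass_finite[of s]
      by (cases "mass s") (auto simp: ennreal_mult'[symmetric] ennreal_less_iff)
    then show ?thesis using mass_scale(1)[of s t] that by (simp add: less_le_trans)
  qed
  then show ?thesis by (metis less_asym linorder_neqE)
qed

lemma mass_le_iff: "mass m \<le> mass m' \<longleftrightarrow> m \<le> m'"
  using mass_less_iff[of m' m] by (simp add: not_less[symmetric])

lemma mu_le_if: "mass m \<ge> 1 \<Longrightarrow> mu V \<xi> \<le> m"
  using mass_le_iff[of "mu V \<xi>" m] by (simp add: mass_mu)

text \<open>The mass grows at least like \<open>exp (\<kappa> * m)\<close>, so a surplus of
  \<open>X\<close> over 1 is used up within distance \<open>X / \<kappa>\<close>.\<close>

lemma mu_diff_le:
  assumes "mass m \<le> ennreal (1 + X)" "0 \<le> X"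
  shows "m - mu V \<xi> \<le> X / \<kappa>"
proof (cases "mu V \<xi> \<le> m")
  case True
  have "ennreal (exp (\<kappa> * (m - mu V \<xi>))) \<le> ennreal (1 + X)"
    using mass_scale(1)[OF True] assms(1) by (simp add: mass_mu)
  then have "exp (\<kappa> * (m - mu V \<xi>)) \<le> 1 + X" using assms(2) by (simp add: ennreal_le_iff del: ennreal_plus)
  moreover have "1 + \<kappa> * (m - mu V \<xi>) \<le> exp (\<kappa> * (m - mu V \<xi>))" by (rule exp_ge_add_one_self)
  ultimately show ?thesis using \<kappa> by (simp add: field_simps)
next
  case False
  moreover have "0 \<le> X / \<kappa>" using assms \<kappa> by simp
  ultimately show ?thesis by simp
qed

lemma stat_density_eq: "stat_density V \<xi> x = g_inv \<xi> (mu V \<xi> - V x)"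
  by (simp add: stat_density_def q_fun_def)

lemma stat_density_pos: "0 < stat_density V \<xi> x"
  by (simp add: stat_density_eq)

lemma stat_density_measurable [measurable]: "stat_density V \<xi> \<in> borel_measurable borel"
  unfolding stat_density_eq[abs_def] by measurable

lemma stat_density_mass: "1 \<le> (\<integral>\<^sup>+ x. ennreal (stat_density V \<xi> x) \<partial>lborel)"
  "(\<integral>\<^sup>+ x. ennreal (stat_density V \<xi> x) \<partial>lborel) < \<infinity>"
  using mass_le[of "mu V \<xi>"] nn_integral_density_finite by (simp_all add: mass_mu stat_density_eq)

lemma stat_density_integrable: "integrable lborel (stat_density V \<xi>)"
  using stat_density_mass(2) stat_density_pos by (intro integrableI_nonneg) (auto simp: less_imp_le)

lemma stat_density_integral: "1 \<le> (\<integral>x. stat_density V \<xi> x \<partial>lborel)"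
proof -
  have "(\<integral>\<^sup>+ x. ennreal (stat_density V \<xi> x) \<partial>lborel) = ennreal (\<integral>x. stat_density V \<xi> x \<partial>lborel)"
    using stat_density_pos by (intro nn_integral_eq_integral stat_density_integrable) (auto simp: less_imp_le)
  then show ?thesis using stat_density_mass(1) by simp
qed

end

text \<open>Markov's inequality for the integrable function \<open>exp (- V x)\<close>.\<close>

lemma (in stationary) sublevel_finite: "emeasure lborel {x. V x \<le> c} < \<infinity>"
proof -
  have int: "integrable lborel (\<lambda>x. exp c * exp (- 1 * V x))"
  proof -
    have "\<forall>a>0. integrable lborel (\<lambda>x. exp (- a * V x))" using V unfolding admissible_potential_def by blast
    then have "integrable lborel (\<lambda>x. exp (- 1 * V x))" by (rule allE[of _ 1]) simp
    then show ?thesis by (rule integrable_mult_right)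
  qed
  have "emeasure lborel {x. V x \<le> c} = (\<integral>\<^sup>+ x. indicator {x. V x \<le> c} x \<partial>lborel)"
    by (rule nn_integral_indicator[symmetric]) measurable
  also have "\<dots> \<le> (\<integral>\<^sup>+ x. ennreal (exp c * exp (- 1 * V x)) \<partial>lborel)"
  proof (intro nn_integral_mono)
    fix x
    show "indicator {x. V x \<le> c} x \<le> ennreal (exp c * exp (- 1 * V x))"
    proof (cases "V x \<le> c")
      case True
      then have "1 \<le> exp c * exp (- 1 * V x)" by (simp add: exp_add[symmetric])
      then show ?thesis using True by (simp add: ennreal_leI del: ennreal_1 flip: ennreal_1)
    qed simp
  qed
  also have "\<dots> < \<infinity>" using int by (subst nn_integral_eq_integral) auto
  finally show ?thesis .
qed

section \<open>Stability of the density under a change of the coefficient\<close>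

lemma g_inv_shift:
  assumes "coefficient \<kappa> K \<xi>" "coefficient \<kappa> K \<xi>'"
    and "\<And>r. 0 < r \<Longrightarrow> g_fun \<xi> r \<le> g_fun \<xi>' r + D"
  shows "g_inv \<xi>' y \<le> g_inv \<xi> (y + D)"
proof -
  interpret x: coefficient \<kappa> K \<xi> by fact
  interpret y: coefficient \<kappa> K \<xi>' by fact
  have "g_fun \<xi> (g_inv \<xi>' y) \<le> y + D" using assms(3)[of "g_inv \<xi>' y"] by simp
  then have "g_inv \<xi> (g_fun \<xi> (g_inv \<xi>' y)) \<le> g_inv \<xi> (y + D)" by (rule monoD[OF x.g_inv_mono])
  then show ?thesis by simp
qed

lemma ln_g_inv_diff:
  assumes c: "coefficient \<kappa> K \<xi>" "coefficient \<kappa> K \<xi>'"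
    and D: "\<And>r. 0 < r \<Longrightarrow> \<bar>g_fun \<xi> r - g_fun \<xi>' r\<bar> \<le> D"
  shows "\<bar>ln (g_inv \<xi> y) - ln (g_inv \<xi>' y)\<bar> \<le> K * D"
proof -
  have *: "ln (g_inv \<eta>' y) - ln (g_inv \<eta> y) \<le> K * D"
    if c: "coefficient \<kappa> K \<eta>" "coefficient \<kappa> K \<eta>'" and D: "\<And>r. 0 < r \<Longrightarrow> \<bar>g_fun \<eta> r - g_fun \<eta>' r\<bar> \<le> D" for \<eta> \<eta>'
  proof -
    interpret x: coefficient \<kappa> K \<eta> by fact
    interpret y: coefficient \<kappa> K \<eta>' by fact
    have "0 \<le> D" using D[of 1] by linarith
    have "g_inv \<eta>' y \<le> g_inv \<eta> (y + D)"
      by (rule g_inv_shift[OF c]) (use D in \<open>force simp: abs_le_iff\<close>)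
    then have "ln (g_inv \<eta>' y) \<le> ln (g_inv \<eta> (y + D))"
      using x.g_inv_pos y.g_inv_pos by (simp only: ln_le_cancel_iff)
    moreover have "ln (g_inv \<eta> (y + D)) - ln (g_inv \<eta> y) \<le> K * D"
      using x.g_inv_ratio(2)[of y "y + D"] \<open>0 \<le> D\<close> by simp
    ultimately show ?thesis by linarith
  qed
  have D': "\<bar>g_fun \<xi>' r - g_fun \<xi> r\<bar> \<le> D" if "0 < r" for r
    using D[OF that] by linarith
  show ?thesis
    using *[OF c D] *[OF c(2,1) D'] by linarith
qed

text \<open>By monotonicity a height outside \<open>{g_fun \<xi> a<..<g_fun \<xi> b}\<close> is
  attained at a point outside \<open>{a<..<b}\<close>, where the two functions agree.\<close>

lemma g_inv_eq_off:
  assumes "coefficient \<kappa> K \<xi>" "coefficient \<kappa> K \<xi>'" and ab: "0 < a" "a < b"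
    and eq: "\<And>r. 0 < r \<Longrightarrow> r \<notin> {a<..<b} \<Longrightarrow> g_fun \<xi> r = g_fun \<xi>' r"
    and y: "y \<notin> {g_fun \<xi> a<..<g_fun \<xi> b}"
  shows "g_inv \<xi> y = g_inv \<xi>' y"
proof -
  interpret x: coefficient \<kappa> K \<xi> by fact
  interpret y: coefficient \<kappa> K \<xi>' by fact
  have "g_inv \<xi> y \<notin> {a<..<b}"
    using y x.g_fun_less_iff[of a "g_inv \<xi> y"] x.g_fun_less_iff[of "g_inv \<xi> y" b] ab by auto
  then have "g_fun \<xi>' (g_inv \<xi> y) = y" using eq[of "g_inv \<xi> y"] by simp
  then show ?thesis by (metis x.g_inv_pos y.g_inv_g_fun)
qed

text \<open>A uniform change of \<open>g\<close> by \<open>D\<close> is compensated by shifting the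
  argument of the inverse by \<open>D\<close>. Compared with \<open>mu_diff_local\<close> a factor
  of the order of the interval length is lost, but the bound suffices to locate the heights that a
  perturbation affects.\<close>

lemma mu_diff_crude:
  assumes c: "stationary \<kappa> K \<xi> V" "stationary \<kappa> K \<xi>' V"
    and D: "\<And>r. 0 < r \<Longrightarrow> \<bar>g_fun \<xi> r - g_fun \<xi>' r\<bar> \<le> D"
  shows "\<bar>mu V \<xi> - mu V \<xi>'\<bar> \<le> D"
proof -
  have *: "mu V \<eta> - mu V \<eta>' \<le> D"
    if c: "stationary \<kappa> K \<eta> V" "stationary \<kappa> K \<eta>' V" and D: "\<And>r. 0 < r \<Longrightarrow> \<bar>g_fun \<eta> r - g_fun \<eta>' r\<bar> \<le> D" for \<eta> \<eta>'
  proof -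
    interpret x: stationary \<kappa> K \<eta> V by fact
    interpret y: stationary \<kappa> K \<eta>' V by fact
    have "1 = y.mass (mu V \<eta>')" by (rule y.mass_mu[symmetric])
    also have "\<dots> \<le> x.mass (mu V \<eta>' + D)"
      unfolding x.mass_def y.mass_def
    proof (intro nn_integral_mono mult_right_mono ennreal_leI)
      fix s
      have "g_inv \<eta>' (mu V \<eta>' - s) \<le> g_inv \<eta> ((mu V \<eta>' - s) + D)"
        by (rule g_inv_shift[OF x.coefficient_axioms y.coefficient_axioms]) (use D in \<open>force simp: abs_le_iff\<close>)
      then show "g_inv \<eta>' (mu V \<eta>' - s) \<le> g_inv \<eta> (mu V \<eta>' + D - s)" by (simp add: algebra_simps)
    qed auto
    finally have "mu V \<eta> \<le> mu V \<eta>' + D" by (rule x.mu_le_if)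
    then show ?thesis by simp
  qed
  have D': "\<bar>g_fun \<xi>' r - g_fun \<xi> r\<bar> \<le> D" if "0 < r" for r
    using D[OF that] by linarith
  show ?thesis
    using *[OF c D] *[OF c(2,1) D'] by linarith
qed

lemma exp_le_1_plus_double: "0 \<le> x \<Longrightarrow> x \<le> 1 \<Longrightarrow> exp x \<le> 1 + 2 * (x::real)"
  using exp_bound[of x] mult_left_le[of x x] by (simp add: power2_eq_square)

text \<open>At the old constant \<open>mu V \<xi>\<close> the new coefficient has almost the right
  mass: the density changes only over heights in an interval of length
  \<open>g_fun \<xi> b - g_fun \<xi> a\<close>, there by at most \<open>2 * K * D * b\<close>, and
  the level mass is at most \<open>C\<close>. The surplus is converted by
  \<open>mu_diff_le\<close>.\<close>

lemma mu_diff_local: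
  fixes V :: "real^'d \<Rightarrow> real"
  assumes c: "stationary \<kappa> K \<xi> V" "stationary \<kappa> K \<xi>' V" and ab: "0 < a" "a < b"
    and eq: "\<And>r. 0 < r \<Longrightarrow> r \<notin> {a<..<b} \<Longrightarrow> g_fun \<xi> r = g_fun \<xi>' r"
    and D: "\<And>r. 0 < r \<Longrightarrow> \<bar>g_fun \<xi> r - g_fun \<xi>' r\<bar> \<le> D" and KD: "K * D \<le> 1"
    and C: "\<And>s. s \<in> {mu V \<xi> - g_fun \<xi> b..mu V \<xi> - g_fun \<xi> a} \<Longrightarrow> level_mass V s \<le> ennreal C"
    and C0: "0 \<le> C"
  shows "mu V \<xi> - mu V \<xi>' \<le> 2 * K * D * b * C * (g_fun \<xi> b - g_fun \<xi> a) / \<kappa>"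
proof -
  interpret x: stationary \<kappa> K \<xi> V by fact
  interpret y: stationary \<kappa> K \<xi>' V by fact
  have D0: "0 \<le> D" using D[of 1] by linarith
  let ?T = "{mu V \<xi> - g_fun \<xi> b..mu V \<xi> - g_fun \<xi> a}"
  let ?g = "g_fun \<xi> b - g_fun \<xi> a"
  have g: "0 \<le> ?g" using x.g_fun_mono_iff[of a b] ab by simp
  define X where "X = 2 * K * D * b * C * ?g"
  have K: "0 < K" by (rule x.K)
  have X: "0 \<le> X" using K D0 ab C0 g by (simp add: X_def)
  have "y.mass (mu V \<xi>) \<le> (\<integral>\<^sup>+ s. ennreal (g_inv \<xi> (mu V \<xi> - s)) * level_mass V s * indicator {vmin V<..} s
       + ennreal (2 * K * D * b * C) * indicator ?T s \<partial>lborel)"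
    unfolding y.mass_def
  proof (intro nn_integral_mono)
    fix s
    let ?G = "\<lambda>\<xi>. g_inv \<xi> (mu V \<xi> - s)"
    let ?L = "level_mass V s" and ?i = "indicator {vmin V<..} s :: ennreal"
    let ?y = "mu V \<xi> - s"
    show "ennreal (g_inv \<xi>' ?y) * ?L * ?i \<le> ennreal (g_inv \<xi> ?y) * ?L * ?i + ennreal (2 * K * D * b * C) * indicator ?T s"
    proof (cases "?y \<in> {g_fun \<xi> a<..<g_fun \<xi> b}")
      case False
      then have "g_inv \<xi> ?y = g_inv \<xi>' ?y"
        using g_inv_eq_off[OF x.coefficient_axioms y.coefficient_axioms ab eq] by blast
      then show ?thesis by simp
    next
      case True
      then have s: "s \<in> ?T" by auto
      have le: "g_inv \<xi> ?y \<le> b" using True ab by (simp add: x.g_inv_le_iff)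
      have "ln (g_inv \<xi>' ?y) \<le> ln (g_inv \<xi> ?y) + K * D"
        using ln_g_inv_diff[OF x.coefficient_axioms y.coefficient_axioms D, of ?y] by linarith
      then have "exp (ln (g_inv \<xi>' ?y)) \<le> exp (ln (g_inv \<xi> ?y) + K * D)" unfolding exp_le_cancel_iff .
      then have "g_inv \<xi>' ?y \<le> g_inv \<xi> ?y * exp (K * D)" by (simp add: exp_add)
      also have "\<dots> \<le> g_inv \<xi> ?y * (1 + 2 * (K * D))"
        using K D0 KD by (intro mult_left_mono exp_le_1_plus_double) (auto simp: less_imp_le)
      also have "\<dots> = g_inv \<xi> ?y + g_inv \<xi> ?y * (2 * (K * D))" by (simp add: algebra_simps)
      also have "\<dots> \<le> g_inv \<xi> ?y + b * (2 * (K * D))"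
        using le K D0 by (intro add_left_mono mult_right_mono) auto
      finally have "ennreal (g_inv \<xi>' ?y) \<le> ennreal (g_inv \<xi> ?y + 2 * K * D * b)" by (intro ennreal_leI) (simp add: mult_ac)
      also have "\<dots> = ennreal (g_inv \<xi> ?y) + ennreal (2 * K * D * b)"
        using K D0 ab by (intro ennreal_plus) (auto simp: less_imp_le)
      finally have "ennreal (g_inv \<xi>' ?y) * ?L * ?i \<le> (ennreal (g_inv \<xi> ?y) + ennreal (2 * K * D * b)) * ?L * ?i"
        by (intro mult_right_mono) auto
      also have "\<dots> = ennreal (g_inv \<xi> ?y) * ?L * ?i + ennreal (2 * K * D * b) * ?L * ?i" by (simp add: distrib_right)
      also have "\<dots> \<le> ennreal (g_inv \<xi> ?y) * ?L * ?i + ennreal (2 * K * D * b) * ennreal C * 1"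
        using C[OF s] by (intro add_left_mono mult_mono mult_left_mono) (auto simp: indicator_def)
      also have "ennreal (2 * K * D * b) * ennreal C = ennreal (2 * K * D * b * C)"
        using C0 by (simp add: ennreal_mult'')
      finally show ?thesis using s by simp
    qed
  qed
  \<comment> \<open>The change has been bounded by a measurable step function beforehand, so that
    \<open>level_mass\<close> occurs in the first summand only, as subadditivity of the lower
    integral demands.\<close>
  also have "\<dots> \<le> x.mass (mu V \<xi>) + (\<integral>\<^sup>+ s. ennreal (2 * K * D * b * C) * indicator ?T s \<partial>lborel)"
    unfolding x.mass_def by (rule nn_integral_add_le) (measurable, auto simp: indicator_def)
  also have "\<dots> = 1 + ennreal X"
    using g K D0 ab C0 by (simp add: x.mass_mu nn_integral_cmult_indicator X_def ennreal_mult')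
  also have "\<dots> = ennreal (1 + X)" using X by simp
  finally have "y.mass (mu V \<xi>) \<le> ennreal (1 + X)" .
  then show ?thesis using y.mu_diff_le[OF _ X] by (simp add: X_def)
qed

text \<open>
  A perturbation of \<open>\<xi>\<close> that leaves \<open>g\<close> unchanged off \<open>(a, b)\<close> changes the density by a factor
  close to 1 on the level sets of heights \<open>\<mu> - g\<close> over \<open>(a, b)\<close>, and elsewhere
  only through the much smaller shift of \<open>\<mu>\<close>.
\<close>

lemma stat_density_log_diff:
  fixes V :: "real^'d \<Rightarrow> real"
  assumes c: "stationary \<kappa> K \<xi> V" "stationary \<kappa> K \<xi>' V" and ab: "0 < a" "a < b"
    and eq: "\<And>r. 0 < r \<Longrightarrow> r \<notin> {a<..<b} \<Longrightarrow> g_fun \<xi> r = g_fun \<xi>' r"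
    and D: "\<And>r. 0 < r \<Longrightarrow> \<bar>g_fun \<xi> r - g_fun \<xi>' r\<bar> \<le> D"
    and M: "\<bar>mu V \<xi> - mu V \<xi>'\<bar> \<le> M"
  shows "\<bar>ln (stat_density V \<xi> x) - ln (stat_density V \<xi>' x)\<bar>
    \<le> K * D * indicator {x. mu V \<xi> - V x \<in> {g_fun \<xi> a<..<g_fun \<xi> b}} x + K * M"
proof -
  interpret x: stationary \<kappa> K \<xi> V by fact
  interpret y: stationary \<kappa> K \<xi>' V by fact
  let ?y = "mu V \<xi> - V x" and ?y' = "mu V \<xi>' - V x"
  have 1: "\<bar>ln (g_inv \<xi> ?y) - ln (g_inv \<xi>' ?y)\<bar> \<le> K * D * indicator {x. mu V \<xi> - V x \<in> {g_fun \<xi> a<..<g_fun \<xi> b}} x"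
  proof (cases "?y \<in> {g_fun \<xi> a<..<g_fun \<xi> b}")
    case True
    then show ?thesis using ln_g_inv_diff[OF x.coefficient_axioms y.coefficient_axioms D, of ?y] by simp
  next
    case False
    then have "g_inv \<xi> ?y = g_inv \<xi>' ?y"
      using g_inv_eq_off[OF x.coefficient_axioms y.coefficient_axioms ab eq] by blast
    then show ?thesis using False by simp
  qed
  have 2: "\<bar>ln (g_inv \<xi>' ?y) - ln (g_inv \<xi>' ?y')\<bar> \<le> K * \<bar>mu V \<xi> - mu V \<xi>'\<bar>"
  proof (cases "?y \<le> ?y'")
    case True
    have "0 \<le> \<kappa> * (?y' - ?y)" using True x.\<kappa> by simp
    then show ?thesis using y.g_inv_ratio[OF True] True by simp
  next
    case False
    then have le: "?y' \<le> ?y" by simp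
    then have "0 \<le> \<kappa> * (?y - ?y')" using x.\<kappa> by simp
    then show ?thesis using y.g_inv_ratio[OF le] le by simp
  qed
  have "K * \<bar>mu V \<xi> - mu V \<xi>'\<bar> \<le> K * M" using M x.K by (intro mult_left_mono) auto
  then show ?thesis using 1 2 unfolding x.stat_density_eq y.stat_density_eq by linarith
qed

text \<open>The left-hand side dominates, up to a constant, a squared Hellinger distance and is the
  quantity that \<open>normalized_affinity\<close> consumes. The bound separates the local change,
  on a set where the density is at most \<open>b\<close>, from the global shift of
  \<open>mu\<close>.\<close>

lemma stat_density_log_diff_integral:
  fixes V :: "real^'d \<Rightarrow> real"
  assumes c: "stationary \<kappa> K \<xi> V" "stationary \<kappa> K \<xi>' V" and ab: "0 < a" "a < b"
    and eq: "\<And>r. 0 < r \<Longrightarrow> r \<notin> {a<..<b} \<Longrightarrow> g_fun \<xi> r = g_fun \<xi>' r"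
    and D: "\<And>r. 0 < r \<Longrightarrow> \<bar>g_fun \<xi> r - g_fun \<xi>' r\<bar> \<le> D"
    and M: "\<bar>mu V \<xi> - mu V \<xi>'\<bar> \<le> M"
  defines "X \<equiv> {x. mu V \<xi> - V x \<in> {g_fun \<xi> a<..<g_fun \<xi> b}}"
  shows "(\<integral>\<^sup>+ x. ennreal (stat_density V \<xi> x * (ln (stat_density V \<xi> x) - ln (stat_density V \<xi>' x))\<^sup>2) \<partial>lborel)
    \<le> ennreal (2 * K\<^sup>2 * D\<^sup>2 * b * measure lborel X + 2 * K\<^sup>2 * M\<^sup>2 * (\<integral>x. stat_density V \<xi> x \<partial>lborel))"
proof -
  interpret x: stationary \<kappa> K \<xi> V by fact
  interpret y: stationary \<kappa> K \<xi>' V by fact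
  let ?p = "stat_density V \<xi>"
  have [measurable]: "X \<in> sets borel" unfolding X_def by measurable
  have Xfin: "emeasure lborel X < \<infinity>"
  proof -
    have "emeasure lborel X \<le> emeasure lborel {x. V x \<le> mu V \<xi> - g_fun \<xi> a}"
      by (rule emeasure_mono) (auto simp: X_def)
    then show ?thesis using x.sublevel_finite by (rule le_less_trans)
  qed
  have D0: "0 \<le> D" using D[of 1] by linarith
  have pt: "?p x * (ln (?p x) - ln (stat_density V \<xi>' x))\<^sup>2 \<le> 2 * K\<^sup>2 * D\<^sup>2 * b * indicator X x + 2 * K\<^sup>2 * M\<^sup>2 * ?p x" for x
  proof -
    let ?\<Delta> = "ln (?p x) - ln (stat_density V \<xi>' x)"
    let ?i = "indicator X x :: real"
    have "\<bar>?\<Delta>\<bar> \<le> K * D * ?i + K * M"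
      unfolding X_def by (rule stat_density_log_diff[OF c ab eq D M])
    then have "?\<Delta>\<^sup>2 \<le> (K * D * ?i + K * M)\<^sup>2" by (metis abs_ge_zero power2_abs power_mono)
    also have "\<dots> \<le> 2 * (K * D * ?i)\<^sup>2 + 2 * (K * M)\<^sup>2"
      using zero_le_power2[of "K * D * ?i - K * M"] by (simp add: power2_eq_square algebra_simps)
    also have "\<dots> = 2 * K\<^sup>2 * D\<^sup>2 * ?i + 2 * K\<^sup>2 * M\<^sup>2"
      by (simp add: power_mult_distrib indicator_def)
    finally have "?p x * ?\<Delta>\<^sup>2 \<le> ?p x * (2 * K\<^sup>2 * D\<^sup>2 * ?i + 2 * K\<^sup>2 * M\<^sup>2)"
      using x.stat_density_pos[of x] by (intro mult_left_mono) auto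
    also have "\<dots> = 2 * K\<^sup>2 * D\<^sup>2 * (?p x * ?i) + 2 * K\<^sup>2 * M\<^sup>2 * ?p x" by (simp add: algebra_simps)
    also have "2 * K\<^sup>2 * D\<^sup>2 * (?p x * ?i) \<le> 2 * K\<^sup>2 * D\<^sup>2 * (b * ?i)"
    proof (intro mult_left_mono)
      show "?p x * ?i \<le> b * ?i"
      proof (cases "x \<in> X")
        case True
        then have "?p x \<le> b" using ab unfolding x.stat_density_eq by (subst x.g_inv_le_iff) (auto simp: X_def)
        then show ?thesis using True by simp
      qed simp
    qed simp
    finally show ?thesis by (simp only: mult.assoc)
  qed
  have int: "integrable lborel (\<lambda>x. 2 * K\<^sup>2 * D\<^sup>2 * b * indicator X x + 2 * K\<^sup>2 * M\<^sup>2 * ?p x)"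
    using Xfin by (intro Bochner_Integration.integrable_add integrable_mult_right x.stat_density_integrable integrable_real_indicator) auto
  have "(\<integral>\<^sup>+ x. ennreal (?p x * (ln (?p x) - ln (stat_density V \<xi>' x))\<^sup>2) \<partial>lborel)
    \<le> (\<integral>\<^sup>+ x. ennreal (2 * K\<^sup>2 * D\<^sup>2 * b * indicator X x + 2 * K\<^sup>2 * M\<^sup>2 * ?p x) \<partial>lborel)"
    by (intro nn_integral_mono ennreal_leI pt)
  also have "\<dots> = ennreal (\<integral>x. 2 * K\<^sup>2 * D\<^sup>2 * b * indicator X x + 2 * K\<^sup>2 * M\<^sup>2 * ?p x \<partial>lborel)"
    using ab x.stat_density_pos by (intro nn_integral_eq_integral int) (auto intro!: add_nonneg_nonneg mult_nonneg_nonneg simp: less_imp_le)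
  also have "(\<integral>x. 2 * K\<^sup>2 * D\<^sup>2 * b * indicator X x + 2 * K\<^sup>2 * M\<^sup>2 * ?p x \<partial>lborel)
    = 2 * K\<^sup>2 * D\<^sup>2 * b * measure lborel X + 2 * K\<^sup>2 * M\<^sup>2 * (\<integral>x. ?p x \<partial>lborel)"
    using Xfin x.stat_density_integrable by (subst Bochner_Integration.integral_add) (auto intro!: integrable_mult_right integrable_real_indicator)
  finally show ?thesis .
qed

section \<open>Bumps and Hoelder balls\<close>

text \<open>Derivatives within a nondegenerate interval are unique, so any explicit chain of
  derivatives computes \<open>iter_deriv\<close>.\<close>

lemma iter_deriv_eq:
  fixes a b :: real
  assumes ab: "a < b" and F0: "\<And>x. x \<in> {a..b} \<Longrightarrow> F 0 x = f x"
    and F: "\<And>k x. k < m \<Longrightarrow> x \<in> {a..b} \<Longrightarrow> (F k has_vector_derivative F (Suc k) x) (at x within {a..b})"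
  shows "k \<le> m \<Longrightarrow> x \<in> {a..b} \<Longrightarrow> iter_deriv {a..b} k f x = F k x"
proof (induction k arbitrary: x)
  case 0
  then show ?case using F0 by simp
next
  case (Suc k)
  have "(iter_deriv {a..b} k f has_vector_derivative F (Suc k) x) (at x within {a..b})"
  proof (rule has_vector_derivative_transform)
    show "iter_deriv {a..b} k f y = F k y" if "y \<in> {a..b}" for y
      using Suc.prems that by (intro Suc.IH) auto
    show "(F k has_vector_derivative F (Suc k) x) (at x within {a..b})"
      using Suc.prems by (intro F) auto
  qed (rule Suc.prems)
  then show ?case
    using Suc.prems ab by (simp add: vector_derivative_within_closed_interval)
qed

text \<open>The factor \<open>hoelder_deg \<beta> + 2\<close> counts the
  \<open>hoelder_deg \<beta> + 1\<close> suprema in the norm and the one Hoelder quotient.\<close>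

lemma hoelder_ball_add:
  fixes a b \<beta> H N :: real
  assumes ab: "a < b" and f: "f \<in> hoelder_ball \<beta> {a..b} H" and H: "0 \<le> H" and N: "0 \<le> N"
    and h: "\<And>x. x \<in> {a..b} \<Longrightarrow> h x = f x + B 0 x"
    and B: "\<And>k x. k < hoelder_deg \<beta> \<Longrightarrow> x \<in> {a..b} \<Longrightarrow> (B k has_real_derivative B (Suc k) x) (at x)"
    and B1: "\<And>k x. k \<le> hoelder_deg \<beta> \<Longrightarrow> x \<in> {a..b} \<Longrightarrow> \<bar>B k x\<bar> \<le> N"
    and B2: "\<And>x y. x \<in> {a..b} \<Longrightarrow> y \<in> {a..b} \<Longrightarrow> x \<noteq> y \<Longrightarrow>
      \<bar>B (hoelder_deg \<beta>) x - B (hoelder_deg \<beta>) y\<bar> \<le> N * \<bar>x - y\<bar> powr (\<beta> - hoelder_deg \<beta>)"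
  shows "h \<in> hoelder_ball \<beta> {a..b} (H + (hoelder_deg \<beta> + 2) * N)"
proof -
  let ?m = "hoelder_deg \<beta>"
  let ?S = "{a..b}"
  let ?d = "iter_deriv ?S"
  define F where "F k x = ?d k f x + B k x" for k x
  have fd: "(?d k f has_vector_derivative ?d (Suc k) f x) (at x within ?S)" if "k < ?m" "x \<in> ?S" for k x
    using f that by (auto simp: hoelder_ball_def differentiable_on_def vector_derivative_works)
  have Fd: "(F k has_vector_derivative F (Suc k) x) (at x within ?S)" if "k < ?m" "x \<in> ?S" for k x
  proof -
    have "(B k has_vector_derivative B (Suc k) x) (at x within ?S)"
      using B[OF that] unfolding has_real_derivative_iff_has_vector_derivative by (rule has_vector_derivative_at_within)
    from has_vector_derivative_add[OF fd[OF that] this] show ?thesis by (simp only: F_def[abs_def])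
  qed
  have eq: "?d k h x = F k x" if "k \<le> ?m" "x \<in> ?S" for k x
  proof (rule iter_deriv_eq[where F = F and m = ?m, OF ab _ _ that])
    show "F 0 y = h y" if "y \<in> ?S" for y using h[OF that] by (simp add: F_def)
  qed (rule Fd)
  have diff: "?d k h differentiable_on ?S" if "k < ?m" for k
    unfolding differentiable_on_def
  proof
    fix x assume x: "x \<in> ?S"
    have "(?d k h has_vector_derivative F (Suc k) x) (at x within ?S)"
      by (rule has_vector_derivative_transform[OF x _ Fd[OF that x]]) (use that in \<open>simp add: eq\<close>)
    then show "?d k h differentiable at x within ?S" by (rule differentiableI_vector)
  qed
  have sup: "(SUP x\<in>?S. ennreal \<bar>?d k h x\<bar>) \<le> (SUP x\<in>?S. ennreal \<bar>?d k f x\<bar>) + ennreal N" if "k \<le> ?m" for k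
  proof (rule SUP_least)
    fix x assume x: "x \<in> ?S"
    have "ennreal \<bar>?d k h x\<bar> \<le> ennreal (\<bar>?d k f x\<bar> + N)"
      using eq[OF that x] B1[OF that x] by (intro ennreal_leI) (simp add: F_def)
    also have "\<dots> = ennreal \<bar>?d k f x\<bar> + ennreal N" using N by simp
    also have "\<dots> \<le> (SUP x\<in>?S. ennreal \<bar>?d k f x\<bar>) + ennreal N"
      using x by (intro add_right_mono SUP_upper)
    finally show "ennreal \<bar>?d k h x\<bar> \<le> (SUP x\<in>?S. ennreal \<bar>?d k f x\<bar>) + ennreal N" .
  qed
  let ?P = "{(x, y). x \<in> ?S \<and> y \<in> ?S \<and> x \<noteq> y}"
  let ?q = "\<lambda>f (x, y). ennreal (\<bar>?d ?m f x - ?d ?m f y\<bar> / \<bar>x - y\<bar> powr (\<beta> - ?m))"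
  have quot: "(SUP z\<in>?P. ?q h z) \<le> (SUP z\<in>?P. ?q f z) + ennreal N"
  proof (rule SUP_least)
    fix z assume "z \<in> ?P"
    then obtain x y where z: "z = (x, y)" "x \<in> ?S" "y \<in> ?S" "x \<noteq> y" by auto
    let ?n = "\<bar>x - y\<bar> powr (\<beta> - ?m)"
    have n: "0 < ?n" using z by simp
    have "\<bar>?d ?m h x - ?d ?m h y\<bar> \<le> \<bar>?d ?m f x - ?d ?m f y\<bar> + N * ?n"
      using B2[OF z(2-4)] z by (simp add: eq F_def)
    then have "\<bar>?d ?m h x - ?d ?m h y\<bar> / ?n \<le> \<bar>?d ?m f x - ?d ?m f y\<bar> / ?n + N"
      using n by (simp add: field_simps)
    then have "?q h z \<le> ennreal (\<bar>?d ?m f x - ?d ?m f y\<bar> / ?n + N)" by (simp add: z ennreal_leI)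
    also have "\<dots> = ?q f z + ennreal N" using N n by (simp add: z)
    also have "\<dots> \<le> (SUP z\<in>?P. ?q f z) + ennreal N" using \<open>z \<in> ?P\<close> by (intro add_right_mono SUP_upper)
    finally show "?q h z \<le> (SUP z\<in>?P. ?q f z) + ennreal N" .
  qed
  have "hoelder_norm \<beta> ?S h \<le> (\<Sum>k\<le>?m. (SUP x\<in>?S. ennreal \<bar>?d k f x\<bar>) + ennreal N) + ((SUP z\<in>?P. ?q f z) + ennreal N)"
    unfolding hoelder_norm_def by (intro add_mono sum_mono sup quot) auto
  also have "\<dots> = hoelder_norm \<beta> ?S f + ((\<Sum>k\<le>?m. ennreal N) + ennreal N)"
    unfolding hoelder_norm_def by (simp add: sum.distrib add_ac)
  also have "(\<Sum>k\<le>?m. ennreal N) + ennreal N = ennreal ((?m + 2) * N)"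
  proof -
    have "(\<Sum>k\<le>?m. ennreal N) = ennreal (\<Sum>k\<le>?m. N)" using N by (intro sum_ennreal) auto
    then show ?thesis using N by (simp add: algebra_simps flip: ennreal_plus)
  qed
  also have "hoelder_norm \<beta> ?S f + ennreal ((?m + 2) * N) \<le> ennreal H + ennreal ((?m + 2) * N)"
    using f by (intro add_right_mono) (simp add: hoelder_ball_def)
  also have "\<dots> = ennreal (H + (?m + 2) * N)" using H N by simp
  finally show ?thesis using diff by (simp add: hoelder_ball_def)
qed

section \<open>A compactly supported profile and its rescaled copies\<close>

lemma power_Suc_dvd_pderiv:
  fixes q :: "'a::idom poly"
  assumes "q ^ Suc n dvd p"
  shows "q ^ n dvd pderiv p"
proof -
  obtain s where "p = q ^ Suc n * s" using assms by (rule dvdE)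
  then have "pderiv p = q ^ Suc n * pderiv s + s * (smult (of_nat (Suc n)) (q ^ n) * pderiv q)"
    by (simp only: pderiv_mult pderiv_power_Suc)
  also have "q ^ n dvd \<dots>"
    by (intro dvd_add dvd_mult dvd_mult2 dvd_smult) (auto intro: le_imp_power_dvd)
  finally show ?thesis .
qed

text \<open>At 0 and 1 the difference quotients of the truncated function are dominated by those of
  \<open>f\<close>, which tend to 0.\<close>

lemma has_real_derivative_cut_off:
  fixes f f' :: "real \<Rightarrow> real"
  assumes f: "\<And>x. (f has_real_derivative f' x) (at x)"
    and z: "f 0 = 0" "f 1 = 0" "f' 0 = 0" "f' 1 = 0"
  shows "((\<lambda>x. if x \<in> {0..1} then f x else 0) has_real_derivative (if x \<in> {0..1} then f' x else 0)) (at x)"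
proof -
  let ?h = "\<lambda>x. if x \<in> {0..1} then f x else 0" and ?h' = "\<lambda>x. if x \<in> {0..1} then f' x else 0"
  have bd: "\<bar>?h y - ?h x\<bar> \<le> \<bar>f y - f x\<bar>" if "x = 0 \<or> x = 1" for x y using that z by auto
  consider "x \<in> {0<..<1}" | "x < 0" | "x > 1" | "x = 0 \<or> x = 1" by force
  then show ?thesis
  proof cases
    case 1
    then have "\<forall>\<^sub>F y in nhds x. ?h y = f y"
      by (intro eventually_nhds[THEN iffD2] exI[of _ "{0<..<1}"]) auto
    then show ?thesis using f[of x] 1 by (subst DERIV_cong_ev[OF refl _ refl]) auto
  next
    case 2
    then have "\<forall>\<^sub>F y in nhds x. ?h y = 0"
      by (intro eventually_nhds[THEN iffD2] exI[of _ "{..<0}"]) auto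
    then show ?thesis using 2 by (subst DERIV_cong_ev[OF refl _ refl]) auto
  next
    case 3
    then have "\<forall>\<^sub>F y in nhds x. ?h y = 0"
      by (intro eventually_nhds[THEN iffD2] exI[of _ "{1<..}"]) auto
    then show ?thesis using 3 by (subst DERIV_cong_ev[OF refl _ refl]) auto
  next
    case 4
    then have z': "f x = 0" "f' x = 0" "?h x = 0" "?h' x = 0" using z by auto
    have "((\<lambda>y. (f y - f x) / (y - x)) \<longlongrightarrow> 0) (at x)"
      using f[of x] z' by (simp add: has_field_derivative_iff)
    then have "((\<lambda>y. (?h y - ?h x) / (y - x)) \<longlongrightarrow> 0) (at x)"
    proof (rule Lim_transform_bound[rotated])
      show "\<forall>\<^sub>F y in at x. norm ((?h y - ?h x) / (y - x)) \<le> norm ((f y - f x) / (y - x))"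
        using bd[OF 4] by (intro always_eventually allI) (simp add: divide_right_mono)
    qed
    then show ?thesis using z' unfolding has_field_derivative_iff by simp
  qed
qed

text \<open>The polynomial \<open>(x * (1 - x)) ^ (m + 2)\<close>, cut off outside the unit
  interval. Its zeros have order \<open>m + 2\<close>, so all derivatives up to order
  \<open>m + 1\<close> vanish at the ends; the bounded derivative of order \<open>m + 1\<close>
  makes the one of order \<open>m\<close> Lipschitz. On the middle half \<open>x * (1 - x)\<close>
  is at least 1/16, whence \<open>d\<close>.\<close>

lemma bump_profile:
  obtains \<Phi> :: "nat \<Rightarrow> real \<Rightarrow> real" and c d :: real where
    "\<And>k x. k \<le> m \<Longrightarrow> (\<Phi> k has_real_derivative \<Phi> (Suc k) x) (at x)"
    "\<And>k x. k \<le> Suc m \<Longrightarrow> x \<notin> {0<..<1} \<Longrightarrow> \<Phi> k x = 0"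
    "\<And>k x. k \<le> Suc m \<Longrightarrow> \<bar>\<Phi> k x\<bar> \<le> c" "0 < c"
    "\<And>x. 0 \<le> \<Phi> 0 x" "\<And>x. x \<in> {1/4..3/4} \<Longrightarrow> d \<le> \<Phi> 0 x" "0 < d"
proof -
  define q where "q = [:0, 1, -1::real:]"
  have q: "poly q x = x * (1 - x)" for x by (simp add: q_def algebra_simps)
  define P where "P k = (pderiv ^^ k) (q ^ (m + 2))" for k
  have dvd: "q ^ (m + 2 - k) dvd P k" if "k \<le> m + 2" for k
    using that
  proof (induction k)
    case (Suc k)
    have "m + 2 - k = Suc (m + 2 - Suc k)" using Suc.prems by simp
    then have "q ^ Suc (m + 2 - Suc k) dvd P k" using Suc by (simp only:)
    then show ?case unfolding P_def by (simp only: funpow.simps o_apply) (rule power_Suc_dvd_pderiv)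
  qed (simp add: P_def)
  have P0: "poly (P k) x = 0" if "k \<le> Suc m" "x = 0 \<or> x = 1" for k x
  proof -
    have "q dvd q ^ (m + 2 - k)" using that by (intro dvd_power) auto
    then have "q dvd P k" using dvd[of k] that by (auto intro: dvd_trans)
    then obtain s where "P k = q * s" by (rule dvdE)
    then show ?thesis using that q by auto
  qed
  define \<Phi> where "\<Phi> k x = (if x \<in> {0..1} then poly (P k) x else 0)" for k x
  have der: "(\<Phi> k has_real_derivative \<Phi> (Suc k) x) (at x)" if "k \<le> m" for k x
    unfolding \<Phi>_def[abs_def]
  proof (rule has_real_derivative_cut_off)
    show "(poly (P k) has_real_derivative poly (P (Suc k)) x) (at x)" for x
      using poly_DERIV[of "P k" x] by (simp add: P_def)
  qed (use P0 that in auto)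
  have supp: "\<Phi> k x = 0" if "k \<le> Suc m" "x \<notin> {0<..<1}" for k x
    using P0[OF that(1), of x] that by (auto simp: \<Phi>_def)
  have "\<exists>c. \<forall>x. \<bar>\<Phi> k x\<bar> \<le> c" for k
  proof -
    have "compact (poly (P k) ` {0..1})" by (intro compact_continuous_image continuous_intros) auto
    then obtain c where "\<And>x. x \<in> {0..1} \<Longrightarrow> \<bar>poly (P k) x\<bar> \<le> c"
      using compact_imp_bounded bounded_iff by (metis (no_types, lifting) image_eqI real_norm_def)
    then show ?thesis by (intro exI[of _ "\<bar>c\<bar>"]) (auto simp: \<Phi>_def intro: order_trans[OF _ abs_ge_self])
  qed
  then obtain c where c: "\<And>k x. \<bar>\<Phi> k x\<bar> \<le> c k" by metis
  define c' where "c' = (\<Sum>k\<le>Suc m. c k) + 1"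
  have c0: "0 \<le> c k" for k using c[of k 0] by linarith
  have c': "\<bar>\<Phi> k x\<bar> \<le> c'" if "k \<le> Suc m" for k x
  proof -
    have "c k \<le> (\<Sum>k\<le>Suc m. c k)" using that c0 by (intro member_le_sum) auto
    then show ?thesis using c[of k x] by (simp add: c'_def)
  qed
  have "0 < c'" unfolding c'_def using c0 by (simp add: sum_nonneg add_nonneg_pos)
  moreover have "0 \<le> \<Phi> 0 x" for x
    by (simp add: \<Phi>_def P_def q del: power_Suc)
  moreover have "(1/16) ^ (m + 2) \<le> \<Phi> 0 x" if "x \<in> {1/4..3/4}" for x
  proof -
    have "1/4 * (1/4) \<le> x * (1 - x)" using that by (intro mult_mono) auto
    then have "(1/16) ^ (m + 2) \<le> (x * (1 - x)) ^ (m + 2)" by (intro power_mono) auto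
    then show ?thesis using that by (simp add: \<Phi>_def P_def q del: power_Suc power_add)
  qed
  ultimately show thesis
    using that[of \<Phi> c' "(1/16) ^ (m + 2)"] der supp c' by simp
qed

locale bumps =
  fixes m :: nat and \<Phi> :: "nat \<Rightarrow> real \<Rightarrow> real" and c d :: real
  assumes deriv: "\<And>k x. k \<le> m \<Longrightarrow> (\<Phi> k has_real_derivative \<Phi> (Suc k) x) (at x)"
    and support: "\<And>k x. k \<le> Suc m \<Longrightarrow> x \<notin> {0<..<1} \<Longrightarrow> \<Phi> k x = 0"
    and bound: "\<And>k x. k \<le> Suc m \<Longrightarrow> \<bar>\<Phi> k x\<bar> \<le> c" and c: "0 < c"
    and nonneg: "\<And>x. 0 \<le> \<Phi> 0 x" and lower: "\<And>x. x \<in> {1/4..3/4} \<Longrightarrow> d \<le> \<Phi> 0 x" and d: "0 < d"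
begin

text \<open>The index \<open>k\<close> is the order of the derivative, and
  \<open>(1 / w) ^ k\<close> comes from the chain rule. Profile \<open>j\<close> occupies an
  interval of length \<open>w\<close> starting at \<open>a0 + pos j * w\<close>.\<close>

definition train :: "real \<Rightarrow> real \<Rightarrow> nat set \<Rightarrow> (nat \<Rightarrow> real) \<Rightarrow> (nat \<Rightarrow> nat) \<Rightarrow> nat \<Rightarrow> real \<Rightarrow> real" where
  "train a0 w \<omega> \<alpha> pos k x = (\<Sum>j\<in>\<omega>. \<alpha> j * (1 / w) ^ k * \<Phi> k ((x - a0) / w - real (pos j)))"

lemma train_deriv:
  assumes "k \<le> m" "w \<noteq> 0"
  shows "(train a0 w \<omega> \<alpha> pos k has_real_derivative train a0 w \<omega> \<alpha> pos (Suc k) x) (at x)"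
proof -
  have "((\<lambda>x. \<alpha> j * (1 / w) ^ k * \<Phi> k ((x - a0) / w - real (pos j))) has_real_derivative
      \<alpha> j * (1 / w) ^ Suc k * \<Phi> (Suc k) ((x - a0) / w - real (pos j))) (at x)" for j
  proof -
    have "((\<lambda>x. (x - a0) / w - real (pos j)) has_real_derivative 1 / w) (at x)"
      using assms by (auto intro!: derivative_eq_intros)
    from DERIV_chain2[OF deriv[OF assms(1)] this]
    have "((\<lambda>x. \<Phi> k ((x - a0) / w - real (pos j))) has_real_derivative \<Phi> (Suc k) ((x - a0) / w - real (pos j)) * (1 / w)) (at x)" .
    from DERIV_cmult[OF this, of "\<alpha> j * (1 / w) ^ k"] show ?thesis by (simp add: mult_ac)
  qed
  then have "((\<lambda>x. train a0 w \<omega> \<alpha> pos k x) has_real_derivative train a0 w \<omega> \<alpha> pos (Suc k) x) (at x)"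
    unfolding train_def by (rule DERIV_sum)
  then show ?thesis by simp
qed

lemma active_card:
  assumes "inj_on pos \<omega>" "k \<le> Suc m"
  shows "card {j\<in>\<omega>. \<Phi> k (u - real (pos j)) \<noteq> 0} \<le> 1" (is "card ?S \<le> 1")
proof -
  have "j = j'" if "j \<in> ?S" "j' \<in> ?S" for j j'
  proof -
    have "u - real (pos j) \<in> {0<..<1}" "u - real (pos j') \<in> {0<..<1}"
      using that support[OF assms(2)] by blast+
    then have "pos j = pos j'" by auto
    then show ?thesis using assms(1) that by (auto dest: inj_onD)
  qed
  then show ?thesis by (metis (no_types, lifting) card_le_Suc0_iff_eq card.infinite le0 One_nat_def)
qed

lemma train_bound:
  assumes "finite \<omega>" "inj_on pos \<omega>" "k \<le> Suc m" "0 < w" and \<alpha>: "\<And>j. j \<in> \<omega> \<Longrightarrow> \<bar>\<alpha> j\<bar> \<le> A" and A: "0 \<le> A"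
  shows "\<bar>train a0 w \<omega> \<alpha> pos k x\<bar> \<le> A * (1 / w) ^ k * c"
proof -
  let ?u = "(x - a0) / w"
  let ?t = "\<lambda>j. \<alpha> j * (1 / w) ^ k * \<Phi> k (?u - real (pos j))"
  let ?S = "{j\<in>\<omega>. \<Phi> k (?u - real (pos j)) \<noteq> 0}"
  have eq: "train a0 w \<omega> \<alpha> pos k x = (\<Sum>j\<in>?S. ?t j)"
    unfolding train_def using assms(1) by (intro sum.mono_neutral_right) auto
  have "\<bar>train a0 w \<omega> \<alpha> pos k x\<bar> \<le> (\<Sum>j\<in>?S. \<bar>?t j\<bar>)" unfolding eq by (rule sum_abs)
  also have "\<dots> \<le> (\<Sum>j\<in>?S. A * (1 / w) ^ k * c)"
  proof (rule sum_mono)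
    fix j assume "j \<in> ?S"
    have w: "0 \<le> (1 / w) ^ k" using assms(4) by simp
    have "\<bar>?t j\<bar> = \<bar>\<alpha> j\<bar> * (1 / w) ^ k * \<bar>\<Phi> k (?u - real (pos j))\<bar>"
      unfolding abs_mult abs_of_nonneg[OF w] ..
    also have "\<dots> \<le> A * (1 / w) ^ k * c"
    proof (rule mult_mono)
      show "\<bar>\<alpha> j\<bar> * (1 / w) ^ k \<le> A * (1 / w) ^ k"
        using \<open>j \<in> ?S\<close> w by (intro mult_right_mono \<alpha>) auto
      show "0 \<le> A * (1 / w) ^ k" using A w by (rule mult_nonneg_nonneg)
    qed (use bound[OF assms(3)] in auto)
    finally show "\<bar>?t j\<bar> \<le> A * (1 / w) ^ k * c" .
  qed
  also have "\<dots> = real (card ?S) * (A * (1 / w) ^ k * c)" by simp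
  also have "\<dots> \<le> 1 * (A * (1 / w) ^ k * c)"
  proof (rule mult_right_mono)
    show "0 \<le> A * (1 / w) ^ k * c" using A assms(4) c by simp
  qed (use active_card[OF assms(2,3), of ?u] in simp)
  finally show ?thesis by simp
qed

text \<open>The Lipschitz bound serves for distances up to 1 and the trivial bound
  \<open>2 * c\<close> beyond.\<close>

lemma profile_hoelder:
  assumes "k \<le> m" "0 \<le> \<gamma>" "\<gamma> \<le> 1" "u \<noteq> v"
  shows "\<bar>\<Phi> k u - \<Phi> k v\<bar> \<le> 2 * c * \<bar>u - v\<bar> powr \<gamma>"
proof (cases "\<bar>u - v\<bar> \<le> 1")
  case True
  have lip: "\<bar>\<Phi> k u - \<Phi> k v\<bar> \<le> c * \<bar>u - v\<bar>"
  proof -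
    have "norm (\<Phi> k u - \<Phi> k v) \<le> c * norm (u - v)"
      using deriv[OF assms(1)] bound[of "Suc k"] assms(1)
      by (intro field_differentiable_bound[of UNIV "\<Phi> k" "\<Phi> (Suc k)"]) auto
    then show ?thesis by simp
  qed
  have "\<bar>u - v\<bar> = \<bar>u - v\<bar> powr 1" using assms by simp
  also have "\<dots> \<le> \<bar>u - v\<bar> powr \<gamma>" using assms True by (intro powr_mono') auto
  finally have "c * \<bar>u - v\<bar> \<le> c * \<bar>u - v\<bar> powr \<gamma>" using c by simp
  moreover have "0 \<le> c * \<bar>u - v\<bar> powr \<gamma>" using c by simp
  ultimately show ?thesis using lip by linarith
next
  case False
  have "\<bar>\<Phi> k u - \<Phi> k v\<bar> \<le> 2 * c * 1" using bound[of k u] bound[of k v] assms(1) by simp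
  also have "\<dots> \<le> 2 * c * \<bar>u - v\<bar> powr \<gamma>"
    using False assms c by (intro mult_left_mono ge_one_powr_ge_zero) auto
  finally show ?thesis .
qed

text \<open>At most one profile is active at \<open>x\<close> and one at \<open>y\<close>; this
  factor 2 and the factor 2 of \<open>profile_hoelder\<close> make the 4. The bound is independent
  of the number of profiles.\<close>

lemma train_hoelder:
  assumes "finite \<omega>" "inj_on pos \<omega>" "k \<le> m" "0 < w" and \<alpha>: "\<And>j. j \<in> \<omega> \<Longrightarrow> \<bar>\<alpha> j\<bar> \<le> A" and A: "0 \<le> A"
    and \<gamma>: "0 \<le> \<gamma>" "\<gamma> \<le> 1" and xy: "x \<noteq> y"
  shows "\<bar>train a0 w \<omega> \<alpha> pos k x - train a0 w \<omega> \<alpha> pos k y\<bar> \<le> 4 * A * c * (1 / w) ^ k * (\<bar>x - y\<bar> / w) powr \<gamma>"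
proof -
  let ?u = "(x - a0) / w" and ?v = "(y - a0) / w"
  let ?t = "\<lambda>u j. \<alpha> j * (1 / w) ^ k * \<Phi> k (u - real (pos j))"
  let ?S = "\<lambda>u. {j\<in>\<omega>. \<Phi> k (u - real (pos j)) \<noteq> 0}"
  let ?T = "?S ?u \<union> ?S ?v"
  have uv: "?u - ?v = (x - y) / w" by (simp add: diff_divide_distrib)
  have eq: "train a0 w \<omega> \<alpha> pos k x - train a0 w \<omega> \<alpha> pos k y = (\<Sum>j\<in>\<omega>. ?t ?u j - ?t ?v j)"
    unfolding train_def by (simp add: sum_subtractf)
  have eq': "(\<Sum>j\<in>\<omega>. ?t ?u j - ?t ?v j) = (\<Sum>j\<in>?T. ?t ?u j - ?t ?v j)"
    using assms(1) by (intro sum.mono_neutral_right) auto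
  have "\<bar>train a0 w \<omega> \<alpha> pos k x - train a0 w \<omega> \<alpha> pos k y\<bar> \<le> (\<Sum>j\<in>?T. \<bar>?t ?u j - ?t ?v j\<bar>)"
    unfolding eq eq' by (rule sum_abs)
  also have "\<dots> \<le> (\<Sum>j\<in>?T. A * (1 / w) ^ k * (2 * c * (\<bar>x - y\<bar> / w) powr \<gamma>))"
  proof (rule sum_mono)
    fix j assume j: "j \<in> ?T"
    have w: "0 \<le> (1 / w) ^ k" using assms(4) by simp
    have "?t ?u j - ?t ?v j = \<alpha> j * (1 / w) ^ k * (\<Phi> k (?u - real (pos j)) - \<Phi> k (?v - real (pos j)))"
      by (simp add: algebra_simps)
    then have "\<bar>?t ?u j - ?t ?v j\<bar> = \<bar>\<alpha> j\<bar> * (1 / w) ^ k * \<bar>\<Phi> k (?u - real (pos j)) - \<Phi> k (?v - real (pos j))\<bar>"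
      by (simp only: abs_mult abs_of_nonneg[OF w])
    also have "\<dots> \<le> A * (1 / w) ^ k * (2 * c * (\<bar>x - y\<bar> / w) powr \<gamma>)"
    proof (rule mult_mono)
      have "?u - real (pos j) \<noteq> ?v - real (pos j)" using xy assms(4) by simp
      from profile_hoelder[OF assms(3) \<gamma> this]
      show "\<bar>\<Phi> k (?u - real (pos j)) - \<Phi> k (?v - real (pos j))\<bar> \<le> 2 * c * (\<bar>x - y\<bar> / w) powr \<gamma>"
        using assms(4) by (simp add: uv abs_divide)
      show "\<bar>\<alpha> j\<bar> * (1 / w) ^ k \<le> A * (1 / w) ^ k"
        using j w by (intro mult_right_mono \<alpha>) auto
      show "0 \<le> A * (1 / w) ^ k" using A w by (rule mult_nonneg_nonneg)
    qed auto
    finally show "\<bar>?t ?u j - ?t ?v j\<bar> \<le> A * (1 / w) ^ k * (2 * c * (\<bar>x - y\<bar> / w) powr \<gamma>)" .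
  qed
  also have "\<dots> = real (card ?T) * (A * (1 / w) ^ k * (2 * c * (\<bar>x - y\<bar> / w) powr \<gamma>))" by simp
  also have "\<dots> \<le> 2 * (A * (1 / w) ^ k * (2 * c * (\<bar>x - y\<bar> / w) powr \<gamma>))"
  proof (rule mult_right_mono)
    have "card ?T \<le> card (?S ?u) + card (?S ?v)" by (rule card_Un_le)
    also have "\<dots> \<le> 2" using active_card[OF assms(2), of k ?u] active_card[OF assms(2), of k ?v] assms(3) by simp
    finally show "real (card ?T) \<le> 2" by simp
    show "0 \<le> A * (1 / w) ^ k * (2 * c * (\<bar>x - y\<bar> / w) powr \<gamma>)" using A c assms(4) by simp
  qed
  finally show ?thesis by (simp add: mult_ac)
qed

text \<open>The amplitude \<open>w powr \<beta>\<close> exactly cancels the \<open>m\<close>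
  derivatives and the Hoelder exponent \<open>\<beta> - m\<close>, so the perturbation has a norm
  that is bounded in \<open>w\<close>.\<close>

lemma train_hoelder_ball:
  assumes \<beta>: "1 < \<beta>" "m = hoelder_deg \<beta>" and ab: "a < b" and f: "f \<in> hoelder_ball \<beta> {a..b} H" and H: "0 \<le> H"
    and h: "\<And>x. x \<in> {a..b} \<Longrightarrow> h x = f x + train a0 w \<omega> \<alpha> pos 0 x"
    and \<omega>: "finite \<omega>" "inj_on pos \<omega>" and w: "0 < w" "w \<le> 1" and \<alpha>: "\<And>j. j \<in> \<omega> \<Longrightarrow> \<bar>\<alpha> j\<bar> \<le> A * w powr \<beta>" and A: "0 \<le> A"
  shows "h \<in> hoelder_ball \<beta> {a..b} (H + (m + 2) * (4 * A * c))"
proof -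
  have deg: "real m < \<beta>" "\<beta> - m \<le> 1"
    using \<beta> unfolding hoelder_deg_def by linarith+
  have pw: "w powr \<beta> * (1 / w) ^ k \<le> 1" if "k \<le> m" for k
  proof -
    have "w powr \<beta> * (1 / w) ^ k = w powr (\<beta> - k)"
      using w by (simp add: powr_diff powr_realpow power_divide)
    also have "\<dots> \<le> 1" using w that deg by (intro powr_le1) auto
    finally show ?thesis .
  qed
  have A': "0 \<le> A * w powr \<beta>" using A by simp
  show ?thesis
    unfolding \<beta>(2)
  proof (rule hoelder_ball_add[where B = "train a0 w \<omega> \<alpha> pos", OF ab f H _ h])
    show "0 \<le> 4 * A * c" using A c by simp
    show "(train a0 w \<omega> \<alpha> pos k has_real_derivative train a0 w \<omega> \<alpha> pos (Suc k) x) (at x)" if "k < hoelder_deg \<beta>" for k x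
      using that \<beta> w by (intro train_deriv) auto
    show "\<bar>train a0 w \<omega> \<alpha> pos k x\<bar> \<le> 4 * A * c" if "k \<le> hoelder_deg \<beta>" for k x
    proof -
      have "\<bar>train a0 w \<omega> \<alpha> pos k x\<bar> \<le> A * w powr \<beta> * (1 / w) ^ k * c"
        using that \<beta> by (intro train_bound \<omega> w \<alpha> A') auto
      also have "\<dots> = (A * c) * (w powr \<beta> * (1 / w) ^ k)" by simp
      also have "\<dots> \<le> (A * c) * 1" using pw[of k] that \<beta> A c by (intro mult_left_mono) auto
      also have "\<dots> \<le> 4 * A * c" using A c by simp
      finally show ?thesis .
    qed
    show "\<bar>train a0 w \<omega> \<alpha> pos (hoelder_deg \<beta>) x - train a0 w \<omega> \<alpha> pos (hoelder_deg \<beta>) y\<bar>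
        \<le> 4 * A * c * \<bar>x - y\<bar> powr (\<beta> - hoelder_deg \<beta>)" if "x \<noteq> y" for x y
    proof -
      have "\<bar>train a0 w \<omega> \<alpha> pos m x - train a0 w \<omega> \<alpha> pos m y\<bar> \<le> 4 * (A * w powr \<beta>) * c * (1 / w) ^ m * (\<bar>x - y\<bar> / w) powr (\<beta> - m)"
        using deg that by (intro train_hoelder \<omega> w \<alpha> A') auto
      also have "(\<bar>x - y\<bar> / w) powr (\<beta> - m) = \<bar>x - y\<bar> powr (\<beta> - m) / (w powr \<beta> / w ^ m)"
        using w by (simp add: powr_divide powr_diff powr_realpow)
      also have "4 * (A * w powr \<beta>) * c * (1 / w) ^ m * (\<bar>x - y\<bar> powr (\<beta> - m) / (w powr \<beta> / w ^ m)) = 4 * A * c * \<bar>x - y\<bar> powr (\<beta> - m)"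
        using w by (simp add: power_divide)
      finally show ?thesis by (simp add: \<beta>(2))
    qed
  qed
qed

end

section \<open>Testing on a hypercube\<close>

lemma PiM_density:
  fixes p :: "'a \<Rightarrow> real"
  assumes I: "finite I" and M: "sigma_finite_measure M" and p[measurable]: "p \<in> borel_measurable M" and p0: "\<And>x. 0 \<le> p x"
  shows "PiM I (\<lambda>_. density M (\<lambda>x. ennreal (p x))) = density (PiM I (\<lambda>_. M)) (\<lambda>x. ennreal (\<Prod>i\<in>I. p (x i)))"
proof -
  interpret M: sigma_finite_measure M by fact
  interpret N: product_sigma_finite "\<lambda>_. M" by standard
  have "sigma_finite_measure (density M (\<lambda>x. ennreal (p x)))"
    by (subst M.sigma_finite_iff_density_finite) auto
  then interpret P: product_sigma_finite "\<lambda>_. density M (\<lambda>x. ennreal (p x))"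
    by (simp add: product_sigma_finite_def)
  show ?thesis
  proof (rule P.PiM_eqI[symmetric, OF I])
    show "sets (density (PiM I (\<lambda>_. M)) (\<lambda>x. ennreal (\<Prod>i\<in>I. p (x i)))) = sets (PiM I (\<lambda>_. density M (\<lambda>x. ennreal (p x))))"
      by (auto intro!: sets_PiM_cong)
    fix A assume A: "\<And>i. i \<in> I \<Longrightarrow> A i \<in> sets (density M (\<lambda>x. ennreal (p x)))"
    then have A'[measurable]: "\<And>i. i \<in> I \<Longrightarrow> A i \<in> sets M" by simp
    have "emeasure (density (PiM I (\<lambda>_. M)) (\<lambda>x. ennreal (\<Prod>i\<in>I. p (x i)))) (Pi\<^sub>E I A)
      = (\<integral>\<^sup>+ x. ennreal (\<Prod>i\<in>I. p (x i)) * indicator (Pi\<^sub>E I A) x \<partial>PiM I (\<lambda>_. M))"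
      using I A' by (intro emeasure_density) (auto intro!: sets_PiM_I_finite)
    also have "\<dots> = (\<integral>\<^sup>+ x. (\<Prod>i\<in>I. ennreal (p (x i)) * indicator (A i) (x i)) \<partial>PiM I (\<lambda>_. M))"
    proof (intro nn_integral_cong)
      fix x assume x: "x \<in> space (PiM I (\<lambda>_. M))"
      have "indicator (Pi\<^sub>E I A) x = (\<Prod>i\<in>I. indicator (A i) (x i) :: ennreal)"
      proof (cases "x \<in> Pi\<^sub>E I A")
        case True
        then show ?thesis by (auto simp: PiE_iff intro!: prod.neutral[symmetric])
      next
        case False
        then obtain i where "i \<in> I" "x i \<notin> A i" using x by (auto simp: space_PiM PiE_iff)
        then have "(\<Prod>i\<in>I. indicator (A i) (x i) :: ennreal) = 0"
          using I by (intro prod_zero) (auto intro!: bexI[of _ i])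
        then show ?thesis using False by simp
      qed
      then show "ennreal (\<Prod>i\<in>I. p (x i)) * indicator (Pi\<^sub>E I A) x = (\<Prod>i\<in>I. ennreal (p (x i)) * indicator (A i) (x i))"
        using p0 by (simp add: prod.distrib prod_ennreal)
    qed
    also have "\<dots> = (\<Prod>i\<in>I. \<integral>\<^sup>+ x. ennreal (p x) * indicator (A i) x \<partial>M)"
      by (rule N.product_nn_integral_prod[OF I]) measurable
    also have "\<dots> = (\<Prod>i\<in>I. emeasure (density M (\<lambda>x. ennreal (p x))) (A i))"
      by (intro prod.cong refl emeasure_density[symmetric]) auto
    finally show "emeasure (density (PiM I (\<lambda>_. M)) (\<lambda>x. ennreal (\<Prod>i\<in>I. p (x i)))) (Pi\<^sub>E I A)
       = (\<Prod>i\<in>I. emeasure (density M (\<lambda>x. ennreal (p x))) (A i))" .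
  qed
qed

text \<open>A linear bound that can be integrated term by term, in place of the Cauchy-Schwarz
  inequality between affinity and total variation. With \<open>x\<close> the smaller number it reads
  \<open>sqrt (x * y) \<le> x + y / 4\<close>, the inequality of the means for \<open>2 * x\<close>
  and \<open>y / 2\<close>.\<close>

lemma sqrt_mult_le_min:
  assumes "0 \<le> a" "0 \<le> (b::real)"
  shows "sqrt (a * b) \<le> 3/4 * min a b + (a + b) / 4"
proof -
  have *: "sqrt (x * y) \<le> x + y / 4" if "0 \<le> x" "0 \<le> y" for x y :: real
  proof -
    have "sqrt ((2 * x) * (y / 2)) \<le> (2 * x + y / 2) / 2" using that by (intro arith_geo_mean_sqrt) auto
    then show ?thesis by (simp add: field_simps)
  qed
  show ?thesis using *[OF assms] *[OF assms(2,1)] by (cases "a \<le> b") (auto simp: min_def mult.commute field_simps)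
qed

text \<open>Affinities multiply over independent observations, and Bernoulli's inequality bounds the
  power. The errors of any test sum to at least the integral \<open>m\<close> of the minimum of the
  two densities; solving \<open>1 - n * e / 2 \<le> 3/4 * m + 1/2\<close> for it gives the
  constants.\<close>

lemma testing_affinity:
  fixes p q :: "'a \<Rightarrow> real"
  assumes M: "sigma_finite_measure M" and [measurable]: "p \<in> borel_measurable M" "q \<in> borel_measurable M"
    and nn: "\<And>x. 0 \<le> p x" "\<And>x. 0 \<le> q x"
    and p1: "(\<integral>\<^sup>+ x. ennreal (p x) \<partial>M) = 1" and q1: "(\<integral>\<^sup>+ x. ennreal (q x) \<partial>M) = 1"
    and aff: "ennreal (1 - e / 2) \<le> (\<integral>\<^sup>+ x. ennreal (sqrt (p x * q x)) \<partial>M)" and e: "e \<le> 2"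
    and A: "A \<in> sets (PiM {..<n} (\<lambda>_. M))"
  shows "ennreal (2/3 * (1 - n * e)) \<le> emeasure (PiM {..<n::nat} (\<lambda>_. density M (\<lambda>x. ennreal (p x)))) A +
     emeasure (PiM {..<n} (\<lambda>_. density M (\<lambda>x. ennreal (q x)))) (space (PiM {..<n} (\<lambda>_. M)) - A)"
proof -
  interpret M: sigma_finite_measure M by fact
  interpret N: product_sigma_finite "\<lambda>_. M" by standard
  let ?N = "PiM {..<n} (\<lambda>_. M)"
  let ?f = "\<lambda>x. \<Prod>i<n. p (x i)" and ?g = "\<lambda>x. \<Prod>i<n. q (x i)"
  note [measurable] = A
  have f0: "0 \<le> ?f x" "0 \<le> ?g x" for x using nn by (auto intro: prod_nonneg)
  have prodint: "(\<integral>\<^sup>+ x. ennreal (\<Prod>i<n. h (x i)) \<partial>?N) = (\<integral>\<^sup>+ x. ennreal (h x) \<partial>M) ^ n"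
    if [measurable]: "h \<in> borel_measurable M" and "\<And>x. 0 \<le> h x" for h
  proof -
    have "(\<integral>\<^sup>+ x. ennreal (\<Prod>i<n. h (x i)) \<partial>?N) = (\<integral>\<^sup>+ x. (\<Prod>i<n. ennreal (h (x i))) \<partial>?N)"
      using that by (simp add: prod_ennreal)
    also have "\<dots> = (\<Prod>i<n. \<integral>\<^sup>+ x. ennreal (h x) \<partial>M)"
      by (rule N.product_nn_integral_prod) auto
    finally show ?thesis by simp
  qed
  define m where "m = (\<integral>\<^sup>+ x. ennreal (min (?f x) (?g x)) \<partial>?N)"
  have "1 + real n * (- (e / 2)) \<le> (1 + - (e / 2)) ^ n"
    using e by (intro Bernoulli_inequality) simp
  then have "ennreal (1 - n * e / 2) \<le> ennreal ((1 - e / 2) ^ n)" by (intro ennreal_leI) simp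
  also have "\<dots> = ennreal (1 - e / 2) ^ n" using e by (intro ennreal_power[symmetric]) simp
  also have "\<dots> \<le> (\<integral>\<^sup>+ x. ennreal (sqrt (p x * q x)) \<partial>M) ^ n" using aff by (rule power_mono) simp
  also have "\<dots> = (\<integral>\<^sup>+ x. ennreal (\<Prod>i<n. sqrt (p (x i) * q (x i))) \<partial>?N)"
    using nn by (intro prodint[symmetric]) auto
  also have "\<dots> = (\<integral>\<^sup>+ x. ennreal (sqrt (?f x * ?g x)) \<partial>?N)"
  proof (intro nn_integral_cong)
    fix x
    have "(\<Prod>i<n. sqrt (p (x i) * q (x i))) = sqrt (\<Prod>i<n. p (x i) * q (x i))"
      by (induction n) (auto simp: real_sqrt_mult)
    then show "ennreal (\<Prod>i<n. sqrt (p (x i) * q (x i))) = ennreal (sqrt (?f x * ?g x))"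
      by (simp add: prod.distrib)
  qed
  also have "\<dots> \<le> (\<integral>\<^sup>+ x. ennreal (3/4) * ennreal (min (?f x) (?g x)) + ennreal (1/4) * (ennreal (?f x) + ennreal (?g x)) \<partial>?N)"
  proof (intro nn_integral_mono)
    fix x
    have "ennreal (sqrt (?f x * ?g x)) \<le> ennreal (3/4 * min (?f x) (?g x) + 1/4 * (?f x + ?g x))"
      using sqrt_mult_le_min[OF f0[of x]] by (intro ennreal_leI) simp
    also have "\<dots> = ennreal (3/4) * ennreal (min (?f x) (?g x)) + ennreal (1/4) * (ennreal (?f x) + ennreal (?g x))"
    proof -
      have "0 \<le> min (?f x) (?g x)" using f0[of x] by simp
      then show ?thesis using f0[of x]
        by (simp add: ennreal_plus[symmetric] ennreal_mult'[symmetric] del: ennreal_plus)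
    qed
    finally show "ennreal (sqrt (?f x * ?g x)) \<le> ennreal (3/4) * ennreal (min (?f x) (?g x)) + ennreal (1/4) * (ennreal (?f x) + ennreal (?g x))" .
  qed
  also have "\<dots> = ennreal (3/4) * m + ennreal (1/4) * ((\<integral>\<^sup>+ x. ennreal (?f x) \<partial>?N) + (\<integral>\<^sup>+ x. ennreal (?g x) \<partial>?N))"
    unfolding m_def by (simp add: nn_integral_add nn_integral_cmult)
  also have "\<dots> = ennreal (3/4) * m + ennreal (1/2)"
  proof -
    have "ennreal (1/4) * (1 + 1) = ennreal (1/2)"
      by (simp add: ennreal_mult'[symmetric] flip: ennreal_numeral)
    then show ?thesis using nn p1 q1 by (simp add: prodint)
  qed
  finally have le: "ennreal (1 - n * e / 2) \<le> ennreal (3/4) * m + ennreal (1/2)" .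
  have "ennreal (2/3 * (1 - n * e)) \<le> m"
  proof (cases m)
    case (real r)
    have r: "0 \<le> 3/4 * r" "0 \<le> (3/4::real)" "0 \<le> (1/2::real)" using real(1) by auto
    have "ennreal (1 - n * e / 2) \<le> ennreal (3/4 * r + 1/2)"
      using le unfolding real(2) ennreal_plus[OF r(1,3)] ennreal_mult'[OF r(2)] .
    then have "1 - n * e / 2 \<le> 3/4 * r + 1/2"
      by (rule ennreal_le_iff[THEN iffD1, rotated]) (use r in simp)
    then have "2/3 * (1 - n * e) \<le> r" by (simp add: field_simps)
    then show ?thesis unfolding real(2) by (rule ennreal_leI)
  qed simp
  also have "m \<le> (\<integral>\<^sup>+ x. ennreal (?f x) * indicator A x + ennreal (?g x) * indicator (space ?N - A) x \<partial>?N)"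
    unfolding m_def
  proof (intro nn_integral_mono)
    fix x assume "x \<in> space ?N"
    then show "ennreal (min (?f x) (?g x)) \<le> ennreal (?f x) * indicator A x + ennreal (?g x) * indicator (space ?N - A) x"
      by (cases "x \<in> A") (auto intro!: ennreal_leI)
  qed
  also have "\<dots> = emeasure (density ?N (\<lambda>x. ennreal (?f x))) A + emeasure (density ?N (\<lambda>x. ennreal (?g x))) (space ?N - A)"
    by (subst nn_integral_add) (auto simp: emeasure_density)
  finally show ?thesis
    using nn by (simp add: PiM_density[OF _ M])
qed

text \<open>Masses above 1 do no harm: the affinity is divided by the geometric mean of the two
  masses, which is at least 1 and at most their arithmetic mean.\<close>

lemma normalized_affinity:
  fixes p q :: "'a \<Rightarrow> real"
  assumes p: "integrable M p" "\<And>x. 0 < p x" "1 \<le> (\<integral>x. p x \<partial>M)"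
    and q: "integrable M q" "\<And>x. 0 < q x" "1 \<le> (\<integral>x. q x \<partial>M)"
    and d1: "\<And>x. \<bar>ln (p x) - ln (q x)\<bar> \<le> 1"
    and d2: "(\<integral>\<^sup>+ x. ennreal (p x * (ln (p x) - ln (q x))\<^sup>2) \<partial>M) \<le> ennreal e" and e: "0 \<le> e"
  shows "ennreal (1 - e / 2) \<le> (\<integral>\<^sup>+ x. ennreal (sqrt (p x / (\<integral>x. p x \<partial>M) * (q x / (\<integral>x. q x \<partial>M)))) \<partial>M)"
proof -
  let ?a = "\<integral>x. p x \<partial>M" and ?b = "\<integral>x. q x \<partial>M"
  have [measurable]: "p \<in> borel_measurable M" "q \<in> borel_measurable M" using p(1) q(1) by auto
  have half: "ennreal (1/2) * ennreal y = ennreal (y / 2)" for y by (subst ennreal_mult'[symmetric]) simp_all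
  have pt: "(p x + q x) / 2 \<le> sqrt (p x * q x) + p x * (ln (p x) - ln (q x))\<^sup>2 / 2" for x
  proof -
    \<comment> \<open>With this \<open>d\<close> the difference between the arithmetic and the
      geometric mean is \<open>p x * (exp d - 1)\<^sup>2 / 2\<close>, and
      \<open>\<bar>exp d - 1\<bar>\<close> is at most \<open>2 * \<bar>d\<bar>\<close>.\<close>
    define d where "d = (ln (q x) - ln (p x)) / 2"
    have d: "\<bar>d\<bar> \<le> 1/2" using d1[of x] by (simp add: d_def)
    have ed: "\<bar>exp d - 1\<bar> \<le> 2 * \<bar>d\<bar>"
    proof (cases "0 \<le> d")
      case True
      then have "exp d \<le> 1 + d + d\<^sup>2" using d by (intro exp_bound) auto
      also have "d\<^sup>2 \<le> d" using True d mult_left_le[of d d] by (simp add: power2_eq_square)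
      finally show ?thesis using True by simp
    next
      case False
      then have "exp d \<le> 1" by simp
      then show ?thesis using False exp_ge_add_one_self[of d] by linarith
    qed
    have q: "q x = p x * (exp d)\<^sup>2"
    proof -
      have "(exp d)\<^sup>2 = exp (ln (q x) - ln (p x))" by (simp add: d_def exp_double[symmetric] add_divide_distrib[symmetric])
      then show ?thesis using p(2)[of x] q(2)[of x] by (simp add: exp_diff)
    qed
    have s: "sqrt (p x * q x) = p x * exp d"
      unfolding q using p(2)[of x] by (simp add: real_sqrt_mult power2_eq_square mult.assoc[symmetric])
    have "(exp d - 1)\<^sup>2 \<le> (2 * \<bar>d\<bar>)\<^sup>2" using ed by (metis abs_ge_zero power2_abs power_mono)
    also have "\<dots> = (ln (p x) - ln (q x))\<^sup>2" by (simp add: d_def power2_commute power_divide)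
    finally have "p x * (exp d - 1)\<^sup>2 \<le> p x * (ln (p x) - ln (q x))\<^sup>2" using p(2)[of x] by (intro mult_left_mono) auto
    moreover define L where "L = (ln (p x) - ln (q x))\<^sup>2"
    ultimately show ?thesis
      unfolding s L_def[symmetric] by (subst q) (simp add: power2_eq_square algebra_simps)
  qed
  have sq: "sqrt (p x * q x) \<le> (p x + q x) / 2" for x
    using p(2)[of x] q(2)[of x] by (intro arith_geo_mean_sqrt) auto
  have int: "integrable M (\<lambda>x. sqrt (p x * q x))"
  proof (rule Bochner_Integration.integrable_bound)
    show "integrable M (\<lambda>x. (p x + q x) / 2)" using p(1) q(1) by auto
    show "AE x in M. norm (sqrt (p x * q x)) \<le> norm ((p x + q x) / 2)"
    proof (rule AE_I2)
      fix x
      have "0 \<le> sqrt (p x * q x)" using p(2)[of x] q(2)[of x] by simp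
      then show "norm (sqrt (p x * q x)) \<le> norm ((p x + q x) / 2)" using sq[of x] by simp
    qed
  qed simp
  define S where "S = (\<integral>x. sqrt (p x * q x) \<partial>M)"
  have nnS: "(\<integral>\<^sup>+ x. ennreal (sqrt (p x * q x)) \<partial>M) = ennreal S"
    unfolding S_def using p(2) q(2) by (intro nn_integral_eq_integral int) (auto simp: less_imp_le)
  have S0: "0 \<le> S" unfolding S_def using p(2) q(2) by (intro integral_nonneg_AE) (auto simp: less_imp_le)
  have "ennreal ((?a + ?b) / 2) = (\<integral>\<^sup>+ x. ennreal ((p x + q x) / 2) \<partial>M)"
    using p(1,2) q(1,2) by (subst nn_integral_eq_integral) (auto simp: less_imp_le add_nonneg_nonneg)
  also have "\<dots> \<le> (\<integral>\<^sup>+ x. ennreal (sqrt (p x * q x)) + ennreal (1/2) * ennreal (p x * (ln (p x) - ln (q x))\<^sup>2) \<partial>M)"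
  proof (intro nn_integral_mono)
    fix x
    have "0 \<le> sqrt (p x * q x)" "0 \<le> p x * (ln (p x) - ln (q x))\<^sup>2" using p(2)[of x] q(2)[of x] by (auto simp: less_imp_le)
    then have "ennreal (sqrt (p x * q x)) + ennreal (1/2) * ennreal (p x * (ln (p x) - ln (q x))\<^sup>2)
      = ennreal (sqrt (p x * q x) + p x * (ln (p x) - ln (q x))\<^sup>2 / 2)"
    proof -
      define L where "L = p x * (ln (p x) - ln (q x))\<^sup>2"
      assume nn: "0 \<le> sqrt (p x * q x)" "0 \<le> p x * (ln (p x) - ln (q x))\<^sup>2"
      have "0 \<le> L / 2" using nn(2) by (simp add: L_def)
      then show ?thesis
        unfolding L_def[symmetric] half by (rule ennreal_plus[OF nn(1), symmetric])
    qed
    then show "ennreal ((p x + q x) / 2) \<le> ennreal (sqrt (p x * q x)) + ennreal (1/2) * ennreal (p x * (ln (p x) - ln (q x))\<^sup>2)"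
      using pt[of x] by (simp add: ennreal_leI)
  qed
  also have "\<dots> = ennreal S + ennreal (1/2) * (\<integral>\<^sup>+ x. ennreal (p x * (ln (p x) - ln (q x))\<^sup>2) \<partial>M)"
    by (simp add: nn_integral_add nn_integral_cmult nnS)
  also have "\<dots> \<le> ennreal S + ennreal (1/2) * ennreal e" using d2 by (intro add_left_mono mult_left_mono) auto
  also have "\<dots> = ennreal (S + e / 2)"
    unfolding half using S0 e by (intro ennreal_plus[symmetric]) auto
  finally have "ennreal ((?a + ?b) / 2) \<le> ennreal (S + e / 2)" .
  then have le: "(?a + ?b) / 2 \<le> S + e / 2" using S0 e by (subst (asm) ennreal_le_iff) auto
  let ?c = "sqrt (?a * ?b)"
  have c1: "1 \<le> ?c" using p(3) q(3) mult_mono[of 1 ?a 1 ?b] by simp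
  have c2: "?c \<le> (?a + ?b) / 2" using p(3) q(3) by (intro arith_geo_mean_sqrt) auto
  \<comment> \<open>This is where masses of at least 1 are used: division by \<open>?c\<close> does
    not enlarge the deficit \<open>e / 2\<close>.\<close>
  have "e / 2 \<le> e / 2 * ?c" using e c1 mult_left_mono[of 1 ?c "e / 2"] by simp
  then have "(1 - e / 2) * ?c \<le> S" using le c2 by (simp add: algebra_simps)
  then have "1 - e / 2 \<le> S / ?c" using c1 by (simp add: pos_le_divide_eq)
  then have "ennreal (1 - e / 2) \<le> ennreal (S / ?c)" by (rule ennreal_leI)
  also have "\<dots> = (\<integral>\<^sup>+ x. ennreal (sqrt (p x * q x) / ?c) \<partial>M)"
    using int p(2) q(2) c1 by (subst nn_integral_eq_integral) (auto simp: S_def less_imp_le)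
  finally show ?thesis by (simp add: real_sqrt_divide real_sqrt_mult)
qed

text \<open>
  Averaging the errors of the coordinate tests over the cube bounds the expected Hamming loss
  from below by \<open>M / 4\<close>; as the loss is at most \<open>M\<close>, it is of that order with positive probability.
\<close>

lemma assouad:
  fixes Q :: "nat set \<Rightarrow> 'x measure" and \<psi> :: "nat \<Rightarrow> 'x set" and t :: "nat \<Rightarrow> real"
  assumes M: "0 < M" and Q: "\<And>\<omega>. \<omega> \<subseteq> {..<M} \<Longrightarrow> prob_space (Q \<omega>)" "\<And>\<omega>. \<omega> \<subseteq> {..<M} \<Longrightarrow> sets (Q \<omega>) = sets N"
    and \<psi>: "\<And>j. j < M \<Longrightarrow> \<psi> j \<in> sets N"
    and t: "\<And>\<omega> j. \<omega> \<subseteq> {..<M} \<Longrightarrow> j < M \<Longrightarrow> j \<notin> \<omega> \<Longrightarrow> t j \<le> measure (Q \<omega>) (\<psi> j) + measure (Q (insert j \<omega>)) (space N - \<psi> j)"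
    and tsum: "M / 2 \<le> (\<Sum>j<M. t j)"
  obtains \<omega> where "\<omega> \<subseteq> {..<M}"
    "1 / 8 \<le> measure (Q \<omega>) {x \<in> space N. M / 8 \<le> card {j. j < M \<and> (x \<in> \<psi> j) \<noteq> (j \<in> \<omega>)}}"
proof -
  \<comment> \<open>\<open>\<psi> j\<close> is the event that the test decides for
    \<open>j \<in> \<omega>\<close>; accordingly \<open>E \<omega> j\<close> is its error under
    \<open>\<omega>\<close>.\<close>
  define E where "E \<omega> j = (if j \<in> \<omega> then space N - \<psi> j else \<psi> j)" for \<omega> j
  define err where "err \<omega> j = measure (Q \<omega>) (E \<omega> j)" for \<omega> j
  have E[measurable]: "E \<omega> j \<in> sets N" if "j < M" for \<omega> j using \<psi>[OF that] by (auto simp: E_def)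
  have "(\<Sum>\<omega>\<in>Pow {..<M}. \<Sum>j<M. err \<omega> j) = (\<Sum>j<M. \<Sum>\<omega>\<in>Pow {..<M}. err \<omega> j)" by (rule sum.swap)
  \<comment> \<open>The vertices are paired by flipping coordinate \<open>j\<close>; each of the
    \<open>2 ^ (M - 1)\<close> pairs contributes at least \<open>t j\<close>.\<close>
  also have "\<dots> \<ge> (\<Sum>j<M. 2 ^ (M - 1) * t j)"
  proof (rule sum_mono)
    fix j assume "j \<in> {..<M}"
    then have j: "j < M" by simp
    let ?A = "{..<M} - {j}"
    have ins: "{..<M} = insert j ?A" using j by auto
    have inj: "inj_on (insert j) (Pow ?A)" by (rule inj_onI) auto
    have disj: "Pow ?A \<inter> insert j ` Pow ?A = {}" by auto
    have "(\<Sum>\<omega>\<in>Pow {..<M}. err \<omega> j) = (\<Sum>\<omega>\<in>Pow ?A \<union> insert j ` Pow ?A. err \<omega> j)"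
      by (subst ins, subst Pow_insert) simp
    also have "\<dots> = (\<Sum>\<omega>\<in>Pow ?A. err \<omega> j) + (\<Sum>\<omega>\<in>insert j ` Pow ?A. err \<omega> j)"
      using disj by (intro sum.union_disjoint) auto
    also have "\<dots> = (\<Sum>\<omega>\<in>Pow ?A. err \<omega> j + err (insert j \<omega>) j)"
      using inj by (simp add: sum.reindex sum.distrib)
    also have "\<dots> \<ge> (\<Sum>\<omega>\<in>Pow ?A. t j)"
    proof (rule sum_mono)
      fix \<omega> assume "\<omega> \<in> Pow ?A"
      then have "\<omega> \<subseteq> {..<M}" "j \<notin> \<omega>" by auto
      then show "t j \<le> err \<omega> j + err (insert j \<omega>) j" using t[of \<omega> j] j by (simp add: err_def E_def)
    qed
    finally show "2 ^ (M - 1) * t j \<le> (\<Sum>\<omega>\<in>Pow {..<M}. err \<omega> j)"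
      using j by (simp add: card_Pow)
  qed
  also have "(\<Sum>j<M. 2 ^ (M - 1) * t j) = 2 ^ (M - 1) * (\<Sum>j<M. t j)" by (simp add: sum_distrib_left)
  also have "\<dots> \<ge> 2 ^ (M - 1) * (M / 2)" using tsum by (intro mult_left_mono) auto
  finally have tot: "2 ^ (M - 1) * (M / 2) \<le> (\<Sum>\<omega>\<in>Pow {..<M}. \<Sum>j<M. err \<omega> j)" .
  have "\<exists>\<omega>\<in>Pow {..<M}. M / 4 \<le> (\<Sum>j<M. err \<omega> j)"
  proof (rule ccontr)
    assume "\<not> ?thesis"
    then have "(\<Sum>\<omega>\<in>Pow {..<M}. \<Sum>j<M. err \<omega> j) < (\<Sum>\<omega>\<in>Pow {..<M}. M / 4)"
      by (intro sum_strict_mono) (auto simp: not_le)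
    also have "\<dots> = 2 ^ M * (M / 4)" by (simp add: card_Pow)
    also have "\<dots> = 2 ^ (M - 1) * (M / 2)" using M by (cases M) auto
    finally show False using tot by simp
  qed
  then obtain \<omega> where \<omega>: "\<omega> \<subseteq> {..<M}" and ge: "M / 4 \<le> (\<Sum>j<M. err \<omega> j)" by auto
  interpret prob_space "Q \<omega>" by (rule Q(1)[OF \<omega>])
  have setsQ[measurable_cong]: "sets (Q \<omega>) = sets N" by (rule Q(2)[OF \<omega>])
  have spQ: "space (Q \<omega>) = space N" using setsQ by (rule sets_eq_imp_space_eq)
  define ham where "ham x = card {j. j < M \<and> (x \<in> \<psi> j) \<noteq> (j \<in> \<omega>)}" for x
  define B where "B = {x \<in> space N. M / 8 \<le> real (ham x)}"
  have ham: "real (ham x) = (\<Sum>j<M. indicator (E \<omega> j) x)" if "x \<in> space N" for x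
  proof -
    have "(\<Sum>j<M. indicator (E \<omega> j) x :: real) = (\<Sum>j\<in>{j. j < M \<and> (x \<in> \<psi> j) \<noteq> (j \<in> \<omega>)}. 1)"
      using that by (intro sum.mono_neutral_cong_right) (auto simp: E_def indicator_def)
    then show ?thesis by (simp add: ham_def)
  qed
  have hM: "real (ham x) \<le> M" for x
  proof -
    have "ham x \<le> card {..<M}" unfolding ham_def by (rule card_mono) auto
    then show ?thesis by simp
  qed
  have hmeas: "(\<lambda>x. \<Sum>j<M. indicator (E \<omega> j) x :: real) \<in> borel_measurable N" by measurable
  have Beq: "B = {x \<in> space N. M / 8 \<le> (\<Sum>j<M. indicator (E \<omega> j) x :: real)}"
    using ham by (auto simp: B_def)
  have Bm: "B \<in> sets (Q \<omega>)" unfolding Beq setsQ using hmeas by measurable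
  have Eint: "integrable (Q \<omega>) (indicat_real (E \<omega> j))" if "j < M" for j
    using E[OF that] emeasure_finite by (intro integrable_real_indicator) (auto simp: setsQ less_top[symmetric])
  have "(\<Sum>j<M. err \<omega> j) = (\<integral>x. (\<Sum>j<M. indicator (E \<omega> j) x) \<partial>Q \<omega>)"
    using Eint by (simp add: err_def integral_indicator setsQ E)
  \<comment> \<open>The Hamming loss is at most \<open>M\<close> on \<open>B\<close> and below
    \<open>M / 8\<close> elsewhere, so a mean of \<open>M / 4\<close> forces probability
    1/8.\<close>
  also have "\<dots> \<le> (\<integral>x. real M * indicat_real B x + M / 8 \<partial>Q \<omega>)"
  proof (rule integral_mono)
    show "integrable (Q \<omega>) (\<lambda>x. \<Sum>j<M. indicator (E \<omega> j) x :: real)"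
      using Eint by (intro Bochner_Integration.integrable_sum) simp
    show "integrable (Q \<omega>) (\<lambda>x. real M * indicat_real B x + M / 8)"
      using Bm emeasure_finite
      by (intro Bochner_Integration.integrable_add integrable_mult_right integrable_real_indicator) (auto simp: less_top[symmetric])
    fix x assume "x \<in> space (Q \<omega>)"
    then have x: "x \<in> space N" by (simp add: spQ)
    show "(\<Sum>j<M. indicator (E \<omega> j) x) \<le> real M * indicat_real B x + M / 8"
      using hM[of x] x unfolding ham[OF x, symmetric] by (cases "x \<in> B") (auto simp: B_def)
  qed
  also have "\<dots> = M * measure (Q \<omega>) B + M / 8"
  proof -
    have "integrable (Q \<omega>) (indicat_real B)"
      using Bm emeasure_finite by (intro integrable_real_indicator) (auto simp: less_top[symmetric])
    then show ?thesis
      using Bm by (subst Bochner_Integration.integral_add) (auto simp: prob_space)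
  qed
  finally have "M / 4 \<le> M * measure (Q \<omega>) B + M / 8" using ge by simp
  then have "M * (1 / 8) \<le> M * measure (Q \<omega>) B" by simp
  then have "1 / 8 \<le> measure (Q \<omega>) B" using M by (subst (asm) mult_le_cancel_left_pos) auto
  then show thesis using that[OF \<omega>] by (simp add: B_def ham_def)
qed

section \<open>From the squared loss to coordinate tests\<close>

lemma L2_norm_on_eq: "L2_norm_on I f = sqrt (\<integral>r. indicator I r * (f r)\<^sup>2 \<partial>lborel)"
  by (simp add: L2_norm_on_def set_lebesgue_integral_def)

lemma square_integrable_diff:
  fixes f g :: "real \<Rightarrow> real"
  assumes [measurable]: "f \<in> borel_measurable borel" "g \<in> borel_measurable borel" "C \<in> sets borel"
    and f: "integrable lborel (\<lambda>r. indicator C r * (f r)\<^sup>2)" and g: "integrable lborel (\<lambda>r. indicator C r * (g r)\<^sup>2)"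
  shows "integrable lborel (\<lambda>r. indicator C r * (f r - g r)\<^sup>2)"
proof (rule Bochner_Integration.integrable_bound)
  show "integrable lborel (\<lambda>r. 2 * (indicator C r * (f r)\<^sup>2) + 2 * (indicator C r * (g r)\<^sup>2))"
    using f g by auto
  show "AE r in lborel. norm (indicator C r * (f r - g r)\<^sup>2) \<le> norm (2 * (indicator C r * (f r)\<^sup>2) + 2 * (indicator C r * (g r)\<^sup>2))"
  proof (rule AE_I2)
    fix r
    have "(f r - g r)\<^sup>2 \<le> 2 * (f r)\<^sup>2 + 2 * (g r)\<^sup>2"
      using zero_le_power2[of "f r + g r"] by (simp add: power2_eq_square algebra_simps)
    then show "norm (indicator C r * (f r - g r)\<^sup>2) \<le> norm (2 * (indicator C r * (f r)\<^sup>2) + 2 * (indicator C r * (g r)\<^sup>2))"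
      by (simp add: indicator_def)
  qed
qed simp

lemma square_integrable_subset:
  fixes f :: "real \<Rightarrow> real"
  assumes [measurable]: "f \<in> borel_measurable borel" "C \<in> sets borel" and CI: "C \<subseteq> I"
    and f: "integrable lborel (\<lambda>r. indicator I r * (f r)\<^sup>2)"
  shows "integrable lborel (\<lambda>r. indicator C r * (f r)\<^sup>2)"
proof (rule Bochner_Integration.integrable_bound[OF f])
  show "AE r in lborel. norm (indicator C r * (f r)\<^sup>2) \<le> norm (indicator I r * (f r)\<^sup>2)"
    using CI by (intro AE_I2) (auto simp: indicator_def)
qed simp

text \<open>\<open>P j\<close> decides which of the two candidates on \<open>C j\<close> is closer
  to \<open>T\<close>. The squared distances of \<open>T\<close> to the candidates sum to at least
  \<open>s / 2\<close>, so after a wrong decision the true candidate, being the farther one, is at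
  squared distance at least \<open>s / 4\<close>.\<close>

lemma hypercube_loss:
  fixes I :: "real set" and C :: "nat \<Rightarrow> real set" and f :: "nat set \<Rightarrow> real \<Rightarrow> real" and g :: "nat \<Rightarrow> real \<Rightarrow> real"
  assumes [measurable]: "I \<in> sets borel" and C[measurable]: "\<And>j. j < M \<Longrightarrow> C j \<in> sets borel" and CI: "\<And>j. j < M \<Longrightarrow> C j \<subseteq> I"
    and disj: "disjoint_family_on C {..<M}"
    and bm[measurable]: "base \<in> borel_measurable borel" "\<And>j. j < M \<Longrightarrow> g j \<in> borel_measurable borel" "f \<omega> \<in> borel_measurable borel"
    and sq: "integrable lborel (\<lambda>r. indicator I r * (base r)\<^sup>2)" "\<And>j. j < M \<Longrightarrow> integrable lborel (\<lambda>r. indicator I r * (g j r)\<^sup>2)"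
      "integrable lborel (\<lambda>r. indicator I r * (f \<omega> r)\<^sup>2)"
    and f: "\<And>j x. j < M \<Longrightarrow> x \<in> C j \<Longrightarrow> f \<omega> x = base x + (if j \<in> \<omega> then g j x else 0)"
    and s: "\<And>j. j < M \<Longrightarrow> s \<le> (\<integral>r. indicator (C j) r * (g j r)\<^sup>2 \<partial>lborel)" "0 \<le> s"
    and T[measurable]: "T \<in> borel_measurable borel" and TI: "integrable lborel (\<lambda>r. indicator I r * (T r)\<^sup>2)"
    and P: "\<And>j. j < M \<Longrightarrow> P j \<longleftrightarrow>
      (\<integral>r. indicator (C j) r * (T r - base r - g j r)\<^sup>2 \<partial>lborel) \<le> (\<integral>r. indicator (C j) r * (T r - base r)\<^sup>2 \<partial>lborel)"
  shows "sqrt (s / 4 * card {j. j < M \<and> P j \<noteq> (j \<in> \<omega>)}) \<le> L2_norm_on I (\<lambda>r. T r - f \<omega> r)"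
proof -
  let ?err = "{j. j < M \<and> P j \<noteq> (j \<in> \<omega>)}"
  let ?A = "\<lambda>j. \<integral>r. indicator (C j) r * (T r - f \<omega> r)\<^sup>2 \<partial>lborel"
  have int: "integrable lborel (\<lambda>r. indicator I r * (T r - f \<omega> r)\<^sup>2)"
    by (rule square_integrable_diff) (use TI sq in auto)
  have intC: "integrable lborel (\<lambda>r. indicator (C j) r * (T r - f \<omega> r)\<^sup>2)" if "j < M" for j
    by (rule square_integrable_subset[OF _ _ CI[OF that] int]) (use that in auto)
  have le: "s / 4 \<le> ?A j" if j: "j \<in> ?err" for j
  proof -
    have jM: "j < M" using j by simp
    note [measurable] = C[OF jM] bm(2)[OF jM]
    have iC: "integrable lborel (\<lambda>r. indicator (C j) r * (h r)\<^sup>2)"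
      if "h \<in> borel_measurable borel" "integrable lborel (\<lambda>r. indicator I r * (h r)\<^sup>2)" for h :: "real \<Rightarrow> real"
      by (rule square_integrable_subset[OF that(1) C[OF jM] CI[OF jM] that(2)])
    let ?a = "\<lambda>r. T r - base r"
    have ia: "integrable lborel (\<lambda>r. indicator (C j) r * (?a r)\<^sup>2)"
      by (rule square_integrable_diff) (use iC TI sq in auto)
    have ig: "integrable lborel (\<lambda>r. indicator (C j) r * (g j r)\<^sup>2)"
      by (rule iC) (use sq jM in auto)
    have iag: "integrable lborel (\<lambda>r. indicator (C j) r * (?a r - g j r)\<^sup>2)"
      by (rule square_integrable_diff) (use ia ig in auto)
    let ?x = "\<integral>r. indicator (C j) r * (?a r)\<^sup>2 \<partial>lborel" and ?y = "\<integral>r. indicator (C j) r * (?a r - g j r)\<^sup>2 \<partial>lborel"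
    have "s \<le> (\<integral>r. indicator (C j) r * (g j r)\<^sup>2 \<partial>lborel)" by (rule s(1)[OF jM])
    also have "\<dots> \<le> (\<integral>r. 2 * (indicator (C j) r * (?a r)\<^sup>2) + 2 * (indicator (C j) r * (?a r - g j r)\<^sup>2) \<partial>lborel)"
    proof (rule integral_mono)
      fix r
      have "(g j r)\<^sup>2 \<le> 2 * (?a r)\<^sup>2 + 2 * (?a r - g j r)\<^sup>2"
        using zero_le_power2[of "2 * ?a r - g j r"] by (simp add: power2_eq_square algebra_simps)
      then show "indicator (C j) r * (g j r)\<^sup>2 \<le> 2 * (indicator (C j) r * (?a r)\<^sup>2) + 2 * (indicator (C j) r * (?a r - g j r)\<^sup>2)"
        by (simp add: indicator_def)
    qed (use ig ia iag in auto)
    also have "\<dots> = 2 * ?x + 2 * ?y" using ia iag by simp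
    finally have sxy: "s \<le> 2 * ?x + 2 * ?y" .
    show ?thesis
    proof (cases "j \<in> \<omega>")
      case True
      then have "?A j = ?y" using f[OF jM] by (intro Bochner_Integration.integral_cong) (auto simp: indicator_def algebra_simps)
      moreover have "?x < ?y" using P[OF jM] j True by auto
      ultimately show ?thesis using sxy by simp
    next
      case False
      then have "?A j = ?x" using f[OF jM] by (intro Bochner_Integration.integral_cong) (auto simp: indicator_def)
      moreover have "?y \<le> ?x" using P[OF jM] j False by auto
      ultimately show ?thesis using sxy by simp
    qed
  qed
  have A0: "0 \<le> ?A j" for j by (intro integral_nonneg_AE) auto
  have "s / 4 * card ?err = (\<Sum>j\<in>?err. s / 4)" by simp
  also have "\<dots> \<le> (\<Sum>j\<in>?err. ?A j)" by (rule sum_mono) (rule le)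
  also have "\<dots> \<le> (\<Sum>j<M. ?A j)" using A0 by (intro sum_mono2) auto
  also have "\<dots> = (\<integral>r. (\<Sum>j<M. indicator (C j) r * (T r - f \<omega> r)\<^sup>2) \<partial>lborel)"
    using intC by (subst Bochner_Integration.integral_sum) auto
  also have "\<dots> \<le> (\<integral>r. indicator I r * (T r - f \<omega> r)\<^sup>2 \<partial>lborel)"
  proof (rule integral_mono)
    fix r
    have "(\<Sum>j<M. indicator (C j) r :: real) = indicator (\<Union>j<M. C j) r"
      using disj by (intro indicator_UN_disjoint[symmetric]) auto
    also have "\<dots> \<le> indicator I r" using CI by (auto simp: indicator_def)
    finally show "(\<Sum>j<M. indicator (C j) r * (T r - f \<omega> r)\<^sup>2) \<le> indicator I r * (T r - f \<omega> r)\<^sup>2"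
      unfolding sum_distrib_right[symmetric] by (intro mult_right_mono) auto
    show "integrable lborel (\<lambda>r. \<Sum>j<M. indicator (C j) r * (T r - f \<omega> r)\<^sup>2)"
      using intC by (intro Bochner_Integration.integrable_sum) auto
  qed (rule int)
  finally show ?thesis unfolding L2_norm_on_eq by (rule real_sqrt_le_mono)
qed

text \<open>
  The densities \<open>p \<omega>\<close> may have mass larger than 1, which only increases the error probabilities.
\<close>

lemma hypercube_lower_bound:
  fixes I :: "real set" and C :: "nat \<Rightarrow> real set" and f :: "nat set \<Rightarrow> real \<Rightarrow> real" and g :: "nat \<Rightarrow> real \<Rightarrow> real"
    and p :: "nat set \<Rightarrow> real^'d \<Rightarrow> real" and law :: "nat set \<Rightarrow> (nat \<Rightarrow> real^'d) measure"
  assumes M: "0 < M" and n: "1 \<le> n"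
    and I[measurable]: "I \<in> sets borel" and C[measurable]: "\<And>j. j < M \<Longrightarrow> C j \<in> sets borel" and CI: "\<And>j. j < M \<Longrightarrow> C j \<subseteq> I"
    and disj: "disjoint_family_on C {..<M}"
    and bm: "base \<in> borel_measurable borel" "\<And>j. j < M \<Longrightarrow> g j \<in> borel_measurable borel" "\<And>\<omega>. \<omega> \<subseteq> {..<M} \<Longrightarrow> f \<omega> \<in> borel_measurable borel"
    and sq: "integrable lborel (\<lambda>r. indicator I r * (base r)\<^sup>2)" "\<And>j. j < M \<Longrightarrow> integrable lborel (\<lambda>r. indicator I r * (g j r)\<^sup>2)"
      "\<And>\<omega>. \<omega> \<subseteq> {..<M} \<Longrightarrow> integrable lborel (\<lambda>r. indicator I r * (f \<omega> r)\<^sup>2)"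
    and f: "\<And>\<omega> j x. \<omega> \<subseteq> {..<M} \<Longrightarrow> j < M \<Longrightarrow> x \<in> C j \<Longrightarrow> f \<omega> x = base x + (if j \<in> \<omega> then g j x else 0)"
    and s: "\<And>j. j < M \<Longrightarrow> s \<le> (\<integral>r. indicator (C j) r * (g j r)\<^sup>2 \<partial>lborel)" "0 \<le> s"
    and p: "\<And>\<omega>. \<omega> \<subseteq> {..<M} \<Longrightarrow> integrable lborel (p \<omega>)" "\<And>\<omega> x. \<omega> \<subseteq> {..<M} \<Longrightarrow> 0 < p \<omega> x" "\<And>\<omega>. \<omega> \<subseteq> {..<M} \<Longrightarrow> 1 \<le> (\<integral>x. p \<omega> x \<partial>lborel)"
    and law: "\<And>\<omega>. \<omega> \<subseteq> {..<M} \<Longrightarrow> law \<omega> = PiM {..<n} (\<lambda>_. density lborel (\<lambda>x. ennreal (p \<omega> x)))"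
    and d1: "\<And>\<omega> j x. \<omega> \<subseteq> {..<M} \<Longrightarrow> j < M \<Longrightarrow> j \<notin> \<omega> \<Longrightarrow> \<bar>ln (p \<omega> x) - ln (p (insert j \<omega>) x)\<bar> \<le> 1"
    and d2: "\<And>\<omega> j. \<omega> \<subseteq> {..<M} \<Longrightarrow> j < M \<Longrightarrow> j \<notin> \<omega> \<Longrightarrow>
      (\<integral>\<^sup>+ x. ennreal (p \<omega> x * (ln (p \<omega> x) - ln (p (insert j \<omega>) x))\<^sup>2) \<partial>lborel) \<le> ennreal (e j)"
    and e: "\<And>j. j < M \<Longrightarrow> 0 \<le> e j" "n * (\<Sum>j<M. e j) \<le> M / 4"
    and T: "T \<in> estimators n I"
  shows "\<exists>\<omega>\<subseteq>{..<M}. ennreal (1 / 8) \<le> emeasure (law \<omega>) {x \<in> space (law \<omega>). sqrt (s * M / 32) \<le> L2_norm_on I (\<lambda>r. T x r - f \<omega> r)}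
     \<and> {x \<in> space (law \<omega>). sqrt (s * M / 32) \<le> L2_norm_on I (\<lambda>r. T x r - f \<omega> r)} \<in> sets (law \<omega>)"
proof -
  let ?N = "PiM {..<n} (\<lambda>_. borel) :: (nat \<Rightarrow> real^'d) measure"
  \<comment> \<open>\<open>Q\<close> is the sample law of the normalised densities. It is a
    probability measure below \<open>law\<close>, so lower bounds for \<open>Q\<close> carry
    over.\<close>
  define c where "c \<omega> = (\<integral>x. p \<omega> x \<partial>lborel)" for \<omega>
  define q where "q \<omega> x = p \<omega> x / c \<omega>" for \<omega> x
  define Q where "Q \<omega> = PiM {..<n} (\<lambda>_. density lborel (\<lambda>x. ennreal (q \<omega> x)))" for \<omega>
  have c1: "1 \<le> c \<omega>" if "\<omega> \<subseteq> {..<M}" for \<omega> using p(3)[OF that] by (simp add: c_def)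
  have pm: "p \<omega> \<in> borel_measurable lborel" if "\<omega> \<subseteq> {..<M}" for \<omega> using p(1)[OF that] by auto
  then have qm: "q \<omega> \<in> borel_measurable lborel" if "\<omega> \<subseteq> {..<M}" for \<omega> using that unfolding q_def[abs_def] by simp
  have q0: "0 \<le> q \<omega> x" if "\<omega> \<subseteq> {..<M}" for \<omega> x using p(2)[OF that, of x] c1[OF that] by (simp add: q_def)
  have qp: "q \<omega> x \<le> p \<omega> x" if "\<omega> \<subseteq> {..<M}" for \<omega> x
    using p(2)[OF that, of x] c1[OF that] by (simp add: q_def divide_le_eq mult_le_cancel_left1)
  have q1: "(\<integral>\<^sup>+ x. ennreal (q \<omega> x) \<partial>lborel) = 1" if "\<omega> \<subseteq> {..<M}" for \<omega>
  proof -
    have "(\<integral>\<^sup>+ x. ennreal (q \<omega> x) \<partial>lborel) = ennreal (\<integral>x. q \<omega> x \<partial>lborel)"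
      using p(1)[OF that] q0[OF that] unfolding q_def by (intro nn_integral_eq_integral) auto
    also have "(\<integral>x. q \<omega> x \<partial>lborel) = 1" using c1[OF that] by (simp add: q_def c_def)
    finally show ?thesis by simp
  qed
  have sf: "sigma_finite_measure (lborel :: (real^'d) measure)" by (rule lborel.sigma_finite_measure_axioms)
  have setsN: "sets (PiM {..<n} (\<lambda>_. lborel)) = sets ?N" by (intro sets_PiM_cong) auto
  have spN: "space (PiM {..<n} (\<lambda>_. lborel)) = space ?N" using setsN by (rule sets_eq_imp_space_eq)
  have setsQ: "sets (Q \<omega>) = sets ?N" for \<omega> unfolding Q_def by (intro sets_PiM_cong) auto
  have setsL: "sets (law \<omega>) = sets ?N" if "\<omega> \<subseteq> {..<M}" for \<omega> unfolding law[OF that] by (intro sets_PiM_cong) auto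
  have probQ: "prob_space (Q \<omega>)" if "\<omega> \<subseteq> {..<M}" for \<omega>
  proof -
    have "prob_space (density lborel (\<lambda>x. ennreal (q \<omega> x)))"
      using qm[OF that] q1[OF that] by (intro prob_spaceI) (simp add: emeasure_density)
    then show ?thesis unfolding Q_def by (intro prob_space_PiM)
  qed
  have Qle: "emeasure (Q \<omega>) A \<le> emeasure (law \<omega>) A" if \<omega>: "\<omega> \<subseteq> {..<M}" and A: "A \<in> sets ?N" for \<omega> A
  proof -
    have Q': "Q \<omega> = density (PiM {..<n} (\<lambda>_. lborel)) (\<lambda>x. ennreal (\<Prod>i<n. q \<omega> (x i)))"
      unfolding Q_def by (rule PiM_density) (use qm[OF \<omega>] q0[OF \<omega>] sf in auto)
    have L': "law \<omega> = density (PiM {..<n} (\<lambda>_. lborel)) (\<lambda>x. ennreal (\<Prod>i<n. p \<omega> (x i)))"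
      unfolding law[OF \<omega>] by (rule PiM_density) (use pm[OF \<omega>] p(2)[OF \<omega>] sf in \<open>auto simp: less_imp_le\<close>)
    have [measurable]: "A \<in> sets (PiM {..<n} (\<lambda>_. lborel))" using A setsN by simp
    have [measurable]: "p \<omega> \<in> borel_measurable lborel" "q \<omega> \<in> borel_measurable lborel" using pm qm \<omega> by auto
    have "emeasure (Q \<omega>) A = (\<integral>\<^sup>+ x. ennreal (\<Prod>i<n. q \<omega> (x i)) * indicator A x \<partial>PiM {..<n} (\<lambda>_. lborel))"
      unfolding Q' by (rule emeasure_density) measurable
    also have "\<dots> \<le> (\<integral>\<^sup>+ x. ennreal (\<Prod>i<n. p \<omega> (x i)) * indicator A x \<partial>PiM {..<n} (\<lambda>_. lborel))"
      using q0[OF \<omega>] qp[OF \<omega>] by (intro nn_integral_mono mult_right_mono ennreal_leI prod_mono) auto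
    also have "\<dots> = emeasure (law \<omega>) A" unfolding L' by (rule emeasure_density[symmetric]) measurable
    finally show ?thesis .
  qed
  have Tm[measurable]: "(\<lambda>(x, r). T x r) \<in> borel_measurable (?N \<Otimes>\<^sub>M borel)"
    and TI: "\<And>x. x \<in> space ?N \<Longrightarrow> integrable lborel (\<lambda>r. indicator I r * (T x r)\<^sup>2)"
    using T by (auto simp: estimators_def set_integrable_def)
  have Tm'[measurable]: "(\<lambda>z. T (fst z) (snd z)) \<in> borel_measurable (?N \<Otimes>\<^sub>M lborel)"
  proof -
    have "sets (?N \<Otimes>\<^sub>M lborel) = sets (?N \<Otimes>\<^sub>M borel)" by (intro sets_pair_measure_cong) auto
    then show ?thesis using Tm by (simp add: case_prod_beta' cong: measurable_cong_sets)
  qed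
  have Tx: "T x \<in> borel_measurable borel" if "x \<in> space ?N" for x
    using measurable_Pair2[OF Tm that] by simp
  have meas: "(\<lambda>x. \<integral>r. indicator D r * (T x r - h r)\<^sup>2 \<partial>lborel) \<in> borel_measurable ?N"
    if [measurable]: "D \<in> sets borel" "h \<in> borel_measurable borel" for D :: "real set" and h
  proof -
    have "(\<lambda>z. indicator D (snd z) * (T (fst z) (snd z) - h (snd z))\<^sup>2) \<in> borel_measurable (?N \<Otimes>\<^sub>M lborel)"
      by measurable
    then have "(\<lambda>(x, r). indicator D r * (T x r - h r)\<^sup>2) \<in> borel_measurable (?N \<Otimes>\<^sub>M lborel)"
      by (simp add: case_prod_beta')
    then show ?thesis by (rule lborel.borel_measurable_lebesgue_integral)
  qed
  define \<psi> where "\<psi> j = {x \<in> space ?N. (\<integral>r. indicator (C j) r * (T x r - (base r + g j r))\<^sup>2 \<partial>lborel)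
      \<le> (\<integral>r. indicator (C j) r * (T x r - base r)\<^sup>2 \<partial>lborel)}" for j
  have \<psi>[measurable]: "\<psi> j \<in> sets ?N" if "j < M" for j
  proof -
    note [measurable] = bm(1) bm(2)[OF that] meas[OF C[OF that], of "\<lambda>r. base r + g j r"] meas[OF C[OF that], of base]
    show ?thesis unfolding \<psi>_def by measurable
  qed
  define t where "t j = 2/3 * (1 - n * e j)" for j
  have test: "t j \<le> measure (Q \<omega>) (\<psi> j) + measure (Q (insert j \<omega>)) (space ?N - \<psi> j)"
    if \<omega>: "\<omega> \<subseteq> {..<M}" and j: "j < M" "j \<notin> \<omega>" for \<omega> j
  proof (cases "e j \<le> 2")
    case True
    have \<omega>': "insert j \<omega> \<subseteq> {..<M}" using \<omega> j by simp
    interpret Q: prob_space "Q \<omega>" by (rule probQ[OF \<omega>])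
    interpret Q': prob_space "Q (insert j \<omega>)" by (rule probQ[OF \<omega>'])
    have "ennreal (t j) \<le> emeasure (Q \<omega>) (\<psi> j) + emeasure (Q (insert j \<omega>)) (space (PiM {..<n} (\<lambda>_. lborel)) - \<psi> j)"
      unfolding Q_def t_def
    proof (rule testing_affinity[OF sf qm[OF \<omega>] qm[OF \<omega>'] q0[OF \<omega>] q0[OF \<omega>'] q1[OF \<omega>] q1[OF \<omega>'] _ True])
      show "ennreal (1 - e j / 2) \<le> (\<integral>\<^sup>+ x. ennreal (sqrt (q \<omega> x * q (insert j \<omega>) x)) \<partial>lborel)"
        unfolding q_def c_def
        by (rule normalized_affinity) (use p \<omega> \<omega>' d1 d2 e j in auto)
      show "\<psi> j \<in> sets (PiM {..<n} (\<lambda>_. lborel))" using \<psi>[OF j(1)] setsN by simp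
    qed
    also have "\<dots> = ennreal (measure (Q \<omega>) (\<psi> j) + measure (Q (insert j \<omega>)) (space ?N - \<psi> j))"
      unfolding spN Q.emeasure_eq_measure Q'.emeasure_eq_measure by simp
    finally show ?thesis by (subst (asm) ennreal_le_iff) auto
  next
    case False
    \<comment> \<open>\<open>testing_affinity\<close> does not cover a budget above 2, but then
      \<open>t j\<close> is not positive because of \<open>1 \<le> n\<close>.\<close>
    have "1 * 2 \<le> real n * e j" using n False by (intro mult_mono) auto
    then have "t j \<le> 0" by (simp add: t_def)
    then show ?thesis by (meson add_nonneg_nonneg measure_nonneg order_trans)
  qed
  have "(\<Sum>j<M. t j) = 2/3 * (M - n * (\<Sum>j<M. e j))"
    unfolding t_def sum_distrib_left[symmetric] sum_subtractf by simp
  \<comment> \<open>The constants fit: 2/3 of \<open>M - M / 4\<close> is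
    \<open>M / 2\<close>.\<close>
  then have tsum: "M / 2 \<le> (\<Sum>j<M. t j)" using e(2) by simp
  obtain \<omega> where \<omega>: "\<omega> \<subseteq> {..<M}" and prob: "1 / 8 \<le> measure (Q \<omega>) {x \<in> space ?N. M / 8 \<le> card {j. j < M \<and> (x \<in> \<psi> j) \<noteq> (j \<in> \<omega>)}}"
    by (rule assouad[OF M probQ setsQ \<psi> test tsum])
  interpret Q: prob_space "Q \<omega>" by (rule probQ[OF \<omega>])
  let ?L = "{x \<in> space ?N. sqrt (s * M / 32) \<le> L2_norm_on I (\<lambda>r. T x r - f \<omega> r)}"
  have Lm: "?L \<in> sets ?N"
  proof -
    note [measurable] = meas[OF I bm(3)[OF \<omega>]]
    show ?thesis unfolding L2_norm_on_eq by measurable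
  qed
  have sub: "{x \<in> space ?N. M / 8 \<le> card {j. j < M \<and> (x \<in> \<psi> j) \<noteq> (j \<in> \<omega>)}} \<subseteq> ?L"
  proof
    fix x assume "x \<in> {x \<in> space ?N. M / 8 \<le> card {j. j < M \<and> (x \<in> \<psi> j) \<noteq> (j \<in> \<omega>)}}"
    then have x: "x \<in> space ?N" and card: "M / 8 \<le> card {j. j < M \<and> (x \<in> \<psi> j) \<noteq> (j \<in> \<omega>)}" by auto
    have "s * M / 32 = s / 4 * (M / 8)" by simp
    also have "\<dots> \<le> s / 4 * card {j. j < M \<and> (x \<in> \<psi> j) \<noteq> (j \<in> \<omega>)}"
      using s(2) card by (intro mult_left_mono) auto
    finally have "sqrt (s * M / 32) \<le> sqrt (s / 4 * card {j. j < M \<and> (x \<in> \<psi> j) \<noteq> (j \<in> \<omega>)})"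
      by (rule real_sqrt_le_mono)
    also have "\<dots> \<le> L2_norm_on I (\<lambda>r. T x r - f \<omega> r)"
    proof (rule hypercube_loss[where C = C and base = base and g = g])
      show "(x \<in> \<psi> j) \<longleftrightarrow> (\<integral>r. indicator (C j) r * (T x r - base r - g j r)\<^sup>2 \<partial>lborel)
          \<le> (\<integral>r. indicator (C j) r * (T x r - base r)\<^sup>2 \<partial>lborel)" if "j < M" for j
        using x by (simp add: \<psi>_def diff_diff_eq)
    qed (use I C CI disj bm sq f s Tx TI x \<omega> in auto)
    finally show "x \<in> ?L" using x by simp
  qed
  have "1 / 8 \<le> measure (Q \<omega>) ?L"
  proof (rule order_trans[OF prob Q.finite_measure_mono[OF sub]])
    show "?L \<in> Q.events" unfolding setsQ by (rule Lm)
  qed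
  then have "ennreal (1 / 8) \<le> emeasure (Q \<omega>) ?L" unfolding Q.emeasure_eq_measure by (rule ennreal_leI)
  also have "\<dots> \<le> emeasure (law \<omega>) ?L" by (rule Qle[OF \<omega> Lm])
  finally have ge: "ennreal (1 / 8) \<le> emeasure (law \<omega>) ?L" .
  show ?thesis
  proof (intro exI[of _ \<omega>] conjI \<omega>)
    have sp: "space (law \<omega>) = space ?N" using setsL[OF \<omega>] by (rule sets_eq_imp_space_eq)
    show "ennreal (1 / 8) \<le> emeasure (law \<omega>) {x \<in> space (law \<omega>). sqrt (s * M / 32) \<le> L2_norm_on I (\<lambda>r. T x r - f \<omega> r)}"
      unfolding sp by (rule ge)
    show "{x \<in> space (law \<omega>). sqrt (s * M / 32) \<le> L2_norm_on I (\<lambda>r. T x r - f \<omega> r)} \<in> sets (law \<omega>)"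
      unfolding sp setsL[OF \<omega>] by (rule Lm)
  qed
qed

section \<open>The perturbed coefficients\<close>

lemma inverse_diff:
  fixes x a b :: real
  assumes "0 < x" "0 < a" "0 < b"
  shows "1 / (x * b) - 1 / (x * a) = (a - b) / (x * a * b)"
  using assms by (simp add: field_simps)

text \<open>The last condition bounds a bump whose negative half has the extreme scale
  \<open>\<Lambda>\<close> by the margin \<open>\<epsilon>\<close>, so that perturbed coefficients
  stay between \<open>\<kappa>\<close> and \<open>K\<close>.\<close>

locale cube = bumps m \<Phi> c d + base: stationary \<kappa> K \<xi> V
  for m \<Phi> c d \<kappa> K \<xi> and V :: "real^'d \<Rightarrow> real" +
  fixes \<epsilon> r1 r2 A :: real and M :: nat
  assumes margin: "\<And>r. 0 < r \<Longrightarrow> \<kappa> + \<epsilon> \<le> \<xi> r" "\<And>r. 0 < r \<Longrightarrow> \<xi> r \<le> K - \<epsilon>"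
    and r12: "0 < r1" "r1 < r2" "1 \<notin> {r1<..<r2}" and M: "0 < M"
    and A: "0 \<le> A" "A * c * (1 + r2 * K\<^sup>2 / (r1 * \<kappa>\<^sup>2)) \<le> \<epsilon>"
begin

text \<open>The ratio of the extreme values \<open>r2 * K\<^sup>2\<close> and
  \<open>r1 * \<kappa>\<^sup>2\<close> of the denominators in a difference of
  \<open>1 / (x * \<xi> x)\<close>. With this scale the negative half of a bump certainly outweighs
  the positive one.\<close>

definition \<Lambda> :: real where "\<Lambda> = r2 * K\<^sup>2 / (r1 * \<kappa>\<^sup>2)"
text \<open>Each of the \<open>M\<close> cells is cut into four quarters of width \<open>w\<close>.
  A bump is positive on the second and negative on the third quarter, so \<open>left\<close> and
  \<open>right\<close> delimit its support; the outer quarters stay empty as a safety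
  distance.\<close>

definition w :: real where "w = (r2 - r1) / (4 * M)"
definition left :: "nat \<Rightarrow> real" where "left j = r1 + (4 * j + 1) * w"
definition right :: "nat \<Rightarrow> real" where "right j = r1 + (4 * j + 3) * w"
definition up :: "nat \<Rightarrow> real \<Rightarrow> real" where "up j x = \<Phi> 0 ((x - r1) / w - real (4 * j + 1))"
definition down :: "nat \<Rightarrow> real \<Rightarrow> real" where "down j x = \<Phi> 0 ((x - r1) / w - real (4 * j + 2))"
definition bump :: "real \<Rightarrow> nat \<Rightarrow> real \<Rightarrow> real" where "bump l j x = A * up j x - l * A * down j x"

lemma \<Lambda>: "0 < \<Lambda>" using r12 base.K base.\<kappa> by (simp add: \<Lambda>_def)

lemma w: "0 < w" using r12 M by (simp add: w_def)

lemma Mw: "4 * M * w = r2 - r1" using M by (simp add: w_def)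

lemma cell_bounds:
  assumes "j < M"
  shows "r1 + w \<le> left j" "right j = left j + 2 * w" "right j + w \<le> r2"
proof -
  show "r1 + w \<le> left j" using w by (simp add: left_def algebra_simps)
  show "right j = left j + 2 * w" by (simp add: left_def right_def algebra_simps)
  have "real j + 1 \<le> M" using assms by simp
  then have "4 * (real j + 1) * w \<le> 4 * M * w" using w by (intro mult_right_mono mult_left_mono) auto
  then show "right j + w \<le> r2" using Mw by (simp add: right_def algebra_simps)
qed

lemma left_pos: "j < M \<Longrightarrow> 0 < left j" using cell_bounds(1)[of j] w r12 by linarith

lemma cells_separated: "i < j \<Longrightarrow> right i + 2 * w \<le> left j"
proof -
  assume "i < j"
  then have "4 * (real i + 1) * w \<le> 4 * real j * w" using w by (intro mult_right_mono mult_left_mono) auto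
  then show ?thesis by (simp add: left_def right_def algebra_simps)
qed

lemma cells_disjoint:
  assumes "i \<noteq> j" "x \<in> {left i<..<right i}"
  shows "x \<notin> {left j<..<right j}"
proof (cases "i < j")
  case True
  then show ?thesis using cells_separated[OF True] w assms(2) by auto
next
  case False
  then have "j < i" using assms(1) by simp
  then show ?thesis using cells_separated[OF \<open>j < i\<close>] w assms(2) by auto
qed

lemma up_support: "up j x \<noteq> 0 \<Longrightarrow> left j < x \<and> x < left j + w"
proof -
  assume "up j x \<noteq> 0"
  then have "(x - r1) / w - real (4 * j + 1) \<in> {0<..<1}" using support[of 0] unfolding up_def by blast
  then show ?thesis using w by (simp add: left_def field_simps)
qed

lemma down_support: "down j x \<noteq> 0 \<Longrightarrow> left j + w < x \<and> x < right j"
proof -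
  assume "down j x \<noteq> 0"
  then have "(x - r1) / w - real (4 * j + 2) \<in> {0<..<1}" using support[of 0] unfolding down_def by blast
  then show ?thesis using w by (simp add: left_def right_def field_simps)
qed

lemma bump_support: "x \<notin> {left j<..<right j} \<Longrightarrow> bump l j x = 0"
proof -
  assume x: "x \<notin> {left j<..<right j}"
  have r: "right j = left j + 2 * w" by (simp add: left_def right_def algebra_simps)
  have "up j x = 0" using up_support[of j x] x r w by fastforce
  moreover have "down j x = 0" using down_support[of j x] x r w by fastforce
  ultimately show ?thesis by (simp add: bump_def)
qed

lemma up_down_zero: "up j x = 0 \<or> down j x = 0"
  using up_support[of j x] down_support[of j x] by fastforce

lemma up_down_bounds: "0 \<le> up j x" "0 \<le> down j x" "up j x \<le> c" "down j x \<le> c"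
  using nonneg bound[of 0] unfolding up_def down_def by (auto simp: abs_le_iff)

lemma bump_bound: "0 \<le> l \<Longrightarrow> l \<le> \<Lambda> \<Longrightarrow> \<bar>bump l j x\<bar> \<le> A * c * (1 + \<Lambda>)"
proof -
  assume l: "0 \<le> l" "l \<le> \<Lambda>"
  have 1: "A * up j x \<le> A * c" "0 \<le> A * up j x" using A up_down_bounds[of j x] by (auto intro: mult_left_mono)
  have "l * (A * down j x) \<le> \<Lambda> * (A * c)"
    using A up_down_bounds[of j x] l \<Lambda> by (intro mult_mono) (auto intro: mult_left_mono)
  moreover have "0 \<le> l * (A * down j x)" using A up_down_bounds[of j x] l by simp
  ultimately show ?thesis using 1 by (simp add: bump_def algebra_simps)
qed

lemma bump_bound_\<epsilon>: "0 \<le> l \<Longrightarrow> l \<le> \<Lambda> \<Longrightarrow> \<bar>bump l j x\<bar> \<le> \<epsilon>"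
  using bump_bound[of l j x] A(2) unfolding \<Lambda>_def by linarith

lemma \<Phi>0_cont: "continuous_on S (\<Phi> 0)"
  using deriv[of 0] by (intro continuous_at_imp_continuous_on ballI DERIV_isCont) auto

lemma up_cont: "continuous_on S (up j)" and down_cont: "continuous_on S (down j)"
  unfolding up_def[abs_def] down_def[abs_def] using w
  by (auto intro!: continuous_intros continuous_on_compose2[OF \<Phi>0_cont[of UNIV]])

lemma bump_cont: "continuous_on S (bump l j)"
  unfolding bump_def[abs_def] by (intro continuous_intros up_cont down_cont)

lemma integral_up_down:
  assumes "j < M"
  shows "integral {left j..right j} (up j) = integral {left j..right j} (down j)"
proof -
  note r = cell_bounds(2)[OF assms]
  have int: "f integrable_on {p..q}" if "continuous_on {p..q} f" for f :: "real \<Rightarrow> real" and p q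
    using that by (rule integrable_continuous_real)
  have "integral {left j..right j} (up j) = integral {left j..left j + w} (up j) + integral {left j + w..right j} (up j)"
    using w r by (intro Henstock_Kurzweil_Integration.integral_combine[symmetric] int up_cont) auto
  also have "integral {left j + w..right j} (up j) = integral {left j + w..right j} (\<lambda>_. 0)"
    using up_support by (intro Henstock_Kurzweil_Integration.integral_cong) fastforce
  finally have u: "integral {left j..right j} (up j) = integral {left j..left j + w} (up j)" by simp
  have "integral {left j..right j} (down j) = integral {left j..left j + w} (down j) + integral {left j + w..right j} (down j)"
    using w r by (intro Henstock_Kurzweil_Integration.integral_combine[symmetric] int down_cont) auto
  also have "integral {left j..left j + w} (down j) = integral {left j..left j + w} (\<lambda>_. 0)"
    using down_support by (intro Henstock_Kurzweil_Integration.integral_cong) fastforce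
  also have "integral {left j + w..right j} (down j) = integral {left j..left j + w} (down j \<circ> (\<lambda>x. x + w))"
    using integral_shift[of "left j" w "left j + w" "down j"] down_cont r by (simp add: algebra_simps)
  also have "down j \<circ> (\<lambda>x. x + w) = up j"
    using w by (auto simp: fun_eq_iff up_def down_def add_divide_distrib diff_divide_distrib algebra_simps)
  finally show ?thesis using u by simp
qed

text \<open>
  The negative half of a bump is scaled so that \<open>g\<close> does not change off the cell; the intermediate
  value theorem provides the scale.
\<close>

lemma balance:
  assumes j: "j < M"
  shows "\<exists>l. 0 \<le> l \<and> l \<le> \<Lambda> \<and> integral {left j..right j} (\<lambda>x. 1 / (x * (\<xi> x + bump l j x))) = integral {left j..right j} (\<lambda>x. 1 / (x * \<xi> x))"
proof -
  let ?S = "{left j..right j}"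
  let ?T = "\<lambda>l. integral ?S (\<lambda>x. 1 / (x * (\<xi> x + bump l j x)))"
  have S: "r1 \<le> x" "x \<le> r2" "0 < x" if "x \<in> ?S" for x
    using that cell_bounds[OF j] w r12 by auto
  have \<xi>c: "continuous_on ?S \<xi>" using S by (intro continuous_on_subset[OF base.cont]) auto
  have pos: "\<kappa> \<le> \<xi> x + bump l j x" "\<xi> x + bump l j x \<le> K" if "x \<in> ?S" "0 \<le> l" "l \<le> \<Lambda>" for x l
    using bump_bound_\<epsilon>[OF that(2,3), of j x] margin[OF S(3)[OF that(1)]] by (auto simp: abs_le_iff)
  have cont: "continuous_on {0..\<Lambda>} ?T"
  proof -
    have "continuous_on ({0..\<Lambda>} \<times> cbox (left j) (right j)) (\<lambda>(l, x). 1 / (x * (\<xi> x + bump l j x)))"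
      unfolding case_prod_beta' bump_def
    proof (intro continuous_intros ballI)
      show "continuous_on ({0..\<Lambda>} \<times> cbox (left j) (right j)) (\<lambda>z. \<xi> (snd z))"
        by (rule continuous_on_compose2[OF \<xi>c]) (auto intro!: continuous_intros)
      show "continuous_on ({0..\<Lambda>} \<times> cbox (left j) (right j)) (\<lambda>z. up j (snd z))"
        by (rule continuous_on_compose2[OF up_cont[of UNIV]]) (auto intro!: continuous_intros)
      show "continuous_on ({0..\<Lambda>} \<times> cbox (left j) (right j)) (\<lambda>z. down j (snd z))"
        by (rule continuous_on_compose2[OF down_cont[of UNIV]]) (auto intro!: continuous_intros)
      fix z assume "z \<in> {0..\<Lambda>} \<times> cbox (left j) (right j)"
      then have z: "snd z \<in> ?S" "0 \<le> fst z" "fst z \<le> \<Lambda>" by auto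
      then show "snd z * (\<xi> (snd z) + (A * up j (snd z) - fst z * A * down j (snd z))) \<noteq> 0"
        using pos(1)[OF z] S(3)[OF z(1)] base.\<kappa> by (simp add: bump_def)
    qed
    then have "continuous_on {0..\<Lambda>} (\<lambda>l. integral (cbox (left j) (right j)) (\<lambda>x. 1 / (x * (\<xi> x + bump l j x))))"
      by (rule integral_continuous_on_param)
    then show ?thesis by simp
  qed
  have int: "(\<lambda>x. 1 / (x * (\<xi> x + bump l j x))) integrable_on ?S" if "0 \<le> l" "l \<le> \<Lambda>" for l
  proof (intro integrable_continuous_real continuous_intros \<xi>c bump_cont ballI)
    fix x assume x: "x \<in> ?S"
    show "x * (\<xi> x + bump l j x) \<noteq> 0" using pos(1)[OF x that] S(3)[OF x] base.\<kappa> by simp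
  qed
  have intX: "(\<lambda>x. 1 / (x * \<xi> x)) integrable_on ?S"
    by (intro integrable_continuous_real base.cont_integrand left_pos j)
  \<comment> \<open>At scale 0 only the positive half is left, which lowers the integral; at scale
    \<open>\<Lambda>\<close> the integral is not lowered.\<close>
  have lo: "?T 0 \<le> integral ?S (\<lambda>x. 1 / (x * \<xi> x))"
  proof (rule Henstock_Kurzweil_Integration.integral_le[OF int intX])
    fix x assume x: "x \<in> ?S"
    have "0 \<le> bump 0 j x" using A up_down_bounds[of j x] by (simp add: bump_def)
    then show "1 / (x * (\<xi> x + bump 0 j x)) \<le> 1 / (x * \<xi> x)"
      using S(3)[OF x] base.bounds(1)[OF S(3)[OF x]] base.\<kappa> by (intro divide_left_mono mult_left_mono mult_pos_pos) auto
  qed (use \<Lambda> in auto)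
  have hi: "integral ?S (\<lambda>x. 1 / (x * \<xi> x)) \<le> ?T \<Lambda>"
  proof -
    let ?q = "A / (r1 * \<kappa>\<^sup>2)"
    have q0: "0 \<le> ?q" using A r12 by simp
    \<comment> \<open>The denominator is replaced by its lower bound on the positive half and by its
      upper bound on the negative half. The value of \<open>\<Lambda>\<close> makes both
      coefficients equal to \<open>?q\<close>, and the integrals of \<open>up j\<close> and
      \<open>down j\<close> then cancel.\<close>
    have pt: "1 / (x * \<xi> x) + ?q * (down j x - up j x) \<le> 1 / (x * (\<xi> x + bump \<Lambda> j x))" if x: "x \<in> ?S" for x
    proof -
      let ?X = "\<xi> x" and ?Y = "\<xi> x + bump \<Lambda> j x"
      have X: "\<kappa> \<le> ?X" "?X \<le> K" using base.bounds S(3)[OF x] by auto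
      have Y: "\<kappa> \<le> ?Y" "?Y \<le> K" using pos[OF x] \<Lambda> by auto
      note x' = S[OF x]
      have diff: "1 / (x * ?Y) - 1 / (x * ?X) = - bump \<Lambda> j x / (x * ?X * ?Y)"
        using inverse_diff[of x ?X ?Y] X Y x' base.\<kappa> by simp
      have den: "r1 * \<kappa>\<^sup>2 \<le> x * ?X * ?Y" "x * ?X * ?Y \<le> r2 * K\<^sup>2"
      proof -
        have "r1 * \<kappa> * \<kappa> \<le> x * ?X * ?Y" using X Y x' base.\<kappa> r12 by (intro mult_mono) auto
        then show "r1 * \<kappa>\<^sup>2 \<le> x * ?X * ?Y" by (simp add: power2_eq_square)
        have "x * ?X * ?Y \<le> r2 * K * K" using X Y x' base.\<kappa> r12 by (intro mult_mono) auto
        then show "x * ?X * ?Y \<le> r2 * K\<^sup>2" by (simp add: power2_eq_square)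
      qed
      have den0: "0 < r1 * \<kappa>\<^sup>2" using r12 base.\<kappa> by simp
      have p0: "0 < x * ?X * ?Y" using den den0 by linarith
      have K0: "0 < r2 * K\<^sup>2" using r12 base.K by simp
      have "?q * (down j x - up j x) \<le> - bump \<Lambda> j x / (x * ?X * ?Y)"
      proof (cases "down j x = 0")
        case True
        have "A * up j x / (x * ?X * ?Y) \<le> A * up j x / (r1 * \<kappa>\<^sup>2)"
          by (rule divide_left_mono[OF den(1) _ mult_pos_pos[OF p0 den0]]) (use A up_down_bounds[of j x] in simp)
        then show ?thesis using True by (simp add: bump_def)
      next
        case False
        then have up0: "up j x = 0" using up_down_zero[of j x] by blast
        have "\<Lambda> * (A * down j x) / (r2 * K\<^sup>2) \<le> \<Lambda> * (A * down j x) / (x * ?X * ?Y)"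
          by (rule divide_left_mono[OF den(2) _ mult_pos_pos[OF K0 p0]]) (use A up_down_bounds[of j x] \<Lambda> in simp)
        moreover have "\<Lambda> * (A * down j x) / (r2 * K\<^sup>2) = ?q * down j x"
          using r12 base.K by (simp add: \<Lambda>_def)
        ultimately show ?thesis using up0 by (simp add: bump_def mult_ac)
      qed
      then show ?thesis using diff by linarith
    qed
    have "integral ?S (\<lambda>x. 1 / (x * \<xi> x) + ?q * (down j x - up j x)) \<le> ?T \<Lambda>"
      using \<Lambda> by (intro Henstock_Kurzweil_Integration.integral_le int pt integrable_add intX integrable_on_mult_right integrable_diff integrable_continuous_real up_cont down_cont) auto
    moreover have "integral ?S (\<lambda>x. 1 / (x * \<xi> x) + ?q * (down j x - up j x)) = integral ?S (\<lambda>x. 1 / (x * \<xi> x)) + ?q * (integral ?S (down j) - integral ?S (up j))"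
    proof -
      have iu: "up j integrable_on ?S" and id: "down j integrable_on ?S"
        by (intro integrable_continuous_real up_cont down_cont)+
      have "integral ?S (\<lambda>x. 1 / (x * \<xi> x) + ?q * (down j x - up j x)) = integral ?S (\<lambda>x. 1 / (x * \<xi> x)) + integral ?S (\<lambda>x. ?q * (down j x - up j x))"
        by (intro Henstock_Kurzweil_Integration.integral_add intX integrable_on_mult_right integrable_diff iu id)
      also have "integral ?S (\<lambda>x. ?q * (down j x - up j x)) = ?q * integral ?S (\<lambda>x. down j x - up j x)"
        by (rule integral_mult_right)
      also have "integral ?S (\<lambda>x. down j x - up j x) = integral ?S (down j) - integral ?S (up j)"
        by (rule Henstock_Kurzweil_Integration.integral_diff[OF id iu])
      finally show ?thesis .
    qed
    ultimately show ?thesis using integral_up_down[OF j] by simp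
  qed
  show ?thesis
    using IVT'[of ?T 0 _ \<Lambda>, OF lo hi _ cont] \<Lambda> by auto
qed

definition scale :: "nat \<Rightarrow> real" where
  "scale j = (SOME l. 0 \<le> l \<and> l \<le> \<Lambda> \<and> integral {left j..right j} (\<lambda>x. 1 / (x * (\<xi> x + bump l j x))) = integral {left j..right j} (\<lambda>x. 1 / (x * \<xi> x)))"

lemma scale:
  assumes "j < M"
  shows "0 \<le> scale j" "scale j \<le> \<Lambda>"
    "integral {left j..right j} (\<lambda>x. 1 / (x * (\<xi> x + bump (scale j) j x))) = integral {left j..right j} (\<lambda>x. 1 / (x * \<xi> x))"
  using someI_ex[OF balance[OF assms]] unfolding scale_def by auto

definition B :: "nat \<Rightarrow> real \<Rightarrow> real" where "B j = bump (scale j) j"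

definition \<eta> :: "nat set \<Rightarrow> real \<Rightarrow> real" where "\<eta> \<omega> x = \<xi> x + (\<Sum>j\<in>\<omega>. B j x)"

lemma B_support: "x \<notin> {left j<..<right j} \<Longrightarrow> B j x = 0"
  unfolding B_def by (rule bump_support)

lemma B_bound: "j < M \<Longrightarrow> \<bar>B j x\<bar> \<le> A * c * (1 + \<Lambda>)"
  unfolding B_def using scale by (intro bump_bound)

lemma sum_B_active:
  assumes "finite \<omega>" "x \<in> {left j<..<right j}"
  shows "(\<Sum>i\<in>\<omega>. B i x) = (if j \<in> \<omega> then B j x else 0)"
proof -
  have "(\<Sum>i\<in>\<omega>. B i x) = (\<Sum>i\<in>\<omega>. if i = j then B j x else 0)"
  proof (intro sum.cong refl)
    fix i
    show "B i x = (if i = j then B j x else 0)"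
      using cells_disjoint[OF _ assms(2), of i] by (cases "i = j") (auto intro: B_support)
  qed
  then show ?thesis using assms(1) by (simp add: sum.delta')
qed

lemma sum_B_inactive: "(\<And>j. j \<in> \<omega> \<Longrightarrow> x \<notin> {left j<..<right j}) \<Longrightarrow> (\<Sum>i\<in>\<omega>. B i x) = 0"
  by (intro sum.neutral ballI B_support)

lemma sum_B_bound:
  assumes "\<omega> \<subseteq> {..<M}"
  shows "\<bar>\<Sum>i\<in>\<omega>. B i x\<bar> \<le> \<epsilon>"
proof -
  have fin: "finite \<omega>" using assms finite_subset by blast
  have \<epsilon>: "0 \<le> \<epsilon>" using bump_bound_\<epsilon>[of 0 0 0] \<Lambda> by simp
  show ?thesis
  proof (cases "\<exists>j\<in>\<omega>. x \<in> {left j<..<right j}")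
    case True
    then obtain j where j: "j \<in> \<omega>" "x \<in> {left j<..<right j}" by blast
    then have "j < M" using assms by auto
    have "(\<Sum>i\<in>\<omega>. B i x) = B j x" using sum_B_active[OF fin j(2)] j(1) by simp
    then show ?thesis using bump_bound_\<epsilon>[of "scale j" j x] scale[OF \<open>j < M\<close>] by (simp add: B_def)
  next
    case False
    then have "(\<Sum>i\<in>\<omega>. B i x) = 0" by (intro sum_B_inactive) auto
    then show ?thesis using \<epsilon> by simp
  qed
qed

lemma \<eta>_stationary:
  assumes "\<omega> \<subseteq> {..<M}"
  shows "stationary \<kappa> K (\<eta> \<omega>) V"
proof -
  have "coefficient \<kappa> K (\<eta> \<omega>)"
  proof
    show "continuous_on {0<..} (\<eta> \<omega>)"
      unfolding \<eta>_def[abs_def] B_def by (intro continuous_intros base.cont bump_cont)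
    fix r :: real assume "0 < r"
    then show "\<kappa> \<le> \<eta> \<omega> r" "\<eta> \<omega> r \<le> K"
      using margin[of r] sum_B_bound[OF assms, of r] by (auto simp: \<eta>_def abs_le_iff)
  qed (rule base.\<kappa>)
  then show ?thesis using base.V base.level_pos by (simp add: stationary_def stationary_axioms_def)
qed

lemma \<eta>_empty [simp]: "\<eta> {} = \<xi>" by (simp add: \<eta>_def fun_eq_iff)

lemma g_fun_1: "g_fun \<zeta> 1 = 0" by (simp add: g_fun_def one_ereal_def[symmetric])

text \<open>The length \<open>2 * w\<close> of the support times the largest change of the integrand
  of \<open>g\<close>. It is of order \<open>A * w\<close>.\<close>

definition D :: real where "D = 2 * w * (A * c * (1 + \<Lambda>)) / (r1 * \<kappa>\<^sup>2)"

text \<open>The difference \<open>h\<close> of the two functions is constant on each side of the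
  support. By the balance the two constants agree, and \<open>h 1 = 0\<close> with 1 outside the
  support makes both vanish. The balance was arranged for \<open>\<xi>\<close> alone, but no other
  bump is active on this cell.\<close>

lemma g_fun_insert:
  assumes \<omega>: "\<omega> \<subseteq> {..<M}" and j: "j < M" "j \<notin> \<omega>" and r: "0 < r"
  shows "r \<notin> {left j<..<right j} \<Longrightarrow> g_fun (\<eta> \<omega>) r = g_fun (\<eta> (insert j \<omega>)) r"
    "\<bar>g_fun (\<eta> \<omega>) r - g_fun (\<eta> (insert j \<omega>)) r\<bar> \<le> D"
proof -
  have fin: "finite \<omega>" using \<omega> finite_subset by blast
  have \<omega>': "insert j \<omega> \<subseteq> {..<M}" using \<omega> j by auto
  interpret x: stationary \<kappa> K "\<eta> \<omega>" V by (rule \<eta>_stationary[OF \<omega>])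
  interpret y: stationary \<kappa> K "\<eta> (insert j \<omega>)" V by (rule \<eta>_stationary[OF \<omega>'])
  define h where "h r = g_fun (\<eta> (insert j \<omega>)) r - g_fun (\<eta> \<omega>) r" for r
  have \<eta>': "\<eta> (insert j \<omega>) x = \<eta> \<omega> x + B j x" for x using fin j by (simp add: \<eta>_def)
  have hd: "h q - h p = integral {p..q} (\<lambda>u. 1 / (u * \<eta> (insert j \<omega>) u)) - integral {p..q} (\<lambda>u. 1 / (u * \<eta> \<omega> u))"
    if "0 < p" "p \<le> q" for p q
    using x.g_fun_diff[OF that] y.g_fun_diff[OF that] by (simp add: h_def)
  have lr: "0 < left j" "left j < right j" "right j = left j + 2 * w" "r1 \<le> left j" "right j \<le> r2"
    using left_pos[OF j(1)] cell_bounds[OF j(1)] w by auto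
  have off: "h p = h q" if "0 < p" "p \<le> q" "q \<le> left j \<or> right j \<le> p" for p q
  proof -
    have "integral {p..q} (\<lambda>u. 1 / (u * \<eta> (insert j \<omega>) u)) = integral {p..q} (\<lambda>u. 1 / (u * \<eta> \<omega> u))"
    proof (rule Henstock_Kurzweil_Integration.integral_cong)
      fix u assume "u \<in> {p..q}"
      then have "u \<notin> {left j<..<right j}" using that by auto
      then show "1 / (u * \<eta> (insert j \<omega>) u) = 1 / (u * \<eta> \<omega> u)" by (simp add: \<eta>' B_support)
    qed
    then show ?thesis using hd[OF that(1,2)] by simp
  qed
  have on: "h (left j) = h (right j)"
  proof -
    have cell: "\<eta> \<omega> u = \<xi> u" "\<eta> (insert j \<omega>) u = \<xi> u + bump (scale j) j u" if "u \<in> {left j..right j}" for u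
    proof -
      have "u \<notin> {left i<..<right i}" if "i \<in> \<omega>" for i
      proof -
        have "i \<noteq> j" using that j by auto
        then show ?thesis using cells_separated[of i j] cells_separated[of j i] w \<open>u \<in> {left j..right j}\<close>
          by (cases "i < j") auto
      qed
      then have "(\<Sum>i\<in>\<omega>. B i u) = 0" by (intro sum_B_inactive) auto
      then show 1: "\<eta> \<omega> u = \<xi> u" by (simp add: \<eta>_def)
      show "\<eta> (insert j \<omega>) u = \<xi> u + bump (scale j) j u" by (simp add: \<eta>' 1 B_def)
    qed
    have "integral {left j..right j} (\<lambda>u. 1 / (u * \<eta> (insert j \<omega>) u)) = integral {left j..right j} (\<lambda>u. 1 / (u * (\<xi> u + bump (scale j) j u)))"
      by (intro Henstock_Kurzweil_Integration.integral_cong) (simp add: cell)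
    also have "\<dots> = integral {left j..right j} (\<lambda>u. 1 / (u * \<xi> u))" by (rule scale(3)[OF j(1)])
    also have "\<dots> = integral {left j..right j} (\<lambda>u. 1 / (u * \<eta> \<omega> u))"
      by (intro Henstock_Kurzweil_Integration.integral_cong) (simp add: cell)
    finally show ?thesis using hd[of "left j" "right j"] lr by simp
  qed
  have h1: "h 1 = 0" by (simp add: h_def g_fun_1)
  have hl: "h (left j) = 0"
  proof (cases "1 \<le> left j")
    case True
    then show ?thesis using off[of 1 "left j"] h1 by simp
  next
    case False
    then have "right j \<le> 1" using r12(3) lr by auto
    then show ?thesis using off[of "right j" 1] h1 on lr by simp
  qed
  have h0: "h r = 0" if "r \<notin> {left j<..<right j}" "0 < r" for r
  proof (cases "r \<le> left j")
    case True
    then show ?thesis using off[of r "left j"] hl that by simp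
  next
    case False
    then show ?thesis using off[of "right j" r] hl on that lr by simp
  qed
  show "g_fun (\<eta> \<omega>) r = g_fun (\<eta> (insert j \<omega>)) r" if "r \<notin> {left j<..<right j}"
    using h0[OF that r] by (simp add: h_def)
  have D0: "0 \<le> D" unfolding D_def using w A c \<Lambda> r12 by simp
  show "\<bar>g_fun (\<eta> \<omega>) r - g_fun (\<eta> (insert j \<omega>)) r\<bar> \<le> D"
  proof (cases "r \<in> {left j<..<right j}")
    case False
    then show ?thesis using h0[OF False r] D0 by (simp add: h_def)
  next
    case True
    then have lr': "left j \<le> r" "r \<le> right j" by auto
    let ?f = "\<lambda>u. 1 / (u * \<eta> (insert j \<omega>) u) - 1 / (u * \<eta> \<omega> u)"
    let ?Bd = "A * c * (1 + \<Lambda>) / (r1 * \<kappa>\<^sup>2)"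
    have Bd: "0 \<le> ?Bd" using A c \<Lambda> r12 by simp
    have i1: "(\<lambda>u. 1 / (u * \<eta> (insert j \<omega>) u)) integrable_on {left j..r}"
      by (intro integrable_continuous_real y.cont_integrand lr)
    have i2: "(\<lambda>u. 1 / (u * \<eta> \<omega> u)) integrable_on {left j..r}"
      by (intro integrable_continuous_real x.cont_integrand lr)
    have "h r = integral {left j..r} ?f"
      using hd[of "left j" r] lr lr' hl Henstock_Kurzweil_Integration.integral_diff[OF i1 i2] by simp
    moreover have "norm (integral {left j..r} ?f) \<le> ?Bd * measure lborel {left j..r}"
    proof (rule has_integral_bound_real[OF Bd finite.emptyI])
      show "(?f has_integral integral {left j..r} ?f) {left j..r}"
        by (intro integrable_integral integrable_diff i1 i2)
      fix u assume "u \<in> {left j..r} - {}"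
      then have u0: "0 < u" "r1 \<le> u" using lr by auto
      let ?X = "\<eta> \<omega> u" and ?Y = "\<eta> (insert j \<omega>) u"
      have X: "\<kappa> \<le> ?X" and Y: "\<kappa> \<le> ?Y" using x.bounds y.bounds u0 by auto
      have eq: "1 / (u * ?Y) - 1 / (u * ?X) = (?X - ?Y) / (u * ?X * ?Y)"
        using inverse_diff[of u ?X ?Y] u0 X Y base.\<kappa> by simp
      have num: "\<bar>?X - ?Y\<bar> = \<bar>B j u\<bar>" by (simp add: \<eta>')
      have den: "\<bar>u * ?X * ?Y\<bar> = u * ?X * ?Y" using u0 X Y base.\<kappa> by (intro abs_of_nonneg) auto
      have "norm (?f u) = \<bar>B j u\<bar> / (u * ?X * ?Y)"
        by (simp only: eq real_norm_def abs_divide num den)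
      also have "\<dots> \<le> A * c * (1 + \<Lambda>) / (r1 * \<kappa>\<^sup>2)"
      proof (rule frac_le)
        have "r1 * \<kappa> * \<kappa> \<le> u * ?X * ?Y" using X Y u0 base.\<kappa> r12 by (intro mult_mono) auto
        then show "r1 * \<kappa>\<^sup>2 \<le> u * ?X * ?Y" by (simp add: power2_eq_square)
      qed (use B_bound[OF j(1), of u] A c \<Lambda> r12 base.\<kappa> in auto)
      finally show "norm (?f u) \<le> ?Bd" .
    qed
    moreover have "?Bd * (r - left j) \<le> ?Bd * (2 * w)" using lr' lr Bd by (intro mult_left_mono) auto
    moreover have "?Bd * (2 * w) = D" by (simp add: D_def)
    moreover have "measure lborel {left j..r} = r - left j" using lr' by simp
    ultimately show ?thesis by (simp add: h_def abs_minus_commute)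
  qed
qed

lemma g_fun_off:
  assumes "\<omega> \<subseteq> {..<M}" "0 < r" "\<And>j. j \<in> \<omega> \<Longrightarrow> r \<notin> {left j<..<right j}"
  shows "g_fun (\<eta> \<omega>) r = g_fun \<xi> r"
proof -
  have "finite \<omega>" using assms(1) finite_subset by blast
  then show ?thesis using assms
  proof (induction \<omega>)
    case (insert j \<omega>)
    then have "g_fun (\<eta> \<omega>) r = g_fun (\<eta> (insert j \<omega>)) r" by (intro g_fun_insert(1)) auto
    then show ?case using insert by auto
  qed simp
qed

lemma D_nonneg: "0 \<le> D" unfolding D_def using w A c \<Lambda> r12 by simp

text \<open>At most one bump acts at a given \<open>r\<close>, so the bound does not grow with the
  number of bumps.\<close>

lemma g_fun_close:
  assumes \<omega>: "\<omega> \<subseteq> {..<M}" and r: "0 < r"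
  shows "\<bar>g_fun \<xi> r - g_fun (\<eta> \<omega>) r\<bar> \<le> D"
proof (cases "\<exists>j\<in>\<omega>. r \<in> {left j<..<right j}")
  case True
  then obtain j where j: "j \<in> \<omega>" "r \<in> {left j<..<right j}" by blast
  have "g_fun (\<eta> (\<omega> - {j})) r = g_fun \<xi> r"
  proof (rule g_fun_off)
    show "r \<notin> {left i<..<right i}" if "i \<in> \<omega> - {j}" for i
      using cells_disjoint[OF _ j(2), of i] that by auto
  qed (use \<omega> r in auto)
  moreover have "\<bar>g_fun (\<eta> (\<omega> - {j})) r - g_fun (\<eta> (insert j (\<omega> - {j}))) r\<bar> \<le> D"
    using \<omega> r j by (intro g_fun_insert(2)) auto
  ultimately show ?thesis using j by (simp add: insert_absorb)
next
  case False
  then have "g_fun (\<eta> \<omega>) r = g_fun \<xi> r" using \<omega> r by (intro g_fun_off) auto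
  then show ?thesis using D_nonneg by simp
qed

text \<open>This makes the heights that delimit a bump independent of \<open>\<omega>\<close>, up to
  the value of \<open>mu\<close>.\<close>

lemma g_fun_left_right:
  assumes \<omega>: "\<omega> \<subseteq> {..<M}" and j: "j < M"
  shows "g_fun (\<eta> \<omega>) (left j) = g_fun \<xi> (left j)" "g_fun (\<eta> \<omega>) (right j) = g_fun \<xi> (right j)"
proof -
  have out: "left j \<notin> {left i<..<right i} \<and> right j \<notin> {left i<..<right i}" for i
    using cells_separated[of i j] cells_separated[of j i] w cell_bounds(2)[OF j]
    by (cases "i = j"; cases "i < j") auto
  show "g_fun (\<eta> \<omega>) (left j) = g_fun \<xi> (left j)"
    by (rule g_fun_off[OF \<omega> left_pos[OF j]]) (use out in blast)
  have "0 < right j" using left_pos[OF j] cell_bounds(2)[OF j] w by simp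
  then show "g_fun (\<eta> \<omega>) (right j) = g_fun \<xi> (right j)"
    by (rule g_fun_off[OF \<omega>]) (rule out[THEN conjunct2])
qed

lemma B_measurable [measurable]: "B j \<in> borel_measurable borel"
  unfolding B_def by (intro borel_measurable_continuous_onI bump_cont)

text \<open>Only the middle half of the positive part is counted: there the bump is at least
  \<open>A * d\<close>, over a length of \<open>w / 2\<close>.\<close>

lemma B_square_lower:
  assumes j: "j < M"
  shows "A\<^sup>2 * d\<^sup>2 * w / 2 \<le> (\<integral>x. indicator {left j<..<right j} x * (B j x)\<^sup>2 \<partial>lborel)"
proof -
  let ?T = "{left j + w / 4..left j + 3 * w / 4}"
  note r = cell_bounds(2)[OF j]
  have "A\<^sup>2 * d\<^sup>2 * w / 2 = (\<integral>x. (A * d)\<^sup>2 * indicator ?T x \<partial>lborel)"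
    using w by (simp add: power_mult_distrib)
  also have "\<dots> \<le> (\<integral>x. indicator {left j<..<right j} x * (B j x)\<^sup>2 \<partial>lborel)"
  proof (rule integral_mono)
    show "integrable lborel (\<lambda>x. (A * d)\<^sup>2 * indicator ?T x :: real)"
      by (intro integrable_mult_right integrable_real_indicator emeasure_bounded_finite) auto
    have "continuous_on {left j..right j} (\<lambda>x. (B j x)\<^sup>2)" unfolding B_def by (intro continuous_intros bump_cont)
    then have "set_integrable lborel {left j..right j} (\<lambda>x. (B j x)\<^sup>2)" by (rule borel_integrable_atLeastAtMost')
    then have "set_integrable lborel {left j<..<right j} (\<lambda>x. (B j x)\<^sup>2)" by (rule set_integrable_subset) auto
    then show "integrable lborel (\<lambda>x. indicator {left j<..<right j} x * (B j x)\<^sup>2)" by (simp add: set_integrable_def)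
    fix x
    show "(A * d)\<^sup>2 * indicator ?T x \<le> indicator {left j<..<right j} x * (B j x)\<^sup>2"
    proof (cases "x \<in> ?T")
      case True
      then have "(x - r1) / w - real (4 * j + 1) \<in> {1/4..3/4}"
        using w by (auto simp: left_def field_simps)
      then have up: "d \<le> up j x" unfolding up_def by (rule lower)
      then have "down j x = 0" using up_down_zero[of j x] d by auto
      then have "B j x = A * up j x" by (simp add: B_def bump_def)
      then have "(A * d)\<^sup>2 \<le> (B j x)\<^sup>2" using up A d by (auto intro!: power_mono mult_left_mono)
      moreover have "x \<in> {left j<..<right j}" using True r w by auto
      ultimately show ?thesis using True by simp
    qed simp
  qed
  finally show ?thesis .
qed

end

section \<open>Effect of the bumps on the stationary density\<close>

context cube
begin

text \<open>The bound of \<open>mu_diff_local\<close> for one bump, with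
  \<open>2 * w / (r1 * \<kappa>)\<close> in place of the length of the height interval. It is of
  order \<open>D * w\<close>.\<close>

definition Mu :: "real \<Rightarrow> real" where
  "Mu C = 2 * K * D * r2 * C * (2 * w / (r1 * \<kappa>)) / \<kappa>"

text \<open>\<open>mu\<close> moves by at most \<open>D\<close>; widening by \<open>D\<close> on
  both sides makes one set contain the region affected by bump \<open>j\<close> for every
  \<open>\<omega>\<close>.\<close>

definition slab :: "nat \<Rightarrow> (real^'d) set" where
  "slab j = {x. mu V \<xi> - V x \<in> {g_fun \<xi> (left j) - D<..<g_fun \<xi> (right j) + D}}"

definition zone :: "(real^'d) set" where
  "zone = {x. mu V \<xi> - V x \<in> {g_fun \<xi> r1..g_fun \<xi> r2}}"

lemma mu_close:
  assumes "\<omega> \<subseteq> {..<M}"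
  shows "\<bar>mu V \<xi> - mu V (\<eta> \<omega>)\<bar> \<le> D"
  using g_fun_close[OF assms] by (intro mu_diff_crude[OF base.stationary_axioms \<eta>_stationary[OF assms]])

lemma mu_insert:
  assumes \<omega>: "\<omega> \<subseteq> {..<M}" and j: "j < M" "j \<notin> \<omega>" and KD: "K * D \<le> 1" and C0: "0 \<le> C"
    and C: "\<And>s. s \<in> {mu V \<xi> - g_fun \<xi> r2 - D..mu V \<xi> - g_fun \<xi> r1 + D} \<Longrightarrow> level_mass V s \<le> ennreal C"
  shows "\<bar>mu V (\<eta> \<omega>) - mu V (\<eta> (insert j \<omega>))\<bar> \<le> Mu C"
proof -
  have \<omega>': "insert j \<omega> \<subseteq> {..<M}" using \<omega> j by auto
  note st = \<eta>_stationary[OF \<omega>] \<eta>_stationary[OF \<omega>']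
  have lr: "0 < left j" "left j < right j" "right j = left j + 2 * w" "r1 \<le> left j" "right j \<le> r2"
    using left_pos[OF j(1)] cell_bounds[OF j(1)] w by auto
  have gm: "g_fun \<xi> r1 \<le> g_fun \<xi> (left j)" "g_fun \<xi> (right j) \<le> g_fun \<xi> r2"
    using lr r12 by (auto simp: base.g_fun_mono_iff)
  have gd: "g_fun \<xi> (right j) - g_fun \<xi> (left j) \<le> 2 * w / (r1 * \<kappa>)"
  proof -
    have "g_fun \<xi> (right j) - g_fun \<xi> (left j) \<le> ln (right j / left j) / \<kappa>"
      using lr by (intro base.g_fun_bounds) auto
    also have "ln (right j / left j) \<le> right j / left j - 1" using lr by (intro ln_le_minus_one) auto
    also have "right j / left j - 1 = 2 * w / left j" using lr by (simp add: field_simps)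
    also have "\<dots> \<le> 2 * w / r1" using lr r12 w by (intro divide_left_mono) auto
    finally show ?thesis using base.\<kappa> by (simp add: divide_right_mono)
  qed
  have g0: "0 \<le> g_fun \<xi> (right j) - g_fun \<xi> (left j)" using lr by (simp add: base.g_fun_mono_iff)
  have le: "2 * K * D * right j * C * (g_fun \<xi> (right j) - g_fun \<xi> (left j)) / \<kappa> \<le> Mu C"
    unfolding Mu_def
  proof (intro divide_right_mono mult_mono[OF mult_right_mono[OF mult_left_mono]] gd)
    show "right j \<le> r2" by (rule lr)
  qed (use base.K base.\<kappa> D_nonneg C0 lr r12 g0 in auto)
  have one: "mu V (\<eta> \<omega>1) - mu V (\<eta> \<omega>2) \<le> Mu C"
    if \<omega>1: "\<omega>1 \<subseteq> {..<M}" and \<omega>2: "\<omega>2 \<subseteq> {..<M}"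
      and eq: "\<And>r. 0 < r \<Longrightarrow> r \<notin> {left j<..<right j} \<Longrightarrow> g_fun (\<eta> \<omega>1) r = g_fun (\<eta> \<omega>2) r"
      and d: "\<And>r. 0 < r \<Longrightarrow> \<bar>g_fun (\<eta> \<omega>1) r - g_fun (\<eta> \<omega>2) r\<bar> \<le> D" for \<omega>1 \<omega>2
  proof -
    note g = g_fun_left_right[OF \<omega>1 j(1)]
    have "mu V (\<eta> \<omega>1) - mu V (\<eta> \<omega>2) \<le> 2 * K * D * right j * C * (g_fun (\<eta> \<omega>1) (right j) - g_fun (\<eta> \<omega>1) (left j)) / \<kappa>"
    proof (rule mu_diff_local[OF \<eta>_stationary[OF \<omega>1] \<eta>_stationary[OF \<omega>2] lr(1,2) eq d KD _ C0])
      fix s assume "s \<in> {mu V (\<eta> \<omega>1) - g_fun (\<eta> \<omega>1) (right j)..mu V (\<eta> \<omega>1) - g_fun (\<eta> \<omega>1) (left j)}"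
      then show "level_mass V s \<le> ennreal C"
        using mu_close[OF \<omega>1] gm unfolding g by (intro C) auto
    qed auto
    then show ?thesis using le unfolding g by linarith
  qed
  have "mu V (\<eta> \<omega>) - mu V (\<eta> (insert j \<omega>)) \<le> Mu C"
    by (rule one[OF \<omega> \<omega>']) (use g_fun_insert[OF \<omega> j] in auto)
  moreover have "mu V (\<eta> (insert j \<omega>)) - mu V (\<eta> \<omega>) \<le> Mu C"
  proof (rule one[OF \<omega>' \<omega>])
    fix r :: real assume r: "0 < r"
    show "g_fun (\<eta> (insert j \<omega>)) r = g_fun (\<eta> \<omega>) r" if "r \<notin> {left j<..<right j}"
      using g_fun_insert(1)[OF \<omega> j r that] by simp
    show "\<bar>g_fun (\<eta> (insert j \<omega>)) r - g_fun (\<eta> \<omega>) r\<bar> \<le> D"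
      using g_fun_insert(2)[OF \<omega> j r] by (simp add: abs_minus_commute)
  qed
  ultimately show ?thesis by linarith
qed

lemma zone_measurable [measurable]: "zone \<in> sets borel" and slab_measurable [measurable]: "slab j \<in> sets borel"
  unfolding zone_def slab_def by measurable

lemma zone_finite: "emeasure lborel zone < \<infinity>"
proof -
  have "emeasure lborel zone \<le> emeasure lborel {x. V x \<le> mu V \<xi> - g_fun \<xi> r1}"
    by (rule emeasure_mono) (auto simp: zone_def)
  then show ?thesis using base.sublevel_finite by (rule le_less_trans)
qed

text \<open>\<open>g_fun\<close> rises by at least \<open>w / (K * r2)\<close> across a quarter of a
  cell, so the widening of a slab fits into the empty quarters.\<close>

lemma g_fun_step:
  assumes Dw: "D \<le> w / (K * r2)" and p: "r1 \<le> p" "p + w \<le> r2"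
  shows "g_fun \<xi> p + D \<le> g_fun \<xi> (p + w)"
proof -
  have p0: "0 < p" using p r12 by simp
  have "ln (p / (p + w)) \<le> p / (p + w) - 1" using p0 w by (intro ln_le_minus_one) auto
  then have "w / (p + w) \<le> ln ((p + w) / p)" using p0 w by (simp add: ln_div field_simps)
  moreover have "w / r2 \<le> w / (p + w)" using p p0 w by (intro divide_left_mono) auto
  ultimately have "w / r2 / K \<le> ln ((p + w) / p) / K" using base.K by (intro divide_right_mono) auto
  also have "\<dots> \<le> g_fun \<xi> (p + w) - g_fun \<xi> p" using p0 w by (intro base.g_fun_bounds) auto
  finally show ?thesis using Dw by (simp add: mult.commute)
qed

lemma slabs:
  assumes Dw: "D \<le> w / (K * r2)"
  shows "disjoint_family_on slab {..<M}" "\<And>j. j < M \<Longrightarrow> slab j \<subseteq> zone"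
proof -
  have in_cell: "g_fun \<xi> (left j - w) \<le> g_fun \<xi> (left j) - D" "g_fun \<xi> (right j) + D \<le> g_fun \<xi> (right j + w)"
    if "j < M" for j
    using g_fun_step[OF Dw, of "left j - w"] g_fun_step[OF Dw, of "right j"] cell_bounds[OF that] w by auto
  have sep: "g_fun \<xi> (right i) + D \<le> g_fun \<xi> (left j) - D" if "i < j" "j < M" for i j
  proof -
    have "right i + w \<le> left j - w" using cells_separated[OF that(1)] w by simp
    moreover have "0 < right i + w" using left_pos[of i] cell_bounds(2)[of i] that w by simp
    ultimately have "g_fun \<xi> (right i + w) \<le> g_fun \<xi> (left j - w)" by (subst base.g_fun_mono_iff) auto
    then show ?thesis using in_cell[of i] in_cell[of j] that by simp
  qed
  show "disjoint_family_on slab {..<M}"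
    unfolding disjoint_family_on_def
  proof (intro ballI impI)
    fix i j assume ij: "i \<in> {..<M}" "j \<in> {..<M}" "i \<noteq> j"
    then consider "i < j" | "j < i" by linarith
    then show "slab i \<inter> slab j = {}"
      using sep[of i j] sep[of j i] ij by cases (auto simp: slab_def)
  qed
  show "slab j \<subseteq> zone" if j: "j < M" for j
  proof -
    have "g_fun \<xi> r1 \<le> g_fun \<xi> (left j - w)" "g_fun \<xi> (right j + w) \<le> g_fun \<xi> r2"
      using cell_bounds[OF j] r12 w by (auto simp: base.g_fun_mono_iff)
    then show ?thesis using in_cell[OF j] by (auto simp: slab_def zone_def)
  qed
qed

text \<open>Disjointness takes the place of a volume estimate for each slab, and the sum is all that
  the error budget asks for.\<close>

lemma sum_slab_le:
  assumes Dw: "D \<le> w / (K * r2)"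
  shows "(\<Sum>j<M. measure lborel (slab j)) \<le> measure lborel zone"
proof -
  have fm: "zone \<in> fmeasurable lborel" using zone_finite by (intro fmeasurableI) auto
  have "slab j \<in> fmeasurable lborel" if "j < M" for j
    using fmeasurableI2[OF fm slabs(2)[OF Dw that]] by simp
  then have "(\<Sum>j<M. measure lborel (slab j)) = measure lborel (\<Union>j<M. slab j)"
    using slabs(1)[OF Dw] by (intro measure_UNION_AE[symmetric] measure_finite_Union[symmetric]) (auto simp: fmeasurable_def less_top)
  also have "\<dots> \<le> measure lborel zone"
    using slabs(2)[OF Dw] by (intro measure_mono_fmeasurable fm) auto
  finally show ?thesis .
qed

text \<open>The changes of \<open>g\<close> and of \<open>mu\<close> contribute \<open>K * D\<close>
  each to the logarithm, together at most 1, and \<open>exp 1\<close> is at most 3.\<close>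

lemma density_integral_le:
  assumes \<omega>: "\<omega> \<subseteq> {..<M}" and KD: "K * D \<le> 1/2"
  shows "(\<integral>x. stat_density V (\<eta> \<omega>) x \<partial>lborel) \<le> 3 * (\<integral>x. stat_density V \<xi> x \<partial>lborel)"
proof -
  interpret x: stationary \<kappa> K "\<eta> \<omega>" V by (rule \<eta>_stationary[OF \<omega>])
  have "stat_density V (\<eta> \<omega>) x \<le> 3 * stat_density V \<xi> x" for x
  proof -
    have "\<bar>ln (stat_density V \<xi> x) - ln (stat_density V (\<eta> \<omega>) x)\<bar>
      \<le> K * D * indicator {x. mu V \<xi> - V x \<in> {g_fun \<xi> r1<..<g_fun \<xi> r2}} x + K * D"
    proof (rule stat_density_log_diff[OF base.stationary_axioms x.stationary_axioms r12(1,2) _ g_fun_close[OF \<omega>] mu_close[OF \<omega>]])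
      fix r :: real assume r: "0 < r" "r \<notin> {r1<..<r2}"
      show "g_fun \<xi> r = g_fun (\<eta> \<omega>) r"
      proof (rule g_fun_off[OF \<omega> r(1), symmetric])
        fix j assume "j \<in> \<omega>"
        then have "j < M" using \<omega> by auto
        then show "r \<notin> {left j<..<right j}" using cell_bounds[of j] r w by auto
      qed
    qed
    also have "\<dots> \<le> 1" using KD D_nonneg base.K by (simp add: indicator_def)
    finally have "ln (stat_density V (\<eta> \<omega>) x) \<le> 1 + ln (stat_density V \<xi> x)" by linarith
    then have "exp (ln (stat_density V (\<eta> \<omega>) x)) \<le> exp (1 + ln (stat_density V \<xi> x))" unfolding exp_le_cancel_iff .
    then have "stat_density V (\<eta> \<omega>) x \<le> exp 1 * stat_density V \<xi> x"
      using x.stat_density_pos[of x] base.stat_density_pos[of x] by (simp add: exp_add)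
    also have "\<dots> \<le> 3 * stat_density V \<xi> x"
      using exp_le base.stat_density_pos[of x] by (intro mult_right_mono) auto
    finally show ?thesis .
  qed
  then have "(\<integral>x. stat_density V (\<eta> \<omega>) x \<partial>lborel) \<le> (\<integral>x. 3 * stat_density V \<xi> x \<partial>lborel)"
    by (intro integral_mono integrable_mult_right x.stat_density_integrable base.stat_density_integrable)
  then show ?thesis by simp
qed

text \<open>The functions \<open>f\<close> to be estimated are kept apart from the coefficients
  \<open>\<eta>\<close> that define the laws, because an element of the class and the constant
  extension of its restriction may differ beyond \<open>U\<close>.\<close>

lemma cube_minimax:
  fixes f :: "nat set \<Rightarrow> real \<Rightarrow> real" and s p q C :: real
  assumes KD: "K * D \<le> 1/2" and KM: "K * Mu C \<le> 1/2" and Dw: "D \<le> w / (K * r2)" and C0: "0 \<le> C"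
    and C: "\<And>s. s \<in> {mu V \<xi> - g_fun \<xi> r2 - D..mu V \<xi> - g_fun \<xi> r1 + D} \<Longrightarrow> level_mass V s \<le> ennreal C"
    and n: "1 \<le> n" and budget: "n * (2 * K\<^sup>2 * D\<^sup>2 * r2 * measure lborel zone + M * (6 * K\<^sup>2 * (Mu C)\<^sup>2 * (\<integral>x. stat_density V \<xi> x \<partial>lborel))) \<le> M / 4"
    and I: "I = {p..q}" "{r1..r2} \<subseteq> I"
    and h: "h \<in> borel_measurable borel" "integrable lborel (\<lambda>r. indicator I r * (h r)\<^sup>2)"
    and f: "\<And>\<omega> x. f \<omega> x = h x + (\<Sum>j\<in>\<omega>. B j x)"
    and law: "\<And>\<omega>. \<omega> \<subseteq> {..<M} \<Longrightarrow> law \<omega> = PiM {..<n} (\<lambda>_. stat_law V (\<eta> \<omega>))"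
    and s: "0 \<le> s" "s \<le> A\<^sup>2 * d\<^sup>2 * w / 2"
    and T: "T \<in> estimators n I"
  shows "\<exists>\<omega>\<subseteq>{..<M}. ennreal (1 / 8) \<le> emeasure (law \<omega>) {x \<in> space (law \<omega>). sqrt (s * M / 32) \<le> L2_norm_on I (\<lambda>r. T x r - f \<omega> r)}
     \<and> {x \<in> space (law \<omega>). sqrt (s * M / 32) \<le> L2_norm_on I (\<lambda>r. T x r - f \<omega> r)} \<in> sets (law \<omega>)"
proof -
  have lr: "0 < left j" "left j < right j" "r1 \<le> left j" "right j \<le> r2" if "j < M" for j
    using left_pos[OF that] cell_bounds[OF that] w by auto
  have sqc: "integrable lborel (\<lambda>r. indicator I r * (k r)\<^sup>2)" if "continuous_on UNIV k" for k :: "real \<Rightarrow> real"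
  proof -
    have "continuous_on {p..q} (\<lambda>r. (k r)\<^sup>2)" by (intro continuous_intros continuous_on_subset[OF that]) auto
    then have "set_integrable lborel {p..q} (\<lambda>r. (k r)\<^sup>2)" by (rule borel_integrable_atLeastAtMost')
    then show ?thesis by (simp add: set_integrable_def I)
  qed
  have Bc: "continuous_on UNIV (B j)" for j unfolding B_def by (rule bump_cont)
  let ?c = "\<integral>x. stat_density V \<xi> x \<partial>lborel"
  have c1: "1 \<le> ?c" by (rule base.stat_density_integral)
  \<comment> \<open>The first summand is the local change on the slab; the second is the shift of
    \<open>mu\<close>, felt everywhere, with the factor 3 from
    \<open>density_integral_le\<close>.\<close>
  define e where "e j = 2 * K\<^sup>2 * D\<^sup>2 * r2 * measure lborel (slab j) + 2 * K\<^sup>2 * (Mu C)\<^sup>2 * (3 * ?c)" for j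
  have KD1: "K * D \<le> 1" using KD by simp
  show ?thesis
  proof (rule hypercube_lower_bound[where C = "\<lambda>j. {left j<..<right j}" and base = h and g = B and p = "\<lambda>\<omega>. stat_density V (\<eta> \<omega>)" and e = e, OF M n])
    show "I \<in> sets borel" by (simp add: I)
    show "{left j<..<right j} \<subseteq> I" if "j < M" for j using lr[OF that] I by auto
    show "disjoint_family_on (\<lambda>j. {left j<..<right j}) {..<M}"
      using cells_disjoint unfolding disjoint_family_on_def by blast
    show fm: "f \<omega> \<in> borel_measurable borel" for \<omega> using h unfolding f[abs_def] by measurable
    show "integrable lborel (\<lambda>r. indicator I r * (f \<omega> r)\<^sup>2)" for \<omega>
    proof -
      have "integrable lborel (\<lambda>r. indicator I r * (h r - (- (\<Sum>j\<in>\<omega>. B j r)))\<^sup>2)"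
        by (rule square_integrable_diff[OF h(1) _ _ h(2) sqc]) (auto intro!: continuous_intros Bc simp: I)
      then show ?thesis by (simp add: f)
    qed
    show "f \<omega> x = h x + (if j \<in> \<omega> then B j x else 0)"
      if "\<omega> \<subseteq> {..<M}" "x \<in> {left j<..<right j}" for \<omega> j x
      using sum_B_active[OF finite_subset[OF that(1)] that(2)] by (simp add: f)
    show "s \<le> (\<integral>r. indicator {left j<..<right j} r * (B j r)\<^sup>2 \<partial>lborel)" if "j < M" for j
      using s(2) B_square_lower[OF that] by simp
    fix \<omega> assume \<omega>: "\<omega> \<subseteq> {..<M}"
    interpret x: stationary \<kappa> K "\<eta> \<omega>" V by (rule \<eta>_stationary[OF \<omega>])
    show "integrable lborel (stat_density V (\<eta> \<omega>))" by (rule x.stat_density_integrable)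
    show "0 < stat_density V (\<eta> \<omega>) x" for x by (rule x.stat_density_pos)
    show "1 \<le> (\<integral>x. stat_density V (\<eta> \<omega>) x \<partial>lborel)" by (rule x.stat_density_integral)
    show "law \<omega> = PiM {..<n} (\<lambda>_. density lborel (\<lambda>x. ennreal (stat_density V (\<eta> \<omega>) x)))"
      using law[OF \<omega>] by (simp add: stat_law_def)
    fix j assume j: "j < M" "j \<notin> \<omega>"
    have \<omega>': "insert j \<omega> \<subseteq> {..<M}" using \<omega> j by auto
    note g = g_fun_left_right[OF \<omega> j(1)]
    note pair = x.stationary_axioms \<eta>_stationary[OF \<omega>'] lr(1,2)[OF j(1)] g_fun_insert(1)[OF \<omega> j] g_fun_insert(2)[OF \<omega> j] mu_insert[OF \<omega> j KD1 C0 C]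
    show "\<bar>ln (stat_density V (\<eta> \<omega>) x) - ln (stat_density V (\<eta> (insert j \<omega>)) x)\<bar> \<le> 1" for x
    proof -
      have "\<bar>ln (stat_density V (\<eta> \<omega>) x) - ln (stat_density V (\<eta> (insert j \<omega>)) x)\<bar>
        \<le> K * D * indicator {x. mu V (\<eta> \<omega>) - V x \<in> {g_fun (\<eta> \<omega>) (left j)<..<g_fun (\<eta> \<omega>) (right j)}} x + K * Mu C"
        by (rule stat_density_log_diff) (use pair in auto)
      also have "\<dots> \<le> 1" using KD KM D_nonneg base.K by (simp add: indicator_def)
      finally show ?thesis .
    qed
    let ?X = "{x. mu V (\<eta> \<omega>) - V x \<in> {g_fun (\<eta> \<omega>) (left j)<..<g_fun (\<eta> \<omega>) (right j)}}"
    have "(\<integral>\<^sup>+ x. ennreal (stat_density V (\<eta> \<omega>) x * (ln (stat_density V (\<eta> \<omega>) x) - ln (stat_density V (\<eta> (insert j \<omega>)) x))\<^sup>2) \<partial>lborel)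
      \<le> ennreal (2 * K\<^sup>2 * D\<^sup>2 * right j * measure lborel ?X + 2 * K\<^sup>2 * (Mu C)\<^sup>2 * (\<integral>x. stat_density V (\<eta> \<omega>) x \<partial>lborel))"
      by (rule stat_density_log_diff_integral) (use pair in auto)
    also have "\<dots> \<le> ennreal (e j)"
      unfolding e_def
    proof (intro ennreal_leI add_mono)
      have "?X \<subseteq> slab j" using mu_close[OF \<omega>] unfolding g by (auto simp: slab_def abs_le_iff)
      moreover have fm: "slab j \<in> fmeasurable lborel"
      proof (rule fmeasurableI2[of zone])
        show "zone \<in> fmeasurable lborel" using zone_finite by (intro fmeasurableI) auto
      qed (use slabs(2)[OF Dw j(1)] in auto)
      ultimately have "measure lborel ?X \<le> measure lborel (slab j)"
        by (intro measure_mono_fmeasurable) auto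
      then show "2 * K\<^sup>2 * D\<^sup>2 * right j * measure lborel ?X \<le> 2 * K\<^sup>2 * D\<^sup>2 * r2 * measure lborel (slab j)"
        using lr[OF j(1)] r12 by (intro mult_mono[OF mult_left_mono]) auto
      show "2 * K\<^sup>2 * (Mu C)\<^sup>2 * (\<integral>x. stat_density V (\<eta> \<omega>) x \<partial>lborel) \<le> 2 * K\<^sup>2 * (Mu C)\<^sup>2 * (3 * ?c)"
        using density_integral_le[OF \<omega> KD] by (intro mult_left_mono) auto
    qed
    finally show "(\<integral>\<^sup>+ x. ennreal (stat_density V (\<eta> \<omega>) x * (ln (stat_density V (\<eta> \<omega>) x) - ln (stat_density V (\<eta> (insert j \<omega>)) x))\<^sup>2) \<partial>lborel) \<le> ennreal (e j)" .
  next
    show "0 \<le> e j" for j unfolding e_def using r12 c1 by simp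
    have "(\<Sum>j<M. e j) = 2 * K\<^sup>2 * D\<^sup>2 * r2 * (\<Sum>j<M. measure lborel (slab j)) + M * (6 * K\<^sup>2 * (Mu C)\<^sup>2 * ?c)"
      unfolding e_def sum.distrib sum_distrib_left[symmetric] by simp
    also have "\<dots> \<le> 2 * K\<^sup>2 * D\<^sup>2 * r2 * measure lborel zone + M * (6 * K\<^sup>2 * (Mu C)\<^sup>2 * ?c)"
      using sum_slab_le[OF Dw] r12 by (intro add_right_mono mult_left_mono) auto
    finally have "n * (\<Sum>j<M. e j) \<le> n * (2 * K\<^sup>2 * D\<^sup>2 * r2 * measure lborel zone + M * (6 * K\<^sup>2 * (Mu C)\<^sup>2 * ?c))"
      by (rule mult_left_mono) simp
    then show "n * (\<Sum>j<M. e j) \<le> M / 4" using budget by linarith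
  qed (use h s T sqc Bc in auto)
qed

end

section \<open>The minimax lower bounds\<close>

lemma stat_law_cong:
  assumes "\<And>r. 0 < r \<Longrightarrow> \<xi> r = \<xi>' r"
  shows "stat_law V \<xi> = stat_law V \<xi>'"
proof -
  have g: "g_fun \<xi> r = g_fun \<xi>' r" if "0 < r" for r
    unfolding g_fun_def
  proof (rule interval_integral_cong)
    fix u assume "u \<in> einterval (min 1 (ereal r)) (max 1 (ereal r))"
    then have "min 1 (ereal r) < ereal u" by (simp add: einterval_def)
    moreover have "0 < min 1 (ereal r)" using that by simp
    ultimately have "0 < ereal u" by (rule less_trans[rotated])
    then show "1 / (u * \<xi> u) = 1 / (u * \<xi>' u)" using assms[of u] by simp
  qed
  have "g_inv \<xi> = g_inv \<xi>'"
    unfolding g_inv_def the_inv_into_def by (intro ext arg_cong[where f = The]) (auto simp: g)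
  then show ?thesis
    by (simp add: stat_law_def stat_density_def[abs_def] q_fun_def mu_def)
qed

lemma minimax_bounds:
  fixes V :: "real^'d \<Rightarrow> real"
  assumes \<delta>: "0 \<le> \<delta>"
    and *: "\<And>T. T \<in> estimators n I \<Longrightarrow> \<exists>\<xi>\<in>X.
      ennreal (1 / 8) \<le> emeasure (sample_law V U n \<xi>) {x \<in> space (sample_law V U n \<xi>). \<delta> \<le> L2_norm_on I (\<lambda>r. T x r - \<xi> r)}
      \<and> {x \<in> space (sample_law V U n \<xi>). \<delta> \<le> L2_norm_on I (\<lambda>r. T x r - \<xi> r)} \<in> sets (sample_law V U n \<xi>)"
  shows "ennreal (\<delta>\<^sup>2 / 8) \<le> (INF T \<in> estimators n I. SUP \<xi> \<in> X. \<integral>\<^sup>+ x. ennreal ((L2_norm_on I (\<lambda>r. T x r - \<xi> r))\<^sup>2) \<partial>sample_law V U n \<xi>)"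
    "ennreal (1 / 8) \<le> (INF T \<in> estimators n I. SUP \<xi> \<in> X. emeasure (sample_law V U n \<xi>) {x \<in> space (sample_law V U n \<xi>). L2_norm_on I (\<lambda>r. T x r - \<xi> r) \<ge> \<delta>})"
proof -
  show "ennreal (1 / 8) \<le> (INF T \<in> estimators n I. SUP \<xi> \<in> X. emeasure (sample_law V U n \<xi>) {x \<in> space (sample_law V U n \<xi>). L2_norm_on I (\<lambda>r. T x r - \<xi> r) \<ge> \<delta>})"
  proof (rule INF_greatest)
    fix T :: "(nat \<Rightarrow> real^'d) \<Rightarrow> real \<Rightarrow> real" assume "T \<in> estimators n I"
    from *[OF this] obtain \<xi> where \<xi>: "\<xi> \<in> X"
      "ennreal (1 / 8) \<le> emeasure (sample_law V U n \<xi>) {x \<in> space (sample_law V U n \<xi>). \<delta> \<le> L2_norm_on I (\<lambda>r. T x r - \<xi> r)}" by blast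
    show "ennreal (1 / 8) \<le> (SUP \<xi> \<in> X. emeasure (sample_law V U n \<xi>) {x \<in> space (sample_law V U n \<xi>). L2_norm_on I (\<lambda>r. T x r - \<xi> r) \<ge> \<delta>})"
      by (rule SUP_upper2[OF \<xi>(1)]) (rule \<xi>(2))
  qed
  show "ennreal (\<delta>\<^sup>2 / 8) \<le> (INF T \<in> estimators n I. SUP \<xi> \<in> X. \<integral>\<^sup>+ x. ennreal ((L2_norm_on I (\<lambda>r. T x r - \<xi> r))\<^sup>2) \<partial>sample_law V U n \<xi>)"
  proof (rule INF_greatest)
    fix T :: "(nat \<Rightarrow> real^'d) \<Rightarrow> real \<Rightarrow> real" assume "T \<in> estimators n I"
    from *[OF this] obtain \<xi> where \<xi>: "\<xi> \<in> X"
      "ennreal (1 / 8) \<le> emeasure (sample_law V U n \<xi>) {x \<in> space (sample_law V U n \<xi>). \<delta> \<le> L2_norm_on I (\<lambda>r. T x r - \<xi> r)}"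
      "{x \<in> space (sample_law V U n \<xi>). \<delta> \<le> L2_norm_on I (\<lambda>r. T x r - \<xi> r)} \<in> sets (sample_law V U n \<xi>)" by blast
    let ?P = "sample_law V U n \<xi>"
    let ?E = "{x \<in> space ?P. \<delta> \<le> L2_norm_on I (\<lambda>r. T x r - \<xi> r)}"
    have "ennreal (\<delta>\<^sup>2 / 8) = ennreal (\<delta>\<^sup>2) * ennreal (1 / 8)" by (simp add: ennreal_mult'[symmetric])
    also have "\<dots> \<le> ennreal (\<delta>\<^sup>2) * emeasure ?P ?E" using \<xi>(2) by (rule mult_left_mono) simp
    also have "\<dots> = (\<integral>\<^sup>+ x. ennreal (\<delta>\<^sup>2) * indicator ?E x \<partial>?P)"
      using \<xi>(3) by (rule nn_integral_cmult_indicator[symmetric])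
    also have "\<dots> \<le> (\<integral>\<^sup>+ x. ennreal ((L2_norm_on I (\<lambda>r. T x r - \<xi> r))\<^sup>2) \<partial>?P)"
      using \<delta> by (intro nn_integral_mono) (auto simp: indicator_def intro!: ennreal_leI power_mono)
    finally show "ennreal (\<delta>\<^sup>2 / 8) \<le> (SUP \<xi> \<in> X. \<integral>\<^sup>+ x. ennreal ((L2_norm_on I (\<lambda>r. T x r - \<xi> r))\<^sup>2) \<partial>sample_law V U n \<xi>)"
      by (rule SUP_upper2[OF \<xi>(1)])
  qed
qed

lemma eventually_small: "0 < t \<Longrightarrow> \<forall>\<^sub>F c in at_right 0. c * q \<le> (t::real)"
proof -
  assume t: "0 < t"
  have "((\<lambda>c. c * q) \<longlongrightarrow> 0 * q) (at_right 0)" by (intro tendsto_intros)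
  then have "\<forall>\<^sub>F c in at_right 0. c * q < t" using t by (intro order_tendstoD) auto
  then show ?thesis by (rule eventually_mono) simp
qed

lemma hoelder_ball_mono: "f \<in> hoelder_ball \<beta> S H \<Longrightarrow> H \<le> H' \<Longrightarrow> f \<in> hoelder_ball \<beta> S H'"
  unfolding hoelder_ball_def by (auto intro: order_trans ennreal_leI)

lemma hoelder_ball_continuous:
  assumes "1 < \<beta>" "f \<in> hoelder_ball \<beta> S H"
  shows "continuous_on S f"
proof -
  have "0 < hoelder_deg \<beta>" using assms(1) unfolding hoelder_deg_def by simp
  then have "iter_deriv S 0 f differentiable_on S" using assms(2) unfolding hoelder_ball_def by blast
  then show ?thesis by (simp add: differentiable_imp_continuous_on)
qed

text \<open>\<open>ennreal H\<close> is 0 for negative \<open>H\<close>, so positivity of the radius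
  has to come from a nonzero element of the ball.\<close>

lemma hoelder_ball_nonneg:
  assumes "f \<in> hoelder_ball \<beta> S H" "x \<in> S" "0 < \<bar>f x\<bar>"
  shows "0 < H"
proof -
  have "ennreal \<bar>f x\<bar> \<le> (SUP x\<in>S. ennreal \<bar>iter_deriv S 0 f x\<bar>)" using assms(2) by (intro SUP_upper2[of x]) auto
  also have "\<dots> \<le> (\<Sum>k\<le>hoelder_deg \<beta>. SUP x\<in>S. ennreal \<bar>iter_deriv S k f x\<bar>)"
    by (rule member_le_sum) auto
  also have "\<dots> \<le> hoelder_norm \<beta> S f" unfolding hoelder_norm_def by simp
  also have "\<dots> \<le> ennreal H" using assms(1) by (simp add: hoelder_ball_def)
  finally have "ennreal \<bar>f x\<bar> \<le> ennreal H" .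
  then show ?thesis using assms(3) by (metis ennreal_le_iff2 less_le_trans not_le)
qed

lemma ceiling_root_bounds:
  fixes x :: real
  assumes "1 \<le> x"
  shows "x \<le> real (nat \<lceil>x\<rceil>)" "real (nat \<lceil>x\<rceil>) \<le> 2 * x" "1 \<le> nat \<lceil>x\<rceil>"
  using assms by linarith+

section \<open>Choice of the parameters\<close>

locale problem =
  fixes V :: "real^'d \<Rightarrow> real"
    and \<kappa> K U \<beta> H \<epsilon> r_minus r_plus j_minus j_plus s_lo s_hi C :: real
    and \<xi>s :: "real \<Rightarrow> real"
  assumes V: "admissible_potential V"
    and \<kappa>: "0 < \<kappa>" and U: "1 \<le> U" and \<beta>: "1 < \<beta>"
    and ball: "\<xi>s \<in> hoelder_ball \<beta> {0..U} (H / 2)"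
    and \<epsilon>: "0 < \<epsilon>" and margin: "\<And>r. r \<in> {0..U} \<Longrightarrow> \<kappa> + \<epsilon> \<le> \<xi>s r \<and> \<xi>s r \<le> K - \<epsilon>"
    and IJ: "0 < j_minus" "j_minus < r_minus" "r_minus < r_plus" "r_plus < j_plus"
    and S: "vmin V < s_lo" "s_lo \<le> s_hi" "{s_lo..s_hi} \<inter> critical_values V = {}"
    and sJ: "\<And>r. r \<in> {j_minus..j_plus} \<Longrightarrow> s_fun V (const_ext U \<xi>s) r \<in> {s_lo..s_hi}"
    and C: "0 \<le> C" "\<And>s. s \<in> {s_lo..s_hi} \<Longrightarrow> level_mass V s \<le> ennreal C"
begin

abbreviation I :: "real set" where "I \<equiv> {r_minus..r_plus}"
abbreviation X :: "(real \<Rightarrow> real) set" where "X \<equiv> coeff_class \<beta> H \<kappa> K U \<xi>s {j_minus..j_plus}"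
abbreviation \<xi> :: "real \<Rightarrow> real" where "\<xi> \<equiv> const_ext U \<xi>s"

text \<open>\<open>\<xi>s\<close> is controlled on \<open>{0..U}\<close> only; cutting it off there
  makes it measurable and bounded on the whole line.\<close>

definition h :: "real \<Rightarrow> real" where "h x = indicator {0..U} x * \<xi>s x"

lemma \<xi>s_cont: "continuous_on {0..U} \<xi>s"
  using \<beta> ball by (rule hoelder_ball_continuous)

lemma H: "0 < H"
proof -
  have "0 < \<bar>\<xi>s 0\<bar>" using margin[of 0] \<kappa> \<epsilon> U by auto
  then have "0 < H / 2" using ball U by (intro hoelder_ball_nonneg[OF ball, of 0]) auto
  then show ?thesis by simp
qed

lemma \<xi>_margin: "0 < r \<Longrightarrow> \<kappa> + \<epsilon> \<le> \<xi> r \<and> \<xi> r \<le> K - \<epsilon>"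
  unfolding const_ext_def using U by (intro margin) auto

lemma coefficient: "coefficient \<kappa> K \<xi>"
proof
  show "continuous_on {0<..} \<xi>"
    unfolding const_ext_def[abs_def] using U
    by (intro continuous_on_compose2[OF \<xi>s_cont]) (auto intro!: continuous_intros)
  fix r :: real assume "0 < r"
  then show "\<kappa> \<le> \<xi> r" "\<xi> r \<le> K" using \<xi>_margin[of r] \<epsilon> by auto
qed (rule \<kappa>)

sublocale stationary \<kappa> K \<xi> V
proof -
  interpret coefficient \<kappa> K \<xi> by (rule coefficient)
  have "j_minus < j_plus" using IJ by simp
  then have g: "g_fun \<xi> j_minus < g_fun \<xi> j_plus" using IJ by (subst g_fun_less_iff) auto
  \<comment> \<open>The end points suffice by monotonicity of \<open>g_fun\<close>. The resulting
    interval of noncritical heights supplies the positive level mass required by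
    \<open>stationary\<close>.\<close>
  have in_S: "{mu V \<xi> - g_fun \<xi> j_plus..mu V \<xi> - g_fun \<xi> j_minus} \<subseteq> {s_lo..s_hi}"
    using sJ[of j_minus] sJ[of j_plus] IJ by (auto simp: s_fun_def)
  obtain c C' where c: "0 < c" "\<And>s. s \<in> {s_lo..s_hi} \<Longrightarrow> ennreal c \<le> level_mass V s \<and> level_mass V s \<le> ennreal C'"
    using V S unfolding admissible_potential_def by meson
  show "stationary \<kappa> K \<xi> V"
  proof
    show "\<exists>a b c. a < b \<and> vmin V < a \<and> 0 < c \<and> (\<forall>s\<in>{a..b}. ennreal c \<le> level_mass V s)"
    proof (intro exI conjI ballI)
      show "mu V \<xi> - g_fun \<xi> j_plus < mu V \<xi> - g_fun \<xi> j_minus" using g by simp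
      show "vmin V < mu V \<xi> - g_fun \<xi> j_plus" using in_S g S by auto
      show "0 < c" by (rule c)
      fix s assume "s \<in> {mu V \<xi> - g_fun \<xi> j_plus..mu V \<xi> - g_fun \<xi> j_minus}"
      then show "ennreal c \<le> level_mass V s" using in_S c by blast
    qed
  qed (rule V)
qed

lemma h_measurable [measurable]: "h \<in> borel_measurable borel"
  using borel_measurable_continuous_on_indicator[OF _ \<xi>s_cont] by (simp add: h_def[abs_def])

lemma h_bound: "\<bar>h x\<bar> \<le> K"
  using margin[of x] \<kappa> \<epsilon> K by (auto simp: h_def indicator_def)

lemma square_integrable_bounded:
  assumes [measurable]: "f \<in> borel_measurable borel" and f: "\<And>x. \<bar>f x\<bar> \<le> b"
  shows "integrable lborel (\<lambda>r. indicator I r * (f r)\<^sup>2 :: real)"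
proof (rule Bochner_Integration.integrable_bound)
  show "integrable lborel (\<lambda>r. b\<^sup>2 * indicator I r :: real)"
    by (intro integrable_mult_right integrable_real_indicator emeasure_bounded_finite) auto
  have "(f r)\<^sup>2 \<le> b\<^sup>2" for r using f[of r] by (metis abs_ge_zero power2_abs power_mono)
  then show "AE r in lborel. norm (indicator I r * (f r)\<^sup>2) \<le> norm (b\<^sup>2 * indicator I r)"
    by (intro AE_I2) (auto simp: indicator_def)
qed simp

lemma in_class:
  assumes "f \<in> hoelder_ball \<beta> {0..U} H" "\<And>r. r \<in> {0..U} \<Longrightarrow> \<bar>f r - \<xi>s r\<bar> \<le> \<epsilon>" "\<And>r. r \<in> {0..U} - {j_minus..j_plus} \<Longrightarrow> f r = \<xi>s r"
  shows "f \<in> X"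
proof -
  have "\<kappa> \<le> f r \<and> f r \<le> K" if "r \<in> {0..U}" for r
    using assms(2)[OF that] margin[OF that] by (auto simp: abs_le_iff)
  then show ?thesis using assms(1,3) by (simp add: coeff_class_def)
qed

text \<open>
  Coefficients in the class are arbitrary beyond \<open>U\<close> and the laws do not depend on them there, so
  the loss on \<open>I - [0, U]\<close> cannot be made small.
\<close>

lemma lower_bound_outside:
  assumes out: "U < r_plus"
  shows "\<exists>Cs>0. \<forall>n\<ge>1. \<forall>T\<in>estimators n I. \<exists>f\<in>X.
      ennreal (1 / 8) \<le> emeasure (sample_law V U n f) {x \<in> space (sample_law V U n f). Cs * real n powr (- \<beta> / (2 * \<beta> + 3)) \<le> L2_norm_on I (\<lambda>r. T x r - f r)}
      \<and> {x \<in> space (sample_law V U n f). Cs * real n powr (- \<beta> / (2 * \<beta> + 3)) \<le> L2_norm_on I (\<lambda>r. T x r - f r)} \<in> sets (sample_law V U n f)"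
proof -
  define b where "b = max r_minus U"
  define l where "l = r_plus - b"
  have l: "0 < l" using out IJ by (simp add: l_def b_def)
  define f where "f \<omega> x = h x + (if 0 \<in> \<omega> then indicator {b<..r_plus} x else 0)" for \<omega> :: "nat set" and x
  define Cs where "Cs = sqrt (l / 32)"
  have Cs: "0 < Cs" using l by (simp add: Cs_def)
  have fin: "f \<omega> x = \<xi>s x" if "x \<in> {0..U}" for \<omega> x using that by (simp add: f_def h_def b_def)
  have fX: "f \<omega> \<in> X" for \<omega>
  proof (rule in_class)
    have "f \<omega> \<in> hoelder_ball \<beta> {0..U} (H / 2 + (hoelder_deg \<beta> + 2) * (0::real))"
      by (rule hoelder_ball_add[where B = "\<lambda>_ _. 0", OF _ ball]) (use U H fin in auto)
    then show "f \<omega> \<in> hoelder_ball \<beta> {0..U} H" using H by (auto intro: hoelder_ball_mono)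
  qed (use fin \<epsilon> in auto)
  have law: "sample_law V U n (f \<omega>) = PiM {..<n} (\<lambda>_. density lborel (\<lambda>x. ennreal (stat_density V \<xi> x)))" for n \<omega>
  proof -
    have "stat_law V (const_ext U (f \<omega>)) = stat_law V \<xi>"
      by (rule stat_law_cong) (use U in \<open>auto simp: const_ext_def fin\<close>)
    then show ?thesis by (simp add: sample_law_def stat_law_def)
  qed
  show ?thesis
  proof (intro exI[of _ Cs] conjI Cs allI impI ballI)
    fix n :: nat and T :: "(nat \<Rightarrow> real^'d) \<Rightarrow> real \<Rightarrow> real" assume n: "1 \<le> n" and T: "T \<in> estimators n I"
    define z where "z = real n powr (- \<beta> / (2 * \<beta> + 3))"
    have z: "0 \<le> z" "z \<le> 1"
    proof -
      have "- \<beta> / (2 * \<beta> + 3) \<le> 0" using \<beta> by simp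
      then have "z \<le> real n powr 0" unfolding z_def using n by (intro powr_mono) auto
      then show "0 \<le> z" "z \<le> 1" using n by (auto simp: z_def)
    qed
    \<comment> \<open>The loss beyond \<open>U\<close> does not decrease with \<open>n\<close>; the
      factor \<open>z\<^sup>2\<close> merely brings the threshold into the same form as in the other
      case.\<close>
    define s where "s = l * z\<^sup>2"
    have s: "0 \<le> s" "s \<le> l" using l z by (auto simp: s_def mult_left_le power_le_one)
    have thr: "sqrt (s * real 1 / 32) = Cs * z" using z l by (simp add: s_def Cs_def real_sqrt_mult real_sqrt_divide)
    \<comment> \<open>A cube with a single coordinate: both vertices have the same law, so the
      log-differences vanish and the budget is 0.\<close>
    have "\<exists>\<omega>\<subseteq>{..<1}. ennreal (1 / 8) \<le> emeasure (sample_law V U n (f \<omega>)) {x \<in> space (sample_law V U n (f \<omega>)). sqrt (s * real 1 / 32) \<le> L2_norm_on I (\<lambda>r. T x r - f \<omega> r)}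
     \<and> {x \<in> space (sample_law V U n (f \<omega>)). sqrt (s * real 1 / 32) \<le> L2_norm_on I (\<lambda>r. T x r - f \<omega> r)} \<in> sets (sample_law V U n (f \<omega>))"
    proof (rule hypercube_lower_bound[where C = "\<lambda>_. {b<..r_plus}" and base = h and g = "\<lambda>_ _. 1" and e = "\<lambda>_. 0" and p = "\<lambda>_. stat_density V \<xi>", OF zero_less_one n])
      show "disjoint_family_on (\<lambda>_. {b<..r_plus}) {..<1::nat}" by (auto simp: disjoint_family_on_def)
      show fm: "f \<omega> \<in> borel_measurable borel" for \<omega> unfolding f_def[abs_def] by measurable
      show "integrable lborel (\<lambda>r. indicator I r * (f \<omega> r)\<^sup>2)" for \<omega>
      proof (rule square_integrable_bounded[OF fm])
        show "\<bar>f \<omega> x\<bar> \<le> K + 1" for x using h_bound[of x] by (auto simp: f_def indicator_def)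
      qed
      show "integrable lborel (\<lambda>r. indicator I r * (h r)\<^sup>2)" using h_bound by (intro square_integrable_bounded[of _ K]) auto
      show "integrable lborel (\<lambda>r. indicator I r * 1\<^sup>2 :: real)" by (rule square_integrable_bounded[of _ 1]) auto
      show "s \<le> (\<integral>r. indicator {b<..r_plus} r * 1\<^sup>2 \<partial>lborel)" using s l by (simp add: l_def)
      show "f \<omega> x = h x + (if j \<in> \<omega> then 1 else 0)" if "j < 1" "x \<in> {b<..r_plus}" for \<omega> j x
        using that by (simp add: f_def)
    qed (use s T law stat_density_integrable stat_density_pos stat_density_integral in \<open>auto simp: b_def\<close>)
    then obtain \<omega> where "ennreal (1 / 8) \<le> emeasure (sample_law V U n (f \<omega>)) {x \<in> space (sample_law V U n (f \<omega>)). Cs * z \<le> L2_norm_on I (\<lambda>r. T x r - f \<omega> r)}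
     \<and> {x \<in> space (sample_law V U n (f \<omega>)). Cs * z \<le> L2_norm_on I (\<lambda>r. T x r - f \<omega> r)} \<in> sets (sample_law V U n (f \<omega>))"
      unfolding thr by blast
    then show "\<exists>f\<in>X.
      ennreal (1 / 8) \<le> emeasure (sample_law V U n f) {x \<in> space (sample_law V U n f). Cs * real n powr (- \<beta> / (2 * \<beta> + 3)) \<le> L2_norm_on I (\<lambda>r. T x r - f r)}
      \<and> {x \<in> space (sample_law V U n f). Cs * real n powr (- \<beta> / (2 * \<beta> + 3)) \<le> L2_norm_on I (\<lambda>r. T x r - f r)} \<in> sets (sample_law V U n f)"
      unfolding z_def[symmetric] by (intro bexI[of _ "f \<omega>"] fX)
  qed
qed

text \<open>Everything up to \<open>Cs\<close> is fixed before \<open>n\<close>; only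
  \<open>M\<close>, \<open>w\<close> and \<open>A = c0 * w powr \<beta>\<close> depend on it. As
  \<open>w \<le> 1\<close>, each smallness requirement of the cube follows from an inequality that
  is linear in \<open>c0\<close>.\<close>

lemma lower_bound_inside:
  assumes ins: "r_plus \<le> U"
  shows "\<exists>Cs>0. \<forall>n\<ge>1. \<forall>T\<in>estimators n I. \<exists>f\<in>X.
      ennreal (1 / 8) \<le> emeasure (sample_law V U n f) {x \<in> space (sample_law V U n f). Cs * real n powr (- \<beta> / (2 * \<beta> + 3)) \<le> L2_norm_on I (\<lambda>r. T x r - f r)}
      \<and> {x \<in> space (sample_law V U n f). Cs * real n powr (- \<beta> / (2 * \<beta> + 3)) \<le> L2_norm_on I (\<lambda>r. T x r - f r)} \<in> sets (sample_law V U n f)"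
proof -
  text \<open>As \<open>g\<close> is normalised at 1, no cell may contain 1.\<close>
  define r1 where "r1 = (if r_minus < 1 \<and> 1 < r_plus then 1 else r_minus)"
  define r2 where "r2 = r_plus"
  have r12: "0 < r1" "r1 < r2" "1 \<notin> {r1<..<r2}" "r_minus \<le> r1" "r2 \<le> U" "r2 = r_plus" "j_minus < r1" "r2 < j_plus"
    using IJ ins by (auto simp: r1_def r2_def)
  let ?m = "hoelder_deg \<beta>"
  obtain \<Phi> c d where \<Phi>: "bumps ?m \<Phi> c d"
    using bump_profile[of ?m] unfolding bumps_def by metis
  interpret bumps ?m \<Phi> c d by (rule \<Phi>)
  define \<Lambda> where "\<Lambda> = r2 * K\<^sup>2 / (r1 * \<kappa>\<^sup>2)"
  have \<Lambda>: "0 < \<Lambda>" using r12 K \<kappa> by (simp add: \<Lambda>_def)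
  define D1 where "D1 = 2 * c * (1 + \<Lambda>) / (r1 * \<kappa>\<^sup>2)"
  define M1 where "M1 = 4 * K * r2 * C / (r1 * \<kappa>) / \<kappa>"
  have D1: "0 < D1" using c \<Lambda> r12 \<kappa> by (simp add: D1_def)
  have M1: "0 \<le> M1" using K r12 C \<kappa> by (simp add: M1_def)
  define Z where "Z = measure lborel {x. mu V \<xi> - V x \<in> {g_fun \<xi> r1..g_fun \<xi> r2}}"
  define cs where "cs = (\<integral>x. stat_density V \<xi> x \<partial>lborel)"
  have cs: "1 \<le> cs" unfolding cs_def by (rule stat_density_integral)
  \<comment> \<open>The total error budget, \<open>n\<close> times the sum over all bumps, will be
    at most \<open>M * c0\<^sup>2 * Q\<close>. The first term is the local change, with
    \<open>4 / (r2 - r1)\<close> from \<open>1 / w = 4 * M / (r2 - r1)\<close>; the second is the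
    shift of \<open>mu\<close>.\<close>
  define Q where "Q = 2 * K\<^sup>2 * r2 * Z * D1\<^sup>2 * (4 / (r2 - r1)) + 6 * K\<^sup>2 * cs * (M1 * D1)\<^sup>2"
  have Q: "0 \<le> Q" unfolding Q_def using r12 cs by (simp add: Z_def)
  \<comment> \<open>The room in height between \<open>{r1..r2}\<close> and the ends of the larger
    interval: heights moved by less than this stay where \<open>level_mass\<close> is bounded by
    \<open>C\<close>.\<close>
  define \<delta>0 where "\<delta>0 = min (g_fun \<xi> j_plus - g_fun \<xi> r2) (g_fun \<xi> r1 - g_fun \<xi> j_minus)"
  have \<delta>0: "0 < \<delta>0"
    using g_fun_less_iff[of r2 j_plus] g_fun_less_iff[of j_minus r1] r12 IJ by (simp add: \<delta>0_def)
  \<comment> \<open>In order: the margin, the Hoelder radius, the log-differences from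
    \<open>g\<close> and from \<open>mu\<close>, the separation of the slabs, the range of heights,
    and the error budget.\<close>
  have "\<forall>\<^sub>F c0 in at_right 0. c0 * (c * (1 + \<Lambda>)) \<le> \<epsilon> \<and> c0 * ((?m + 2) * 4 * c * (1 + \<Lambda>)) \<le> H / 2
    \<and> c0 * (K * D1) \<le> 1/2 \<and> c0 * (K * (M1 * D1)) \<le> 1/2 \<and> c0 * D1 \<le> 1 / (K * r2) \<and> c0 * D1 \<le> \<delta>0 \<and> c0 * Q \<le> 1/4 \<and> c0 * 1 \<le> 1 \<and> 0 < c0"
    (is "\<forall>\<^sub>F c0 in _. ?small c0")
  proof -
    have "0 < 1 / (K * r2)" "0 < H / 2" using K r12 H by auto
    then show ?thesis using \<epsilon> \<delta>0 by (intro eventually_conj eventually_small eventually_at_right_less) simp_all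
  qed
  then have "\<exists>c0. ?small c0" by (rule eventually_happens'[OF trivial_limit_at_right_real])
  then obtain c0 where "?small c0" ..
  then have c0: "c0 * (c * (1 + \<Lambda>)) \<le> \<epsilon>" "c0 * ((?m + 2) * 4 * c * (1 + \<Lambda>)) \<le> H / 2"
    "c0 * (K * D1) \<le> 1/2" "c0 * (K * (M1 * D1)) \<le> 1/2" "c0 * D1 \<le> 1 / (K * r2)" "c0 * D1 \<le> \<delta>0" "c0 * Q \<le> 1/4" "c0 \<le> 1" "0 < c0"
    by simp_all
  define l where "l = r2 - r1"
  have l: "0 < l" using r12 by (simp add: l_def)
  \<comment> \<open>Since \<open>m0\<close> is at least the length \<open>l\<close>, using
    \<open>m0 * N\<close> cells gives \<open>w * y \<le> 1\<close>, and in particular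
    \<open>w \<le> 1\<close>.\<close>
  define m0 where "m0 = nat \<lceil>max 1 l\<rceil>"
  have m0: "1 \<le> real m0" "l \<le> real m0" "0 < m0" unfolding m0_def by linarith+
  \<comment> \<open>As \<open>N \<le> 2 * y\<close>, the width \<open>w\<close> is at least
    \<open>l / (8 * m0 * y)\<close>, which gives the power. The 256 is the 32 of the threshold
    \<open>sqrt (s * M / 32)\<close> times the 8 in \<open>w / 2 = l / (8 * M)\<close>.\<close>
  define Cs where "Cs = sqrt (c0\<^sup>2 * d\<^sup>2 * l * (l / (8 * m0)) powr (2 * \<beta>) / 256)"
  have Cs: "0 < Cs" using c0 d l m0 by (simp add: Cs_def)
  show ?thesis
  proof (intro exI[of _ Cs] conjI Cs allI impI ballI)
    fix n :: nat and T :: "(nat \<Rightarrow> real^'d) \<Rightarrow> real \<Rightarrow> real" assume n: "1 \<le> n" and T: "T \<in> estimators n I"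
    define y where "y = real n powr (1 / (2 * \<beta> + 3))"
    have y1: "1 \<le> y" unfolding y_def using n \<beta> by (intro ge_one_powr_ge_zero) auto
    define N where "N = nat \<lceil>y\<rceil>"
    note N = ceiling_root_bounds[OF y1, folded N_def]
    define M where "M = m0 * N"
    have M: "0 < M" using m0 N by (simp add: M_def)
    define w where "w = l / (4 * M)"
    have w0: "0 < w" using l M by (simp add: w_def)
    have wy: "w * y \<le> 1"
    proof -
      have "l * y \<le> real m0 * real N" using m0 N l y1 by (intro mult_mono) auto
      also have "\<dots> \<le> 4 * real M" by (simp add: M_def)
      finally have "l * y \<le> 4 * real M" .
      then show ?thesis using M by (simp add: w_def field_simps)
    qed
    have w1: "w \<le> 1"
    proof -
      have "w * 1 \<le> w * y" using w0 y1 by (intro mult_left_mono) auto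
      then show ?thesis using wy by simp
    qed
    have yn: "y powr (2 * \<beta> + 3) = real n" unfolding y_def using \<beta> n by (simp add: powr_powr)
    have nw: "n * w powr (2 * \<beta> + 3) \<le> 1"
    proof -
      have "n * w powr (2 * \<beta> + 3) = (w * y) powr (2 * \<beta> + 3)"
      proof -
        have eq: "(w * y) powr (2 * \<beta> + 3) = w powr (2 * \<beta> + 3) * y powr (2 * \<beta> + 3)"
          by (rule powr_mult)
        show ?thesis unfolding eq yn by (rule mult.commute)
      qed
      also have "\<dots> \<le> 1" using wy w0 y1 \<beta> by (intro powr_le1) auto
      finally show ?thesis .
    qed
    define A where "A = c0 * w powr \<beta>"
    have wb: "w powr \<beta> \<le> 1" "0 \<le> w powr \<beta>" using w0 w1 \<beta> by (auto intro: powr_le1)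
    have A: "0 \<le> A" "A \<le> c0" using c0 wb by (auto simp: A_def mult_left_le)
    have cube: "cube ?m \<Phi> c d \<kappa> K \<xi> V \<epsilon> r1 r2 A M"
    proof
      show "A * c * (1 + r2 * K\<^sup>2 / (r1 * \<kappa>\<^sup>2)) \<le> \<epsilon>"
      proof -
        have "A * (c * (1 + \<Lambda>)) \<le> c0 * (c * (1 + \<Lambda>))" using A c \<Lambda> by (intro mult_right_mono) auto
        then show ?thesis using c0(1) by (simp add: \<Lambda>_def mult.assoc)
      qed
    qed (use \<xi>_margin r12 M A in auto)
    interpret Q: cube ?m \<Phi> c d \<kappa> K \<xi> V \<epsilon> r1 r2 A M by (rule cube)
    have Qw: "Q.w = w" by (simp add: Q.w_def w_def l_def)
    have Q\<Lambda>: "Q.\<Lambda> = \<Lambda>" by (simp add: Q.\<Lambda>_def \<Lambda>_def)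
    have QD: "Q.D = A * w * D1" by (simp add: Q.D_def Qw Q\<Lambda> D1_def)
    have QM: "Q.Mu C = A * w\<^sup>2 * (M1 * D1)" by (simp add: Q.Mu_def QD Qw M1_def power2_eq_square)
    have w2: "w\<^sup>2 \<le> 1" using w0 w1 by (simp add: power_le_one)
    have Aw: "A * w \<le> c0 * w" "A * w \<le> c0" "A * w\<^sup>2 \<le> c0"
      using A w0 w1 w2 c0 mult_mono[of A c0 w 1] mult_mono[of A c0 "w\<^sup>2" 1] by (auto intro: mult_right_mono)
    have KD: "K * Q.D \<le> 1/2"
    proof -
      have "A * w * (K * D1) \<le> c0 * (K * D1)" using K D1 by (intro mult_right_mono[OF Aw(2)]) auto
      then show ?thesis using c0(3) by (simp add: QD mult_ac)
    qed
    have KM: "K * Q.Mu C \<le> 1/2"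
    proof -
      have "A * w\<^sup>2 * (K * (M1 * D1)) \<le> c0 * (K * (M1 * D1))" using K D1 M1 by (intro mult_right_mono[OF Aw(3)]) auto
      then show ?thesis using c0(4) by (simp add: QM mult_ac)
    qed
    have Dw: "Q.D \<le> Q.w / (K * r2)"
    proof -
      have "A * w * D1 \<le> c0 * w * D1" using D1 by (intro mult_right_mono[OF Aw(1)]) auto
      also have "\<dots> = w * (c0 * D1)" by simp
      also have "\<dots> \<le> w * (1 / (K * r2))" using c0(5) w0 by (intro mult_left_mono) auto
      finally show ?thesis by (simp add: QD Qw)
    qed
    have D\<delta>: "Q.D \<le> \<delta>0"
    proof -
      have "A * w * D1 \<le> c0 * D1" using D1 by (intro mult_right_mono[OF Aw(2)]) auto
      then show ?thesis using c0(6) by (simp add: QD)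
    qed
    have lev: "level_mass V s \<le> ennreal C" if "s \<in> {mu V \<xi> - g_fun \<xi> r2 - Q.D..mu V \<xi> - g_fun \<xi> r1 + Q.D}" for s
    proof (rule C(2))
      have "mu V \<xi> - g_fun \<xi> j_plus \<in> {s_lo..s_hi}" "mu V \<xi> - g_fun \<xi> j_minus \<in> {s_lo..s_hi}"
        using sJ[of j_plus] sJ[of j_minus] IJ by (auto simp: s_fun_def)
      then show "s \<in> {s_lo..s_hi}" using that D\<delta> by (auto simp: \<delta>0_def)
    qed
    have budget: "n * (2 * K\<^sup>2 * Q.D\<^sup>2 * r2 * measure lborel Q.zone + M * (6 * K\<^sup>2 * (Q.Mu C)\<^sup>2 * (\<integral>x. stat_density V \<xi> x \<partial>lborel))) \<le> M / 4"
    proof -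
      have Zz: "measure lborel Q.zone = Z" by (simp add: Z_def Q.zone_def)
      have A2: "A\<^sup>2 = c0\<^sup>2 * w powr (2 * \<beta>)"
        using w0 by (simp add: A_def power_mult_distrib powr_add[symmetric] power2_eq_square)
      have nDw: "n * A\<^sup>2 * w\<^sup>2 * w \<le> c0\<^sup>2"
      proof -
        have "w\<^sup>2 * w = w powr 3" using w0 by (simp add: powr_numeral power3_eq_cube power2_eq_square)
        then have "n * A\<^sup>2 * w\<^sup>2 * w = c0\<^sup>2 * (n * w powr (2 * \<beta> + 3))"
          by (simp add: A2 powr_add mult_ac)
        also have "\<dots> \<le> c0\<^sup>2 * 1" using nw by (intro mult_left_mono) auto
        finally show ?thesis by simp
      qed
      have wM: "1 / w = M * (4 / (r2 - r1))" using M l by (simp add: w_def l_def)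
      have t1: "n * A\<^sup>2 * w\<^sup>2 \<le> c0\<^sup>2 * (M * (4 / (r2 - r1)))"
        unfolding wM[symmetric] using nDw w0 by (simp add: field_simps)
      have t2: "n * A\<^sup>2 * w ^ 4 \<le> c0\<^sup>2"
      proof -
        have "n * A\<^sup>2 * w ^ 4 = (n * A\<^sup>2 * w\<^sup>2 * w) * w" by (simp add: power2_eq_square power4_eq_xxxx)
        also have "\<dots> \<le> c0\<^sup>2 * 1" using nDw w0 w1 by (intro mult_mono) auto
        finally show ?thesis by simp
      qed
      have "n * (2 * K\<^sup>2 * Q.D\<^sup>2 * r2 * measure lborel Q.zone + M * (6 * K\<^sup>2 * (Q.Mu C)\<^sup>2 * (\<integral>x. stat_density V \<xi> x \<partial>lborel)))
        = (2 * K\<^sup>2 * r2 * Z * D1\<^sup>2) * (n * A\<^sup>2 * w\<^sup>2) + M * (6 * K\<^sup>2 * cs * (M1 * D1)\<^sup>2) * (n * A\<^sup>2 * w ^ 4)"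
        by (simp add: QD QM Zz cs_def[symmetric] power_mult_distrib algebra_simps flip: power_mult)
      also have "\<dots> \<le> (2 * K\<^sup>2 * r2 * Z * D1\<^sup>2) * (c0\<^sup>2 * (M * (4 / (r2 - r1)))) + M * (6 * K\<^sup>2 * cs * (M1 * D1)\<^sup>2) * c0\<^sup>2"
        using t1 t2 r12 cs by (intro add_mono mult_left_mono) (auto simp: Z_def)
      also have "\<dots> = M * (c0 * (c0 * Q))" by (simp add: Q_def power2_eq_square algebra_simps)
      also have "\<dots> \<le> M * (1 * (1/4))" using c0 Q by (intro mult_left_mono mult_mono) auto
      finally show ?thesis by simp
    qed
    define f where "f \<omega> x = h x + (\<Sum>j\<in>\<omega>. Q.B j x)" for \<omega> :: "nat set" and x
    have fX: "f \<omega> \<in> X" if \<omega>: "\<omega> \<subseteq> {..<M}" for \<omega>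
    proof (rule in_class)
      have fin: "finite \<omega>" using \<omega> finite_subset by blast
      \<comment> \<open>The positive halves form one train and the negative halves another, added
        one after the other; their amplitudes are at most \<open>c0 * w powr \<beta>\<close> and
        \<open>\<Lambda> * c0 * w powr \<beta>\<close>.\<close>
      let ?L = "\<lambda>x. \<xi>s x + train r1 w \<omega> (\<lambda>_. A) (\<lambda>j. 4 * j + 1) 0 x"
      have L: "?L \<in> hoelder_ball \<beta> {0..U} (H / 2 + (?m + 2) * (4 * c0 * c))"
        by (rule train_hoelder_ball[OF \<beta> refl _ ball _ _ fin _ w0 w1]) (use U H c0 A in \<open>auto simp: A_def inj_on_def\<close>)
      have "f \<omega> \<in> hoelder_ball \<beta> {0..U} (H / 2 + (?m + 2) * (4 * c0 * c) + (?m + 2) * (4 * (\<Lambda> * c0) * c))"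
      proof (rule train_hoelder_ball[OF \<beta> refl _ L _ _ fin _ w0 w1])
        show "f \<omega> x = ?L x + train r1 w \<omega> (\<lambda>j. - (Q.scale j * A)) (\<lambda>j. 4 * j + 2) 0 x" if "x \<in> {0..U}" for x
        proof -
          have "(\<Sum>j\<in>\<omega>. Q.B j x) = train r1 w \<omega> (\<lambda>_. A) (\<lambda>j. 4 * j + 1) 0 x + train r1 w \<omega> (\<lambda>j. - (Q.scale j * A)) (\<lambda>j. 4 * j + 2) 0 x"
            unfolding train_def sum.distrib[symmetric]
            by (intro sum.cong refl) (simp add: Q.B_def Q.bump_def Q.up_def Q.down_def Qw)
          then show ?thesis using that by (simp add: f_def h_def)
        qed
        show "\<bar>- (Q.scale j * A)\<bar> \<le> \<Lambda> * c0 * w powr \<beta>" if "j \<in> \<omega>" for j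
        proof -
          have "j < M" using that \<omega> by auto
          from Q.scale(1,2)[OF this] have "Q.scale j * A \<le> \<Lambda> * A" "0 \<le> Q.scale j * A"
            using A by (auto simp: Q\<Lambda> intro: mult_right_mono)
          then show ?thesis by (simp add: A_def)
        qed
      qed (use U H c0 c \<Lambda> in \<open>auto simp: inj_on_def\<close>)
      moreover have "H / 2 + (?m + 2) * (4 * c0 * c) + (?m + 2) * (4 * (\<Lambda> * c0) * c) \<le> H"
        using c0(2) by (simp add: algebra_simps)
      ultimately show "f \<omega> \<in> hoelder_ball \<beta> {0..U} H" by (rule hoelder_ball_mono)
      show "\<bar>f \<omega> r - \<xi>s r\<bar> \<le> \<epsilon>" if "r \<in> {0..U}" for r
        using Q.sum_B_bound[OF \<omega>, of r] that by (simp add: f_def h_def)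
      show "f \<omega> r = \<xi>s r" if "r \<in> {0..U} - {j_minus..j_plus}" for r
      proof -
        have "(\<Sum>j\<in>\<omega>. Q.B j r) = 0"
        proof (rule Q.sum_B_inactive)
          fix j assume "j \<in> \<omega>"
          then have "j < M" using \<omega> by auto
          then show "r \<notin> {Q.left j<..<Q.right j}" using Q.cell_bounds[of j] Q.w r12 that by auto
        qed
        then show ?thesis using that by (simp add: f_def h_def)
      qed
    qed
    have law: "sample_law V U n (f \<omega>) = PiM {..<n} (\<lambda>_. stat_law V (Q.\<eta> \<omega>))" if \<omega>: "\<omega> \<subseteq> {..<M}" for \<omega>
    proof -
      have "stat_law V (const_ext U (f \<omega>)) = stat_law V (Q.\<eta> \<omega>)"
      proof (rule stat_law_cong)
        fix r :: real assume r: "0 < r"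
        \<comment> \<open>The constant extension does not affect the bumps, because their supports
          end before \<open>U\<close>.\<close>
        have "(\<Sum>j\<in>\<omega>. Q.B j (min r U)) = (\<Sum>j\<in>\<omega>. Q.B j r)"
        proof (rule sum.cong[OF refl])
          fix j assume "j \<in> \<omega>"
          then have "j < M" using \<omega> by auto
          then have "Q.right j \<le> U" using Q.cell_bounds[of j] Q.w r12 by auto
          then show "Q.B j (min r U) = Q.B j r"
            using Q.B_support[of r j] Q.B_support[of U j] by (cases "r \<le> U") auto
        qed
        moreover have "h (min r U) = \<xi> r" using r U by (simp add: h_def const_ext_def)
        ultimately show "const_ext U (f \<omega>) r = Q.\<eta> \<omega> r"
          by (simp add: Q.\<eta>_def f_def const_ext_def[of U "f \<omega>"])
      qed
      then show ?thesis by (simp add: sample_law_def)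
    qed
    define z where "z = real n powr (- \<beta> / (2 * \<beta> + 3))"
    have z0: "0 < z" unfolding z_def using n by simp
    have zy: "z\<^sup>2 = (1 / y) powr (2 * \<beta>)"
      using n \<beta> by (simp add: z_def y_def power2_eq_square powr_add[symmetric] powr_powr powr_divide powr_minus[symmetric] add_divide_distrib[symmetric] divide_inverse[symmetric] flip: powr_minus_divide)
    define s where "s = 32 * Cs\<^sup>2 * z\<^sup>2 / M"
    have s0: "0 \<le> s" by (simp add: s_def)
    have thr: "sqrt (s * M / 32) = Cs * z" using Cs z0 M by (simp add: s_def real_sqrt_mult)
    have s1: "s \<le> A\<^sup>2 * d\<^sup>2 * Q.w / 2"
    proof -
      have Cs2: "Cs\<^sup>2 = c0\<^sup>2 * d\<^sup>2 * l * (l / (8 * m0)) powr (2 * \<beta>) / 256"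
        unfolding Cs_def using l by (intro real_sqrt_pow2) simp
      have "l / (8 * m0) * (1 / y) \<le> w"
      proof -
        have "4 * M \<le> 8 * m0 * y" using N(2) m0 by (simp add: M_def)
        then have "l / (8 * m0 * y) \<le> l / (4 * M)" using l M m0 y1 by (intro divide_left_mono) auto
        then show ?thesis by (simp add: w_def)
      qed
      then have "(l / (8 * m0) * (1 / y)) powr (2 * \<beta>) \<le> w powr (2 * \<beta>)"
        using l m0 y1 \<beta> by (intro powr_mono2) auto
      then have p: "(l / (8 * m0)) powr (2 * \<beta>) * z\<^sup>2 \<le> w powr (2 * \<beta>)"
        unfolding zy using l m0 y1 by (subst powr_mult[symmetric]) auto
      have "s = c0\<^sup>2 * d\<^sup>2 * l / (8 * M) * ((l / (8 * m0)) powr (2 * \<beta>) * z\<^sup>2)"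
        by (simp add: s_def Cs2)
      also have "\<dots> \<le> c0\<^sup>2 * d\<^sup>2 * l / (8 * M) * w powr (2 * \<beta>)"
        using p l by (intro mult_left_mono) auto
      also have "\<dots> = A\<^sup>2 * d\<^sup>2 * w / 2"
      proof -
        have eq: "c0\<^sup>2 * d\<^sup>2 * l / (8 * M) = c0\<^sup>2 * d\<^sup>2 * w / 2" by (simp add: w_def)
        have eq': "A\<^sup>2 = c0\<^sup>2 * w powr (2 * \<beta>)"
          using w0 by (simp add: A_def power_mult_distrib powr_add[symmetric] power2_eq_square)
        show ?thesis unfolding eq eq' by simp
      qed
      finally show ?thesis by (simp add: Qw)
    qed
    have "\<exists>\<omega>\<subseteq>{..<M}. ennreal (1 / 8) \<le> emeasure (sample_law V U n (f \<omega>)) {x \<in> space (sample_law V U n (f \<omega>)). sqrt (s * M / 32) \<le> L2_norm_on I (\<lambda>r. T x r - f \<omega> r)}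
     \<and> {x \<in> space (sample_law V U n (f \<omega>)). sqrt (s * M / 32) \<le> L2_norm_on I (\<lambda>r. T x r - f \<omega> r)} \<in> sets (sample_law V U n (f \<omega>))"
    proof (rule Q.cube_minimax[where law = "\<lambda>\<omega>. sample_law V U n (f \<omega>)", OF KD KM Dw C(1) lev n budget refl _ h_measurable _ f_def law s0 s1 T])
      show "{r1..r2} \<subseteq> I" using r12 by auto
      show "integrable lborel (\<lambda>r. indicator I r * (h r)\<^sup>2)" using h_bound by (intro square_integrable_bounded[of _ K]) auto
    qed
    then obtain \<omega> where \<omega>: "\<omega> \<subseteq> {..<M}" and res: "ennreal (1 / 8) \<le> emeasure (sample_law V U n (f \<omega>)) {x \<in> space (sample_law V U n (f \<omega>)). Cs * z \<le> L2_norm_on I (\<lambda>r. T x r - f \<omega> r)}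
     \<and> {x \<in> space (sample_law V U n (f \<omega>)). Cs * z \<le> L2_norm_on I (\<lambda>r. T x r - f \<omega> r)} \<in> sets (sample_law V U n (f \<omega>))"
      unfolding thr by blast
    show "\<exists>f\<in>X.
      ennreal (1 / 8) \<le> emeasure (sample_law V U n f) {x \<in> space (sample_law V U n f). Cs * real n powr (- \<beta> / (2 * \<beta> + 3)) \<le> L2_norm_on I (\<lambda>r. T x r - f r)}
      \<and> {x \<in> space (sample_law V U n f). Cs * real n powr (- \<beta> / (2 * \<beta> + 3)) \<le> L2_norm_on I (\<lambda>r. T x r - f r)} \<in> sets (sample_law V U n f)"
      unfolding z_def[symmetric] by (rule bexI[of _ "f \<omega>"], rule res, rule fX[OF \<omega>])
  qed
qed

end

theorem theorem7p2:
  fixes V :: "real^'d \<Rightarrow> real"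
    and \<kappa> K U \<beta> H r_minus r_plus j_minus j_plus :: real
    and \<xi>s :: "real \<Rightarrow> real"
    and I J :: "real set"
  assumes "admissible_potential V"
    and "0 < \<kappa>" and "\<kappa> < K"
    and "U \<ge> max 1 (inverse (LINT x|lborel. exp (- K * (V x - vmin V))))"
    and "\<beta> > 1"
    and "\<xi>s \<in> hoelder_ball \<beta> {0..U} (H / 2)"
    and "\<exists>\<epsilon>0>0. \<forall>r\<in>{0..U}. \<kappa> + \<epsilon>0 \<le> \<xi>s r \<and> \<xi>s r \<le> K - \<epsilon>0"
    and "I = {r_minus..r_plus}" and "r_minus < r_plus"
    and "J = {j_minus..j_plus}"
    and "compactly_inside I J"
    and "compactly_inside J {0<..<max_density V (const_ext U \<xi>s)}"
  shows "\<exists>C_risk>0. \<exists>C_sep>0. \<exists>p::real. 0 < p \<and> p < 1 \<and>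
    (\<forall>\<xi>0 \<in> coeff_class \<beta> H \<kappa> K U \<xi>s J. \<forall>\<xi>1 \<in> coeff_class \<beta> H \<kappa> K U \<xi>s J.
     \<forall>s_lo s_hi S_J C_VJ.
       S_J = {s_lo..s_hi} \<longrightarrow> s_lo \<le> s_hi \<longrightarrow> S_J \<subseteq> {vmin V<..} \<longrightarrow>
       S_J \<inter> critical_values V = {} \<longrightarrow>
       s_fun V (const_ext U \<xi>s) ` J \<subseteq> S_J \<longrightarrow>
       (\<forall>t\<in>{0..1}. s_fun V (interp_coeff (const_ext U \<xi>0) (const_ext U \<xi>1) t) ` J \<subseteq> S_J) \<longrightarrow>
       (\<forall>s\<in>S_J. level_mass V s \<le> ennreal C_VJ) \<longrightarrow>
       (\<forall>r\<in>{0..U} - J. G_fun (const_ext U \<xi>0) (const_ext U \<xi>1) r = 0) \<longrightarrow>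
       (\<forall>r\<in>{0..U}. \<bar>G_fun (const_ext U \<xi>0) (const_ext U \<xi>1) r\<bar>
          \<le> ln 2 / (K * (1 + C_VJ * (j_plus - j_minus) * inverse \<kappa>))) \<longrightarrow>
       (\<forall>n\<ge>1.
          (INF T \<in> estimators n I. SUP \<xi> \<in> coeff_class \<beta> H \<kappa> K U \<xi>s J.
             \<integral>\<^sup>+ x. ennreal ((L2_norm_on I (\<lambda>r. T x r - \<xi> r))\<^sup>2) \<partial>sample_law V U n \<xi>)
           \<ge> ennreal (C_risk * real n powr (- (2 * \<beta>) / (2 * \<beta> + 3))) \<and>
          (INF T \<in> estimators n I. SUP \<xi> \<in> coeff_class \<beta> H \<kappa> K U \<xi>s J.
             emeasure (sample_law V U n \<xi>)
               {x \<in> space (sample_law V U n \<xi>).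
                  L2_norm_on I (\<lambda>r. T x r - \<xi> r) \<ge> C_sep * real n powr (- \<beta> / (2 * \<beta> + 3))})
           \<ge> ennreal p))"
proof -
  note V = assms(1) and \<kappa> = assms(2) and \<beta> = assms(5) and ball = assms(6)
  have U: "1 \<le> U" using assms(4) by simp
  obtain \<epsilon> where \<epsilon>: "0 < \<epsilon>" "\<And>r. r \<in> {0..U} \<Longrightarrow> \<kappa> + \<epsilon> \<le> \<xi>s r \<and> \<xi>s r \<le> K - \<epsilon>"
    using assms(7) by blast
  have "{r_minus..r_plus} \<subseteq> {j_minus<..<j_plus}"
    using assms(11) by (simp add: assms(8,10) compactly_inside_def interior_atLeastAtMost_real)
  moreover have "r_minus \<in> {r_minus..r_plus}" "r_plus \<in> {r_minus..r_plus}" using assms(9) by auto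
  ultimately have IJ: "j_minus < r_minus" "r_plus < j_plus" by auto
  have "J \<subseteq> {0<..}"
    using assms(12) interior_subset unfolding compactly_inside_def by fastforce
  moreover have "j_minus \<in> J" using IJ assms(9) by (simp add: assms(10))
  ultimately have j0: "0 < j_minus" by auto
  \<comment> \<open>The constants have to be chosen before the interval of heights is given. Whether
    some suitable interval exists does not depend on the later quantifiers: if so, one fixed choice
    yields the constant, otherwise the claim is vacuous and any constant will do.\<close>
  define hyp where "hyp \<longleftrightarrow> (\<exists>s_lo s_hi C. vmin V < s_lo \<and> s_lo \<le> s_hi \<and> {s_lo..s_hi} \<inter> critical_values V = {} \<and>
    (\<forall>r\<in>J. s_fun V (const_ext U \<xi>s) r \<in> {s_lo..s_hi}) \<and> (\<forall>s\<in>{s_lo..s_hi}. level_mass V s \<le> ennreal C))"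
  define bound where "bound Cs \<longleftrightarrow> (\<forall>n\<ge>1. \<forall>T\<in>estimators n I. \<exists>f\<in>coeff_class \<beta> H \<kappa> K U \<xi>s J.
      ennreal (1 / 8) \<le> emeasure (sample_law V U n f) {x \<in> space (sample_law V U n f). Cs * real n powr (- \<beta> / (2 * \<beta> + 3)) \<le> L2_norm_on I (\<lambda>r. T x r - f r)}
      \<and> {x \<in> space (sample_law V U n f). Cs * real n powr (- \<beta> / (2 * \<beta> + 3)) \<le> L2_norm_on I (\<lambda>r. T x r - f r)} \<in> sets (sample_law V U n f))" for Cs
  have "\<exists>Cs>0. hyp \<longrightarrow> bound Cs"
  proof (cases hyp)
    case True
    then obtain s_lo s_hi C where S: "vmin V < s_lo" "s_lo \<le> s_hi" "{s_lo..s_hi} \<inter> critical_values V = {}"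
      "\<And>r. r \<in> J \<Longrightarrow> s_fun V (const_ext U \<xi>s) r \<in> {s_lo..s_hi}" "\<And>s. s \<in> {s_lo..s_hi} \<Longrightarrow> level_mass V s \<le> ennreal C"
      unfolding hyp_def by blast
    \<comment> \<open>\<open>C\<close> might be negative, in which case \<open>ennreal C\<close> is
      0; \<open>max 0 C\<close> is nonnegative and gives the same bound.\<close>
    have "problem V \<kappa> K U \<beta> H \<epsilon> r_minus r_plus j_minus j_plus s_lo s_hi (max 0 C) \<xi>s"
    proof
      show "level_mass V s \<le> ennreal (max 0 C)" if "s \<in> {s_lo..s_hi}" for s
        using S(5)[OF that] by (rule order_trans) (simp add: ennreal_leI)
    qed (use V \<kappa> U \<beta> ball \<epsilon> j0 IJ assms(9) S(1-4) in \<open>auto simp: assms(10)\<close>)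
    then interpret problem V \<kappa> K U \<beta> H \<epsilon> r_minus r_plus j_minus j_plus s_lo s_hi "max 0 C" \<xi>s .
    have "\<exists>Cs>0. bound Cs"
    proof (cases "r_plus \<le> U")
      case True
      then show ?thesis unfolding bound_def assms(8,10) by (rule lower_bound_inside)
    next
      case False
      then have "U < r_plus" by simp
      then show ?thesis unfolding bound_def assms(8,10) by (rule lower_bound_outside)
    qed
    then show ?thesis by blast
  qed (auto intro: exI[of _ 1])
  then obtain Cs where Cs: "0 < Cs" and low: "hyp \<longrightarrow> bound Cs" by blast
  \<comment> \<open>The loss exceeds the separation with probability at least 1/8, so Markov's
    inequality turns the separation constant \<open>Cs\<close> into the risk constant
    \<open>Cs\<^sup>2 / 8\<close>.\<close>
  show ?thesis
  proof (rule exI[of _ "Cs\<^sup>2 / 8"], rule conjI, use Cs in simp, rule exI[of _ Cs], rule conjI, rule Cs,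
      rule exI[of _ "1 / 8"], intro conjI, simp, simp, intro ballI allI impI conjI)
    fix \<xi>0 \<xi>1 :: "real \<Rightarrow> real" and s_lo s_hi :: real and S_J C_VJ and n :: nat
    assume S: "S_J = {s_lo..s_hi}" "s_lo \<le> s_hi" "S_J \<subseteq> {vmin V<..}" "S_J \<inter> critical_values V = {}"
      "s_fun V (const_ext U \<xi>s) ` J \<subseteq> S_J" "\<forall>s\<in>S_J. level_mass V s \<le> ennreal C_VJ" and n: "1 \<le> n"
    have "s_lo \<in> S_J" using S(1,2) by simp
    then have "vmin V < s_lo" using S(3) by blast
    have hyp
      unfolding hyp_def
    proof (intro exI conjI)
      show "{s_lo..s_hi} \<inter> critical_values V = {}" using S(1,4) by simp
      show "\<forall>r\<in>J. s_fun V (const_ext U \<xi>s) r \<in> {s_lo..s_hi}" using S(1,5) by blast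
      show "\<forall>s\<in>{s_lo..s_hi}. level_mass V s \<le> ennreal C_VJ" using S(1,6) by simp
    qed fact+
    with low have "bound Cs" by blast
    note low = this[unfolded bound_def, rule_format, OF n]
    have \<delta>: "0 \<le> Cs * real n powr (- \<beta> / (2 * \<beta> + 3))" using Cs by simp
    have "(Cs * real n powr (- \<beta> / (2 * \<beta> + 3)))\<^sup>2 / 8 = Cs\<^sup>2 / 8 * real n powr (- (2 * \<beta>) / (2 * \<beta> + 3))"
      by (simp add: power_mult_distrib power2_eq_square powr_add[symmetric] add_divide_distrib[symmetric])
    then show "ennreal (Cs\<^sup>2 / 8 * real n powr (- (2 * \<beta>) / (2 * \<beta> + 3)))
        \<le> (INF T \<in> estimators n I. SUP \<xi> \<in> coeff_class \<beta> H \<kappa> K U \<xi>s J.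
             \<integral>\<^sup>+ x. ennreal ((L2_norm_on I (\<lambda>r. T x r - \<xi> r))\<^sup>2) \<partial>sample_law V U n \<xi>)"
      using minimax_bounds(1)[OF \<delta> low] by simp
    show "ennreal (1 / 8) \<le> (INF T \<in> estimators n I. SUP \<xi> \<in> coeff_class \<beta> H \<kappa> K U \<xi>s J.
             emeasure (sample_law V U n \<xi>)
               {x \<in> space (sample_law V U n \<xi>).
                  L2_norm_on I (\<lambda>r. T x r - \<xi> r) \<ge> Cs * real n powr (- \<beta> / (2 * \<beta> + 3))})"
      by (rule minimax_bounds(2)[OF \<delta> low])
  qed
qed

end
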